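(* Let $M$ be the hyperfinite $\mathrm{II}_1$ factor and let $A\subset M$ be the unique (up to conjugacy) subfactor of index $[M:A]=2+\sqrt{2}$. Then $A$ is singular in $M$ but is not strongly singular in $M$.
   Context: $M$ has its unique normal faithful tracial state $\tau$, $\Vert x\Vert_2=\tau(x^*x)^{1/2}$, and $\Vert x\Vert$ is the operator norm. $[M:A]$ is the Jones index. It is known that the hyperfinite $\mathrm{II}_1$ factor has a subfactor of index $2+\sqrt2$ and that it is unique up to conjugacy (i.e. up to an automorphism of $M$). A subfactor $A\subseteq M$ is singular if every unitary $u\in M$ with $uAu^*=A$ belongs to $A$. For a von Neumann subalgebra $B\subseteq M$, $\mathbb{E}_B$ denotes the unique normal faithful $\tau$-preserving conditional expectation of $M$ onto $B$. For a linear map $T:M\to M$, $\Vert T\Vert_{\infty,2}=\sup\{\Vert T(x)\Vert_2 : x\in M,\ \Vert x\Vert\le 1\}$. $B$ is strongly singular in $M$ if $\Vert u-\mathbb{E}_B(u)\Vert_2\le \Vert \mathbb{E}_B-\mathbb{E}_{uBu^*}\Vert_{\infty,2}$ for all unitaries $u\in M$. *)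

theory Defs
  imports "HOL-Analysis.Analysis" "HOL-Library.FuncSet"
begin

section \<open>Complex Hilbert spaces\<close>

text \<open>
  A complex Hilbert space is a complete real inner product space with a complex structure: the
  complex inner product (linear in the first argument) has the given real inner product
  as its real part, so the norm, the topology and completeness are those of the library.
\<close>

class chilbert_space = real_inner + complete_space +
  fixes scaleC :: "complex \<Rightarrow> 'a \<Rightarrow> 'a" (infixr "*\<^sub>C" 75)
    and cinner :: "'a \<Rightarrow> 'a \<Rightarrow> complex"
  assumes scaleC_add_right: "c *\<^sub>C (x + y) = c *\<^sub>C x + c *\<^sub>C y"
    and scaleC_add_left: "(c + d) *\<^sub>C x = c *\<^sub>C x + d *\<^sub>C x"
    and scaleC_scaleC: "c *\<^sub>C (d *\<^sub>C x) = (c * d) *\<^sub>C x"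
    and scaleC_of_real: "complex_of_real r *\<^sub>C x = r *\<^sub>R x"
    and cinner_add_left: "cinner (x + y) z = cinner x z + cinner y z"
    and cinner_scaleC_left: "cinner (c *\<^sub>C x) y = c * cinner x y"
    and cinner_commute: "cinner x y = cnj (cinner y x)"
    and inner_eq_Re_cinner: "inner x y = Re (cinner x y)"

lemma norm_scaleC: "norm (c *\<^sub>C x) = cmod c * norm (x :: 'a :: chilbert_space)"
proof -
  have im: "Im (cinner x x) = 0"
    using cinner_commute[of x x] by (auto simp: complex_eq_iff)
  have "cinner (c *\<^sub>C x) (c *\<^sub>C x) = c * cnj c * cinner x x"
  proof -
    have "cinner x (c *\<^sub>C x) = cnj c * cinner x x"
      by (subst (1 2) cinner_commute) (simp add: cinner_scaleC_left)
    then show ?thesis by (simp add: cinner_scaleC_left mult.assoc)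
  qed
  then have "(norm (c *\<^sub>C x))\<^sup>2 = (cmod c)\<^sup>2 * (norm x)\<^sup>2"
    using im by (simp only: power2_norm_eq_inner[of "_ :: 'a"] inner_eq_Re_cinner complex_mult_cnj
        cmod_power2) simp
  then have "(norm (c *\<^sub>C x))\<^sup>2 = (cmod c * norm x)\<^sup>2"
    by (simp only: power_mult_distrib)
  then show ?thesis
    by (rule power2_eq_imp_eq) simp_all
qed

lemma bounded_linear_scaleC: "bounded_linear (\<lambda>x :: 'a :: chilbert_space. c *\<^sub>C x)"
proof (rule bounded_linear_intro[where K = "cmod c"])
  show "c *\<^sub>C (r *\<^sub>R x) = r *\<^sub>R (c *\<^sub>C x)" for r and x :: 'a
    by (simp add: scaleC_scaleC mult.commute flip: scaleC_of_real)
qed (simp_all add: scaleC_add_right norm_scaleC)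


subsection \<open>The Hilbert space of square-summable sequences\<close>

typedef ell2 = "{f :: nat \<Rightarrow> complex. summable (\<lambda>n. (cmod (f n))\<^sup>2)}"
  morphisms coord Abs_ell2
  by (rule exI[of _ "\<lambda>_. 0"]) simp

setup_lifting type_definition_ell2

lemma summable_coord: "summable (\<lambda>n. (cmod (coord x n))\<^sup>2)"
  using coord[of x] by simp

lemma cmod_mult_le: "cmod (a * cnj b) \<le> (cmod a)\<^sup>2 + (cmod b)\<^sup>2"
proof -
  have "0 \<le> (cmod a - cmod b)\<^sup>2" by simp
  moreover have "0 \<le> cmod a * cmod b" by simp
  ultimately show ?thesis
    unfolding norm_mult complex_mod_cnj power2_diff by linarith
qed

lemma cmod_add_sq_le: "(cmod (a + b))\<^sup>2 \<le> 2 * (cmod a)\<^sup>2 + 2 * (cmod b)\<^sup>2"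
proof -
  have "(cmod (a + b))\<^sup>2 \<le> (cmod a + cmod b)\<^sup>2"
    by (simp add: norm_triangle_ineq power_mono)
  also have "\<dots> \<le> 2 * (cmod a)\<^sup>2 + 2 * (cmod b)\<^sup>2"
    using sum_squares_bound[of "cmod a" "cmod b"] by (simp add: power2_sum)
  finally show ?thesis .
qed

lemma summable_coord_mult: "summable (\<lambda>n. coord x n * cnj (coord y n))"
  by (rule summable_comparison_test'[where N = 0,
      OF summable_add[OF summable_coord[of x] summable_coord[of y]]])
    (rule cmod_mult_le)

instantiation ell2 :: real_vector
begin

lift_definition zero_ell2 :: ell2 is "\<lambda>_. 0" by simp

lift_definition plus_ell2 :: "ell2 \<Rightarrow> ell2 \<Rightarrow> ell2" is "\<lambda>f g n. f n + g n"
proof -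
  fix f g :: "nat \<Rightarrow> complex"
  assume "summable (\<lambda>n. (cmod (f n))\<^sup>2)" and "summable (\<lambda>n. (cmod (g n))\<^sup>2)"
  then have "summable (\<lambda>n. 2 * (cmod (f n))\<^sup>2 + 2 * (cmod (g n))\<^sup>2)"
    by (intro summable_add summable_mult)
  then show "summable (\<lambda>n. (cmod (f n + g n))\<^sup>2)"
    by (rule summable_comparison_test'[where N = 0]) (simp add: cmod_add_sq_le)
qed

lift_definition uminus_ell2 :: "ell2 \<Rightarrow> ell2" is "\<lambda>f n. - f n" by simp

definition minus_ell2 :: "ell2 \<Rightarrow> ell2 \<Rightarrow> ell2" where "minus_ell2 x y = x + - y"

lift_definition scaleR_ell2 :: "real \<Rightarrow> ell2 \<Rightarrow> ell2" is "\<lambda>r f n. r *\<^sub>R f n"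
  by (simp add: power_mult_distrib summable_mult)

instance
  by standard (unfold minus_ell2_def, (transfer, simp add: algebra_simps)+)

end

lemma coord_add [simp]: "coord (x + y) n = coord x n + coord y n"
  by transfer simp

lemma coord_zero [simp]: "coord 0 n = 0"
  by transfer simp

lemma coord_uminus [simp]: "coord (- x) n = - coord x n"
  by transfer simp

lemma coord_diff [simp]: "coord (x - y) n = coord x n - coord y n"
  unfolding minus_ell2_def coord_add coord_uminus by simp

lemma coord_scaleR [simp]: "coord (r *\<^sub>R x) n = r *\<^sub>R coord x n"
  by transfer simp

lemma ell2_eqI: "(\<And>n. coord x n = coord y n) \<Longrightarrow> x = y"
  by (rule iffD1[OF coord_inject], rule ext)

instantiation ell2 :: real_inner
begin

definition inner_ell2 :: "ell2 \<Rightarrow> ell2 \<Rightarrow> real" where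
  "inner_ell2 x y = Re (\<Sum>n. coord x n * cnj (coord y n))"

definition norm_ell2 :: "ell2 \<Rightarrow> real" where "norm_ell2 x = sqrt (inner x x)"

definition dist_ell2 :: "ell2 \<Rightarrow> ell2 \<Rightarrow> real" where "dist_ell2 x y = norm (x - y)"

definition sgn_ell2 :: "ell2 \<Rightarrow> ell2" where "sgn_ell2 x = inverse (norm x) *\<^sub>R x"

definition uniformity_ell2 :: "(ell2 \<times> ell2) filter" where
  "uniformity_ell2 = (INF e\<in>{0<..}. principal {(x, y). dist x y < e})"

definition open_ell2 :: "ell2 set \<Rightarrow> bool" where
  "open_ell2 U \<longleftrightarrow> (\<forall>x\<in>U. \<forall>\<^sub>F (x', y) in uniformity. x' = x \<longrightarrow> y \<in> U)"

lemma inner_ell2_suminf: "inner x y = (\<Sum>n. Re (coord x n * cnj (coord y n)))"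
  unfolding inner_ell2_def by (rule Re_suminf[OF summable_coord_mult])

lemma inner_ell2_self: "inner x x = (\<Sum>n. (cmod (coord x n))\<^sup>2)"
  for x :: ell2
proof -
  have "Re (z * cnj z) = (cmod z)\<^sup>2" for z
    unfolding cmod_power2 by (simp add: power2_eq_square)
  then show ?thesis unfolding inner_ell2_suminf by (simp only:)
qed

instance
proof
  fix x y z :: ell2 and r :: real
  have s: "summable (\<lambda>n. Re (coord x n * cnj (coord y n)))" for x y
    by (rule summable_Re[OF summable_coord_mult])
  show "inner x y = inner y x"
  proof -
    have "Re (a * cnj b) = Re (b * cnj a)" for a b by simp
    then show ?thesis unfolding inner_ell2_suminf by (rule suminf_cong)
  qed
  show "inner (x + y) z = inner x z + inner y z"
    unfolding inner_ell2_suminf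
    using suminf_add[OF s[of x z] s[of y z]]
    by (simp only: coord_add distrib_right plus_complex.sel)
  show "inner (r *\<^sub>R x) y = r * inner x y"
    unfolding inner_ell2_suminf
    using suminf_mult[OF s[of x y], of r]
    by (simp only: coord_scaleR mult_scaleR_left scaleR_complex.sel)
  show "0 \<le> inner x x"
    unfolding inner_ell2_self by (rule suminf_nonneg[OF summable_coord]) simp
  show "inner x x = 0 \<longleftrightarrow> x = 0"
    unfolding inner_ell2_self
    unfolding suminf_eq_zero_iff[OF summable_coord zero_le_power2]
    by (auto intro: ell2_eqI)
qed (rule norm_ell2_def dist_ell2_def sgn_ell2_def uniformity_ell2_def open_ell2_def)+

end

lemma norm_ell2_sq: "(norm x)\<^sup>2 = (\<Sum>n. (cmod (coord x n))\<^sup>2)" for x :: ell2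
  by (simp add: power2_norm_eq_inner inner_ell2_self)

lemma sum_coord_le: "(\<Sum>k<N. (cmod (coord x k))\<^sup>2) \<le> (norm x)\<^sup>2"
  unfolding norm_ell2_sq by (rule sum_le_suminf[OF summable_coord]) auto

lemma cmod_coord_le: "cmod (coord x n) \<le> norm x"
proof -
  have "(cmod (coord x n))\<^sup>2 \<le> (\<Sum>k<Suc n. (cmod (coord x k))\<^sup>2)"
    by (simp add: sum_nonneg)
  also have "\<dots> \<le> (norm x)\<^sup>2" by (rule sum_coord_le)
  finally show ?thesis by (rule power2_le_imp_le) simp
qed

instance ell2 :: complete_space
proof
  fix X :: "nat \<Rightarrow> ell2"
  assume C: "Cauchy X"
  have "Cauchy (\<lambda>m. coord (X m) k)" for k
  proof (rule metric_CauchyI)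
    fix e :: real assume "0 < e"
    then obtain M where M: "\<And>m n. m \<ge> M \<Longrightarrow> n \<ge> M \<Longrightarrow> dist (X m) (X n) < e"
      using metric_CauchyD[OF C \<open>0 < e\<close>] by blast
    have "dist (coord (X m) k) (coord (X n) k) < e" if "m \<ge> M" "n \<ge> M" for m n
      using cmod_coord_le[of "X m - X n" k] M[OF that] by (simp add: dist_norm)
    then show "\<exists>M. \<forall>m\<ge>M. \<forall>n\<ge>M. dist (coord (X m) k) (coord (X n) k) < e"
      by blast
  qed
  then have "\<forall>k. \<exists>l. (\<lambda>m. coord (X m) k) \<longlonglongrightarrow> l"
    using Cauchy_convergent convergent_def by blast
  then obtain f where f: "\<And>k. (\<lambda>m. coord (X m) k) \<longlonglongrightarrow> f k"
    by metis
  have tail: "\<exists>M. \<forall>m\<ge>M. \<forall>N. (\<Sum>k<N. (cmod (coord (X m) k - f k))\<^sup>2) \<le> e\<^sup>2"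
    if e: "0 < e" for e :: real
  proof -
    obtain M where M: "\<And>m n. m \<ge> M \<Longrightarrow> n \<ge> M \<Longrightarrow> dist (X m) (X n) < e"
      using metric_CauchyD[OF C e] by blast
    have "(\<Sum>k<N. (cmod (coord (X m) k - f k))\<^sup>2) \<le> e\<^sup>2" if m: "m \<ge> M" for m N
    proof (rule tendsto_upperbound)
      show "(\<lambda>n. \<Sum>k<N. (cmod (coord (X m) k - coord (X n) k))\<^sup>2)
              \<longlonglongrightarrow> (\<Sum>k<N. (cmod (coord (X m) k - f k))\<^sup>2)"
        by (intro tendsto_intros f)
      have "(\<Sum>k<N. (cmod (coord (X m) k - coord (X n) k))\<^sup>2) \<le> e\<^sup>2" if n: "n \<ge> M" for n
      proof -
        have "(\<Sum>k<N. (cmod (coord (X m - X n) k))\<^sup>2) \<le> (norm (X m - X n))\<^sup>2"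
          by (rule sum_coord_le)
        also have "\<dots> \<le> e\<^sup>2"
          using M[OF m n] by (simp add: dist_norm power_mono)
        finally show ?thesis by simp
      qed
      then show "\<forall>\<^sub>F n in sequentially.
          (\<Sum>k<N. (cmod (coord (X m) k - coord (X n) k))\<^sup>2) \<le> e\<^sup>2"
        by (rule eventually_sequentiallyI[of M])
    qed simp
    then show ?thesis by blast
  qed
  obtain M1 where M1: "\<And>N. (\<Sum>k<N. (cmod (coord (X M1) k - f k))\<^sup>2) \<le> 1\<^sup>2"
    using tail[of 1] by auto
  then have d: "summable (\<lambda>k. (cmod (coord (X M1) k - f k))\<^sup>2)"
    by (intro bounded_imp_summable[where B = "1\<^sup>2"]) (use M1[of "Suc _"] in \<open>simp_all only: lessThan_Suc_atMost zero_le_power2\<close>)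
  have "summable (\<lambda>k. 2 * (cmod (coord (X M1) k))\<^sup>2 + 2 * (cmod (coord (X M1) k - f k))\<^sup>2)"
    by (intro summable_add summable_mult d summable_coord)
  then have "summable (\<lambda>k. (cmod (f k))\<^sup>2)"
  proof (rule summable_comparison_test'[where N = 0])
    fix k
    show "norm ((cmod (f k))\<^sup>2)
        \<le> 2 * (cmod (coord (X M1) k))\<^sup>2 + 2 * (cmod (coord (X M1) k - f k))\<^sup>2"
      using cmod_add_sq_le[of "coord (X M1) k" "f k - coord (X M1) k"]
      by (simp add: norm_minus_commute)
  qed
  then have cf: "coord (Abs_ell2 f) = f"
    by (simp add: Abs_ell2_inverse)
  have "X \<longlonglongrightarrow> Abs_ell2 f"
  proof (rule metric_LIMSEQ_I)
    fix r :: real assume r: "0 < r"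
    obtain M where M: "\<And>m N. m \<ge> M \<Longrightarrow> (\<Sum>k<N. (cmod (coord (X m) k - f k))\<^sup>2) \<le> (r / 2)\<^sup>2"
      using tail[OF half_gt_zero[OF r]] by blast
    have "dist (X m) (Abs_ell2 f) < r" if m: "m \<ge> M" for m
    proof -
      have "(norm (X m - Abs_ell2 f))\<^sup>2 \<le> (r / 2)\<^sup>2"
        unfolding norm_ell2_sq
        by (rule suminf_le_const[OF summable_coord]) (simp add: cf M[OF m])
      then have "norm (X m - Abs_ell2 f) \<le> r / 2"
        by (rule power2_le_imp_le) (use r in simp)
      then show ?thesis using r by (simp add: dist_norm)
    qed
    then show "\<exists>no. \<forall>n\<ge>no. dist (X n) (Abs_ell2 f) < r" by blast
  qed
  then show "convergent X" by (rule convergentI)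
qed

instantiation ell2 :: chilbert_space
begin

lift_definition scaleC_ell2 :: "complex \<Rightarrow> ell2 \<Rightarrow> ell2" is "\<lambda>c f n. c * f n"
  by (simp add: norm_mult power_mult_distrib summable_mult)

definition cinner_ell2 :: "ell2 \<Rightarrow> ell2 \<Rightarrow> complex" where
  "cinner_ell2 x y = (\<Sum>n. coord x n * cnj (coord y n))"

instance
proof
  fix x y z :: ell2 and c d :: complex and r :: real
  have co: "coord (c *\<^sub>C x) n = c * coord x n" for c x n
    by transfer simp
  show "c *\<^sub>C (x + y) = c *\<^sub>C x + c *\<^sub>C y"
    by (rule ell2_eqI) (simp add: co algebra_simps)
  show "(c + d) *\<^sub>C x = c *\<^sub>C x + d *\<^sub>C x"
    by (rule ell2_eqI) (simp add: co algebra_simps)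
  show "c *\<^sub>C (d *\<^sub>C x) = (c * d) *\<^sub>C x"
    by (rule ell2_eqI) (simp add: co algebra_simps)
  show "complex_of_real r *\<^sub>C x = r *\<^sub>R x"
    by (rule ell2_eqI) (simp add: co scaleR_conv_of_real)
  show "cinner (x + y) z = cinner x z + cinner y z"
    unfolding cinner_ell2_def
    using suminf_add[OF summable_coord_mult[of x z] summable_coord_mult[of y z]]
    by (simp add: algebra_simps)
  show "cinner (c *\<^sub>C x) y = c * cinner x y"
    unfolding cinner_ell2_def
    using suminf_mult[OF summable_coord_mult[of x y], of c] by (simp add: co algebra_simps)
  show "cinner x y = cnj (cinner y x)"
  proof -
    have "(\<lambda>n. cnj (coord y n * cnj (coord x n))) sums cnj (cinner y x)"
      unfolding cinner_ell2_def
      by (subst sums_cnj) (rule summable_sums[OF summable_coord_mult])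
    then show ?thesis
      unfolding cinner_ell2_def by (simp add: sums_iff mult.commute)
  qed
  show "inner x y = Re (cinner x y)"
    by (simp add: inner_ell2_def cinner_ell2_def)
qed

end


section \<open>Operators\<close>

text \<open>
  The type \<open>'h op\<close> consists of the bounded \<^emph>\<open>real\<close>-linear operators;
  \<open>BH\<close> is the subset of complex-linear ones, that is, \<open>B(H)\<close>. The norm of the type is the
  operator norm.
\<close>

type_synonym 'h op = "'h \<Rightarrow>\<^sub>L 'h"

definition BH :: "('h::chilbert_space) op set" where
  "BH = {T. \<forall>c x. blinfun_apply T (c *\<^sub>C x) = c *\<^sub>C blinfun_apply T x}"

definition cscale :: "complex \<Rightarrow> ('h::chilbert_space) op \<Rightarrow> 'h op" where
  "cscale c T = Blinfun (\<lambda>x. c *\<^sub>C blinfun_apply T x)"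

lemma cscale_apply: "blinfun_apply (cscale c T) x = c *\<^sub>C blinfun_apply T x"
  unfolding cscale_def
  by (simp add: bounded_linear_Blinfun_apply
      bounded_linear_compose[OF bounded_linear_scaleC blinfun.bounded_linear_right])

definition adj :: "('h::chilbert_space) op \<Rightarrow> 'h op" where
  "adj T = (THE S. \<forall>x y. cinner (blinfun_apply T x) y = cinner x (blinfun_apply S y))"

definition positive_op :: "('h::chilbert_space) op \<Rightarrow> bool" where
  "positive_op T \<longleftrightarrow> T \<in> BH \<and>
     (\<forall>x. Im (cinner (blinfun_apply T x) x) = 0 \<and> 0 \<le> Re (cinner (blinfun_apply T x) x))"

definition op_le :: "('h::chilbert_space) op \<Rightarrow> 'h op \<Rightarrow> bool" (infix "\<sqsubseteq>" 50) where
  "S \<sqsubseteq> T \<longleftrightarrow> positive_op (T - S)"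

definition closed_range_proj :: "('h::chilbert_space) set \<Rightarrow> 'h op" where
  "closed_range_proj V = (THE P. P \<in> BH \<and> P o\<^sub>L P = P \<and> adj P = P \<and> range (blinfun_apply P) = V)"


section \<open>Von Neumann algebras\<close>

definition commutant :: "('h::chilbert_space) op set \<Rightarrow> 'h op set" where
  "commutant S = {T \<in> BH. \<forall>x\<in>S. T o\<^sub>L x = x o\<^sub>L T}"

definition von_neumann_algebra :: "('h::chilbert_space) op set \<Rightarrow> bool" where
  "von_neumann_algebra M \<longleftrightarrow>
     M \<subseteq> BH \<and> (\<forall>x\<in>M. adj x \<in> M) \<and> commutant (commutant M) = M"

definition factor :: "('h::chilbert_space) op set \<Rightarrow> bool" where
  "factor M \<longleftrightarrow> von_neumann_algebra M \<and> M \<inter> commutant M = range (\<lambda>c. cscale c id_blinfun)"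

definition unitaries :: "('h::chilbert_space) op set \<Rightarrow> 'h op set" where
  "unitaries M = {u \<in> M. adj u o\<^sub>L u = id_blinfun \<and> u o\<^sub>L adj u = id_blinfun}"

definition conj_by :: "('h::chilbert_space) op \<Rightarrow> 'h op set \<Rightarrow> 'h op set" where
  "conj_by u B = (\<lambda>b. u o\<^sub>L b o\<^sub>L adj u) ` B"

text \<open>
  Normality of positive maps: preservation of least upper bounds of upward directed families
  of self-adjoint elements.
\<close>

definition self_adjoints :: "('h::chilbert_space) op set \<Rightarrow> 'h op set" where
  "self_adjoints M = {x \<in> M. adj x = x}"

definition up_directed :: "('h::chilbert_space) op set \<Rightarrow> bool" where
  "up_directed D \<longleftrightarrow> D \<noteq> {} \<and> (\<forall>x\<in>D. \<forall>y\<in>D. \<exists>z\<in>D. x \<sqsubseteq> z \<and> y \<sqsubseteq> z)"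

definition lub_in :: "('h::chilbert_space) op set \<Rightarrow> 'h op set \<Rightarrow> 'h op \<Rightarrow> bool" where
  "lub_in M D s \<longleftrightarrow> s \<in> self_adjoints M \<and> (\<forall>d\<in>D. d \<sqsubseteq> s) \<and>
     (\<forall>t\<in>self_adjoints M. (\<forall>d\<in>D. d \<sqsubseteq> t) \<longrightarrow> s \<sqsubseteq> t)"

definition nf_tracial_state :: "('h::chilbert_space) op set \<Rightarrow> ('h op \<Rightarrow> complex) \<Rightarrow> bool" where
  "nf_tracial_state M \<tau> \<longleftrightarrow>
     (\<forall>x\<in>M. \<forall>y\<in>M. \<tau> (x + y) = \<tau> x + \<tau> y) \<and>
     (\<forall>c. \<forall>x\<in>M. \<tau> (cscale c x) = c * \<tau> x) \<and>
     \<tau> id_blinfun = 1 \<and>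
     (\<forall>x\<in>M. Im (\<tau> (adj x o\<^sub>L x)) = 0 \<and> 0 \<le> Re (\<tau> (adj x o\<^sub>L x))) \<and>
     (\<forall>x\<in>M. \<forall>y\<in>M. \<tau> (x o\<^sub>L y) = \<tau> (y o\<^sub>L x)) \<and>
     (\<forall>x\<in>M. \<tau> (adj x o\<^sub>L x) = 0 \<longrightarrow> x = 0) \<and>
     (\<forall>D s. D \<subseteq> self_adjoints M \<and> up_directed D \<and> lub_in M D s \<longrightarrow>
        Re (\<tau> s) = (SUP d\<in>D. Re (\<tau> d)))"

text \<open>
  A factor is finite if it has a normal faithful tracial state; this includes the type
  \<open>I\<^sub>n\<close> factors. The state is unique as a function on \<open>M\<close>; the value outside of \<open>M\<close>
  is fixed by \<^const>\<open>extensional\<close>.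
\<close>

definition finite_factor :: "('h::chilbert_space) op set \<Rightarrow> bool" where
  "finite_factor M \<longleftrightarrow> factor M \<and> (\<exists>\<tau>. nf_tracial_state M \<tau>)"

definition vn_trace :: "('h::chilbert_space) op set \<Rightarrow> 'h op \<Rightarrow> complex" where
  "vn_trace M = (THE \<tau>. \<tau> \<in> extensional M \<and> nf_tracial_state M \<tau>)"

text \<open>Real and complex span yield the same notion of finite dimension.\<close>

definition fin_dim :: "('h::chilbert_space) op set \<Rightarrow> bool" where
  "fin_dim S \<longleftrightarrow> (\<exists>F. finite F \<and> S \<subseteq> span F)"

definition II1_factor :: "('h::chilbert_space) op set \<Rightarrow> bool" where
  "II1_factor M \<longleftrightarrow> finite_factor M \<and> \<not> fin_dim M"

definition star_subalgebra :: "('h::chilbert_space) op set \<Rightarrow> bool" where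
  "star_subalgebra S \<longleftrightarrow> S \<subseteq> BH \<and> id_blinfun \<in> S \<and> (\<forall>x\<in>S. adj x \<in> S) \<and>
     (\<forall>x\<in>S. \<forall>y\<in>S. x + y \<in> S \<and> x o\<^sub>L y \<in> S) \<and> (\<forall>c. \<forall>x\<in>S. cscale c x \<in> S)"

definition hyperfinite :: "('h::chilbert_space) op set \<Rightarrow> bool" where
  "hyperfinite M \<longleftrightarrow> (\<exists>Q :: nat \<Rightarrow> 'h op set.
     (\<forall>n. star_subalgebra (Q n) \<and> fin_dim (Q n) \<and> Q n \<subseteq> Q (Suc n)) \<and>
     M = commutant (commutant (\<Union>n. Q n)))"

definition subfactor :: "('h::chilbert_space) op set \<Rightarrow> 'h op set \<Rightarrow> bool" where
  "subfactor A M \<longleftrightarrow> factor A \<and> A \<subseteq> M"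


section \<open>The Jones index\<close>

text \<open>
  The Murray--von Neumann dimension (coupling constant) \<open>dim\<^sub>N H\<close> of a finite factor \<open>N\<close>
  acting on \<open>H\<close>: for every nonzero vector \<open>\<xi>\<close> it is the quotient of
  \<open>\<tau>\<^sub>N\<close> of the projection onto the closure of \<open>N' \<xi>\<close> by
  \<open>\<tau>\<^sub>N\<^sub>'\<close> of the projection onto the closure of \<open>N \<xi>\<close>, and it is infinite if the
  commutant \<open>N'\<close> is not finite.
\<close>

definition cyclic_proj :: "('h::chilbert_space) op set \<Rightarrow> 'h \<Rightarrow> 'h op" where
  "cyclic_proj S \<xi> = closed_range_proj (closure {blinfun_apply x \<xi> | x. x \<in> S})"

definition vn_dim :: "('h::chilbert_space) op set \<Rightarrow> ereal" where
  "vn_dim N =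
     (if finite_factor (commutant N)
      then ereal (THE d. \<forall>\<xi>. \<xi> \<noteq> 0 \<longrightarrow>
             d = Re (vn_trace N (cyclic_proj (commutant N) \<xi>)) /
                 Re (vn_trace (commutant N) (cyclic_proj N \<xi>)))
      else \<infinity>)"

text \<open>
  \<open>standard_rep M \<pi> \<Omega>\<close>: the Hilbert space of \<open>\<Omega>\<close>, with the action \<open>\<pi>\<close> of \<open>M\<close>, is
  \<open>L\<^sup>2(M)\<close>, the GNS space of the trace, and \<open>\<pi> x \<Omega>\<close> is the vector of \<open>x\<close> in it.
\<close>

definition standard_rep ::
  "('h::chilbert_space) op set \<Rightarrow> ('h op \<Rightarrow> ('k::chilbert_space) op) \<Rightarrow> 'k \<Rightarrow> bool" where
  "standard_rep M \<pi> \<Omega> \<longleftrightarrow>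
     (\<forall>x\<in>M. \<pi> x \<in> BH) \<and>
     (\<forall>x\<in>M. \<forall>y\<in>M. \<pi> (x + y) = \<pi> x + \<pi> y \<and> \<pi> (x o\<^sub>L y) = \<pi> x o\<^sub>L \<pi> y) \<and>
     (\<forall>c. \<forall>x\<in>M. \<pi> (cscale c x) = cscale c (\<pi> x)) \<and>
     (\<forall>x\<in>M. \<pi> (adj x) = adj (\<pi> x)) \<and>
     \<pi> id_blinfun = id_blinfun \<and>
     (\<forall>x\<in>M. cinner (blinfun_apply (\<pi> x) \<Omega>) \<Omega> = vn_trace M x) \<and>
     closure {blinfun_apply (\<pi> x) \<Omega> | x. x \<in> M} = UNIV"

text \<open>
  \<open>[M : A] = dim\<^sub>A L\<^sup>2(M)\<close>. The space \<open>L\<^sup>2(M)\<close> of a \<open>II\<^sub>1\<close> factor with separable predual (such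
  as the hyperfinite one) is separable and infinite-dimensional, hence it can be realised on
  \<^typ>\<open>ell2\<close>; all realisations are unitarily equivalent and give the same dimension.
\<close>

definition jones_index :: "('h::chilbert_space) op set \<Rightarrow> 'h op set \<Rightarrow> ereal" where
  "jones_index M A = (THE d. \<exists>(\<pi> :: 'h op \<Rightarrow> ell2 op) \<Omega>.
     standard_rep M \<pi> \<Omega> \<and> d = vn_dim (\<pi> ` A))"


section \<open>Conditional expectations and singularity\<close>

definition trace_cond_exp ::
  "('h::chilbert_space) op set \<Rightarrow> 'h op set \<Rightarrow> ('h op \<Rightarrow> 'h op) \<Rightarrow> bool" where
  "trace_cond_exp M B E \<longleftrightarrow>
     (\<forall>x\<in>M. E x \<in> B) \<and> (\<forall>b\<in>B. E b = b) \<and>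
     (\<forall>x\<in>M. \<forall>y\<in>M. E (x + y) = E x + E y) \<and>
     (\<forall>c. \<forall>x\<in>M. E (cscale c x) = cscale c (E x)) \<and>
     (\<forall>x\<in>M. positive_op x \<longrightarrow> positive_op (E x)) \<and>
     (\<forall>x\<in>M. \<forall>a\<in>B. \<forall>b\<in>B. E (a o\<^sub>L x o\<^sub>L b) = a o\<^sub>L E x o\<^sub>L b) \<and>
     (\<forall>D s. D \<subseteq> self_adjoints M \<and> up_directed D \<and> lub_in M D s \<longrightarrow> lub_in B (E ` D) (E s)) \<and>
     (\<forall>x\<in>M. E (adj x o\<^sub>L x) = 0 \<longrightarrow> x = 0) \<and>
     (\<forall>x\<in>M. vn_trace M (E x) = vn_trace M x)"

definition cond_exp :: "('h::chilbert_space) op set \<Rightarrow> 'h op set \<Rightarrow> 'h op \<Rightarrow> 'h op" where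
  "cond_exp M B = (THE E. E \<in> extensional M \<and> trace_cond_exp M B E)"

definition norm2 :: "('h::chilbert_space) op set \<Rightarrow> 'h op \<Rightarrow> real" where
  "norm2 M x = sqrt (Re (vn_trace M (adj x o\<^sub>L x)))"

definition norm_inf_2 :: "('h::chilbert_space) op set \<Rightarrow> ('h op \<Rightarrow> 'h op) \<Rightarrow> ereal" where
  "norm_inf_2 M T = (SUP x\<in>{x \<in> M. norm x \<le> 1}. ereal (norm2 M (T x)))"

definition singular :: "('h::chilbert_space) op set \<Rightarrow> 'h op set \<Rightarrow> bool" where
  "singular M A \<longleftrightarrow> (\<forall>u\<in>unitaries M. conj_by u A = A \<longrightarrow> u \<in> A)"

definition strongly_singular :: "('h::chilbert_space) op set \<Rightarrow> 'h op set \<Rightarrow> bool" where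
  "strongly_singular M B \<longleftrightarrow> (\<forall>u\<in>unitaries M.
     ereal (norm2 M (u - cond_exp M B u))
       \<le> norm_inf_2 M (\<lambda>x. cond_exp M B x - cond_exp M (conj_by u B) x))"

end

theory Submission
 imports Defs
begin

text \<open>By the uniqueness of the GNS representation one may assume that \<open>M\<close> is in standard form, with
 trace vector \<open>\<Omega>\<close>. Let \<open>e\<close> be the projection onto the closure of \<open>A\<Omega>\<close>, \<open>M\<^sub>1 = (JAJ)'\<close> and
 \<open>\<lambda> = 1/(2 + sqrt 2) = tr e\<close>. An element \<open>W = We\<close> of \<open>M\<^sub>1\<close> can be pushed down to \<open>W = me\<close> with \<open>m\<close> in \<open>M\<close>.

 Singularity: for a normalising unitary \<open>u\<close> outside \<open>A\<close> the projections \<open>e\<close> and \<open>ueu\<^sup>*\<close> (and \<open>u\<^sup>2e(u\<^sup>2)\<^sup>*\<close>, if \<open>u\<^sup>2\<close> is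
 not in \<open>A\<close>) are orthogonal bimodule projections. Their complement is a nonzero bimodule projection whose
 trace is below the least possible one, because \<open>3 < 1/\<lambda> < 4\<close>.

 Failure of strong singularity: put \<open>t = sqrt 2 - 1\<close> and take a projection \<open>h\<close> in \<open>A\<close> of trace \<open>t\<close>. As \<open>t(1 - \<lambda>) = \<lambda>\<close>,
 the projections \<open>h(1 - e)\<close> and \<open>e\<close> are equivalent in \<open>M\<^sub>1\<close>, say by \<open>me\<close>. Then \<open>f = t m\<^sup>*m\<close> is a projection with
 \<open>E(f) = t\<close>, and \<open>u = 1 - 2f\<close> violates the inequality: \<open>|u - E(u)|\<^sup>2 > 24/25\<close>, whereas
 \<open>|E(uyu)|\<^sup>2 >= |y|\<^sup>2/25\<close> for all \<open>y\<close> in \<open>A\<close> bounds the squared distance of the expectations by \<open>24/25\<close>.\<close>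

text \<open>Trace, expectation and index are definite descriptions, so uniqueness has to precede
  every computation: two traces on a factor are compared by a Hahn decomposition, and all standard
  representations are unitarily equivalent. The index lives on \<open>ell2\<close>, whereas
  \<open>M\<close> acts on a space of arbitrary size. Hyperfiniteness makes the GNS space separable,
  and bounded operators between the two spaces that intertwine \<open>M\<close> carry commutants
  from one to the other. The coupling constant is then computed for every vector, which identifies
  \<open>1/\<lambda>\<close> with the index. If \<open>u ** u\<close> lies in \<open>A\<close>, only
  two orthogonal projections are at hand and their complement is not small. There the trace bound is
  used for \<open>A + Au\<close>, whose Jones projection has trace \<open>2 * \<lambda>\<close>. The
  projection \<open>f\<close> is built to have a scalar expectation, so that
  \<open>|E(u)|^2 = (1 - 2t)^2 = 17 - 12 sqrt 2\<close>, about 0.029. The number \<open>1/25\<close>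
  is a convenient rational between this and the lower bound for
  \<open>|E(uyu)|^2 / |y|^2\<close>.\<close>

no_notation matrix_matrix_mult (infixl "**" 70)
notation blinfun_compose (infixl "**" 55)
notation id_blinfun ("Id")
notation scaleR (infixr "*R" 75) and scaleC (infixr "*C" 75)

section \<open>Complex inner products\<close>

instance chilbert_space \<subseteq> banach ..

lemma scaleC_one [simp]: "1 *C x = (x :: 'a :: chilbert_space)"
 using scaleC_of_real[of 1 x] by simp

lemma scaleC_zero_left [simp]: "0 *C x = (0 :: 'a :: chilbert_space)"
 using scaleC_of_real[of 0 x] by simp

lemma scaleC_zero_right [simp]: "c *C (0 :: 'a :: chilbert_space) = 0"
 using norm_scaleC[of c "0::'a"] by simp

lemma scaleC_minus_right [simp]: "c *C (- x) = - (c *C (x :: 'a :: chilbert_space))"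
 by (metis add.right_inverse add_eq_0_iff scaleC_add_right scaleC_zero_right)

lemma scaleC_minus_left [simp]: "(- c) *C x = - (c *C (x :: 'a :: chilbert_space))"
 by (metis add.right_inverse add_eq_0_iff scaleC_add_left scaleC_zero_left)

lemma scaleC_diff_right: "c *C (x - y) = c *C x - c *C (y :: 'a :: chilbert_space)"
 using scaleC_add_right[of c x "- y"] by simp

lemma scaleC_diff_left: "(c - d) *C x = c *C x - d *C (x :: 'a :: chilbert_space)"
 using scaleC_add_left[of c "- d" x] by simp

lemma scaleC_scaleR: "c *C (r *R x) = r *R (c *C (x :: 'a :: chilbert_space))"
 by (simp add: scaleC_of_real[symmetric] scaleC_scaleC mult.commute)

lemma scaleC_Complex: "c *C x = Re c *R x + Im c *R (\<i> *C (x :: 'a :: chilbert_space))"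
proof -
 have "c = complex_of_real (Re c) + complex_of_real (Im c) * \<i>"
  by (simp add: complex_eq_iff)
 thus ?thesis
  by (metis scaleC_add_left scaleC_of_real scaleC_scaleC)
qed

lemma cinner_add_right: "cinner x (y + z) = cinner x y + cinner x (z :: 'a :: chilbert_space)"
 by (subst (1 2 3) cinner_commute) (simp add: cinner_add_left)

lemma cinner_scaleC_right: "cinner x (c *C y) = cnj c * cinner x (y :: 'a :: chilbert_space)"
 by (subst (1 2) cinner_commute) (simp add: cinner_scaleC_left)

lemma cinner_zero_left [simp]: "cinner 0 (x :: 'a :: chilbert_space) = 0"
 using cinner_scaleC_left[of 0 0 x] by simp

lemma cinner_zero_right [simp]: "cinner (x :: 'a :: chilbert_space) 0 = 0"
 using cinner_scaleC_right[of x 0 0] by simp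

lemma cinner_minus_left [simp]: "cinner (- x) y = - cinner x (y :: 'a :: chilbert_space)"
 using cinner_scaleC_left[of "-1" x y] by simp

lemma cinner_minus_right [simp]: "cinner x (- y) = - cinner x (y :: 'a :: chilbert_space)"
 using cinner_scaleC_right[of x "-1" y] by simp

lemma cinner_diff_left: "cinner (x - y) z = cinner x z - cinner y (z :: 'a :: chilbert_space)"
 using cinner_add_left[of x "- y" z] by simp

lemma cinner_diff_right: "cinner x (y - z) = cinner x y - cinner x (z :: 'a :: chilbert_space)"
 using cinner_add_right[of x y "- z"] by simp

lemma cinner_scaleR_left [simp]: "cinner (r *R x) y = of_real r * cinner x (y :: 'a :: chilbert_space)"
 by (simp add: scaleC_of_real[symmetric] cinner_scaleC_left)

lemma cinner_scaleR_right [simp]: "cinner x (r *R y) = of_real r * cinner x (y :: 'a :: chilbert_space)"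
 by (simp add: scaleC_of_real[symmetric] cinner_scaleC_right)

lemmas cinner_linear = cinner_add_left cinner_add_right cinner_diff_left cinner_diff_right
 cinner_scaleC_left cinner_scaleC_right

lemma cinner_self: "cinner x x = of_real ((norm (x :: 'a :: chilbert_space))^2)"
proof -
 have "Im (cinner x x) = 0"
  using cinner_commute[of x x] by (auto simp: complex_eq_iff)
 moreover have "Re (cinner x x) = (norm x)^2"
  using inner_eq_Re_cinner[of x x] by (simp add: power2_norm_eq_inner)
 ultimately show ?thesis by (simp add: complex_eq_iff)
qed

lemma Re_cinner_self: "Re (cinner x x) = (norm (x :: 'a :: chilbert_space))^2"
 by (simp add: cinner_self)

lemma Im_cinner_self [simp]: "Im (cinner x (x :: 'a :: chilbert_space)) = 0"
 by (simp add: cinner_self)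

lemma cinner_eq_zero_iff [simp]: "cinner x x = 0 \<longleftrightarrow> x = (0 :: 'a :: chilbert_space)"
 by (simp add: cinner_self)

lemma cmod_cinner_le: "cmod (cinner x y) <= norm x * norm (y :: 'a :: chilbert_space)"
proof (cases "cinner x y = 0")
 case False
 define z where "z = cinner x y"
 define c where "c = cnj z / of_real (cmod z)"
 have z: "z ~= 0" using False by (simp add: z_def)
 have "c * z = of_real (cmod z)"
  using z complex_norm_square[of z]
  by (simp add: c_def field_simps power2_eq_square)
 hence "cmod z = inner (c *C x) y"
  by (simp add: inner_eq_Re_cinner cinner_scaleC_left z_def[symmetric])
 also have "... <= norm (c *C x) * norm y"
  by (rule norm_cauchy_schwarz)
 also have "norm (c *C x) = norm x"
  using z by (simp add: norm_scaleC c_def norm_divide)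
 finally show ?thesis by (simp add: z_def)
qed simp

lemma bounded_bilinear_cinner: "bounded_bilinear (cinner :: 'a :: chilbert_space => 'a => complex)"
 by (rule bounded_bilinear.intro)
  (auto simp: cinner_linear scaleR_conv_of_real intro!: exI[of _ 1] cmod_cinner_le)

lemmas tendsto_cinner [tendsto_intros] = bounded_bilinear.tendsto[OF bounded_bilinear_cinner]
lemmas continuous_cinner [continuous_intros] = bounded_bilinear.continuous_on[OF bounded_bilinear_cinner]

lemma cinner_zeroI_dense:
 fixes x :: "'a :: chilbert_space"
 assumes "!!y. y : D ==> cinner x y = 0" and "closure D = UNIV"
 shows "x = 0"
proof -
 have "closed {y. cinner x y = 0}"
  by (intro closed_Collect_eq continuous_intros)
 hence "closure D <= {y. cinner x y = 0}"
  by (intro closure_minimal) (use assms(1) in auto)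
 hence "x : {y. cinner x y = 0}" using assms(2) by (metis UNIV_I subsetD)
 thus ?thesis by simp
qed

lemma cinner_ext:
 fixes x :: "'a :: chilbert_space"
 assumes "!!z. cinner x z = cinner y z"
 shows "x = y"
 using cinner_zeroI_dense[of UNIV "x - y"] assms by (simp add: cinner_diff_left)

lemma cinner_ext_left:
 fixes x :: "'a :: chilbert_space"
 assumes "!!z. cinner z x = cinner z y"
 shows "x = y"
 by (rule cinner_ext) (metis assms cinner_commute)

lemma norm_add_sq: "(norm (x + y))^2 = (norm x)^2 + 2 * Re (cinner x y) + (norm (y :: 'a :: chilbert_space))^2"
 by (simp add: power2_norm_eq_inner inner_simps inner_commute[of y x] inner_eq_Re_cinner[of x y])

lemma parallelogram_law:
 fixes x y :: "'a :: real_inner"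
 shows "(norm (x + y))^2 + (norm (x - y))^2 = 2 * (norm x)^2 + 2 * (norm y)^2"
 by (simp add: power2_norm_eq_inner inner_simps)

section \<open>Closed subspaces\<close>

text \<open>A minimising sequence for the distance to \<open>V\<close> is Cauchy by the
  parallelogram law. Its limit is a nearest point, and moving it along \<open>z\<close> cannot
  decrease the distance, which forces orthogonality.\<close>

lemma ex_orthogonal_decomposition:
 fixes x :: "'a :: {real_inner, complete_space}"
 assumes V: "subspace V" and cl: "closed V"
 shows "EX y:V. ALL z:V. inner (x - y) z = 0"
proof -
 define d where "d = infdist x V"
 have ne: "V ~= {}" using V subspace_0 by blast
 have d: "d <= dist x a" if "a : V" for a
  unfolding d_def using that by (rule infdist_le)
 have d0: "0 <= d" unfolding d_def by (rule infdist_nonneg)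
 have "EX a:V. dist x a < d + inverse (real (Suc n))" for n
 proof -
  have "(INF a\<in>V. dist x a) < d + inverse (real (Suc n))"
   unfolding d_def infdist_def using ne by simp
  then obtain r where "r : dist x ` V" "r < d + inverse (real (Suc n))"
   using cInf_lessD[of "dist x ` V"] ne by blast
  thus ?thesis by auto
 qed
 then obtain a where aV: "!!n. a n : V" and a: "!!n. dist x (a n) < d + inverse (real (Suc n))"
  by metis
 \<comment> \<open>Parallelogram law for \<open>x - p\<close> and \<open>x - q\<close>: the midpoint
   of \<open>p\<close> and \<open>q\<close> lies in \<open>V\<close>, so its distance from
   \<open>x\<close> is at least \<open>d\<close>.\<close>
 have key: "(dist p q)^2 <= 2 * (dist x p)^2 + 2 * (dist x q)^2 - 4 * d^2" if "p : V" "q : V" for p q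
 proof -
  have m: "(1/2) *R (p + q) : V" using that V by (simp add: subspace_add subspace_scale)
  have "d^2 <= (dist x ((1/2) *R (p + q)))^2" using d[OF m] d0 by (simp add: power_mono)
  also have "... = (norm ((x - p) + (x - q)))^2 / 4"
  proof -
   have "x - (1/2) *R (p + q) = (1/2) *R ((x - p) + (x - q))"
   proof -
    have "(1/2::real) *R x + (1/2::real) *R x = x" by (simp add: scaleR_add_left[symmetric])
    thus ?thesis by (simp add: algebra_simps)
   qed
   thus ?thesis by (simp add: dist_norm power_divide)
  qed
  finally have 1: "4 * d^2 <= (norm ((x - p) + (x - q)))^2" by simp
  have "(norm ((x - p) - (x - q)))^2 = 2 * (dist x p)^2 + 2 * (dist x q)^2 - (norm ((x - p) + (x - q)))^2"
   using parallelogram_law[of "x - p" "x - q"] by (simp add: dist_norm)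
  moreover have "norm ((x - p) - (x - q)) = dist p q" by (simp add: dist_norm norm_minus_commute)
  ultimately show ?thesis using 1 by simp
 qed
 have lim: "(%n. 2 * (d + inverse (real (Suc n)))^2 + 2 * (d + inverse (real (Suc n)))^2 - 4 * d^2)
   \<longlonglongrightarrow> 2 * (d + 0)^2 + 2 * (d + 0)^2 - 4 * d^2"
  by (intro tendsto_intros LIMSEQ_inverse_real_of_nat)
 have C: "Cauchy a"
 proof (rule metric_CauchyI)
  fix e :: real assume e: "0 < e"
  from lim have "(%n. 2 * (d + inverse (real (Suc n)))^2 + 2 * (d + inverse (real (Suc n)))^2 - 4 * d^2) \<longlonglongrightarrow> 0"
   by simp
  hence "\<forall>\<^sub>F n in sequentially. 2 * (d + inverse (real (Suc n)))^2 + 2 * (d + inverse (real (Suc n)))^2 - 4 * d^2 < e^2"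
   using e by (intro order_tendstoD(2)[of _ 0]) auto
  then obtain N where N: "2 * (d + inverse (real (Suc N)))^2 + 2 * (d + inverse (real (Suc N)))^2 - 4 * d^2 < e^2"
   by (auto simp: eventually_sequentially)
  have sm: "(dist x (a n))^2 <= (d + inverse (real (Suc N)))^2" if "n \<ge> N" for n
  proof -
   have "dist x (a n) <= d + inverse (real (Suc n))" using a[of n] by simp
   also have "... <= d + inverse (real (Suc N))" using that by (simp add: field_simps)
   finally show ?thesis by (simp add: power_mono)
  qed
  have "dist (a m) (a n) < e" if "m \<ge> N" "n \<ge> N" for m n
  proof -
   have "(dist (a m) (a n))^2 < e^2"
    using key[OF aV[of m] aV[of n]] sm[OF that(1)] sm[OF that(2)] N by linarith
   thus ?thesis using e by (simp add: power_less_imp_less_base)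
  qed
  thus "EX M. ALL m>=M. ALL n>=M. dist (a m) (a n) < e" by blast
 qed
 then obtain y where y: "a \<longlonglongrightarrow> y" using Cauchy_convergent convergent_def by blast
 have yV: "y : V" using closed_sequentially[OF cl] aV y by blast
 have "dist x y <= d + 0"
 proof (rule LIMSEQ_le)
  show "(%n. dist x (a n)) \<longlonglongrightarrow> dist x y" by (intro tendsto_intros y)
  show "(%n. d + inverse (real (Suc n))) \<longlonglongrightarrow> d + 0"
   by (intro tendsto_intros LIMSEQ_inverse_real_of_nat)
  show "EX N. ALL n>=N. dist x (a n) <= d + inverse (real (Suc n))" using a less_imp_le by blast
 qed
 hence min: "dist x y <= dist x z" if "z : V" for z using d[OF that] by simp
 have "inner (x - y) z = 0" if z: "z : V" for z
 proof (rule ccontr)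
  assume ne: "inner (x - y) z ~= 0"
  hence z0: "z ~= 0" by auto
  \<comment> \<open>The place where the quadratic polynomial \<open>|x - y - r z|^2\<close> in
    \<open>r\<close> is smallest.\<close>
  define r where "r = inner (x - y) z / inner z z"
  have "y + r *R z : V" using yV z V by (simp add: subspace_add subspace_scale)
  hence "(norm (x - y))^2 <= (norm (x - (y + r *R z)))^2"
   using min by (simp add: dist_norm power_mono)
  also have "x - (y + r *R z) = (x - y) - r *R z" by simp
  also have "(norm ((x - y) - r *R z))^2 = (norm (x - y))^2 - 2 * r * inner (x - y) z + r^2 * inner z z"
   by (simp only: power2_norm_eq_inner inner_simps) (simp add: inner_commute power2_eq_square algebra_simps)
  also have "... = (norm (x - y))^2 - (inner (x - y) z)^2 / inner z z"
   using z0 by (simp add: r_def power2_eq_square field_simps)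
  finally have "(inner (x - y) z)^2 / inner z z <= 0" by simp
  moreover have "(inner (x - y) z)^2 / inner z z > 0"
   using ne z0 by (simp add: divide_pos_pos)
  ultimately show False by simp
 qed
 thus ?thesis using yV by blast
qed

definition csubspace :: "'a :: chilbert_space set => bool" where
 "csubspace V \<longleftrightarrow> subspace V & (ALL c. ALL x:V. c *C x : V)"

lemma csubspaceI:
 assumes "0 : V" "!!x y. x : V ==> y : V ==> x + y : V" "!!c x. x : V ==> c *C x : V"
 shows "csubspace V"
 unfolding csubspace_def subspace_def using assms by (metis scaleC_of_real)

lemma csubspace_0: "csubspace V ==> 0 : V"
 and csubspace_add: "csubspace V ==> x : V ==> y : V ==> x + y : V"
 and csubspace_diff: "csubspace V ==> x : V ==> y : V ==> x - y : V"
 and csubspace_scaleC: "csubspace V ==> x : V ==> c *C x : V"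
 by (auto simp: csubspace_def subspace_0 subspace_add subspace_diff)

lemma csubspace_closure:
 assumes "csubspace V" shows "csubspace (closure V)"
proof (rule csubspaceI)
 show "0 : closure V" using assms csubspace_0 closure_subset by blast
 show "x + y : closure V" if "x : closure V" "y : closure V" for x y
  using that assms unfolding closure_sequential
  by (metis (mono_tags, lifting) csubspace_add tendsto_add)
 show "c *C x : closure V" if x: "x : closure V" for c x
 proof -
  obtain f where f: "ALL n. f n : V" "f \<longlonglongrightarrow> x" using x unfolding closure_sequential by blast
  hence "(%n. c *C f n) \<longlonglongrightarrow> c *C x"
   using bounded_linear.tendsto[OF bounded_linear_scaleC] by blast
  thus ?thesis unfolding closure_sequential using f(1) csubspace_scaleC[OF assms]
   by (intro exI[of _ "%n. c *C f n"]) simp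
 qed
qed

text \<open>Real orthogonality to \<open>z\<close> and to \<open>\<i> *C z\<close> kills the real
  and the imaginary part of the complex inner product.\<close>

lemma ex_complex_orthogonal_decomposition:
 fixes x :: "'a :: chilbert_space"
 assumes V: "csubspace V" and cl: "closed V"
 shows "EX y:V. ALL z:V. cinner (x - y) z = 0"
proof -
 obtain y where y: "y : V" and o: "!!z. z : V ==> inner (x - y) z = 0"
  using ex_orthogonal_decomposition[of V x] V cl by (auto simp: csubspace_def)
 have "cinner (x - y) z = 0" if "z : V" for z
 proof -
  have "Re (cinner (x - y) z) = 0" using o[OF that] by (simp add: inner_eq_Re_cinner)
  moreover have "Re (cinner (x - y) (\<i> *C z)) = 0"
   using o[of "\<i> *C z"] that V by (simp add: inner_eq_Re_cinner csubspace_scaleC)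
  hence "Im (cinner (x - y) z) = 0" by (simp add: cinner_scaleC_right)
  ultimately show ?thesis by (simp add: complex_eq_iff)
 qed
 thus ?thesis using y by blast
qed

text \<open>The kernel of a nonzero \<open>f\<close> has codimension one, so the representing vector
  is a multiple of any nonzero \<open>w\<close> orthogonal to it; the factor is fixed by the value
  at \<open>w\<close>.\<close>

lemma riesz_representation:
 fixes f :: "'a :: chilbert_space => complex"
 assumes f: "bounded_linear f" and fC: "!!c x. f (c *C x) = c * f x"
 shows "EX y. ALL x. f x = cinner x y"
proof (cases "ALL x. f x = 0")
 case True thus ?thesis by (intro exI[of _ 0]) simp
next
 case False
 interpret bounded_linear f by (rule f)
 obtain x0 where x0: "f x0 ~= 0" using False by blast
 define V where "V = {x. f x = 0}"
 have V: "csubspace V" unfolding V_def by (rule csubspaceI) (auto simp: zero add fC)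
 have "closed V" unfolding V_def
  by (intro closed_Collect_eq continuous_on_const linear_continuous_on f)
 then obtain v where v: "f v = 0" and o: "!!z. f z = 0 ==> cinner (x0 - v) z = 0"
  using ex_complex_orthogonal_decomposition[OF V, of x0] by (auto simp: V_def)
 define w where "w = x0 - v"
 have fw: "f w ~= 0" using x0 v by (simp add: w_def diff)
 hence w0: "w ~= 0" using zero by auto
 have ow: "cinner z w = 0" if "f z = 0" for z
  using o[OF that] by (metis cinner_commute complex_cnj_zero w_def)
 define y where "y = (cnj (f w) / cinner w w) *C w"
 have "f x = cinner x y" for x
 proof -
  have "f (x - (f x / f w) *C w) = 0" using fw by (simp add: diff fC)
  from ow[OF this] have "cinner x w = f x / f w * cinner w w"
   by (simp add: cinner_linear)
  moreover have "cnj (cinner w w) = cinner w w" by (simp add: cinner_self)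
  ultimately show ?thesis using fw w0 by (simp add: y_def cinner_scaleC_right)
 qed
 thus ?thesis by blast
qed

section \<open>Bounded operators\<close>

lemma oL_assoc: "(a ** b) ** c = a ** (b ** c)"
 by (rule blinfun_eqI) simp

lemma oL_id [simp]: "Id ** a = a" "a ** Id = a"
 by (rule blinfun_eqI, simp)+

lemma oL_zero_left [simp]: "0 ** a = 0"
 by (rule blinfun_eqI) simp

lemmas oL_zero_right = bounded_bilinear.zero_right[OF bounded_bilinear_blinfun_compose]
lemmas oL_apply = blinfun_apply_blinfun_compose
lemmas oL_add_left = bounded_bilinear.add_left[OF bounded_bilinear_blinfun_compose]
lemmas oL_add_right = bounded_bilinear.add_right[OF bounded_bilinear_blinfun_compose]
lemmas oL_diff_left = bounded_bilinear.diff_left[OF bounded_bilinear_blinfun_compose]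
lemmas oL_diff_right = bounded_bilinear.diff_right[OF bounded_bilinear_blinfun_compose]
lemmas oL_minus_left = bounded_bilinear.minus_left[OF bounded_bilinear_blinfun_compose]
lemmas oL_minus_right = bounded_bilinear.minus_right[OF bounded_bilinear_blinfun_compose]
lemmas oL_scaleR_left = bounded_bilinear.scaleR_left[OF bounded_bilinear_blinfun_compose]
lemmas oL_scaleR_right = bounded_bilinear.scaleR_right[OF bounded_bilinear_blinfun_compose]
lemmas oL_sum_left = bounded_bilinear.sum_left[OF bounded_bilinear_blinfun_compose]
lemmas oL_sum_right = bounded_bilinear.sum_right[OF bounded_bilinear_blinfun_compose]
lemmas oL_simps = oL_assoc oL_add_left oL_add_right oL_diff_left oL_diff_right oL_minus_left
 oL_minus_right oL_scaleR_left oL_scaleR_right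

lemma BH_apply: "T : BH ==> T (c *C x) = c *C T x"
 by (simp add: BH_def)

lemma BH_id [simp]: "Id : BH"
 by (simp add: BH_def)

lemma BH_zero [simp]: "0 : BH"
 by (simp add: BH_def)

lemma BH_add: "S : BH ==> T : BH ==> S + T : BH"
 by (simp add: BH_def blinfun.add_left scaleC_add_right)

lemma BH_minus: "T : BH ==> - T : BH"
 by (simp add: BH_def blinfun.minus_left)

lemma BH_diff: "S : BH ==> T : BH ==> S - T : BH"
 by (simp add: BH_def blinfun.diff_left scaleC_diff_right)

lemma BH_compose: "S : BH ==> T : BH ==> S ** T : BH"
 by (simp add: BH_def)

lemma BH_scaleR: "T : BH ==> r *R T : BH"
 by (simp add: BH_def blinfun.scaleR_left scaleC_scaleR)

lemma BH_cscale: "T : BH ==> cscale c T : BH"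
 by (simp add: BH_def cscale_apply scaleC_scaleC mult.commute)

lemma BH_subspace: "subspace BH"
 by (simp add: subspace_def BH_add BH_scaleR)

lemma closed_BH: "closed (BH :: 'a :: chilbert_space op set)"
proof -
 have "BH = (\<Inter>c. \<Inter>x. {T :: 'a op. T (c *C x) = c *C T x})"
  by (auto simp: BH_def)
 moreover have "closed {T :: 'a op. T (c *C x) = c *C T x}" for c x
 proof -
  have "bounded_linear (%T :: 'a op. c *C T x)"
   by (rule bounded_linear_compose[OF bounded_linear_scaleC blinfun.bounded_linear_left])
  thus ?thesis
   by (intro closed_Collect_eq linear_continuous_on blinfun.bounded_linear_left)
 qed
 hence "closed (\<Inter>c. \<Inter>x. {T :: 'a op. T (c *C x) = c *C T x})"
  by (intro closed_INT ballI)
 ultimately show ?thesis by simp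
qed

lemmas BH_intros = BH_add BH_minus BH_diff BH_compose BH_scaleR BH_cscale BH_id BH_zero

lemma cscale_of_real: "cscale (of_real r) T = r *R T"
 by (rule blinfun_eqI) (simp add: cscale_apply scaleC_of_real blinfun.scaleR_left)

lemma cscale_one [simp]: "cscale 1 T = T"
 by (rule blinfun_eqI) (simp add: cscale_apply)

lemma cscale_zero_left [simp]: "cscale 0 T = 0"
 by (rule blinfun_eqI) (simp add: cscale_apply)

lemma cscale_zero_right [simp]: "cscale c 0 = 0"
 by (rule blinfun_eqI) (simp add: cscale_apply)

lemma cscale_cscale: "cscale c (cscale d T) = cscale (c * d) T"
 by (rule blinfun_eqI) (simp add: cscale_apply scaleC_scaleC)

lemma cscale_add_right: "cscale c (S + T) = cscale c S + cscale c T"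
 by (rule blinfun_eqI) (simp add: cscale_apply blinfun.add_left scaleC_add_right)

lemma cscale_diff_right: "cscale c (S - T) = cscale c S - cscale c T"
 by (rule blinfun_eqI) (simp add: cscale_apply blinfun.diff_left scaleC_diff_right)

lemma cscale_add_left: "cscale (c + d) T = cscale c T + cscale d T"
 by (rule blinfun_eqI) (simp add: cscale_apply blinfun.add_left scaleC_add_left)

lemma cscale_minus_left: "cscale (- c) T = - cscale c T"
 by (rule blinfun_eqI) (simp add: cscale_apply blinfun.minus_left)

lemma cscale_diff_left: "cscale (c - d) T = cscale c T - cscale d T"
 by (rule blinfun_eqI) (simp add: cscale_apply blinfun.diff_left scaleC_diff_left)

lemma oL_cscale_left: "cscale c S ** T = cscale c (S ** T)"
 by (rule blinfun_eqI) (simp add: cscale_apply)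

lemma oL_cscale_right: "S : BH ==> S ** cscale c T = cscale c (S ** T)"
 by (rule blinfun_eqI) (simp add: cscale_apply BH_apply)

lemma norm_cscale: "norm (cscale c T) = cmod c * norm T"
proof -
 have le: "norm (cscale c S) <= cmod c * norm S" for c and S :: "'a op"
  by (rule norm_blinfun_bound)
   (auto simp: cscale_apply norm_scaleC mult.assoc intro!: mult_left_mono norm_blinfun)
 show ?thesis
 proof (cases "c = 0")
  case False
  have "norm T = norm (cscale (inverse c) (cscale c T))"
   using False by (simp add: cscale_cscale)
  also have "... <= cmod (inverse c) * norm (cscale c T)" by (rule le)
  finally have "cmod c * norm T <= norm (cscale c T)"
   using False by (simp add: norm_inverse norm_divide inverse_eq_divide field_simps)
  thus ?thesis using le[of c T] by simp
 qed simp
qed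

subsection \<open>Adjoints\<close>

text \<open>Stated between two different spaces, since operators from the GNS space to the given
  space need adjoints as well, while \<open>adj\<close> covers endomorphisms only.\<close>

lemma ex_adjoint:
 fixes T :: "'a :: chilbert_space \<Rightarrow>\<^sub>L 'b :: chilbert_space"
 assumes T: "!!c x. T (c *C x) = c *C T x"
 shows "EX S. (ALL c y. blinfun_apply S (c *C y) = c *C S y) & (ALL x y. cinner (T x) y = cinner x (S y))"
proof -
 have "EX w. ALL x. cinner (T x) y = cinner x w" for y
 proof (rule riesz_representation)
  show "bounded_linear (%x. cinner (T x) y)"
   by (rule bounded_linear_compose[OF
      bounded_bilinear.bounded_linear_left[OF bounded_bilinear_cinner]
      blinfun.bounded_linear_right])
 qed (simp add: T cinner_scaleC_left)
 then obtain s where s: "!!x y. cinner (T x) y = cinner x (s y)" by metis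
 have add: "s (y + z) = s y + s z" for y z
  by (rule cinner_ext_left) (simp add: s[symmetric] cinner_linear)
 have scal: "s (c *C y) = c *C s y" for c y
  by (rule cinner_ext_left) (simp add: s[symmetric] cinner_linear)
 have "norm (s y) <= norm y * norm T" for y
 proof (cases "s y = 0")
  case False
  have "complex_of_real ((norm (s y))^2) = cinner (T (s y)) y"
   by (simp only: s cinner_self)
  hence "(norm (s y))^2 <= norm (T (s y)) * norm y"
   using cmod_cinner_le[of "T (s y)" y] by (metis norm_of_real abs_of_nonneg zero_le_power2)
  also have "... <= norm T * norm (s y) * norm y"
   by (intro mult_right_mono norm_blinfun) simp
  finally show ?thesis using False by (simp add: power2_eq_square mult.commute)
 qed simp
 hence "bounded_linear s"
  by (intro bounded_linear_intro[where K = "norm T"])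
   (auto simp: add scal scaleC_of_real[symmetric])
 hence "blinfun_apply (Blinfun s) = s" by (rule bounded_linear_Blinfun_apply)
 thus ?thesis using s scal by (intro exI[of _ "Blinfun s"]) auto
qed

lemma adj_eqI:
 fixes S T :: "'a :: chilbert_space op"
 assumes "!!x y. cinner (T x) y = cinner x (S y)"
 shows "adj T = S"
 unfolding adj_def
proof (rule the_equality)
 show "ALL x y. cinner (T x) y = cinner x (S y)" using assms by blast
 show "R = S" if R: "ALL x y. cinner (T x) y = cinner x (R y)" for R :: "'a op"
  by (rule blinfun_eqI, rule cinner_ext_left) (metis R assms)
qed

lemma adj_BH [simp]: "T : BH ==> adj T : BH"
 and cinner_adj_right: "T : BH ==> cinner x (adj T y) = cinner (T x) y"
proof -
 assume T: "T : BH"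
 obtain S where S: "ALL c y. blinfun_apply S (c *C y) = c *C S y" "ALL x y. cinner (T x) y = cinner x (S y)"
  using ex_adjoint[of T] BH_apply[OF T] by blast
 have "adj T = S" by (rule adj_eqI) (simp add: S(2))
 thus "adj T : BH" "cinner x (adj T y) = cinner (T x) y" for x y
  using S by (simp_all add: BH_def)
qed

lemma cinner_adj_left: "T : BH ==> cinner (adj T x) y = cinner x (T y)"
 by (metis cinner_adj_right cinner_commute)

lemma adj_adj [simp]: "T : BH ==> adj (adj T) = T"
 by (rule adj_eqI) (simp add: cinner_adj_left)

lemma adj_compose: "S : BH ==> T : BH ==> adj (S ** T) = adj T ** adj S"
 by (rule adj_eqI) (simp add: cinner_adj_right)

lemma adj_add: "S : BH ==> T : BH ==> adj (S + T) = adj S + adj T"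
 by (rule adj_eqI) (simp add: cinner_adj_right blinfun.add_left cinner_linear)

lemma adj_diff: "S : BH ==> T : BH ==> adj (S - T) = adj S - adj T"
 by (rule adj_eqI) (simp add: cinner_adj_right blinfun.diff_left cinner_linear)

lemma adj_minus: "T : BH ==> adj (- T) = - adj T"
 by (rule adj_eqI) (simp add: cinner_adj_right blinfun.minus_left)

lemma adj_scaleR: "T : BH ==> adj (r *R T) = r *R adj T"
 by (rule adj_eqI) (simp add: cinner_adj_right blinfun.scaleR_left)

lemma adj_cscale: "T : BH ==> adj (cscale c T) = cscale (cnj c) (adj T)"
 by (rule adj_eqI) (simp add: cinner_adj_right cscale_apply cinner_linear)

lemma adj_id [simp]: "adj Id = Id"
 by (rule adj_eqI) simp

lemma adj_zero [simp]: "adj 0 = 0"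
 by (rule adj_eqI) simp

lemmas adj_simps = adj_compose adj_add adj_diff adj_minus adj_scaleR adj_cscale

lemma norm_adj_le: "T : BH ==> norm (adj T) <= norm T"
proof (rule norm_blinfun_bound)
 fix y assume T: "T : BH"
 show "norm (adj T y) <= norm T * norm y"
 proof (cases "adj T y = 0")
  case False
  have "(norm (adj T y))^2 = Re (cinner (T (adj T y)) y)"
   by (simp add: Re_cinner_self[symmetric] cinner_adj_right[OF T])
  also have "... <= norm (T (adj T y)) * norm y"
   using cmod_cinner_le complex_Re_le_cmod order_trans by blast
  also have "... <= norm T * norm (adj T y) * norm y"
   by (intro mult_right_mono norm_blinfun) simp
  finally show ?thesis using False by (simp add: power2_eq_square mult.commute mult.left_commute)
 qed simp
qed simp

lemma norm_adj: "T : BH ==> norm (adj T) = norm T"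
 using norm_adj_le[of T] norm_adj_le[of "adj T"] by simp

lemma norm_apply_sq: "T : BH ==> (norm (T x))^2 = Re (cinner ((adj T ** T) x) x)"
 by (simp add: Re_cinner_self[symmetric] cinner_adj_left)

lemma adj_compose_self_eq_0: "T : BH ==> adj T ** T = 0 ==> T = 0"
 using norm_apply_sq[of T] by (intro blinfun_eqI) simp

subsection \<open>Extension from dense subspaces\<close>

text \<open>The map is given by its graph, so that it may be specified by any parametrisation of a
  dense subspace; the norm bound, applied to differences, makes it single-valued.\<close>

lemma ex_bounded_extension:
 fixes G :: "('a :: real_normed_vector \<times> 'b :: banach) set"
 assumes G: "subspace G" and C: "0 <= C" and bd: "!!x y. (x, y) : G ==> norm y <= C * norm x"
  and dense: "closure (fst ` G) = UNIV"
 shows "EX T. (ALL (x, y):G. blinfun_apply T x = y) & norm T <= C"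
proof -
 have ex: "EX y. (EX g. (ALL n. g n : G) & (%n. fst (g n)) \<longlonglongrightarrow> x & (%n. snd (g n)) \<longlonglongrightarrow> y)" for x :: 'a
 proof -
  have "x : closure (fst ` G)" using dense by simp
  then obtain a where a: "ALL n. a n : fst ` G" "a \<longlonglongrightarrow> x" unfolding closure_sequential by blast
  hence "ALL n. EX y. (a n, y) : G" by force
  then obtain b where b: "!!n. (a n, b n) : G" by metis
  have nb: "norm (b m - b n) <= C * norm (a m - a n)" for m n
   using bd subspace_diff[OF G b[of m] b[of n]] by simp
  have "Cauchy b"
  proof (rule metric_CauchyI)
   fix e :: real assume e: "0 < e"
   have "Cauchy a" using a(2) LIMSEQ_imp_Cauchy by blast
   then obtain N where N: "!!m n. m \<ge> N ==> n \<ge> N ==> dist (a m) (a n) < e / (C + 1)"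
    using metric_CauchyD[of a "e / (C + 1)"] e C by auto
   have "dist (b m) (b n) < e" if "m \<ge> N" "n \<ge> N" for m n
   proof -
    have "dist (b m) (b n) <= (C + 1) * dist (a m) (a n)"
     using nb[of m n] norm_ge_zero[of "a m - a n"] unfolding dist_norm distrib_right by linarith
    also have "... < e" using N[OF that] C by (simp add: field_simps)
    finally show ?thesis .
   qed
   thus "EX M. ALL m>=M. ALL n>=M. dist (b m) (b n) < e" by blast
  qed
  then obtain y where "b \<longlonglongrightarrow> y" using Cauchy_convergent convergent_def by blast
  thus ?thesis using a b by (intro exI[of _ y] exI[of _ "%n. (a n, b n)"]) auto
 qed
 define R where "R x y \<longleftrightarrow> (EX g. (ALL n. g n : G) & (%n. fst (g n)) \<longlonglongrightarrow> x & (%n. snd (g n)) \<longlonglongrightarrow> y)" for x y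
 have Rbd: "norm y <= C * norm x" if R: "R x y" for x y
 proof -
  obtain g where g: "ALL n. g n : G" "(%n. fst (g n)) \<longlonglongrightarrow> x" "(%n. snd (g n)) \<longlonglongrightarrow> y"
   using R unfolding R_def by blast
  show ?thesis
  proof (rule LIMSEQ_le)
   show "(%n. norm (snd (g n))) \<longlonglongrightarrow> norm y" by (intro tendsto_intros g)
   show "(%n. C * norm (fst (g n))) \<longlonglongrightarrow> C * norm x" by (intro tendsto_intros g)
   show "EX N. ALL n>=N. norm (snd (g n)) <= C * norm (fst (g n))"
    using bd g(1) by (metis prod.collapse)
  qed
 qed
 have Radd: "R (x + x') (y + y')" if R: "R x y" "R x' y'" for x x' y y'
 proof -
  obtain g where g: "ALL n. g n : G" "(%n. fst (g n)) \<longlonglongrightarrow> x" "(%n. snd (g n)) \<longlonglongrightarrow> y"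
   using R(1) unfolding R_def by blast
  obtain h where h: "ALL n. h n : G" "(%n. fst (h n)) \<longlonglongrightarrow> x'" "(%n. snd (h n)) \<longlonglongrightarrow> y'"
   using R(2) unfolding R_def by blast
  show ?thesis unfolding R_def
   by (rule exI[of _ "%n. g n + h n"]) (use g h in "auto intro!: tendsto_add subspace_add[OF G]")
 qed
 have Rsc: "R (r *R x) (r *R y)" if R: "R x y" for r x y
 proof -
  obtain g where g: "ALL n. g n : G" "(%n. fst (g n)) \<longlonglongrightarrow> x" "(%n. snd (g n)) \<longlonglongrightarrow> y"
   using R(1) unfolding R_def by blast
  show ?thesis unfolding R_def
   by (rule exI[of _ "%n. r *R g n"])
    (use g in "auto intro!: tendsto_scaleR tendsto_const subspace_scale[OF G]")
 qed
 have Runiq: "y = y'" if "R x y" "R x y'" for x y y'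
 proof -
  have "R (x + (-1) *R x) (y + (-1) *R y')" by (intro Radd Rsc that)
  from Rbd[OF this] show ?thesis by simp
 qed
 obtain f where f: "!!x. R x (f x)" using ex unfolding R_def by metis
 have "bounded_linear f"
  by (rule bounded_linear_intro[where K = C])
   (use Runiq[OF f Radd[OF f f]] Runiq[OF f Rsc[OF f]] Rbd[OF f] in "auto simp: mult.commute")
 hence B: "blinfun_apply (Blinfun f) = f" by (rule bounded_linear_Blinfun_apply)
 have "R x y" if "(x, y) : G" for x y
  unfolding R_def by (rule exI[of _ "%n. (x, y)"]) (use that in auto)
 hence "ALL (x, y):G. f x = y" using Runiq f by blast
 moreover have "norm (Blinfun f) <= C"
  by (rule norm_blinfun_bound[OF C]) (use Rbd[OF f] B in auto)
 ultimately show ?thesis using B by (intro exI[of _ "Blinfun f"]) auto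
qed

subsection \<open>Projections\<close>

lemma ex_blinfun_on_image:
 fixes f :: "'c :: real_vector => 'a :: real_normed_vector" and g :: "'c => 'b :: banach"
 assumes X: "subspace X"
  and f: "!!x y. x : X ==> y : X ==> f (x + y) = f x + f y" "!!r x. x : X ==> f (r *R x) = r *R f x"
  and g: "!!x y. x : X ==> y : X ==> g (x + y) = g x + g y" "!!r x. x : X ==> g (r *R x) = r *R g x"
  and C: "0 <= C" "!!x. x : X ==> norm (g x) <= C * norm (f x)" and d: "closure (f ` X) = UNIV"
 shows "EX T. ALL x:X. blinfun_apply T (f x) = g x"
proof -
 define G where "G = (%x. (f x, g x)) ` X"
 have "subspace G"
  unfolding subspace_def G_def
 proof (intro conjI ballI allI)
  have "f 0 = 0" "g 0 = 0" using f(2)[OF subspace_0[OF X], of 0] g(2)[OF subspace_0[OF X], of 0] by simp_all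
  thus "0 : (%x. (f x, g x)) ` X"
   using subspace_0[OF X] by (intro image_eqI[of _ _ 0]) (auto simp: zero_prod_def)
  fix a assume "a : (%x. (f x, g x)) ` X"
  then obtain x where x: "a = (f x, g x)" "x : X" by blast
  show "r *R a : (%x. (f x, g x)) ` X" for r
   using x f g subspace_scale[OF X] by (intro image_eqI[of _ _ "r *R x"]) auto
  fix b assume "b : (%x. (f x, g x)) ` X"
  then obtain y where "b = (f y, g y)" "y : X" by blast
  thus "a + b : (%x. (f x, g x)) ` X"
   using x f g subspace_add[OF X] by (intro image_eqI[of _ _ "x + y"]) auto
 qed
 moreover have "norm b <= C * norm a" if "(a, b) : G" for a b using that C by (auto simp: G_def)
 moreover have "fst ` G = f ` X" by (force simp: G_def)
 ultimately obtain T where "ALL (a, b):G. blinfun_apply T a = b"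
  using ex_bounded_extension[of G C] C d by auto
 thus ?thesis by (intro exI[of _ T]) (auto simp: G_def)
qed

definition is_proj :: "'a :: chilbert_space op => bool" where
 "is_proj P \<longleftrightarrow> P : BH & P ** P = P & adj P = P"

lemma is_projD:
 assumes "is_proj P" shows "P : BH" "P ** P = P" "adj P = P" "P (P x) = P x"
 using assms unfolding is_proj_def by (auto simp flip: blinfun_apply_blinfun_compose)

lemma is_proj_cinner: "is_proj P ==> cinner (P x) (P y) = cinner (P x) y"
 by (metis cinner_adj_right is_projD)

lemma is_proj_norm_sq: "is_proj P ==> (norm (P x))^2 = Re (cinner (P x) x)"
 by (metis Re_cinner_self is_proj_cinner)

lemma is_proj_norm_le: "is_proj P ==> norm (P x) <= norm x"
proof -
 assume P: "is_proj P"
 show ?thesis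
 proof (cases "P x = 0")
  case False
  have "(norm (P x))^2 <= norm (P x) * norm x"
   using is_proj_norm_sq[OF P, of x] cmod_cinner_le[of "P x" x] complex_Re_le_cmod[of "cinner (P x) x"] by linarith
  thus ?thesis using False by (simp add: power2_eq_square)
 qed simp
qed

lemma is_proj_range_eq:
 assumes P: "is_proj P" and Q: "is_proj Q" and r: "range P = range Q"
 shows "P = Q"
proof (rule blinfun_eqI)
 fix x
 have PQ: "P (Q y) = Q y" for y using r is_projD(4)[OF P] by (metis rangeE rangeI)
 have QP: "Q (P y) = P y" for y using r is_projD(4)[OF Q] by (metis rangeE rangeI)
 show "P x = Q x"
 proof (rule cinner_ext)
  fix z
  have "cinner (P x) z = cinner (Q (P x)) z" by (simp add: QP)
  also have "... = cinner x (P (Q z))"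
   by (metis P Q cinner_adj_right is_projD(1,3))
  also have "... = cinner (Q x) z" by (metis PQ Q cinner_adj_right is_projD(1,3))
  finally show "cinner (P x) z = cinner (Q x) z" .
 qed
qed

lemma ex_projection:
 fixes V :: "'a :: chilbert_space set"
 assumes V: "csubspace V" and cl: "closed V"
 shows "EX P. is_proj P & range P = V"
proof -
 obtain p where pV: "!!x. p x : V" and po: "!!x z. z : V ==> cinner (x - p x) z = 0"
  using ex_complex_orthogonal_decomposition[OF V cl] by metis
 have uniq: "y = p x" if "y : V" "!!z. z : V ==> cinner (x - y) z = 0" for x y
 proof -
  have d: "p x - y : V" using pV that V csubspace_diff by blast
  have "cinner (p x - y) (p x - y) = cinner (x - y) (p x - y) - cinner (x - p x) (p x - y)"
   by (simp add: cinner_diff_left)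
  thus ?thesis using po[OF d] that(2)[OF d] by simp
 qed
 have add: "p (x + y) = p x + p y" for x y
 proof (rule uniq[symmetric])
  show "p x + p y : V" by (intro csubspace_add V pV)
  fix z assume "z : V"
  thus "cinner (x + y - (p x + p y)) z = 0"
   using po[of z x] po[of z y] by (simp add: cinner_linear)
 qed
 have sc: "p (c *C x) = c *C p x" for c x
 proof (rule uniq[symmetric])
  show "c *C p x : V" by (intro csubspace_scaleC V pV)
  fix z assume "z : V"
  thus "cinner (c *C x - c *C p x) z = 0"
   using po[of z x] by (simp add: cinner_linear)
 qed
 have bd: "norm (p x) <= norm x" for x
 proof -
  have "cinner (p x) (x - p x) = 0"
   using po[OF pV, of x x] by (metis cinner_commute complex_cnj_zero)
  hence "(norm x)^2 = (norm (p x))^2 + (norm (x - p x))^2"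
   using norm_add_sq[of "p x" "x - p x"] by simp
  hence "(norm (p x))^2 <= (norm x)^2" by simp
  thus ?thesis by (rule power2_le_imp_le) simp
 qed
 have "bounded_linear p"
  by (rule bounded_linear_intro[where K = 1]) (auto simp: add sc bd scaleC_of_real[symmetric])
 hence B: "blinfun_apply (Blinfun p) = p" by (rule bounded_linear_Blinfun_apply)
 have fix1: "p x = x" if "x : V" for x
  by (rule uniq[symmetric]) (use that in auto)
 have "is_proj (Blinfun p)"
  unfolding is_proj_def
 proof (intro conjI)
  show "Blinfun p : BH" by (simp add: BH_def B sc)
  show "Blinfun p ** Blinfun p = Blinfun p"
   by (rule blinfun_eqI) (simp add: B fix1 pV)
  show "adj (Blinfun p) = Blinfun p"
  proof (rule adj_eqI)
   fix x y
   have "cinner (p x) (y - p y) = 0"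
    by (metis cinner_commute complex_cnj_zero pV po)
   moreover have "cinner (x - p x) (p y) = 0" by (simp add: pV po)
   ultimately show "cinner (Blinfun p x) y = cinner x (Blinfun p y)"
    by (simp add: B cinner_linear)
  qed
 qed
 moreover have "range p = V" using pV fix1 by (metis image_subset_iff rangeI subsetI subset_antisym)
 ultimately show ?thesis using B by metis
qed

abbreviation prj :: "'a :: chilbert_space set => 'a op" where "prj \<equiv> closed_range_proj"

lemma prj_eqI: "is_proj P ==> range P = V ==> prj V = P"
 unfolding closed_range_proj_def
 by (rule the_equality) (auto simp: is_proj_def intro!: is_proj_range_eq)

lemma
 assumes "csubspace V" "closed V"
 shows is_proj_prj: "is_proj (prj V)" and range_prj: "range (prj V) = V"
 using ex_projection[OF assms] prj_eqI by metis+

lemma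
 assumes V: "csubspace V" "closed V"
 shows prj_mem: "prj V x : V" and prj_fix: "x : V ==> prj V x = x"
  and prj_orth: "z : V ==> cinner (x - prj V x) z = 0"
proof -
 note P = is_proj_prj[OF V] and r = range_prj[OF V]
 show "prj V x : V" using r by blast
 show f: "x : V ==> prj V x = x" for x using r is_projD(4)[OF P] by (metis rangeE)
 show "cinner (x - prj V x) z = 0" if "z : V"
  using f[OF that] is_projD[OF P] by (metis cinner_adj_right cinner_diff_left right_minus_eq)
qed

lemma is_proj_id [simp]: "is_proj Id" and is_proj_zero [simp]: "is_proj 0"
 by (auto simp: is_proj_def)

lemma is_proj_complement: "is_proj P ==> is_proj (Id - P)"
 by (simp add: is_proj_def BH_diff adj_diff oL_simps)

section \<open>Commutants and positive operators\<close>

lemmas lin_right = blinfun.bounded_linear_right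

lemma commutantI: "T : BH ==> (!!x. x : S ==> T ** x = x ** T) ==> T : commutant S"
 by (simp add: commutant_def)

lemma commutant_BH: "commutant S <= BH"
 by (auto simp: commutant_def)

lemma commutantD: "T : commutant S ==> x : S ==> T ** x = x ** T"
 by (simp add: commutant_def)

lemma commutant_apply: "T : commutant S ==> x : S ==> T (x v) = x (T v)"
 by (metis oL_apply commutantD)

lemma commutant_antimono: "S <= S' ==> commutant S' <= commutant S"
 by (auto simp: commutant_def)

lemma subset_bicommutant: "S <= BH ==> S <= commutant (commutant S)"
 by (auto simp: commutant_def)

lemma triple_commutant: "S <= BH ==> commutant (commutant (commutant S)) = commutant S"
 by (simp add: commutant_BH commutant_antimono subset_antisym subset_bicommutant)

lemma commutant_id [simp]: "Id : commutant S"
 by (rule commutantI) auto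

lemma commutant_zero [simp]: "0 : commutant S"
 by (rule commutantI) auto

lemma commutant_add: "T : commutant S ==> U : commutant S ==> T + U : commutant S"
 by (auto simp: commutant_def oL_simps intro: BH_intros)

lemma commutant_diff: "T : commutant S ==> U : commutant S ==> T - U : commutant S"
 by (auto simp: commutant_def oL_simps intro: BH_intros)

lemma commutant_minus: "T : commutant S ==> - T : commutant S"
 by (auto simp: commutant_def oL_simps intro: BH_intros)

lemma commutant_scaleR: "T : commutant S ==> r *R T : commutant S"
 by (auto simp: commutant_def oL_simps intro: BH_intros)

lemma commutant_compose: "T : commutant S ==> U : commutant S ==> T ** U : commutant S"
 by (auto simp: commutant_def intro: BH_intros) (metis oL_assoc)

lemma commutant_cscale: "T : commutant S ==> S <= BH ==> cscale c T : commutant S"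
 by (auto simp: commutant_def oL_cscale_left oL_cscale_right subset_iff intro: BH_intros)

lemma commutant_adj:
 assumes "T : commutant S" "S <= BH" "!!x. x : S ==> adj x : S"
 shows "adj T : commutant S"
proof (rule commutantI)
 have T: "T : BH" using assms(1) commutant_BH by blast
 show "adj T : BH" using T by simp
 fix x assume x: "x : S"
 hence xB: "x : BH" using assms by blast
 have "adj (T ** adj x) = adj (adj x ** T)"
  using commutantD[OF assms(1) assms(3)[OF x]] by simp
 thus "adj T ** x = x ** adj T" using T xB by (simp add: adj_compose)
qed

text \<open>Stated for filters, because it serves both increasing nets of operators and infinite
  sums over finite subsets.\<close>

lemma commutant_strong_limit:
 fixes L :: "'a :: chilbert_space op"
 assumes F: "F ~= bot" and T: "\<forall>\<^sub>F i in F. T i : commutant S"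
  and lim: "!!v. ((%i. blinfun_apply (T i) v) \<longlongrightarrow> L v) F"
 shows "L : commutant S"
proof (rule commutantI)
 show "L : BH"
  unfolding BH_def
 proof (intro CollectI allI)
  fix c x
  have "((%i. T i (c *C x)) \<longlongrightarrow> c *C L x) F"
  proof (rule Lim_transform_eventually)
   show "((%i. c *C T i x) \<longlongrightarrow> c *C L x) F"
    by (rule bounded_linear.tendsto[OF bounded_linear_scaleC lim])
   show "\<forall>\<^sub>F i in F. c *C T i x = T i (c *C x)"
    using T by eventually_elim (metis BH_apply commutant_BH subsetD)
  qed
  thus "L (c *C x) = c *C L x" using tendsto_unique[OF F lim] by blast
 qed
 fix x assume x: "x : S"
 show "L ** x = x ** L"
 proof (rule blinfun_eqI)
  fix v
  have "((%i. T i (x v)) \<longlongrightarrow> x (L v)) F"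
  proof (rule Lim_transform_eventually)
   show "((%i. x (T i v)) \<longlongrightarrow> x (L v)) F" by (intro tendsto_intros lim)
   show "\<forall>\<^sub>F i in F. x (T i v) = T i (x v)"
    using T by eventually_elim (metis commutant_apply x)
  qed
  thus "(L ** x) v = (x ** L) v" using tendsto_unique[OF F lim[of "x v"]] by simp
 qed
qed

lemma vn_BH: "von_neumann_algebra M ==> M <= BH"
 and vn_adj: "von_neumann_algebra M ==> x : M ==> adj x : M"
 and vn_bicommutant: "von_neumann_algebra M ==> commutant (commutant M) = M"
 by (auto simp: von_neumann_algebra_def)

lemma vn_inBH: "von_neumann_algebra M ==> x : M ==> x : BH"
 using vn_BH by blast

lemma
 assumes "von_neumann_algebra M"
 shows vn_id: "Id : M" and vn_zero: "0 : M"
  and vn_add: "x : M ==> y : M ==> x + y : M"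
  and vn_diff: "x : M ==> y : M ==> x - y : M"
  and vn_minus: "x : M ==> - x : M"
  and vn_compose: "x : M ==> y : M ==> x ** y : M"
  and vn_scaleR: "x : M ==> r *R x : M"
  and vn_cscale: "x : M ==> cscale c x : M"
 using commutant_id[of "commutant M"] commutant_zero[of "commutant M"]
  commutant_add[of x "commutant M" y] commutant_diff[of x "commutant M" y]
  commutant_minus[of x "commutant M"] commutant_compose[of x "commutant M" y]
  commutant_scaleR[of x "commutant M"] commutant_cscale[of x "commutant M" c]
  vn_bicommutant[OF assms] commutant_BH[of M]
 by auto

lemmas vn_intros = vn_id vn_zero vn_add vn_diff vn_minus vn_compose vn_scaleR vn_cscale vn_adj

lemma vn_subspace: "von_neumann_algebra M ==> subspace M"
 by (auto simp: subspace_def intro: vn_intros)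

lemma vn_sum: "von_neumann_algebra M ==> (!!i. i : I ==> f i : M) ==> sum f I : M"
 by (induction I rule: infinite_finite_induct) (auto intro: vn_intros)

lemma vn_commutant:
 assumes "S <= BH" "!!x. x : S ==> adj x : S"
 shows "von_neumann_algebra (commutant S)"
 unfolding von_neumann_algebra_def
 using assms commutant_BH triple_commutant commutant_adj by blast

lemma vn_commutant_vn: "von_neumann_algebra M ==> von_neumann_algebra (commutant M)"
 by (rule vn_commutant) (auto simp: vn_BH vn_adj)

lemma vn_strong_limit:
 fixes L :: "'a :: chilbert_space op"
 assumes "von_neumann_algebra M" "F ~= bot" "\<forall>\<^sub>F i in F. T i : M"
  "!!v. ((%i. blinfun_apply (T i) v) \<longlongrightarrow> L v) F"
 shows "L : M"
 using commutant_strong_limit[of F T "commutant M" L] assms vn_bicommutant[OF assms(1)] by simp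

text \<open>As \<open>S\<close> is closed under adjoints, the orthogonal complement of
  \<open>V\<close> is invariant as well.\<close>

lemma prj_in_commutant:
 assumes V: "csubspace V" "closed V" and S: "S <= BH" "!!x. x : S ==> adj x : S"
  and inv: "!!x v. x : S ==> v : V ==> blinfun_apply x v : V"
 shows "prj V : commutant S"
proof (rule commutantI)
 show "prj V : BH" using is_proj_prj[OF V] is_projD by blast
 fix x assume x: "x : S"
 hence xB: "x : BH" using S by blast
 show "prj V ** x = x ** prj V"
 proof (rule blinfun_eqI)
  fix v
  have "cinner (x (v - prj V v)) z = 0" if z: "z : V" for z
   using prj_orth[OF V inv[OF S(2)[OF x] z]] cinner_adj_right[OF xB] by metis
  hence "cinner (prj V (x (v - prj V v))) z = 0" for z
   using is_projD[OF is_proj_prj[OF V]] prj_mem[OF V] by (metis cinner_adj_right)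
  hence "prj V (x (v - prj V v)) = 0" by (metis cinner_eq_zero_iff)
  thus "(prj V ** x) v = (x ** prj V) v"
   using prj_fix[OF V inv[OF x prj_mem[OF V, of v]]] by (simp add: blinfun.diff_right)
 qed
qed

subsection \<open>Positive operators\<close>

text \<open>Polarisation: the form at \<open>x + y\<close> and at \<open>x + \<i> *C y\<close> gives
  two relations between \<open>cinner (S x) y\<close> and \<open>cinner (S y) x\<close>. Over the
  reals a quarter turn would be a counterexample.\<close>

lemma op_zeroI:
 fixes S :: "'a :: chilbert_space op"
 assumes S: "S : BH" and z: "!!x. cinner (S x) x = 0"
 shows "S = 0"
proof (rule blinfun_eqI, rule cinner_ext)
 fix x y
 have 1: "cinner (S x) y + cinner (S y) x = 0"
  using z[of "x + y"] z[of x] z[of y] by (simp add: blinfun.add_right cinner_linear add.commute)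
 have "cinner (S x) (\<i> *C y) + cinner (S (\<i> *C y)) x = 0"
  using z[of "x + \<i> *C y"] z[of x] z[of "\<i> *C y"] by (simp add: blinfun.add_right cinner_linear)
 hence "- cinner (S x) y + cinner (S y) x = 0"
  by (simp add: BH_apply[OF S] cinner_linear complex_eq_iff)
 with 1 show "cinner (S x) y = cinner ((0 :: 'a op) x) y"
  by (simp add: add_eq_0_iff)
qed

lemma self_adjoint_Im: "T : BH ==> adj T = T ==> Im (cinner (T x) x) = 0"
 by (metis add_cancel_right_left cinner_adj_right cinner_commute cnj.sel(2) equal_neg_zero)

lemma positive_opI:
 "T : BH ==> adj T = T ==> (!!x. 0 <= Re (cinner (T x) x)) ==> positive_op T"
 by (simp add: positive_op_def self_adjoint_Im)

lemma positive_op_BH: "positive_op T ==> T : BH"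
 and positive_op_Re: "positive_op T ==> 0 <= Re (cinner (T x) x)"
 by (auto simp: positive_op_def)

lemma positive_op_adj: "positive_op T ==> adj T = T"
proof -
 assume P: "positive_op T"
 hence T: "T : BH" by (simp add: positive_op_BH)
 have "T - adj T = 0"
 proof (rule op_zeroI)
  fix x
  have "cinner (adj T x) x = cnj (cinner (T x) x)"
   by (metis T cinner_adj_left cinner_commute)
  also have "... = cinner (T x) x" using P by (simp add: positive_op_def complex_eq_iff)
  finally show "cinner ((T - adj T) x) x = 0" by (simp add: blinfun.diff_left cinner_linear)
 qed (use T in "auto intro: BH_intros")
 thus ?thesis by simp
qed

lemma positive_zero [simp]: "positive_op 0" and positive_id [simp]: "positive_op Id"
 by (auto simp: positive_op_def cinner_self)

lemma positive_add: "positive_op S ==> positive_op T ==> positive_op (S + T)"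
 by (simp add: positive_op_def BH_add blinfun.add_left cinner_linear)

lemma positive_scaleR: "positive_op T ==> 0 <= r ==> positive_op (r *R T)"
 by (simp add: positive_op_def BH_scaleR blinfun.scaleR_left)

lemma positive_sum: "(!!i. i : I ==> positive_op (f i)) ==> positive_op (sum f I)"
 by (induction I rule: infinite_finite_induct) (auto intro: positive_add)

lemma positive_adj_self: "T : BH ==> positive_op (adj T ** T)"
 by (auto simp: positive_op_def cinner_adj_left cinner_self intro: BH_intros)

lemma positive_conj: "positive_op T ==> S : BH ==> positive_op (adj S ** (T ** S))"
 by (auto simp: positive_op_def cinner_adj_left intro!: BH_intros)

lemma positive_proj: "is_proj P ==> positive_op P"
 by (metis is_projD(1-3) positive_adj_self)

lemma positive_antisym: "positive_op T ==> positive_op (- T) ==> T = 0"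
 by (rule op_zeroI)
  (auto simp: positive_op_def blinfun.minus_left complex_eq_iff dest!: spec intro: antisym)

lemma op_le_refl [simp]: "T \<sqsubseteq> T"
 by (simp add: op_le_def)

lemma op_le_trans: "R \<sqsubseteq> S ==> S \<sqsubseteq> T ==> R \<sqsubseteq> T"
 using positive_add[of "S - R" "T - S"] by (simp add: op_le_def algebra_simps)

lemma op_le_antisym: "S \<sqsubseteq> T ==> T \<sqsubseteq> S ==> S = T"
 using positive_antisym[of "T - S"] by (simp add: op_le_def)

lemma op_le_Re: "S \<sqsubseteq> T ==> Re (cinner (S x) x) <= Re (cinner (T x) x)"
 using positive_op_Re[of "T - S" x] by (simp add: op_le_def blinfun.diff_left cinner_linear)

lemma op_leI:
 assumes "S : BH" "T : BH" "adj S = S" "adj T = T"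
  and "!!x. Re (cinner (S x) x) <= Re (cinner (T x) x)"
 shows "S \<sqsubseteq> T"
 unfolding op_le_def
 by (rule positive_opI) (use assms in "auto simp: adj_diff blinfun.diff_left cinner_linear intro: BH_intros")

lemma op_le_norm:
 assumes "T : BH" "adj T = T" shows "T \<sqsubseteq> norm T *R Id"
proof (rule op_leI)
 fix x
 have "Re (cinner (T x) x) <= norm (T x) * norm x"
  using cmod_cinner_le complex_Re_le_cmod order_trans by blast
 also have "... <= norm T * norm x * norm x" by (intro mult_right_mono norm_blinfun) simp
 finally show "Re (cinner (T x) x) <= Re (cinner ((norm T *R Id) x) x)"
  by (simp add: blinfun.scaleR_left Re_cinner_self power2_eq_square mult.assoc)
qed (use assms in "auto simp: adj_scaleR intro: BH_intros")

text \<open>This is \<open>T ** T \<sqsubseteq> K *R T\<close>: the Cauchy-Schwarz inequality for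
  the form of \<open>T\<close>, taken at \<open>x\<close> and \<open>T x\<close>.\<close>

lemma positive_op_norm_sq_le:
 assumes P: "positive_op T" and K: "T \<sqsubseteq> K *R Id"
 shows "(norm (T x))^2 <= K * Re (cinner (T x) x)"
proof -
 note T = positive_op_BH[OF P] and Ta = positive_op_adj[OF P]
 define y where "y = T x"
 define a b c where "a = Re (cinner (T x) x)" and "b = (norm y)^2" and "c = Re (cinner (T y) y)"
 \<comment> \<open>Positivity along the line \<open>x + r *R y\<close>; the discriminant of this
   polynomial in \<open>r\<close> yields \<open>b^2 <= a * c\<close>.\<close>
 have q: "0 <= a + 2 * r * b + r^2 * c" for r
 proof -
  have "0 <= Re (cinner (T (x + r *R y)) (x + r *R y))" by (rule positive_op_Re[OF P])
  also have "... = a + r * Re (cinner (T x) y) + r * Re (cinner (T y) x) + r^2 * c"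
   by (simp add: a_def c_def blinfun.add_right blinfun.scaleR_right cinner_linear
     power2_eq_square algebra_simps)
  also have "cinner (T y) x = cinner y y" by (metis T Ta cinner_adj_right y_def)
  finally show ?thesis by (simp add: y_def[symmetric] b_def Re_cinner_self)
 qed
 have cK: "c <= K * b"
  using op_le_Re[OF K, of y] by (simp add: c_def b_def blinfun.scaleR_left Re_cinner_self)
 have a0: "0 <= a" unfolding a_def by (rule positive_op_Re[OF P])
 have b0: "0 <= b" by (simp add: b_def)
 have c0: "0 <= c" unfolding c_def by (rule positive_op_Re[OF P])
 have K0: "0 <= K | b = 0"
  using c0 cK b0 by (metis linorder_not_le mult_neg_pos order_le_less order_trans)
 have bac: "b^2 <= a * c"
 proof (cases "c = 0")
  case True
  have "b = 0"
  proof (rule ccontr)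
   assume "b ~= 0"
   have "0 <= a + 2 * (- (a + 1) / (2 * b)) * b" using q[of "- (a + 1) / (2 * b)"] True by simp
   thus False using \<open>b ~= 0\<close> by (simp add: field_simps)
  qed
  thus ?thesis using a0 c0 by simp
 next
  case False
  hence cp: "c > 0" using c0 by simp
  have "0 <= a + 2 * (- b / c) * b + (- b / c)^2 * c" by (rule q)
  also have "... = a - b^2 / c" using cp by (simp add: power2_eq_square field_simps)
  finally show ?thesis using cp by (simp add: field_simps)
 qed
 have "b <= K * a"
 proof (cases "b = 0")
  case True
  show ?thesis
  proof (cases "0 <= K")
   case True with \<open>b = 0\<close> a0 show ?thesis by simp
  next
   case False
   have "a <= K * (norm x)^2"
    using op_le_Re[OF K, of x] by (simp add: a_def blinfun.scaleR_left Re_cinner_self)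
   also have "... <= 0" using False by (simp add: mult_nonpos_nonneg)
   finally show ?thesis using a0 \<open>b = 0\<close> by simp
  qed
 next
  case False
  have "b^2 <= a * (K * b)" using bac mult_left_mono[OF cK a0] by linarith
  hence "b * b <= b * (K * a)" by (simp add: power2_eq_square algebra_simps)
  thus ?thesis using False b0 by (metis mult_le_cancel_left_pos order_le_less)
 qed
 thus ?thesis by (simp add: b_def a_def y_def)
qed

lemma positive_op_norm_le:
 assumes P: "positive_op T" and K: "T \<sqsubseteq> K *R Id" and K0: "0 <= K"
 shows "norm T <= K"
proof (rule norm_blinfun_bound[OF K0])
 fix x
 have "(norm (T x))^2 <= K * (K * (norm x)^2)"
  using positive_op_norm_sq_le[OF P K, of x] op_le_Re[OF K, of x] K0
  by (simp add: blinfun.scaleR_left Re_cinner_self) (meson mult_left_mono order_trans)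
 hence "(norm (T x))^2 <= (K * norm x)^2" by (simp add: power2_eq_square algebra_simps)
 thus "norm (T x) <= K * norm x" by (rule power2_le_imp_le) (use K0 in simp)
qed

subsection \<open>Square roots\<close>

text \<open>With \<open>T = Id - X\<close> and \<open>S = Id - L\<close> the equation
  \<open>S ** S = T\<close> becomes the fixed-point equation
  \<open>L = (1/2) *R (X + (L ** L))\<close>, which is solved by iteration from 0.\<close>

lemma ex_sqrt_contraction:
 fixes T :: "'a :: chilbert_space op"
 assumes P: "positive_op T" and T1: "T \<sqsubseteq> Id"
 shows "EX S. positive_op S & S ** S = T & (ALL R. R ** T = T ** R --> R ** S = S ** R)"
proof -
 define X where "X = Id - T"
 have TB: "T : BH" and Ta: "adj T = T" using P by (auto simp: positive_op_BH positive_op_adj)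
 have XP: "positive_op X" using T1 by (simp add: X_def op_le_def)
 have "X \<sqsubseteq> 1 *R Id" using P by (simp add: X_def op_le_def)
 hence X1: "norm X <= 1" using positive_op_norm_le[OF XP] by simp
 define Y where "Y = rec_nat (0 :: 'a op) (%_ Z. (1/2) *R (X + (Z ** Z)))"
 have Y0: "Y 0 = 0" and YS: "Y (Suc n) = (1/2) *R (X + (Y n ** Y n))" for n
  by (simp_all add: Y_def)
 \<comment> \<open>The same iteration for numbers, with 1 in place of \<open>X\<close>. It is
   increasing and bounded, and its increments dominate those of \<open>Y\<close>; so
   \<open>Y\<close> is Cauchy although the iteration is no strict contraction.\<close>
 define y where "y = rec_nat (0 :: real) (%_ z. (1 + z^2) / 2)"
 have y0: "y 0 = 0" and yS: "y (Suc n) = (1 + (y n)^2) / 2" for n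
  by (simp_all add: y_def)
 have y_bd: "0 <= y n & y n <= 1" for n
 proof (induction n)
  case (Suc n)
  hence "(y n)^2 <= 1" by (simp add: power_le_one)
  thus ?case by (simp add: yS)
 qed (simp add: y0)
 have Y_bd: "norm (Y n) <= y n" for n
 proof (induction n)
  case (Suc n)
  have "norm (Y n ** Y n) <= y n * y n"
   by (rule order_trans[OF norm_blinfun_compose mult_mono]) (use Suc y_bd in auto)
  hence "norm (X + (Y n ** Y n)) <= 1 + (y n)^2"
   using X1 norm_triangle_ineq[of X "Y n ** Y n"] by (simp add: power2_eq_square)
  thus ?case by (simp add: YS yS)
 qed (simp add: Y0 y0)
 have comm: "R ** Y n = Y n ** R" if "R ** T = T ** R" for R n
 proof (induction n)
  case (Suc n)
  have "R ** (Y n ** Y n) = Y n ** (Y n ** R)" by (metis Suc oL_assoc)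
  thus ?case using that by (simp add: YS X_def oL_simps)
 qed (simp add: Y0)
 have YY: "Y m ** Y n = Y n ** Y m" for m n
  by (rule comm, rule sym, rule comm) simp
 have step: "y n <= y (Suc n) & norm (Y (Suc n) - Y n) <= y (Suc n) - y n" for n
 proof (induction n)
  case 0
  show ?case using X1 by (simp add: YS yS Y0 y0)
 next
  case (Suc n)
  have e: "Y (Suc (Suc n)) - Y (Suc n)
    = (1/2) *R ((Y (Suc n) - Y n) ** (Y (Suc n) + Y n))"
   by (subst YS, subst (2) YS) (simp add: oL_simps scaleR_diff_right[symmetric] YY[of n "Suc n"])
  have "norm ((Y (Suc n) - Y n) ** (Y (Suc n) + Y n)) <= (y (Suc n) - y n) * (y (Suc n) + y n)"
   using Suc Y_bd[of n] Y_bd[of "Suc n"] y_bd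
   by (intro order_trans[OF norm_blinfun_compose mult_mono] norm_triangle_le) auto
  also have "... = (y (Suc n))^2 - (y n)^2" by (simp add: power2_eq_square algebra_simps)
  finally have 1: "norm (Y (Suc (Suc n)) - Y (Suc n)) <= ((y (Suc n))^2 - (y n)^2) / 2"
   by (simp add: e)
  also have "... = y (Suc (Suc n)) - y (Suc n)" by (simp add: yS field_simps)
  finally have 2: "norm (Y (Suc (Suc n)) - Y (Suc n)) <= y (Suc (Suc n)) - y (Suc n)" .
  thus ?case using order_trans[OF norm_ge_zero 2] by simp
 qed
 have inc: "incseq y" using step by (simp add: incseq_SucI)
 have diff: "norm (Y (n + k) - Y n) <= y (n + k) - y n" for n k
 proof (induction k)
  case (Suc k)
  have "norm (Y (n + Suc k) - Y n) <= norm (Y (Suc (n + k)) - Y (n + k)) + norm (Y (n + k) - Y n)"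
   using norm_triangle_ineq[of "Y (Suc (n + k)) - Y (n + k)" "Y (n + k) - Y n"] by simp
  thus ?case using Suc step[of "n + k"] by simp
 qed simp
 have "convergent y"
  by (rule Bseq_mono_convergent)
   (use inc y_bd in "auto simp: incseq_def abs_of_nonneg intro!: BseqI'[of _ 1]")
 hence Cy: "Cauchy y" by (rule convergent_Cauchy)
 have "Cauchy Y"
 proof (rule metric_CauchyI)
  fix e :: real assume "0 < e"
  then obtain N where N: "!!m n. m \<ge> N ==> n \<ge> N ==> dist (y m) (y n) < e"
   using metric_CauchyD[OF Cy] by blast
  have w: "dist (Y m) (Y n) < e" if "m \<ge> n" "n \<ge> N" for m n
   using diff[of n "m - n"] N[of m n] that by (simp add: dist_norm dist_real_def)
  have "dist (Y m) (Y n) < e" if "m \<ge> N" "n \<ge> N" for m n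
   using w[of m n] w[of n m] that by (cases "m \<ge> n") (auto simp: dist_commute)
  thus "EX M. ALL m>=M. ALL n>=M. dist (Y m) (Y n) < e" by blast
 qed
 then obtain L where L: "Y \<longlonglongrightarrow> L" using Cauchy_convergent convergent_def by blast
 have "(%n. Y (Suc n)) \<longlonglongrightarrow> (1/2) *R (X + (L ** L))"
  unfolding YS by (intro tendsto_intros L)
 hence LL: "L = (1/2) *R (X + (L ** L))"
  using LIMSEQ_unique L LIMSEQ_Suc by blast
 hence "2 *R L = X + (L ** L)" by (metis scaleR_scaleR scaleR_one mult_2 field_sum_of_halves times_divide_eq_right mult.right_neutral)
 hence LL2: "L + L = X + (L ** L)" by (simp add: scaleR_2)
 have YB: "Y n : BH & adj (Y n) = Y n" for n
  by (induction n) (use XP in "auto simp: Y0 YS adj_simps BH_intros positive_op_BH positive_op_adj")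
 have LB: "L : BH" using closed_sequentially[OF closed_BH] YB L by blast
 have L1: "norm L <= 1"
 proof (rule LIMSEQ_le_const2)
  show "(%n. norm (Y n)) \<longlonglongrightarrow> norm L" by (intro tendsto_intros L)
  show "EX N. ALL n>=N. norm (Y n) <= 1" using Y_bd y_bd order_trans by blast
 qed
 have La: "adj L = L"
 proof (rule adj_eqI)
  fix v w
  have "(%n. cinner (Y n v) w) \<longlonglongrightarrow> cinner (L v) w" by (intro tendsto_intros L)
  moreover have "(%n. cinner v (Y n w)) \<longlonglongrightarrow> cinner v (L w)" by (intro tendsto_intros L)
  moreover have "cinner (Y n v) w = cinner v (Y n w)" for n by (metis YB cinner_adj_right)
  ultimately show "cinner (L v) w = cinner v (L w)" using LIMSEQ_unique by simp
 qed
 define S where "S = Id - L"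
 have "positive_op S"
 proof (rule positive_opI)
  show "S : BH" "adj S = S" using LB La by (auto simp: S_def adj_diff intro: BH_intros)
  fix x
  have "Re (cinner (L x) x) <= Re (cinner ((norm L *R Id) x) x)"
   by (rule op_le_Re[OF op_le_norm[OF LB La]])
  also have "... <= 1 * (norm x)^2"
   using mult_right_mono[OF L1, of "(norm x)^2"]
   by (simp add: blinfun.scaleR_left Re_cinner_self)
  finally show "0 <= Re (cinner (S x) x)"
   by (simp add: S_def blinfun.diff_left cinner_linear Re_cinner_self)
 qed
 moreover have "S ** S = T"
  using LL2 by (simp add: S_def X_def oL_simps algebra_simps)
 moreover have "R ** S = S ** R" if R: "R ** T = T ** R" for R
 proof -
  have "(%n. R ** Y n) \<longlonglongrightarrow> (R ** L)" "(%n. Y n ** R) \<longlonglongrightarrow> (L ** R)"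
   by (intro tendsto_intros L)+
  hence "R ** L = L ** R" using comm[OF R] LIMSEQ_unique by simp
  thus ?thesis by (simp add: S_def oL_simps)
 qed
 ultimately show ?thesis by blast
qed

lemma ex_sqrt:
 assumes P: "positive_op T"
 shows "EX S. positive_op S & S ** S = T & (ALL R. R ** T = T ** R --> R ** S = S ** R)"
proof (cases "T = 0")
 case True thus ?thesis by (intro exI[of _ 0]) auto
next
 case False
 define r where "r = norm T"
 have r: "r > 0" using False by (simp add: r_def)
 define T' where "T' = inverse r *R T"
 have P': "positive_op T'" unfolding T'_def using P r by (intro positive_scaleR) auto
 have "positive_op (inverse r *R (r *R Id - T))"
  using op_le_norm[OF positive_op_BH[OF P] positive_op_adj[OF P]] r
  by (intro positive_scaleR) (auto simp: op_le_def r_def)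
 hence "T' \<sqsubseteq> Id" using r by (simp add: op_le_def T'_def scaleR_diff_right)
 from ex_sqrt_contraction[OF P' this] obtain S where S: "positive_op S" "S ** S = T'"
  "!!R. R ** T' = T' ** R ==> R ** S = S ** R" by blast
 have "sqrt r *R S ** sqrt r *R S = T"
  using r S(2) by (simp add: oL_scaleR_left oL_scaleR_right T'_def mult.assoc[symmetric])
 moreover have "positive_op (sqrt r *R S)" using S(1) r by (intro positive_scaleR) auto
 moreover have "R ** (sqrt r *R S) = (sqrt r *R S) ** R" if "R ** T = T ** R" for R
  unfolding oL_scaleR_left oL_scaleR_right
  by (subst S(3)) (simp_all add: T'_def oL_scaleR_left oL_scaleR_right that)
 ultimately show ?thesis by blast
qed

definition op_sqrt :: "'a :: chilbert_space op => 'a op" where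
 "op_sqrt T = (SOME S. positive_op S & S ** S = T & (ALL R. R ** T = T ** R --> R ** S = S ** R))"

lemma
 assumes "positive_op T"
 shows positive_op_sqrt: "positive_op (op_sqrt T)"
  and op_sqrt_square: "op_sqrt T ** op_sqrt T = T"
  and op_sqrt_commute: "R ** T = T ** R ==> R ** op_sqrt T = op_sqrt T ** R"
 using someI_ex[OF ex_sqrt[OF assms]] unfolding op_sqrt_def by auto

lemma op_sqrt_in_vn:
 assumes M: "von_neumann_algebra M" and T: "positive_op T" "T : M"
 shows "op_sqrt T : M"
proof -
 have "op_sqrt T : commutant (commutant M)"
 proof (rule commutantI)
  show "op_sqrt T : BH" by (rule positive_op_BH[OF positive_op_sqrt[OF T(1)]])
  fix x assume "x : commutant M"
  thus "op_sqrt T ** x = x ** op_sqrt T"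
   using op_sqrt_commute[OF T(1)] T(2) commutantD by metis
 qed
 thus ?thesis by (simp add: vn_bicommutant[OF M])
qed

subsection \<open>Positive parts and spectral projections\<close>

lemmas cont_blinfun = linear_continuous_on[OF lin_right]

lemma cont_scaleC: "continuous_on UNIV (%v :: 'a :: chilbert_space. c *C v)"
 by (intro linear_continuous_on bounded_linear_scaleC)

lemma eq_on_dense:
 fixes f g :: "'a :: topological_space => 'b :: t2_space"
 assumes "continuous_on UNIV f" "continuous_on UNIV g" "!!x. x : D ==> f x = g x" "closure D = UNIV"
 shows "f x = g x"
proof -
 have "closure D <= {x. f x = g x}" by (intro closure_minimal closed_Collect_eq) (use assms in auto)
 thus ?thesis using assms(4) by auto
qed

lemma blinfun_eq_on_dense:
 "(!!x. x : D ==> blinfun_apply S x = blinfun_apply T x) ==> closure D = UNIV ==> S = T"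
 by (rule blinfun_eqI, rule eq_on_dense[OF cont_blinfun cont_blinfun])

lemma csubspace_range: "T : BH ==> csubspace (range (blinfun_apply T))"
 by (rule csubspaceI)
  (auto simp: BH_apply[symmetric] blinfun.add_right[symmetric] simp del: plus_blinfun.rep_eq
   intro: range_eqI[of _ _ 0])

text \<open>On the range of \<open>y\<close> the form of \<open>y\<close> takes the values of the
  form of the cube, and the orthogonal complement of the range is the kernel. It yields the
  positivity of the two parts of a self-adjoint operator without functional calculus.\<close>

lemma positive_op_cube:
 assumes y: "y : BH" "adj y = y" and P: "positive_op (y ** (y ** y))"
 shows "positive_op y"
proof (rule positive_opI[OF y])
 fix x
 define V where "V = closure (range (blinfun_apply y))"
 have V: "csubspace V" "closed V"
  unfolding V_def using y by (simp_all add: csubspace_closure csubspace_range)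
 have ym: "y v : V" for v unfolding V_def by (rule closure_subset[THEN subsetD]) simp
 have "y (x - prj V x) = 0"
 proof (rule cinner_ext)
  fix z show "cinner (y (x - prj V x)) z = cinner 0 z"
   using prj_orth[OF V ym[of z], of x] cinner_adj_right[OF y(1), of "x - prj V x" z] y(2) by simp
 qed
 hence yx: "y x = y (prj V x)" by (simp add: blinfun.diff_right)
 have "closed {v. 0 <= Re (cinner (y v) v)}"
  by (intro closed_Collect_le continuous_intros cont_blinfun)
 moreover have "range (blinfun_apply y) <= {v. 0 <= Re (cinner (y v) v)}"
  using positive_op_Re[OF P] y by (auto simp: cinner_adj_right[of y, symmetric])
 ultimately have "V <= {v. 0 <= Re (cinner (y v) v)}" unfolding V_def by (rule closure_minimal[rotated])
 hence "0 <= Re (cinner (y (prj V x)) (prj V x))" using prj_mem[OF V] by blast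
 also have "cinner (y (prj V x)) (prj V x) = cinner (y x) x"
  using prj_orth[OF V ym, of x "prj V x"] yx
  by (metis cinner_commute cinner_diff_left complex_cnj_zero right_minus_eq)
 finally show "0 <= Re (cinner (y x) x)" .
qed

text \<open>With \<open>h\<close> the absolute value of \<open>x\<close>, the parts are the halves
  of \<open>h + x\<close> and \<open>h - x\<close>. Their product vanishes, so
  \<open>a ** (h ** a)\<close> is the cube of \<open>a\<close>, and likewise for
  \<open>b\<close>.\<close>

lemma ex_positive_part:
 assumes x: "x : BH" "adj x = x"
 shows "EX a b. positive_op a & positive_op b & x = a - b & a ** b = 0 & b ** a = 0 &
  (ALL R. R ** x = x ** R --> R ** a = a ** R)"
proof -
 have P: "positive_op (x ** x)" using positive_adj_self[OF x(1)] x(2) by simp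
 define h where "h = op_sqrt (x ** x)"
 have hP: "positive_op h" and hh: "h ** h = x ** x"
  unfolding h_def using positive_op_sqrt[OF P] op_sqrt_square[OF P] by auto
 have hc: "R ** h = h ** R" if "R ** x = x ** R" for R
 proof -
  have "R ** (x ** x) = (x ** x) ** R" by (metis that oL_assoc)
  thus ?thesis unfolding h_def by (rule op_sqrt_commute[OF P])
 qed
 define a b where "a = (1/2) *R (h + x)" and "b = (1/2) *R (h - x)"
 have xh: "x ** h = h ** x" by (rule hc) simp
 have ab: "a ** b = 0" "b ** a = 0" by (simp_all add: a_def b_def oL_simps hh xh scaleR_diff_right)
 have hab: "h = a + b" and xab: "x = a - b"
  by (simp_all add: a_def b_def scaleR_add_right scaleR_diff_right flip: scaleR_add_left)
 have B: "a : BH" "b : BH" "adj a = a" "adj b = b"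
  using hP x by (auto simp: a_def b_def adj_simps positive_op_BH positive_op_adj BH_intros)
 have "positive_op a"
  by (rule positive_op_cube) (use positive_conj[OF hP B(1)] in "simp_all add: B hab oL_simps ab")
 moreover have "positive_op b"
  by (rule positive_op_cube) (use positive_conj[OF hP B(2)] in "simp_all add: B hab oL_simps ab")
 moreover have "R ** a = a ** R" if "R ** x = x ** R" for R
  unfolding a_def oL_scaleR_left oL_scaleR_right oL_add_left oL_add_right hc[OF that] that ..
 ultimately show ?thesis using xab ab by blast
qed

lemma vn_range_projection:
 assumes M: "von_neumann_algebra M" and a: "a : M"
 shows "prj (closure (range (blinfun_apply a))) : M"
proof -
 have aB: "a : BH" using M a vn_inBH by blast
 have "prj (closure (range (blinfun_apply a))) : commutant (commutant M)"
 proof (rule prj_in_commutant)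
  fix x v assume x: "x : commutant M" and v: "v : closure (range (blinfun_apply a))"
  have "x ` closure (range (blinfun_apply a)) <= closure (x ` range (blinfun_apply a))"
   by (rule image_closure_subset)
    (auto intro!: cont_blinfun closure_subset[THEN subsetD])
  also have "x ` range (blinfun_apply a) <= range (blinfun_apply a)"
   using commutant_apply[OF x a] by auto
  finally show "x v : closure (range (blinfun_apply a))" using v closure_mono by blast
 qed (use aB M in "auto simp: csubspace_closure csubspace_range commutant_BH
   intro: vn_adj[OF vn_commutant_vn]")
 thus ?thesis by (simp add: vn_bicommutant[OF M])
qed

text \<open>\<open>p\<close> projects onto the closed range of the positive part of
  \<open>x - c *R Id\<close>. The last conjunct is what later keeps \<open>p\<close> below a
  projection that carries \<open>x\<close>.\<close>

lemma ex_spectral_projection: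
 assumes M: "von_neumann_algebra M" and x: "x : M" "adj x = x"
 shows "EX p:M. is_proj p & p ** x = x ** p & positive_op (p ** (x - c *R Id)) &
  positive_op ((Id - p) ** (c *R Id - x)) &
  (ALL e. is_proj e --> e ** x = x ** e --> e ** p = p ** e)"
proof -
 define y where "y = x - c *R Id"
 have xB: "x : BH" using M x vn_inBH by blast
 have y: "y : BH" "adj y = y" using xB x by (auto simp: y_def adj_simps BH_intros)
 obtain a b where aP: "positive_op a" and bP: "positive_op b" and yab: "y = a - b"
  and ab: "a ** b = 0" "b ** a = 0" and ac: "!!R. R ** y = y ** R ==> R ** a = a ** R"
  using ex_positive_part[OF y] by blast
 have acx: "R ** a = a ** R" if "R ** x = x ** R" for R
  by (rule ac) (simp add: y_def oL_simps that)
 note aB = positive_op_BH[OF aP] and bB = positive_op_BH[OF bP]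
 have "a : commutant (commutant M)"
  by (rule commutantI[OF aB]) (metis acx x(1) commutantD)
 hence aM: "a : M" by (simp add: vn_bicommutant[OF M])
 define V where "V = closure (range (blinfun_apply a))"
 have V: "csubspace V" "closed V" using aB by (simp_all add: V_def csubspace_closure csubspace_range)
 define p where "p = prj V"
 have pM: "p : M" unfolding p_def V_def by (rule vn_range_projection[OF M aM])
 have p: "is_proj p" unfolding p_def by (rule is_proj_prj[OF V])
 have aV: "a v : V" for v unfolding V_def by (rule closure_subset[THEN subsetD]) simp
 have pa: "p ** a = a" by (rule blinfun_eqI) (simp add: p_def prj_fix[OF V aV])
 have pb: "b ** p = 0"
 proof -
  have "closed {v. b v = 0}"
   by (intro closed_Collect_eq cont_blinfun continuous_on_const)
  moreover have "range (blinfun_apply a) <= {v. b v = 0}"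
   using ab(2) by (auto simp flip: oL_apply)
  ultimately have "V <= {v. b v = 0}" unfolding V_def by (rule closure_minimal[rotated])
  thus ?thesis using prj_mem[OF V] by (intro blinfun_eqI) (auto simp: p_def)
 qed
 have pB: "p : BH" "adj p = p" using p is_projD by auto
 have ap: "a ** p = a" using arg_cong[OF pa, of adj] aB pB by (simp add: adj_compose positive_op_adj[OF aP])
 have bp: "p ** b = 0" using arg_cong[OF pb, of adj] bB pB by (simp add: adj_compose positive_op_adj[OF bP])
 have "p ** y = a" "y ** p = a" by (simp_all add: yab oL_simps pa ap pb bp)
 note py = this
 have "p ** x = x ** p"
  using py by (simp add: y_def oL_simps) (metis diff_add_cancel)
 moreover have "positive_op (p ** (x - c *R Id))" using py aP by (simp add: y_def)
 moreover have "(Id - p) ** (c *R Id - x) = b"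
 proof -
  have "(Id - p) ** (c *R Id - x) = - (y - (p ** y))"
   by (simp add: y_def oL_simps scaleR_diff_right)
  also have "... = b" unfolding py(1) by (simp add: yab)
  finally show ?thesis .
 qed
 hence "positive_op ((Id - p) ** (c *R Id - x))" using bP by simp
 moreover have "e ** p = p ** e" if e: "is_proj e" "e ** x = x ** e" for e
 proof -
  have "p : commutant {e}" unfolding p_def
  proof (rule prj_in_commutant[OF V])
   fix z v assume "z : {e}" and v: "v : V"
   have "e ` V <= V"
    unfolding V_def
   proof (rule image_closure_subset)
    show "e ` range (blinfun_apply a) <= closure (range (blinfun_apply a))"
    proof -
     have "e (a v) = a (e v)" for v
      using acx[OF e(2)] by (metis oL_apply)
     thus ?thesis using aV unfolding V_def by auto
    qed
   qed (auto intro!: cont_blinfun)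
   thus "z v : V" using v \<open>z : {e}\<close> by auto
  qed (use is_projD[OF e(1)] in auto)
  thus ?thesis using commutantD[of p "{e}" e] by simp
 qed
 ultimately show ?thesis using pM p by blast
qed

lemma dyadic_step:
 assumes M: "von_neumann_algebra M" and x: "x : M" "positive_op x" "x \<sqsubseteq> c *R Id"
  and c: "0 < c" and e: "is_proj e" "x ** e = x"
 shows "EX p:M. is_proj p & p ** e = p & positive_op (x - (c/2) *R p) &
  x - (c/2) *R p \<sqsubseteq> (c/2) *R Id"
proof -
 note xB = positive_op_BH[OF x(2)] and xa = positive_op_adj[OF x(2)]
 obtain p where p: "p : M" "is_proj p" "p ** x = x ** p"
  "positive_op (p ** (x - (c/2) *R Id))"
  "positive_op ((Id - p) ** ((c/2) *R Id - x))"
  "!!e. is_proj e ==> e ** x = x ** e ==> e ** p = p ** e"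
  using ex_spectral_projection[OF M x(1) xa, of "c/2"] by blast
 note pD = is_projD[OF p(2)] and eD = is_projD[OF e(1)]
 have ex: "e ** x = x" using arg_cong[OF e(2), of adj] xB eD xa by (simp add: adj_compose)
 have pe: "p ** e = e ** p" using p(6)[OF e(1)] ex e(2) by simp
 have "p ** e = p"
 proof (rule blinfun_eqI)
  fix v
  \<comment> \<open>The part of \<open>p\<close> outside \<open>e\<close>: there \<open>x\<close>
    vanishes, whereas on the range of \<open>p\<close> it is at least \<open>c/2\<close>.\<close>
  define w where "w = p (v - e v)"
  have pw: "p w = w" by (simp add: w_def pD)
  have "e w = p (e (v - e v))" unfolding w_def by (metis oL_apply pe)
  hence ew: "e w = 0" by (simp add: blinfun.diff_right eD)
  have xw: "x w = 0" using e(2) ew by (metis blinfun.zero_right oL_apply)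
  have "0 <= Re (cinner ((p ** (x - (c/2) *R Id)) w) w)" by (rule positive_op_Re[OF p(4)])
  also have "... = - (c/2) * (norm w)^2"
   by (simp add: blinfun.diff_left blinfun.scaleR_left blinfun.scaleR_right blinfun.minus_right xw pw Re_cinner_self)
  finally have "w = 0" using c by (simp add: zero_le_mult_iff mult_le_0_iff)
  thus "(p ** e) v = p v" by (simp add: w_def blinfun.diff_right)
 qed
 moreover have "positive_op (x - (c/2) *R p)"
 proof -
  have i: "is_proj (Id - p)" by (rule is_proj_complement[OF p(2)])
  have "positive_op ((Id - p) ** (x ** (Id - p)))"
   using positive_conj[OF x(2) is_projD(1)[OF i]] is_projD(3)[OF i] by simp
  also have "(Id - p) ** (x ** (Id - p)) = x - (p ** x)"
   using pD(2) p(3) by (simp add: oL_simps) (metis oL_assoc diff_self diff_zero)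
  finally have "positive_op ((p ** (x - (c/2) *R Id)) + (x - (p ** x)))"
   by (rule positive_add[OF p(4)])
  thus ?thesis by (simp add: oL_simps algebra_simps)
 qed
 moreover have "x - (c/2) *R p \<sqsubseteq> (c/2) *R Id"
 proof -
  have "positive_op (p ** ((c *R Id - x) ** p))"
   using positive_conj[of "c *R Id - x" p] x(3) pD by (simp add: op_le_def)
  also have "p ** ((c *R Id - x) ** p) = c *R p - (p ** x)"
   using pD(2) p(3) by (simp add: oL_simps) (metis oL_assoc)
  finally have "positive_op (((Id - p) ** ((c/2) *R Id - x)) + (c *R p - (p ** x)))"
   by (rule positive_add[OF p(5)])
  also have "((Id - p) ** ((c/2) *R Id - x)) + (c *R p - (p ** x))
    = (c/2) *R Id - (x - (c/2) *R p)"
  proof -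
   have "c *R p = (c/2) *R p + (c/2) *R p" by (simp flip: scaleR_add_left)
   thus ?thesis by (simp add: oL_simps algebra_simps)
  qed
  finally show ?thesis by (simp add: op_le_def)
 qed
 ultimately show ?thesis using p by blast
qed

text \<open>Every positive contraction of a von Neumann algebra has a dyadic expansion
 \<open>\<Sum> 2\<^sup>-\<^sup>k p\<^sub>k\<close> with projections \<open>p\<^sub>k\<close>; this replaces the spectral theorem.\<close>

lemma dyadic_expansion:
 assumes M: "von_neumann_algebra M" and x: "x : M" "positive_op x" "x \<sqsubseteq> Id"
  and e: "is_proj e" "x ** e = x"
 shows "EX p. ALL n. p n : M & is_proj (p n) & p n ** e = p n &
  positive_op (x - (\<Sum>k<n. (1/2) ^ Suc k *R p k)) &
  x - (\<Sum>k<n. (1/2) ^ Suc k *R p k) \<sqsubseteq> (1/2) ^ n *R Id"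
proof -
 define good where "good n y \<longleftrightarrow> y : M & positive_op y & y \<sqsubseteq> (1/2) ^ n *R Id & y ** e = y" for n y
 have "ALL n y. EX p. good n y --> (p : M & is_proj p & p ** e = p & good (Suc n) (y - (1/2) ^ Suc n *R p))"
 proof (intro allI)
  fix n y
  show "EX p. good n y --> (p : M & is_proj p & p ** e = p & good (Suc n) (y - (1/2) ^ Suc n *R p))"
  proof (cases "good n y")
   case True
   hence "EX p:M. is_proj p & p ** e = p & positive_op (y - ((1/2) ^ n / 2) *R p) &
     y - ((1/2) ^ n / 2) *R p \<sqsubseteq> ((1/2) ^ n / 2) *R Id"
    by (intro dyadic_step[OF M _ _ _ _ e(1)]) (auto simp: good_def)
   then obtain p where p: "p : M" "is_proj p" "p ** e = p"
    "positive_op (y - (1/2) ^ Suc n *R p)" "y - (1/2) ^ Suc n *R p \<sqsubseteq> (1/2) ^ Suc n *R Id"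
    by (auto simp: mult.commute)
   hence "good (Suc n) (y - (1/2) ^ Suc n *R p)"
    using True unfolding good_def by (auto intro!: vn_intros[OF M] simp: oL_simps)
   thus ?thesis using p by blast
  qed auto
 qed
 then obtain P where P: "!!n y. good n y ==> P n y : M & is_proj (P n y) & P n y ** e = P n y &
   good (Suc n) (y - (1/2) ^ Suc n *R P n y)" by metis
 define r where "r = rec_nat x (%n y. y - (1/2) ^ Suc n *R P n y)"
 have r0: "r 0 = x" and rS: "r (Suc n) = r n - (1/2) ^ Suc n *R P n (r n)" for n by (simp_all add: r_def)
 have g: "good n (r n)" for n
  by (induction n) (use x e P in "auto simp: r0 rS good_def")
 have s: "r n = x - (\<Sum>k<n. (1/2) ^ Suc k *R P k (r k))" for n
  by (induction n) (auto simp: r0 rS)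
 show ?thesis
 proof (intro exI[of _ "%n. P n (r n)"] allI conjI)
  fix n
  show "P n (r n) : M" "is_proj (P n (r n))" "P n (r n) ** e = P n (r n)" using P[OF g] by auto
  show "positive_op (x - (\<Sum>k<n. (1/2) ^ Suc k *R P k (r k)))"
   "x - (\<Sum>k<n. (1/2) ^ Suc k *R P k (r k)) \<sqsubseteq> (1/2) ^ n *R Id"
   using g[of n] unfolding good_def s[symmetric] by auto
 qed
qed

subsection \<open>Polar decomposition\<close>

text \<open>The defect \<open>w = v - (v ** (adj v ** v))\<close> satisfies
  \<open>adj w ** w = 0\<close>.\<close>

lemma partial_isometry:
 assumes v: "v : BH" and s: "is_proj (adj v ** v)"
 shows "v ** (adj v ** v) = v" and "is_proj (v ** adj v)" and "adj v ** (v ** adj v) = adj v"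
proof -
 define w where "w = v - (v ** (adj v ** v))"
 have vv: "(adj v ** v) ** (adj v ** v) = adj v ** v" using is_projD[OF s] by simp
 have "adj w ** w = 0"
  using v vv by (simp add: w_def adj_simps BH_intros oL_simps)
 hence "w = 0" by (rule adj_compose_self_eq_0[rotated]) (use v in "auto simp: w_def intro!: BH_intros adj_BH")
 thus 1: "v ** (adj v ** v) = v" by (simp add: w_def)
 from arg_cong[OF 1, of adj] show 2: "adj v ** (v ** adj v) = adj v"
  using v by (simp add: adj_compose BH_intros oL_assoc)
 show "is_proj (v ** adj v)"
  unfolding is_proj_def using v 2 by (simp add: BH_intros oL_assoc adj_compose)
qed

text \<open>The partial isometry sends \<open>h y + z\<close> to \<open>x y\<close>, where
  \<open>z\<close> is orthogonal to the range of \<open>h\<close>; such sums are dense. The last two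
  conjuncts say that \<open>v\<close> is annihilated by whatever annihilates \<open>x\<close>, which
  is how supports are compared afterwards.\<close>

lemma polar_decomposition:
 assumes M: "von_neumann_algebra M" and x: "x : M"
 shows "EX v:M. EX h:M. positive_op h & h ** h = adj x ** x & v ** h = x & is_proj (adj v ** v) &
  (adj v ** v) ** h = h & (v ** adj v) ** x = x &
  (ALL R. x ** R = 0 --> v ** R = 0) & (ALL R. R ** x = 0 --> R ** v = 0)"
proof -
 have xB: "x : BH" using M x vn_inBH by blast
 define T where "T = adj x ** x"
 have TP: "positive_op T" unfolding T_def by (rule positive_adj_self[OF xB])
 have TM: "T : M" unfolding T_def by (intro vn_intros M x)
 define h where "h = op_sqrt T"
 have hP: "positive_op h" and hh: "h ** h = T" and hM: "h : M"
  unfolding h_def using positive_op_sqrt[OF TP] op_sqrt_square[OF TP] op_sqrt_in_vn[OF M TP TM] by auto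
 note hB = positive_op_BH[OF hP] and ha = positive_op_adj[OF hP]
 have nh: "norm (h y) = norm (x y)" for y
 proof -
  have "(norm (h y))^2 = (norm (x y))^2"
   using norm_apply_sq[OF hB, of y] norm_apply_sq[OF xB, of y] by (simp only: ha hh T_def)
  thus ?thesis by (metis norm_ge_zero power2_eq_imp_eq)
 qed
 define V where "V = closure (range (blinfun_apply h))"
 have V: "csubspace V" "closed V" using hB by (simp_all add: V_def csubspace_closure csubspace_range)
 define s where "s = prj V"
 have sp: "is_proj s" unfolding s_def by (rule is_proj_prj[OF V])
 have sM: "s : M" unfolding s_def V_def by (rule vn_range_projection[OF M hM])
 have sh: "s (h y) = h y" for y
  unfolding s_def by (rule prj_fix[OF V]) (auto simp: V_def intro!: closure_subset[THEN subsetD])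
 have hs: "h (s y) = h y" for y
 proof -
  have "s ** h = h" by (rule blinfun_eqI) (simp add: sh)
  from arg_cong[OF this, of adj] have "h ** s = h"
   using hB ha is_projD[OF sp] by (simp add: adj_compose)
  thus ?thesis by (metis oL_apply)
 qed
 define G where "G = (%(y, z). (h y + (z - s z), x y)) ` UNIV"
 have orth: "(norm (s (h y + (z - s z))))^2 = (norm (x y))^2" for y z
  by (simp add: blinfun.add_right blinfun.diff_right sh is_projD[OF sp] nh)
 have "subspace G"
  unfolding subspace_def G_def
 proof (intro conjI ballI allI)
  show "0 : (%(y, z). (h y + (z - s z), x y)) ` UNIV"
   by (rule image_eqI[of _ _ "(0, 0)"]) (auto simp: zero_prod_def)
  fix g assume "g : (%(y, z). (h y + (z - s z), x y)) ` UNIV"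
  then obtain y z where g: "g = (h y + (z - s z), x y)" by auto
  show "c *R g : (%(y, z). (h y + (z - s z), x y)) ` UNIV" for c
   by (rule image_eqI[of _ _ "(c *R y, c *R z)"])
    (auto simp: g blinfun.scaleR_right algebra_simps)
  fix g' assume "g' : (%(y, z). (h y + (z - s z), x y)) ` UNIV"
  then obtain y' z' where g': "g' = (h y' + (z' - s z'), x y')" by auto
  show "g + g' : (%(y, z). (h y + (z - s z), x y)) ` UNIV"
   by (rule image_eqI[of _ _ "(y + y', z + z')"])
    (auto simp: g g' blinfun.add_right algebra_simps)
 qed
 moreover have "norm b <= 1 * norm a" if abG: "(a, b) : G" for a b
 proof -
  obtain y z where ab: "a = h y + (z - s z)" "b = x y" using abG by (auto simp: G_def)
  have "(norm b)^2 = (norm (s a))^2" using orth ab by simp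
  hence "norm b = norm (s a)" by (metis norm_ge_zero power2_eq_imp_eq)
  thus ?thesis using is_proj_norm_le[OF sp] by simp
 qed
 moreover have "closure (fst ` G) = UNIV"
 proof -
  have "w : closure (fst ` G)" for w
  proof -
   have "s w : closure (range (blinfun_apply h))" using prj_mem[OF V, of w] by (simp add: s_def V_def)
   then obtain f where f: "ALL n. f n : range (blinfun_apply h)" "f \<longlonglongrightarrow> s w" unfolding closure_sequential by blast
   have "f n + (w - s w) : fst ` G" for n
   proof -
    obtain y where "f n = h y" using f(1) by blast
    thus ?thesis unfolding G_def by force
   qed
   moreover have "(%n. f n + (w - s w)) \<longlonglongrightarrow> s w + (w - s w)" by (intro tendsto_intros f)
   ultimately show ?thesis unfolding closure_sequential by (intro exI[of _ "%n. f n + (w - s w)"]) auto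
  qed
  thus ?thesis by blast
 qed
 note dense = this
 ultimately obtain v where v: "ALL (a, b):G. blinfun_apply v a = b"
  using ex_bounded_extension[of G 1] by auto
 have vG: "v (h y + (z - s z)) = x y" for y z using v unfolding G_def by auto
 have vh: "v ** h = x" using vG[of _ 0] by (intro blinfun_eqI) simp
 have fstG: "fst ` G = {h y + (z - s z) | y z. True}" unfolding G_def by force
 have vB: "v : BH"
  unfolding BH_def
 proof (intro CollectI allI)
  fix c w
  have "bounded_linear (%w. v (c *C w))" "bounded_linear (%w. c *C v w)"
   by (intro bounded_linear_compose[OF lin_right bounded_linear_scaleC]
     bounded_linear_compose[OF bounded_linear_scaleC lin_right])+
  hence "Blinfun (%w. v (c *C w)) = Blinfun (%w. c *C v w)"
  proof (intro blinfun_eq_on_dense[OF _ dense])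
   fix a assume "a : fst ` G"
   then obtain y z where a: "a = h y + (z - s z)" unfolding fstG by blast
   have "c *C a = h (c *C y) + (c *C z - s (c *C z))"
    by (simp add: a scaleC_add_right scaleC_diff_right BH_apply[OF hB] BH_apply[OF is_projD(1)[OF sp]])
   hence "v (c *C a) = c *C v a" by (simp add: vG BH_apply[OF xB]) (simp add: a vG)
   thus "blinfun_apply (Blinfun (%w. v (c *C w))) a = blinfun_apply (Blinfun (%w. c *C v w)) a"
    by (simp add: bounded_linear_Blinfun_apply \<open>bounded_linear (%w. v (c *C w))\<close> \<open>bounded_linear (%w. c *C v w)\<close>)
  qed
  thus "v (c *C w) = c *C v w"
   by (metis bounded_linear_Blinfun_apply \<open>bounded_linear (%w. v (c *C w))\<close> \<open>bounded_linear (%w. c *C v w)\<close>)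
 qed
 have "v : commutant (commutant M)"
 proof (rule commutantI[OF vB])
  fix r assume r: "r : commutant M"
  show "v ** r = r ** v"
  proof (rule blinfun_eq_on_dense[OF _ dense])
   fix a assume "a : fst ` G"
   then obtain y z where a: "a = h y + (z - s z)" unfolding fstG by blast
   have "r a = h (r y) + (r z - s (r z))"
    using commutant_apply[OF r hM] commutant_apply[OF r sM]
    by (simp add: a blinfun.add_right blinfun.diff_right)
   thus "(v ** r) a = (r ** v) a"
    using commutant_apply[OF r x] by (simp add: vG) (simp add: a vG)
  qed
 qed
 hence vM: "v : M" by (simp add: vn_bicommutant[OF M])
 have vs: "(norm (v w))^2 = (norm (s w))^2" for w
  by (rule eq_on_dense[OF _ _ _ dense, of "%w. (norm (v w))^2"]) (use orth vG fstG in "auto intro!: continuous_intros cont_blinfun")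
 have vvs: "adj v ** v = s"
 proof -
  have "(adj v ** v) - s = 0"
  proof (rule op_zeroI)
   fix w
   have "cinner ((adj v ** v) w) w = of_real ((norm (v w))^2)"
    by (simp add: cinner_adj_left[OF vB] cinner_self)
   moreover have "cinner (s w) w = of_real ((norm (s w))^2)"
    by (metis cinner_self is_proj_cinner sp)
   ultimately show "cinner (((adj v ** v) - s) w) w = 0"
    by (simp add: blinfun.diff_left cinner_linear vs)
  qed (use vB is_projD[OF sp] in "auto intro!: BH_intros adj_BH")
  thus ?thesis by simp
 qed
 have ss: "s ** h = h" by (rule blinfun_eqI) (simp add: sh)
 have "(v ** adj v) ** x = x"
  using ss vvs vh by (metis oL_assoc)
 moreover have "v ** R = 0" if R: "x ** R = 0" for R
 proof (rule blinfun_eqI)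
  fix w
  have "h (R w) = 0"
   using nh[of "R w"] R by (metis oL_apply norm_eq_zero zero_blinfun.rep_eq)
  hence "cinner (R w) (h z) = 0" for z by (metis cinner_adj_right cinner_zero_left hB ha)
  hence "R w - s (R w) = R w"
  proof -
   have o: "cinner (R w) z = 0" if "z : V" for z
   proof -
    have "closed {z. cinner (R w) z = 0}" by (intro closed_Collect_eq continuous_intros)
    moreover have "range (blinfun_apply h) <= {z. cinner (R w) z = 0}"
     using \<open>!!z. cinner (R w) (h z) = 0\<close> by auto
    ultimately show ?thesis using that unfolding V_def using closure_minimal by blast
   qed
   have "cinner (s (R w)) (s (R w)) = 0"
    using o[OF prj_mem[OF V, of "R w"]] is_proj_cinner[OF sp, of "R w" "R w"]
    by (metis cinner_commute complex_cnj_zero s_def)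
   thus ?thesis by simp
  qed
  thus "(v ** R) w = (0 :: _ op) w" using vG[of 0 "R w"] by simp
 qed
 moreover have "R ** v = 0" if R: "R ** x = 0" for R
 proof (rule blinfun_eq_on_dense[OF _ dense])
  fix a assume "a : fst ` G"
  then obtain y z where a: "a = h y + (z - s z)" unfolding fstG by blast
  show "(R ** v) a = (0 :: _ op) a"
   using R by (simp add: a vG) (metis oL_apply zero_blinfun.rep_eq)
 qed
 ultimately show ?thesis
  using vM hM hP hh vh vvs sp ss unfolding T_def by (intro bexI[of _ v] bexI[of _ h]) auto
qed

section \<open>Normality\<close>

text \<open>The directed set itself, regarded as a net; in this form strong limits along
  \<open>D\<close> are ordinary filter limits.\<close>

definition up_filter :: "'a :: chilbert_space op set => 'a op filter" where
 "up_filter D = (INF d\<in>D. principal {d' : D. d \<sqsubseteq> d'})"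

lemma eventually_up_filter:
 assumes "up_directed D"
 shows "eventually P (up_filter D) \<longleftrightarrow> (EX d:D. ALL d':D. d \<sqsubseteq> d' --> P d')"
proof -
 have "eventually P (up_filter D) \<longleftrightarrow> (EX d:D. eventually P (principal {d' : D. d \<sqsubseteq> d'}))"
  unfolding up_filter_def
 proof (rule eventually_INF_base)
  show "D ~= {}" using assms by (simp add: up_directed_def)
  fix a b assume "a : D" "b : D"
  then obtain c where "c : D" "a \<sqsubseteq> c" "b \<sqsubseteq> c" using assms unfolding up_directed_def by blast
  thus "EX x:D. principal {d' : D. x \<sqsubseteq> d'} <= inf (principal {d' : D. a \<sqsubseteq> d'}) (principal {d' : D. b \<sqsubseteq> d'})"
   by (intro bexI[of _ c]) (auto intro: op_le_trans)
 qed
 thus ?thesis by (auto simp: eventually_principal)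
qed

lemma up_filter_nonbot: "up_directed D ==> up_filter D ~= bot"
 unfolding trivial_limit_def
 by (auto simp: eventually_up_filter) (meson op_le_refl)

lemma up_filter_in: "up_directed D ==> \<forall>\<^sub>F d in up_filter D. d : D"
 by (auto simp: eventually_up_filter up_directed_def)

lemma self_adjoint_strong_limit:
 fixes L :: "'a :: chilbert_space op"
 assumes F: "F ~= bot" and T: "\<forall>\<^sub>F i in F. T i : BH & adj (T i) = T i"
  and lim: "!!v. ((%i. blinfun_apply (T i) v) \<longlongrightarrow> L v) F"
 shows "adj L = L"
proof (rule adj_eqI)
 fix x y
 have "((%i. cinner (T i x) y) \<longlongrightarrow> cinner x (L y)) F"
 proof (rule Lim_transform_eventually)
  show "((%i. cinner x (T i y)) \<longlongrightarrow> cinner x (L y)) F" by (intro tendsto_intros lim)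
  show "\<forall>\<^sub>F i in F. cinner x (T i y) = cinner (T i x) y"
   using T by eventually_elim (metis cinner_adj_right)
 qed
 moreover have "((%i. cinner (T i x) y) \<longlongrightarrow> cinner (L x) y) F" by (intro tendsto_intros lim)
 ultimately show "cinner (L x) y = cinner x (L y)" using tendsto_unique[OF F] by blast
qed

text \<open>Above a fixed \<open>d1\<close> the differences are positive and bounded by
  \<open>K\<close>, hence \<open>|(d' - d) x|^2\<close> is at most \<open>K\<close> times the
  increment of the form at \<open>x\<close>. The forms increase and are bounded, so
  \<open>d x\<close> converges.\<close>

lemma vigier:
 fixes D :: "'a :: chilbert_space op set"
 assumes D: "up_directed D" and sa: "!!d. d : D ==> d : BH & adj d = d"
  and b: "b : BH" "adj b = b" and Db: "!!d. d : D ==> d \<sqsubseteq> b"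
 shows "EX s. s : BH & adj s = s & (ALL x. ((%d. blinfun_apply d x) \<longlongrightarrow> s x) (up_filter D)) &
  (ALL d:D. d \<sqsubseteq> s) & (ALL t. t : BH --> adj t = t --> (ALL d:D. d \<sqsubseteq> t) --> s \<sqsubseteq> t)"
proof -
 define F where "F = up_filter D"
 note ev = eventually_up_filter[OF D, folded F_def]
 have Fb: "F ~= bot" unfolding F_def by (rule up_filter_nonbot[OF D])
 obtain d1 where d1: "d1 : D" using D by (auto simp: up_directed_def)
 define K where "K = norm (b - d1)"
 have K0: "0 <= K" by (simp add: K_def)
 have nd: "(norm (d' x - d x))^2 <= K * (Re (cinner (d' x) x) - Re (cinner (d x) x))"
  if "d : D" "d' : D" "d1 \<sqsubseteq> d" "d \<sqsubseteq> d'" for d d' x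
 proof -
  have P: "positive_op (d' - d)" using that by (simp add: op_le_def)
  have "b - d1 - (d' - d) = (b - d') + (d - d1)" by simp
  hence "d' - d \<sqsubseteq> b - d1"
   using positive_add[of "b - d'" "d - d1"] Db[OF that(2)] that(3) unfolding op_le_def by (simp only:)
  moreover have "b - d1 \<sqsubseteq> K *R Id" unfolding K_def
   by (rule op_le_norm) (use b sa[OF d1] in "auto simp: adj_diff intro: BH_intros")
  ultimately have "d' - d \<sqsubseteq> K *R Id" by (rule op_le_trans)
  from positive_op_norm_sq_le[OF P this, of x] show ?thesis
   by (simp add: blinfun.diff_left cinner_linear)
 qed
 have ex: "EX y. ((%d. blinfun_apply d x) \<longlongrightarrow> y) F & norm y <= (norm d1 + K) * norm x" for x
 proof -
  define q where "q d = Re (cinner (d x) x)" for d :: "'a op"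
  have qb: "bdd_above (q ` D)" by (rule bdd_aboveI[of _ "q b"]) (use Db op_le_Re in "auto simp: q_def")
  define S where "S = (SUP d\<in>D. q d)"
  \<comment> \<open>These almost maximal elements need not be comparable; any two of them are
    compared through a common upper bound in \<open>D\<close>.\<close>
  have "EX d:D. d1 \<sqsubseteq> d & q d > S - inverse (real (Suc n))" for n
  proof -
   have "S - inverse (real (Suc n)) < S" by simp
   then obtain d where d: "d : D" "q d > S - inverse (real (Suc n))"
    unfolding S_def using less_cSUP_iff[OF _ qb] d1 by (metis empty_iff)
   obtain d' where d': "d' : D" "d \<sqsubseteq> d'" "d1 \<sqsubseteq> d'" using D d d1 unfolding up_directed_def by blast
   have "q d <= q d'" using op_le_Re[OF d'(2)] by (simp add: q_def)
   thus ?thesis using d d' by (intro bexI[of _ d']) auto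
  qed
  then obtain e where e: "!!n. e n : D" "!!n. d1 \<sqsubseteq> e n" "!!n. q (e n) > S - inverse (real (Suc n))" by metis
  have close: "(norm (d x - e n x))^2 <= K * inverse (real (Suc n))" if "d : D" "e n \<sqsubseteq> d" for d n
  proof -
   have "(norm (d x - e n x))^2 <= K * (q d - q (e n))" using nd[OF e(1) that(1) e(2) that(2)] by (simp add: q_def)
   also have "... <= K * inverse (real (Suc n))"
   proof (rule mult_left_mono[OF _ K0])
    have "q d <= S" unfolding S_def by (rule cSUP_upper[OF that(1) qb])
    thus "q d - q (e n) <= inverse (real (Suc n))" using e(3)[of n] by simp
   qed
   finally show ?thesis .
  qed
  have lim0: "(%n. K * inverse (real (Suc n))) \<longlonglongrightarrow> 0"
   using tendsto_mult_left[OF LIMSEQ_inverse_real_of_nat, of K] by simp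
  have N: "EX N. ALL n>=N. K * inverse (real (Suc n)) < r^2" if "0 < r" for r :: real
   using order_tendstoD(2)[OF lim0, of "r^2"] that by (simp add: eventually_sequentially)
  have "Cauchy (%n. e n x)"
  proof (rule metric_CauchyI)
   fix r :: real assume r: "0 < r"
   obtain N where N: "!!n. n \<ge> N ==> K * inverse (real (Suc n)) < (r/2)^2" using N[of "r/2"] r by auto
   have "dist (e m x) (e n x) < r" if mn: "m \<ge> N" "n \<ge> N" for m n
   proof -
    obtain d where d: "d : D" "e m \<sqsubseteq> d" "e n \<sqsubseteq> d" using D e(1) unfolding up_directed_def by blast
    have "norm (d x - e m x) < r/2" "norm (d x - e n x) < r/2"
     by (rule power_less_imp_less_base[of _ 2],
       use close[OF d(1,2)] close[OF d(1,3)] N[OF mn(1)] N[OF mn(2)] r in linarith,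
       use r in simp)+
    hence "dist (e m x) (d x) < r/2" "dist (d x) (e n x) < r/2" by (auto simp: dist_norm norm_minus_commute)
    thus ?thesis using dist_triangle_half_l[of "e m x" "d x" r "e n x"] by (simp add: dist_commute)
   qed
   thus "EX M. ALL m>=M. ALL n>=M. dist (e m x) (e n x) < r" by blast
  qed
  then obtain y where y: "(%n. e n x) \<longlonglongrightarrow> y" using Cauchy_convergent convergent_def by blast
  have "((%d. blinfun_apply d x) \<longlongrightarrow> y) F"
  proof (rule tendstoI)
   fix r :: real assume r: "0 < r"
   obtain N where N: "!!n. n \<ge> N ==> K * inverse (real (Suc n)) < (r/2)^2" using N[of "r/2"] r by auto
   obtain N' where N': "!!n. n \<ge> N' ==> dist (e n x) y < r/2"
    using metric_LIMSEQ_D[OF y, of "r/2"] r by auto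
   define n where "n = max N N'"
   have "dist (d x) y < r" if "d : D" "e n \<sqsubseteq> d" for d
   proof -
    have "norm (d x - e n x) < r/2"
     by (rule power_less_imp_less_base[of _ 2], rule le_less_trans[OF close[OF that] N])
      (use r in "simp_all add: n_def")
    hence "dist (e n x) (d x) < r/2" by (simp add: dist_norm norm_minus_commute)
    thus ?thesis using N'[of n] dist_triangle_half_r[of "e n x" "d x" r y] by (simp add: n_def)
   qed
   thus "\<forall>\<^sub>F d in F. dist (blinfun_apply d x) y < r" unfolding ev using e(1) by blast
  qed
  moreover have "norm y <= (norm d1 + K) * norm x"
  proof (rule LIMSEQ_le_const2)
   show "(%n. norm (e n x)) \<longlonglongrightarrow> norm y" by (intro tendsto_intros y)
   have "norm (e n x) <= (norm d1 + K) * norm x" for n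
   proof -
    have P: "positive_op (e n - d1)" using e by (simp add: op_le_def)
    have "b - d1 - (e n - d1) = b - e n" by simp
    hence "e n - d1 \<sqsubseteq> b - d1" using Db[OF e(1)] by (simp add: op_le_def)
    moreover have "b - d1 \<sqsubseteq> K *R Id" unfolding K_def
     by (rule op_le_norm) (use b sa[OF d1] in "auto simp: adj_diff intro: BH_intros")
    ultimately have "norm (e n - d1) <= K" using positive_op_norm_le[OF P _ K0] op_le_trans by blast
    hence "norm (e n) <= norm d1 + K" using norm_triangle_ineq[of d1 "e n - d1"] by simp
    thus ?thesis using norm_blinfun[of "e n" x] by (meson mult_right_mono norm_ge_zero order_trans)
   qed
   thus "EX N. ALL n>=N. norm (e n x) <= (norm d1 + K) * norm x" by blast
  qed
  ultimately show ?thesis by blast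
 qed
 then obtain f where f: "!!x. ((%d. blinfun_apply d x) \<longlongrightarrow> f x) F" "!!x. norm (f x) <= (norm d1 + K) * norm x"
  by metis
 have "bounded_linear f"
 proof (rule bounded_linear_intro[where K = "norm d1 + K"])
  fix x y
  show "f (x + y) = f x + f y"
   using tendsto_unique[OF Fb f(1)[of "x + y"]] tendsto_add[OF f(1)[of x] f(1)[of y]]
   by (simp add: blinfun.add_right)
  show "f (r *R x) = r *R f x" for r
   using tendsto_unique[OF Fb f(1)[of "r *R x"]] tendsto_scaleR[OF tendsto_const f(1)[of x], of r]
   by (simp add: blinfun.scaleR_right)
 qed (use f(2) in "simp add: mult.commute")
 hence Bf: "blinfun_apply (Blinfun f) = f" by (rule bounded_linear_Blinfun_apply)
 define s where "s = Blinfun f"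
 have lim: "((%d. blinfun_apply d x) \<longlongrightarrow> s x) F" for x using f(1) by (simp add: s_def Bf)
 have evD: "\<forall>\<^sub>F d in F. d : D" unfolding F_def by (rule up_filter_in[OF D])
 have "\<forall>\<^sub>F d in F. d : commutant {}"
  using evD by (rule eventually_mono) (use sa in "simp add: commutant_def")
 hence sB: "s : BH"
  using commutant_strong_limit[OF Fb _ lim] commutant_BH by blast
 have ssa: "adj s = s"
  by (rule self_adjoint_strong_limit[OF Fb _ lim]) (use evD sa in "auto elim: eventually_mono")
 have up: "d \<sqsubseteq> s" if d: "d : D" for d
 proof (rule op_leI)
  fix x
  show "Re (cinner (d x) x) <= Re (cinner (s x) x)"
  proof (rule tendsto_lowerbound[OF _ _ Fb])
   show "((%d. Re (cinner (blinfun_apply d x) x)) \<longlongrightarrow> Re (cinner (s x) x)) F" by (intro tendsto_intros lim)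
   show "\<forall>\<^sub>F d' in F. Re (cinner (d x) x) <= Re (cinner (blinfun_apply d' x) x)"
    unfolding ev using d op_le_Re by blast
  qed
 qed (use sa[OF d] sB ssa in auto)
 have least: "s \<sqsubseteq> t" if t: "t : BH" "adj t = t" "ALL d:D. d \<sqsubseteq> t" for t
 proof (rule op_leI)
  fix x
  show "Re (cinner (s x) x) <= Re (cinner (t x) x)"
  proof (rule tendsto_upperbound[OF _ _ Fb])
   show "((%d. Re (cinner (blinfun_apply d x) x)) \<longlongrightarrow> Re (cinner (s x) x)) F" by (intro tendsto_intros lim)
   show "\<forall>\<^sub>F d' in F. Re (cinner (blinfun_apply d' x) x) <= Re (cinner (t x) x)"
    using evD t op_le_Re by (auto elim!: eventually_mono)
  qed
 qed (use t sB ssa in auto)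
 show ?thesis using sB ssa lim up least unfolding F_def by blast
qed

text \<open>The strong limit exists, belongs to \<open>M\<close> and is itself a least upper bound,
  so it coincides with the one formed by order inside \<open>M\<close>. This turns the order
  definition of normality into a topological one.\<close>

lemma lub_in_strong_limit:
 assumes M: "von_neumann_algebra M" and D: "D <= self_adjoints M" "up_directed D" and s: "lub_in M D s"
 shows "((%d. blinfun_apply d x) \<longlongrightarrow> s x) (up_filter D)"
proof -
 have sa: "d : BH & adj d = d" if "d : D" for d
  using that D(1) vn_inBH[OF M] by (auto simp: self_adjoints_def)
 have sM: "s : M" "adj s = s" "s : BH" using s vn_inBH[OF M] by (auto simp: lub_in_def self_adjoints_def)
 obtain s' where s': "s' : BH" "adj s' = s'" "!!x. ((%d. blinfun_apply d x) \<longlongrightarrow> s' x) (up_filter D)"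
  "!!d. d : D ==> d \<sqsubseteq> s'" "!!t. t : BH ==> adj t = t ==> ALL d:D. d \<sqsubseteq> t ==> s' \<sqsubseteq> t"
  using vigier[OF D(2) sa sM(3,2)] s by (auto simp: lub_in_def)
 have "s' : M"
  by (rule vn_strong_limit[OF M up_filter_nonbot[OF D(2)] _ s'(3)])
   (use up_filter_in[OF D(2)] D(1) in "auto simp: self_adjoints_def elim!: eventually_mono")
 hence "s \<sqsubseteq> s'" using s s' by (auto simp: lub_in_def self_adjoints_def)
 moreover have "s' \<sqsubseteq> s" using s'(5) sM s by (auto simp: lub_in_def)
 ultimately show ?thesis using s'(3) op_le_antisym by blast
qed

lemma strong_limit_lub_in:
 fixes s :: "'a :: chilbert_space op"
 assumes M: "von_neumann_algebra M" and D: "D <= self_adjoints M" "up_directed D"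
  and lim: "!!x. ((%d. blinfun_apply d x) \<longlongrightarrow> s x) (up_filter D)"
 shows "lub_in M D s"
proof -
 note Fb = up_filter_nonbot[OF D(2)] and evD = up_filter_in[OF D(2)]
 have sa: "d : BH" "adj d = d" "d : M" if "d : D" for d
  using that D(1) vn_inBH[OF M] by (auto simp: self_adjoints_def)
 have sM: "s : M"
  by (rule vn_strong_limit[OF M Fb _ lim]) (use evD sa in "auto elim: eventually_mono")
 have ssa: "adj s = s"
  by (rule self_adjoint_strong_limit[OF Fb _ lim]) (use evD sa in "auto elim: eventually_mono")
 note limq = tendsto_Re[OF tendsto_cinner[OF lim tendsto_const]]
 have up: "d \<sqsubseteq> s" if d: "d : D" for d
 proof (rule op_leI)
  fix x
  show "Re (cinner (d x) x) <= Re (cinner (s x) x)"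
   by (rule tendsto_lowerbound[OF limq _ Fb])
    (use d op_le_Re in "auto simp: eventually_up_filter[OF D(2)]")
 qed (use sa[OF d] sM ssa vn_inBH[OF M] in auto)
 have least: "s \<sqsubseteq> t" if t: "t : self_adjoints M" "ALL d:D. d \<sqsubseteq> t" for t
 proof (rule op_leI)
  fix x
  show "Re (cinner (s x) x) <= Re (cinner (t x) x)"
   by (rule tendsto_upperbound[OF limq _ Fb])
    (use t op_le_Re evD in "auto elim!: eventually_mono")
 qed (use t sM ssa vn_inBH[OF M] in "auto simp: self_adjoints_def")
 show ?thesis using sM ssa up least by (auto simp: lub_in_def self_adjoints_def)
qed

subsection \<open>Normal positive functionals\<close>

text \<open>Real-valued functionals, so that multiples of the trace and vector states can be
  compared by the same lemmas.\<close>

definition normal_pos :: "'a :: chilbert_space op set => ('a op => real) => bool" where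
 "normal_pos M \<phi> \<longleftrightarrow>
  (ALL x:M. ALL y:M. \<phi> (x + y) = \<phi> x + \<phi> y) & (ALL r. ALL x:M. \<phi> (r *R x) = r * \<phi> x) &
  (ALL x:M. positive_op x --> 0 <= \<phi> x) &
  (ALL D s. D <= self_adjoints M --> up_directed D --> lub_in M D s --> \<phi> s = (SUP d\<in>D. \<phi> d))"

lemma
 assumes "normal_pos M \<phi>"
 shows normal_pos_add: "x : M ==> y : M ==> \<phi> (x + y) = \<phi> x + \<phi> y"
  and normal_pos_scaleR: "x : M ==> \<phi> (r *R x) = r * \<phi> x"
  and normal_pos_nonneg: "x : M ==> positive_op x ==> 0 <= \<phi> x"
  and normal_pos_SUP: "D <= self_adjoints M ==> up_directed D ==> lub_in M D s ==> \<phi> s = (SUP d\<in>D. \<phi> d)"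
 using assms unfolding normal_pos_def by blast+

context
 fixes M and \<phi> :: "'a :: chilbert_space op => real"
 assumes M: "von_neumann_algebra M" and \<phi>: "normal_pos M \<phi>"
begin

lemma normal_pos_zero: "\<phi> 0 = 0"
 using normal_pos_scaleR[OF \<phi> vn_zero[OF M], of 0] by simp

lemma normal_pos_diff: "x : M ==> y : M ==> \<phi> (x - y) = \<phi> x - \<phi> y"
 using normal_pos_add[OF \<phi>, of "x - y" y] vn_diff[OF M] by simp

lemma normal_pos_sum: "(!!i. i : I ==> f i : M) ==> \<phi> (sum f I) = (\<Sum>i\<in>I. \<phi> (f i))"
 by (induction I rule: infinite_finite_induct)
  (auto simp: normal_pos_zero normal_pos_add[OF \<phi>] vn_sum[OF M])

lemma normal_pos_mono: "x : M ==> y : M ==> x \<sqsubseteq> y ==> \<phi> x <= \<phi> y"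
 using normal_pos_nonneg[OF \<phi>, of "y - x"] vn_diff[OF M] by (simp add: op_le_def normal_pos_diff)

lemma normal_pos_cmult: "0 <= c ==> normal_pos M (%x. c * \<phi> x)"
proof -
 assume c: "0 <= c"
 have "c * \<phi> s = (SUP d\<in>D. c * \<phi> d)" if D: "D <= self_adjoints M" "up_directed D" "lub_in M D s" for D s
 proof -
  have sM: "s : M" using D(3) by (auto simp: lub_in_def self_adjoints_def)
  have "bdd_above (\<phi> ` D)"
   using D normal_pos_mono[OF _ sM] by (intro bdd_aboveI[of _ "\<phi> s"]) (auto simp: lub_in_def self_adjoints_def)
  moreover have "D ~= {}" using D by (auto simp: up_directed_def)
  moreover have "continuous (at_left (Sup (\<phi> ` D))) (%x. c * x)" by (intro continuous_intros)
  ultimately show ?thesis using c continuous_at_Sup_mono[of "%x. c * x" "\<phi> ` D"] normal_pos_SUP[OF \<phi> D]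
   by (auto simp: mono_def mult_left_mono image_image)
 qed
 thus ?thesis unfolding normal_pos_def
  using normal_pos_add[OF \<phi>] normal_pos_scaleR[OF \<phi>] normal_pos_nonneg[OF \<phi>] c by (simp add: algebra_simps)
qed

end

lemma normal_pos_vector_state:
 assumes M: "von_neumann_algebra M"
 shows "normal_pos M (%x. Re (cinner (x \<xi>) \<xi>))"
 unfolding normal_pos_def
proof (intro conjI ballI allI impI)
 fix D s assume D: "D <= self_adjoints M" "up_directed D" "lub_in M D s"
 note lim = tendsto_Re[OF tendsto_cinner[OF lub_in_strong_limit[OF M D, of \<xi>] tendsto_const[of \<xi>]]]
 have ub: "Re (cinner (d \<xi>) \<xi>) <= Re (cinner (s \<xi>) \<xi>)" if "d : D" for d
  using D(3) that by (auto simp: lub_in_def intro: op_le_Re)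
 have bdd: "bdd_above ((%d. Re (cinner (blinfun_apply d \<xi>) \<xi>)) ` D)"
  using ub by (intro bdd_aboveI2)
 show "Re (cinner (s \<xi>) \<xi>) = (SUP d\<in>D. Re (cinner (blinfun_apply d \<xi>) \<xi>))"
 proof (rule antisym)
  show "Re (cinner (s \<xi>) \<xi>) <= (SUP d\<in>D. Re (cinner (blinfun_apply d \<xi>) \<xi>))"
   by (rule tendsto_upperbound[OF lim _ up_filter_nonbot[OF D(2)]])
    (use up_filter_in[OF D(2)] cSUP_upper[OF _ bdd] in "auto elim!: eventually_mono")
  show "(SUP d\<in>D. Re (cinner (blinfun_apply d \<xi>) \<xi>)) <= Re (cinner (s \<xi>) \<xi>)"
   using D(2) ub by (intro cSUP_least) (auto simp: up_directed_def)
 qed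
qed (auto simp: blinfun.add_left blinfun.scaleR_left cinner_linear positive_op_Re)

text \<open>The dyadic expansion writes a positive contraction as a combination \<open>S\<close> of
  projections below \<open>e\<close> plus a remainder. The hypothesis applies to \<open>S\<close>,
  the remainder costs at most \<open>(1/2)^n * \<phi> Id\<close>, and \<open>\<psi>\<close> of it is
  nonnegative.\<close>

lemma normal_pos_le_projections:
 assumes M: "von_neumann_algebra M" and \<phi>: "normal_pos M \<phi>" and \<psi>: "normal_pos M \<psi>" and e: "is_proj e"
  and le: "!!r. r : M ==> is_proj r ==> r ** e = r ==> \<phi> r <= \<psi> r"
  and x: "x : M" "positive_op x" "x ** e = x"
 shows "\<phi> x <= \<psi> x"
proof -
 have main: "\<phi> x <= \<psi> x" if x: "x : M" "positive_op x" "x ** e = x" "x \<sqsubseteq> Id" for x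
 proof -
  obtain p where p: "!!n. p n : M" "!!n. is_proj (p n)" "!!n. p n ** e = p n"
   "!!n. positive_op (x - (\<Sum>k<n. (1/2) ^ Suc k *R p k))"
   "!!n. x - (\<Sum>k<n. (1/2) ^ Suc k *R p k) \<sqsubseteq> (1/2) ^ n *R Id"
   using dyadic_expansion[OF M x(1,2,4) e x(3)] by blast
  have "\<phi> x <= \<psi> x + (1/2) ^ n * \<phi> Id" for n
  proof -
   define S where "S = (\<Sum>k<n. (1/2) ^ Suc k *R p k)"
   have SM: "S : M" unfolding S_def by (intro vn_sum[OF M] vn_scaleR[OF M] p)
   have "\<phi> S = (\<Sum>k<n. (1/2) ^ Suc k * \<phi> (p k))" "\<psi> S = (\<Sum>k<n. (1/2) ^ Suc k * \<psi> (p k))"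
    unfolding S_def
    by (simp_all add: normal_pos_sum[OF M \<phi>] normal_pos_sum[OF M \<psi>] vn_scaleR[OF M] p
      normal_pos_scaleR[OF \<phi>] normal_pos_scaleR[OF \<psi>])
   hence "\<phi> S <= \<psi> S" using le[OF p(1-3)] by (simp add: sum_mono)
   moreover have "\<phi> (x - S) <= (1/2) ^ n * \<phi> Id"
    using normal_pos_mono[OF M \<phi> vn_diff[OF M x(1) SM] vn_scaleR[OF M vn_id[OF M]] p(5)[of n, folded S_def]]
    by (simp add: normal_pos_scaleR[OF \<phi> vn_id[OF M]])
   moreover have "0 <= \<psi> (x - S)"
    using normal_pos_nonneg[OF \<psi> vn_diff[OF M x(1) SM] p(4)[of n, folded S_def]] .
   ultimately show ?thesis
    using normal_pos_diff[OF M \<phi> x(1) SM] normal_pos_diff[OF M \<psi> x(1) SM] by linarith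
  qed
  moreover have "(%n. \<psi> x + (1/2) ^ n * \<phi> Id) \<longlonglongrightarrow> \<psi> x + 0 * \<phi> Id"
   by (intro tendsto_intros LIMSEQ_power_zero) simp
  ultimately show ?thesis by (intro LIMSEQ_le_const[of _ "\<psi> x"]) auto
 qed
 show ?thesis
 proof (cases "x = 0")
  case True thus ?thesis using normal_pos_zero[OF M \<phi>] normal_pos_zero[OF M \<psi>] by simp
 next
  case False
  hence n: "norm x > 0" by simp
  define y where "y = inverse (norm x) *R x"
  have "positive_op (inverse (norm x) *R (norm x *R Id - x))"
   using op_le_norm[OF positive_op_BH positive_op_adj, OF x(2,2)] n
   by (intro positive_scaleR) (auto simp: op_le_def)
  hence "y \<sqsubseteq> Id" using n by (simp add: op_le_def y_def scaleR_diff_right)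
  hence "\<phi> y <= \<psi> y"
   using x n by (intro main) (auto simp: y_def oL_simps intro!: vn_scaleR[OF M] positive_scaleR)
  thus ?thesis using n by (simp add: y_def normal_pos_scaleR[OF \<phi> x(1)] normal_pos_scaleR[OF \<psi> x(1)])
 qed
qed

section \<open>Orthogonal families\<close>

text \<open>Zorn's lemma for families with pairwise related members. \<open>R\<close> may be
  unsymmetric, hence both orders in the maximality clause.\<close>

lemma ex_maximal_family:
 "EX F. (ALL x:F. P x) & (ALL x:F. ALL y:F. x ~= y --> R x y) &
  (ALL z. P z --> (ALL x:F. x ~= z --> R x z & R z x) --> z : F)"
proof -
 define A where "A = {F. (ALL x:F. P x) & (ALL x:F. ALL y:F. x ~= y --> R x y)}"
 have "EX F:A. ALL X:A. F <= X --> X = F"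
 proof (rule subset_Zorn')
  fix C assume "subset.chain A C"
  hence C: "C <= A" "!!X Y. X : C ==> Y : C ==> X <= Y | Y <= X"
   by (auto simp: subset.chain_def)
  have "R x y" if "X : C" "Y : C" "x : X" "y : Y" "x ~= y" for X Y x y
   using C(2)[OF that(1,2)] C(1) that unfolding A_def by blast
  thus "\<Union>C : A" using C(1) unfolding A_def by blast
 qed
 then obtain F where F: "F : A" and m: "!!X. X : A ==> F <= X ==> X = F" by blast
 have "z : F" if "P z" "ALL x:F. x ~= z --> R x z & R z x" for z
 proof -
  have "insert z F : A" using F that unfolding A_def by auto
  thus ?thesis using m by blast
 qed
 thus ?thesis using F unfolding A_def by (intro exI[of _ F]) blast
qed

lemma norm_sq_sum_orthogonal:
 fixes f :: "'i => 'a :: real_inner"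
 assumes "finite S" "!!i j. i : S ==> j : S ==> i ~= j ==> inner (f i) (f j) = 0"
 shows "(norm (sum f S))^2 = (\<Sum>i\<in>S. (norm (f i))^2)"
 using assms
proof (induction S rule: finite_induct)
 case (insert i S)
 have "inner (f i) (sum f S) = 0"
  unfolding inner_sum_right using insert by (intro sum.neutral) auto
 thus ?case
  using insert by (simp add: power2_norm_eq_inner inner_simps inner_commute)
qed simp

lemma orthogonal_summable:
 fixes f :: "'i => 'a :: {real_inner, complete_space}"
 assumes orth: "!!i j. i : I ==> j : I ==> i ~= j ==> inner (f i) (f j) = 0"
  and B: "!!S. finite S ==> S <= I ==> (\<Sum>i\<in>S. (norm (f i))^2) <= B"
 shows "f summable_on I"
proof -
 define g where "g i = (norm (f i))^2" for i
 have "g summable_on I"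
  by (rule nonneg_bdd_above_summable_on) (use B in "auto simp: g_def intro!: bdd_aboveI[of _ B]")
 define s where "s = infsum g I"
 have s: "s = (SUP F\<in>{F. finite F & F <= I}. sum g F)"
  unfolding s_def by (rule infsum_nonneg_is_SUPREMUM_real[OF \<open>g summable_on I\<close>]) (simp add: g_def)
 have bdd: "bdd_above (sum g ` {F. finite F & F <= I})"
  using B by (intro bdd_aboveI[of _ B]) (auto simp: g_def)
 have "cauchy_filter (filtermap (sum f) (finite_subsets_at_top I))"
  unfolding cauchy_filter_metric_filtermap
 proof (intro allI impI)
  fix e :: real assume e: "0 < e"
  define d where "d = (e/2)^2"
  have "d > 0" using e by (simp add: d_def)
  hence "s - d < (SUP F\<in>{F. finite F & F <= I}. sum g F)" using s by simp
  then obtain S0 where S0: "finite S0" "S0 <= I" "s - d < sum g S0"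
   using less_cSUP_iff[OF _ bdd] by auto
  have near: "dist (sum f T) (sum f S0) < e/2" if T: "finite T" "S0 <= T" "T <= I" for T
  proof -
   have "sum f T - sum f S0 = sum f (T - S0)" "sum g T - sum g S0 = sum g (T - S0)"
    using T by (simp_all add: sum_diff)
   moreover have "(norm (sum f (T - S0)))^2 = sum g (T - S0)"
    unfolding g_def by (rule norm_sq_sum_orthogonal) (use T in "auto intro!: orth")
   moreover have "sum g T <= s" unfolding s by (rule cSUP_upper[OF _ bdd]) (use T in auto)
   ultimately have "(dist (sum f T) (sum f S0))^2 < (e/2)^2"
    using S0(3) by (simp add: dist_norm d_def)
   thus ?thesis by (rule power_less_imp_less_base) (use e in simp)
  qed
  show "EX P. eventually P (finite_subsets_at_top I) & (ALL x y. P x & P y --> dist (sum f x) (sum f y) < e)"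
  proof (intro exI[of _ "%T. finite T & S0 <= T & T <= I"] conjI allI impI)
   show "\<forall>\<^sub>F T in finite_subsets_at_top I. finite T & S0 <= T & T <= I"
    unfolding eventually_finite_subsets_at_top using S0 by blast
   fix T U assume "(finite T & S0 <= T & T <= I) & finite U & S0 <= U & U <= I"
   thus "dist (sum f T) (sum f U) < e"
    using near[of T] near[of U] dist_triangle_half_l[of "sum f T" "sum f S0" e "sum f U"] by blast
  qed
 qed
 moreover have "filtermap (sum f) (finite_subsets_at_top I) ~= bot"
  by (simp add: filtermap_bot_iff)
 ultimately obtain x where "filtermap (sum f) (finite_subsets_at_top I) <= nhds x"
  using complete_UNIV unfolding complete_uniform by auto
 thus ?thesis unfolding summable_on_def has_sum_def filterlim_def by blast
qed

definition orth_family :: "'a :: chilbert_space op set => 'i set => ('i => 'a op) => bool" where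
 "orth_family M I p \<longleftrightarrow> (ALL i:I. p i : M & is_proj (p i)) & (ALL i:I. ALL j:I. i ~= j --> p i ** p j = 0)"

lemma is_proj_sum:
 assumes "orth_family M I p" "finite S" "S <= I"
 shows "is_proj (sum p S)"
 using assms(2,3)
proof (induction S rule: finite_induct)
 case (insert i S)
 have P: "is_proj (p j)" if "j : I" for j using assms(1) that by (auto simp: orth_family_def)
 have o: "p i ** sum p S = 0" "sum p S ** p i = 0"
  unfolding oL_sum_right oL_sum_left
  using insert assms(1) unfolding orth_family_def by (intro sum.neutral ballI; metis insert_subset subsetD)+
 have "is_proj (p i)" "is_proj (sum p S)" using P insert by auto
 thus ?case using insert o
  by (auto simp: is_proj_def adj_add oL_simps intro: BH_intros)
qed simp

lemma proj_le_id: "is_proj p ==> p \<sqsubseteq> Id"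
 unfolding op_le_def by (intro positive_proj is_proj_complement)

lemma has_sum_apply:
 "((%i. f i) has_sum x) I ==> ((%i. blinfun_apply T (f i)) has_sum T x) I"
 using has_sum_bounded_linear[OF lin_right[of T], of f I x] by (simp add: o_def)

text \<open>The finite sums increase and stay below \<open>Id\<close>, so they converge strongly to
  a projection in \<open>M\<close>; normality becomes complete additivity over the family.\<close>

lemma orth_family_sup:
 fixes p :: "'i => 'a :: chilbert_space op"
 assumes M: "von_neumann_algebra M" and p: "orth_family M I p"
 shows "EX s:M. is_proj s & (ALL i:I. p i ** s = p i) & (ALL x. ((%i. blinfun_apply (p i) x) has_sum s x) I) &
  (ALL \<phi>. normal_pos M \<phi> --> ((%i. \<phi> (p i)) has_sum \<phi> s) I)"
proof -
 have pM: "p i : M" and pP: "is_proj (p i)" if "i : I" for i using p that by (auto simp: orth_family_def)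
 define D where "D = sum p ` {S. finite S & S <= I}"
 have le: "sum p S \<sqsubseteq> sum p T" if "finite T" "S <= T" "T <= I" for S T
 proof -
  have "sum p T - sum p S = sum p (T - S)" using that by (simp add: sum_diff)
  moreover have "positive_op (sum p (T - S))" using that pP by (intro positive_sum positive_proj) auto
  ultimately show ?thesis by (simp add: op_le_def)
 qed
 have D: "up_directed D"
  unfolding up_directed_def
 proof (intro conjI ballI)
  show "D ~= {}" unfolding D_def by blast
  fix x y assume "x : D" "y : D"
  then obtain S T where "x = sum p S" "y = sum p T" "finite S" "finite T" "S <= I" "T <= I"
   unfolding D_def by blast
  thus "EX z:D. x \<sqsubseteq> z & y \<sqsubseteq> z"
   using le[of "S Un T" S] le[of "S Un T" T] unfolding D_def
   by (intro bexI[of _ "sum p (S Un T)"]) auto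
 qed
 have DP: "is_proj d" "d : M" if "d : D" for d
  using that is_proj_sum[OF p] pM unfolding D_def by (auto intro!: vn_sum[OF M])
 have Dsa: "D <= self_adjoints M" using DP by (auto simp: self_adjoints_def is_projD)
 obtain s where s: "s : BH" "adj s = s" "!!x. ((%d. blinfun_apply d x) \<longlongrightarrow> s x) (up_filter D)"
  using vigier[OF D, of Id] DP is_projD(1,3) proj_le_id by (metis BH_id adj_id)
 have lub: "lub_in M D s" by (rule strong_limit_lub_in[OF M Dsa D s(3)])
 hence sM: "s : M" by (simp add: lub_in_def self_adjoints_def)
 have hs: "((%i. p i x) has_sum s x) I" for x
  unfolding has_sum_def
 proof (rule tendstoI)
  fix e :: real assume "0 < e"
  then obtain d where d: "d : D" "!!d'. d' : D ==> d \<sqsubseteq> d' ==> dist (d' x) (s x) < e"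
   using tendstoD[OF s(3)[of x]] unfolding eventually_up_filter[OF D] by blast
  obtain S where S: "d = sum p S" "finite S" "S <= I" using d(1) unfolding D_def by blast
  show "\<forall>\<^sub>F T in finite_subsets_at_top I. dist (\<Sum>i\<in>T. p i x) (s x) < e"
   unfolding eventually_finite_subsets_at_top
  proof (intro exI[of _ S] conjI allI impI)
   fix T assume T: "finite T & S <= T & T <= I"
   have "dist ((sum p T) x) (s x) < e"
    using T le[of T S] S by (intro d(2)) (auto simp: D_def)
   thus "dist (\<Sum>i\<in>T. p i x) (s x) < e" by (simp add: blinfun.sum_left)
  qed (use S in auto)
 qed
 have ps: "p i ** s = p i" if i: "i : I" for i
 proof (rule blinfun_eqI)
  fix x
  have "((%j. p i (p j x)) has_sum p i (s x)) I" by (rule has_sum_apply[OF hs])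
  moreover have "((%j. p i (p j x)) has_sum p i x) I"
  proof -
   have "((%j. p i (p j x)) has_sum p i x) {i}"
    using is_projD(4)[OF pP[OF i]] has_sum_finite[of "{i}" "%j. p i (p j x)"] by simp
   moreover have "p i (p j x) = 0" if "j : I - {i}" for j
   proof -
    have "p i ** p j = 0" using p i that by (auto simp: orth_family_def)
    thus ?thesis by (metis oL_apply zero_blinfun.rep_eq)
   qed
   ultimately show ?thesis
    using has_sum_cong_neutral[of I "{i}" "%j. p i (p j x)" "%j. p i (p j x)" "p i x"] i by auto
  qed
  ultimately show "(p i ** s) x = p i x" using has_sum_unique by fastforce
 qed
 have "s ** s = s"
 proof (rule blinfun_eqI)
  fix x
  have "((%i. p i (s x)) has_sum s (s x)) I" by (rule hs)
  moreover have "((%i. p i (s x)) has_sum s (s x)) I \<longleftrightarrow> ((%i. p i x) has_sum s (s x)) I"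
   by (rule has_sum_cong) (metis oL_apply ps)
  ultimately have "s (s x) = s x" using hs[of x] has_sum_unique by blast
  thus "(s ** s) x = s x" by simp
 qed
 hence sP: "is_proj s" using s by (simp add: is_proj_def)
 have "((%i. \<phi> (p i)) has_sum \<phi> s) I" if \<phi>: "normal_pos M \<phi>" for \<phi>
 proof -
  have Ds: "\<phi> d <= \<phi> s" if "d : D" for d
   using that DP sM lub by (intro normal_pos_mono[OF M \<phi>]) (auto simp: lub_in_def)
  have sumeq: "(\<Sum>i\<in>S. \<phi> (p i)) = \<phi> (sum p S)" if "S <= I" for S
   using that pM by (subst normal_pos_sum[OF M \<phi>]) auto
  have nn: "0 <= \<phi> (p i)" if "i : I" for i
   using normal_pos_nonneg[OF \<phi> pM positive_proj[OF pP]] that by blast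
  have sm: "(%i. \<phi> (p i)) summable_on I"
   by (rule nonneg_bdd_above_summable_on)
    (use nn Ds sumeq in \<open>auto simp: D_def intro!: bdd_aboveI[of _ "\<phi> s"]\<close>)
  have "infsum (%i. \<phi> (p i)) I = (SUP S\<in>{S. finite S & S <= I}. \<Sum>i\<in>S. \<phi> (p i))"
   by (rule infsum_nonneg_is_SUPREMUM_real[OF sm nn])
  also have "... = (SUP S\<in>{S. finite S & S <= I}. \<phi> (sum p S))"
   by (rule SUP_cong) (auto simp: sumeq)
  also have "... = \<phi> s"
   using normal_pos_SUP[OF \<phi> Dsa D lub] by (simp add: D_def image_image)
  finally show ?thesis using has_sum_infsum[OF sm] by simp
 qed
 thus ?thesis using sM sP ps hs by blast
qed

lemma has_sum_zeroI:
 fixes s :: "'a :: chilbert_space op"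
 assumes "!!x. ((%i. blinfun_apply (p i) x) has_sum s x) I" "!!i. i : I ==> r ** p i = 0"
 shows "r ** s = 0"
proof (rule blinfun_eqI)
 fix x
 have "((%i. r (p i x)) has_sum r (s x)) I" by (rule has_sum_apply[OF assms(1)])
 moreover have "((%i. r (p i x)) has_sum 0) I"
  by (rule has_sum_0) (metis assms(2) oL_apply zero_blinfun.rep_eq)
 ultimately show "(r ** s) x = (0 :: _ op) x" using has_sum_unique by fastforce
qed

lemma has_sum_fixI:
 fixes s :: "'a :: chilbert_space op"
 assumes "!!x. ((%i. blinfun_apply (p i) x) has_sum s x) I" "!!i. i : I ==> r ** p i = p i"
 shows "r ** s = s"
proof -
 have "(Id - r) ** s = 0"
  by (rule has_sum_zeroI[OF assms(1)]) (use assms(2) in "simp add: oL_simps")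
 thus ?thesis by (simp add: oL_simps)
qed

lemma proj_le_diff:
 assumes p: "is_proj p" and s: "is_proj s" and ps: "p ** s = s"
 shows "is_proj (p - s)" "s ** p = s"
proof -
 note pD = is_projD[OF p] and sD = is_projD[OF s]
 show sp: "s ** p = s" using arg_cong[OF ps, of adj] pD sD by (simp add: adj_compose)
 show "is_proj (p - s)" using pD sD ps sp by (simp add: is_proj_def BH_diff adj_diff oL_simps)
qed

text \<open>Remove from \<open>p\<close> a maximal orthogonal family of projections on which
  \<open>\<psi>\<close> is strictly smaller than \<open>\<phi>\<close>. The rest \<open>e\<close>
  contains no such projection, and on the removed part complete additivity gives the opposite
  inequality.\<close>

lemma hahn_decomposition:
 fixes p :: "'a :: chilbert_space op"
 assumes M: "von_neumann_algebra M" and \<phi>: "normal_pos M \<phi>" and \<psi>: "normal_pos M \<psi>"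
  and p: "p : M" "is_proj p"
 shows "EX e:M. is_proj e & e ** p = e & \<psi> (p - e) <= \<phi> (p - e) &
  (ALL x:M. positive_op x --> x ** e = x --> \<phi> x <= \<psi> x)"
proof -
 define P where "P r \<longleftrightarrow> r : M & is_proj r & p ** r = r & \<psi> r < \<phi> r" for r
 from ex_maximal_family[of P "%q r. q ** r = 0"] obtain F where
  F0: "ALL r:F. P r" "ALL q:F. ALL r:F. q ~= r --> q ** r = 0"
  "ALL z. P z --> (ALL x:F. x ~= z --> x ** z = 0 & z ** x = 0) --> z : F"
  by (elim exE conjE)
 have F: "r : M & is_proj r & p ** r = r & \<psi> r < \<phi> r" if "r : F" for r
  using F0(1) that by (simp add: P_def)
 have "orth_family M F (%r. r)"
  unfolding orth_family_def using F0(2) by (intro conjI ballI) (use F in blast)+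
 then obtain s where s: "s : M" "is_proj s" "!!r. r : F ==> r ** s = r"
  "!!x. ((%r. blinfun_apply r x) has_sum s x) F" "!!\<phi>. normal_pos M \<phi> ==> (\<phi> has_sum \<phi> s) F"
  using orth_family_sup[OF M, of F "%r. r"] by auto
 have ps: "p ** s = s" by (rule has_sum_fixI[OF s(4)]) (use F in auto)
 define e where "e = p - s"
 have eP: "is_proj e" and sp: "s ** p = s" unfolding e_def using proj_le_diff[OF p(2) s(2) ps] by auto
 have eM: "e : M" unfolding e_def by (intro vn_diff[OF M] p s)
 have ep: "e ** p = e" by (simp add: e_def oL_simps is_projD(2)[OF p(2)] sp)
 have pe: "p ** e = e" by (simp add: e_def oL_simps is_projD(2)[OF p(2)] ps)
 have "\<psi> s <= \<phi> s"
  by (rule has_sum_mono[OF s(5)[OF \<psi>] s(5)[OF \<phi>]]) (use F in force)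
 moreover have "\<phi> x <= \<psi> x" if x: "x : M" "positive_op x" "x ** e = x" for x
 proof (rule normal_pos_le_projections[OF M \<phi> \<psi> eP _ x])
  fix r assume r: "r : M" "is_proj r" "r ** e = r"
  have er: "e ** r = r" using arg_cong[OF r(3), of adj] is_projD[OF r(2)] is_projD[OF eP] by (simp add: adj_compose)
  have pr: "p ** r = r" by (metis er pe oL_assoc)
  have se: "s ** e = 0" by (simp add: e_def oL_simps is_projD(2)[OF s(2)] sp)
  have fr: "f ** r = 0" "r ** f = 0" if f: "f : F" for f
  proof -
   have "f ** r = (f ** s) ** (e ** r)" using s(3)[OF f] er by simp
   also have "... = f ** ((s ** e) ** r)" by (simp add: oL_assoc)
   finally show fr: "f ** r = 0" by (simp add: se)
   show "r ** f = 0"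
    using arg_cong[OF fr, of adj] is_projD[OF r(2)] F[OF f] is_projD[of f] by (simp add: adj_compose)
  qed
  show "\<phi> r <= \<psi> r"
  proof (rule ccontr)
   assume n: "~ \<phi> r <= \<psi> r"
   hence "r : F" using F0(3)[rule_format, of r] r pr fr unfolding P_def by auto
   hence "r = 0" using fr(1)[of r] is_projD(2)[OF r(2)] by simp
   thus False using n normal_pos_zero[OF M \<phi>] normal_pos_zero[OF M \<psi>] by simp
  qed
 qed
 ultimately show ?thesis using eM eP ep by (intro bexI[of _ e]) (auto simp: e_def)
qed

text \<open>Orthogonal initial and final spaces make the sum converge strongly. Since strong
  convergence does not pass to adjoints, the sum of the \<open>adj (v i)\<close> is constructed
  separately and then recognised as \<open>adj w\<close>.\<close>

lemma partial_isometry_sum: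
 fixes v :: "'i => 'a :: chilbert_space op"
 assumes M: "von_neumann_algebra M"
  and v: "!!i. i : I ==> v i : M" "!!i. i : I ==> is_proj (adj (v i) ** v i)"
  and o: "!!i j. i : I ==> j : I ==> i ~= j ==> v i ** adj (v j) = 0"
   "!!i j. i : I ==> j : I ==> i ~= j ==> adj (v i) ** v j = 0"
 shows "EX w:M. (ALL x. ((%i. blinfun_apply (adj (v i) ** v i) x) has_sum (adj w ** w) x) I) &
  (ALL x. ((%i. blinfun_apply (v i ** adj (v i)) x) has_sum (w ** adj w) x) I)"
proof -
 have half: "EX w:M. ALL x. ((%i. blinfun_apply (v i) x) has_sum w x) I"
  if v: "!!i. i : I ==> v i : M" "!!i. i : I ==> is_proj (adj (v i) ** v i)"
   and o: "!!i j. i : I ==> j : I ==> i ~= j ==> v i ** adj (v j) = 0"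
   "!!i j. i : I ==> j : I ==> i ~= j ==> adj (v i) ** v j = 0" for v :: "'i => 'a op"
 proof -
  have vB: "v i : BH" if "i : I" for i using v(1)[OF that] vn_inBH[OF M] by blast
  have fam: "orth_family M I (%i. adj (v i) ** v i)"
   unfolding orth_family_def
  proof (intro conjI ballI impI)
   fix i j assume ij: "i : I" "j : I" "i ~= j"
   have "(adj (v i) ** v i) ** (adj (v j) ** v j) = adj (v i) ** ((v i ** adj (v j)) ** v j)"
    by (simp add: oL_assoc)
   thus "(adj (v i) ** v i) ** (adj (v j) ** v j) = 0" by (simp add: o(1)[OF ij])
  qed (use v in "auto intro!: vn_compose[OF M] vn_adj[OF M]")
  have sq: "(\<Sum>i\<in>S. (norm (v i x))^2) <= (norm x)^2" if S: "finite S" "S <= I" for S x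
  proof -
   have "(\<Sum>i\<in>S. (norm (v i x))^2) = Re (cinner ((\<Sum>i\<in>S. adj (v i) ** v i) x) x)"
   proof -
    have "Re (cinner (\<Sum>i\<in>S. f i) x) = (\<Sum>i\<in>S. Re (cinner (f i) x))" for f :: "'i => 'a"
     by (induction S rule: infinite_finite_induct) (auto simp: cinner_linear)
    thus ?thesis using S vB by (auto simp: blinfun.sum_left norm_apply_sq intro!: sum.cong)
   qed
   also have "... <= Re (cinner (Id x) x)"
    by (rule op_le_Re[OF proj_le_id[OF is_proj_sum[OF fam S]]])
   finally show ?thesis by (simp add: Re_cinner_self)
  qed
  have orth: "inner (v i x) (v j x) = 0" if "i : I" "j : I" "i ~= j" for i j x
  proof -
   have "cinner (v i x) (v j x) = cinner ((adj (v j) ** v i) x) x"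
    using vB that by (simp add: cinner_adj_left)
   thus ?thesis using o(2)[of j i] that by (simp add: inner_eq_Re_cinner)
  qed
  have summ: "(%i. v i x) summable_on I" for x
   by (rule orthogonal_summable[OF orth sq])
  define f where "f x = infsum (%i. v i x) I" for x
  have hf: "((%i. v i x) has_sum f x) I" for x unfolding f_def using summ by (rule has_sum_infsum)
  have "bounded_linear f"
  proof (rule bounded_linear_intro[where K = 1])
   fix x y r
   show "f (x + y) = f x + f y"
    using has_sum_unique[OF hf[of "x + y"]] has_sum_add[OF hf[of x] hf[of y]] by (simp add: blinfun.add_right)
   show "f (r *R x) = r *R f x"
    using has_sum_unique[OF hf[of "r *R x"]]
     has_sum_bounded_linear[OF bounded_linear_scaleR_right hf[of x], of r]
    by (simp add: blinfun.scaleR_right o_def)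
   show "norm (f x) <= norm x * 1"
   proof (rule tendsto_upperbound)
    show "((%S. norm (\<Sum>i\<in>S. v i x)) \<longlongrightarrow> norm (f x)) (finite_subsets_at_top I)"
     using hf[of x] unfolding has_sum_def by (rule tendsto_norm)
    have "norm (\<Sum>i\<in>S. v i x) <= norm x" if S: "finite S" "S <= I" for S
    proof -
     have "(norm (\<Sum>i\<in>S. v i x))^2 = (\<Sum>i\<in>S. (norm (v i x))^2)"
      by (rule norm_sq_sum_orthogonal[OF S(1)]) (use orth S in blast)
     hence "(norm (\<Sum>i\<in>S. v i x))^2 <= (norm x)^2" using sq[OF S] by simp
     thus ?thesis by (rule power2_le_imp_le) simp
    qed
    thus "\<forall>\<^sub>F S in finite_subsets_at_top I. norm (\<Sum>i\<in>S. v i x) <= norm x * 1"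
     by (intro eventually_finite_subsets_at_top_weakI) simp
   qed simp
  qed
  hence Bf: "blinfun_apply (Blinfun f) = f" by (rule bounded_linear_Blinfun_apply)
  have "Blinfun f : M"
  proof (rule vn_strong_limit[OF M, of "finite_subsets_at_top I" "sum v"])
   show "\<forall>\<^sub>F S in finite_subsets_at_top I. sum v S : M"
    by (intro eventually_finite_subsets_at_top_weakI vn_sum[OF M] v) blast
   show "((%S. (sum v S) x) \<longlongrightarrow> Blinfun f x) (finite_subsets_at_top I)" for x
    using hf[of x] unfolding has_sum_def Bf by (simp add: blinfun.sum_left)
  qed simp
  thus ?thesis using hf Bf by (intro bexI[of _ "Blinfun f"]) auto
 qed
 have vB: "v i : BH" if "i : I" for i using v(1)[OF that] vn_inBH[OF M] by blast
 obtain w where w: "w : M" "!!x. ((%i. v i x) has_sum w x) I" using half[of v, OF v o] by blast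
 obtain u where u: "u : M" "!!x. ((%i. adj (v i) x) has_sum u x) I"
  using half[of "%i. adj (v i)"] v o vB partial_isometry(2)[OF vB v(2)] by (auto intro: vn_adj[OF M])
 have uw: "adj w = u"
 proof (rule adj_eqI)
  fix x y
  have "((%i. cinner (v i x) y) has_sum cinner (w x) y) I"
   using has_sum_bounded_linear[OF bounded_bilinear.bounded_linear_left[OF bounded_bilinear_cinner] w(2)]
   by (simp add: o_def)
  moreover have "((%i. cinner x (adj (v i) y)) has_sum cinner x (u y)) I"
   using has_sum_bounded_linear[OF bounded_bilinear.bounded_linear_right[OF bounded_bilinear_cinner] u(2)]
   by (simp add: o_def)
  moreover have "((%i. cinner x (adj (v i) y)) has_sum cinner x (u y)) I \<longleftrightarrow>
    ((%i. cinner (v i x) y) has_sum cinner x (u y)) I"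
   by (rule has_sum_cong) (simp add: cinner_adj_right vB)
  ultimately show "cinner (w x) y = cinner x (u y)" using has_sum_unique by blast
 qed
 have single: "c i (d x) = c i (a i x)"
  if i: "i : I" and d: "!!x. ((%i. blinfun_apply (a i) x) has_sum blinfun_apply d x) I"
   and z: "!!j. j : I ==> j ~= i ==> c i ** a j = 0" for i x a d and c :: "'i => 'a op"
 proof -
  have "((%j. c i (a j x)) has_sum c i (d x)) I" by (rule has_sum_apply[OF d])
  moreover have "((%j. c i (a j x)) has_sum c i (a i x)) I"
  proof -
   have "((%j. c i (a j x)) has_sum c i (a i x)) {i}"
    using has_sum_finite[of "{i}" "%j. c i (a j x)"] by simp
   moreover have "c i (a j x) = 0" if "j : I - {i}" for j
    using z[of j] that by (metis DiffD1 DiffD2 oL_apply insertI1 zero_blinfun.rep_eq)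
   ultimately show ?thesis
    using has_sum_cong_neutral[of I "{i}" "%j. c i (a j x)" "%j. c i (a j x)" "c i (a i x)"] i by auto
  qed
  ultimately show ?thesis using has_sum_unique by blast
 qed
 have "((%i. (adj (v i) ** v i) x) has_sum (adj w ** w) x) I" for x
 proof -
  have "((%i. adj (v i) (w x)) has_sum u (w x)) I" by (rule u(2))
  moreover have "((%i. adj (v i) (w x)) has_sum u (w x)) I \<longleftrightarrow> ((%i. adj (v i) (v i x)) has_sum u (w x)) I"
   by (rule has_sum_cong) (rule single[OF _ w(2)], use o(2) in auto)
  ultimately show ?thesis by (simp add: uw)
 qed
 moreover have "((%i. (v i ** adj (v i)) x) has_sum (w ** adj w) x) I" for x
 proof -
  have "((%i. v i (u x)) has_sum w (u x)) I" by (rule w(2))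
  moreover have "((%i. v i (u x)) has_sum w (u x)) I \<longleftrightarrow> ((%i. v i (adj (v i) x)) has_sum w (u x)) I"
   by (rule has_sum_cong) (rule single[OF _ u(2)], use o(1) in auto)
  ultimately show ?thesis by (simp add: uw)
 qed
 ultimately show ?thesis using w(1) by blast
qed

section \<open>Traces on finite factors\<close>

lemma nft_add: "nf_tracial_state M \<tau> ==> x : M ==> y : M ==> \<tau> (x + y) = \<tau> x + \<tau> y"
 by (simp add: nf_tracial_state_def)

lemma nft_cscale: "nf_tracial_state M \<tau> ==> x : M ==> \<tau> (cscale c x) = c * \<tau> x"
 by (simp add: nf_tracial_state_def)

lemma nft_id: "nf_tracial_state M \<tau> ==> \<tau> Id = 1"
 by (simp add: nf_tracial_state_def)

lemma nft_pos:
 assumes "nf_tracial_state M \<tau>" "x : M"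
 shows "Im (\<tau> (adj x ** x)) = 0" "0 <= Re (\<tau> (adj x ** x))"
 using assms by (simp_all add: nf_tracial_state_def)

lemma nft_comm: "nf_tracial_state M \<tau> ==> x : M ==> y : M ==> \<tau> (x ** y) = \<tau> (y ** x)"
 by (simp add: nf_tracial_state_def)

lemma nft_faithful: "nf_tracial_state M \<tau> ==> x : M ==> \<tau> (adj x ** x) = 0 ==> x = 0"
 unfolding nf_tracial_state_def by (elim conjE) metis

lemma nft_SUP:
 "nf_tracial_state M \<tau> ==> D <= self_adjoints M ==> up_directed D ==> lub_in M D s ==>
  Re (\<tau> s) = (SUP d\<in>D. Re (\<tau> d))"
 unfolding nf_tracial_state_def by (elim conjE) simp

lemma cscale_minus_right: "cscale c (- T) = - cscale c T"
 using cscale_diff_right[of c 0 T] by simp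

lemma imaginary_part_self_adjoint: "x : BH ==> adj (cscale \<i> (x - adj x)) = cscale \<i> (x - adj x)"
proof -
 assume x: "x : BH"
 have "adj (cscale \<i> (x - adj x)) = - cscale \<i> (adj x - x)"
  using x by (simp add: adj_cscale adj_diff BH_diff cscale_minus_left)
 also have "... = cscale \<i> (- (adj x - x))" by (rule cscale_minus_right[symmetric])
 finally show ?thesis by simp
qed

context
 fixes M and \<tau> :: "'a :: chilbert_space op => complex"
 assumes M: "von_neumann_algebra M" and \<tau>: "nf_tracial_state M \<tau>"
begin

lemma nft_scaleR: "x : M ==> \<tau> (r *R x) = of_real r * \<tau> x"
 using nft_cscale[OF \<tau>, of x "of_real r"] by (simp add: cscale_of_real)

lemma nft_zero: "\<tau> 0 = 0"
 using nft_cscale[OF \<tau> vn_zero[OF M], of 0] by simp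

lemma nft_diff: "x : M ==> y : M ==> \<tau> (x - y) = \<tau> x - \<tau> y"
 using nft_add[OF \<tau>, of "x - y" y] vn_diff[OF M] by simp

lemma nft_minus: "x : M ==> \<tau> (- x) = - \<tau> x"
 using nft_diff[of 0 x] vn_zero[OF M] nft_zero by simp

lemma nft_positive:
 assumes "x : M" "positive_op x" shows "Im (\<tau> x) = 0" "0 <= Re (\<tau> x)"
 using nft_pos[OF \<tau> op_sqrt_in_vn[OF M assms(2,1)]] positive_op_adj[OF positive_op_sqrt[OF assms(2)]]
  op_sqrt_square[OF assms(2)] by auto

lemma nft_normal_pos: "normal_pos M (%x. Re (\<tau> x))"
 unfolding normal_pos_def
 using nft_add[OF \<tau>] nft_scaleR nft_positive(2) nft_SUP[OF \<tau>] by simp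

lemma nft_proj: "p : M ==> is_proj p ==> \<tau> p = of_real (Re (\<tau> p))"
 using nft_positive[OF _ positive_proj] by (simp add: complex_eq_iff)

lemma nft_proj_nonneg: "p : M ==> is_proj p ==> 0 <= Re (\<tau> p)"
 using nft_positive[OF _ positive_proj] by simp

lemma nft_proj_zero: "p : M ==> is_proj p ==> Re (\<tau> p) = 0 ==> p = 0"
 using nft_faithful[OF \<tau>, of p] nft_proj[of p] is_projD[of p] by simp

lemma nft_self_adjoint: "x : M ==> adj x = x ==> \<tau> x = of_real (Re (\<tau> x))"
proof -
 assume x: "x : M" "adj x = x"
 have xB: "x : BH" using x vn_inBH[OF M] by blast
 have P: "positive_op (norm x *R Id - x)" using op_le_norm[OF xB x(2)] by (simp add: op_le_def)
 have "Im (\<tau> (norm x *R Id - x)) = 0"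
  by (rule nft_positive(1)[OF _ P]) (intro vn_intros M x)
 thus ?thesis
  using x by (simp add: nft_diff nft_scaleR vn_id[OF M] vn_scaleR[OF M] nft_id[OF \<tau>] complex_eq_iff)
qed

lemma nft_adj: "x : M ==> \<tau> (adj x) = cnj (\<tau> x)"
proof -
 assume x: "x : M"
 have xB: "x : BH" using x vn_inBH[OF M] by blast
 note aM = vn_adj[OF M x]
 have "\<tau> (x + adj x) = of_real (Re (\<tau> (x + adj x)))"
  using xB by (intro nft_self_adjoint vn_add[OF M] x aM) (simp add: adj_add add.commute)
 moreover have "\<tau> (cscale \<i> (x - adj x)) = of_real (Re (\<tau> (cscale \<i> (x - adj x))))"
  by (intro nft_self_adjoint vn_intros M x aM) (rule imaginary_part_self_adjoint[OF xB])
 ultimately show ?thesis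
  using x aM by (simp add: nft_add[OF \<tau>] nft_cscale[OF \<tau>] vn_diff[OF M] nft_diff complex_eq_iff)
qed

lemma nft_cong: "(!!x. x : M ==> \<sigma> x = \<tau> x) ==> nf_tracial_state M \<sigma>"
proof -
 assume eq: "!!x. x : M ==> \<sigma> x = \<tau> x"
 have "Re (\<sigma> s) = (SUP d\<in>D. Re (\<sigma> d))" if D: "D <= self_adjoints M" "up_directed D" "lub_in M D s" for D s
 proof -
  have "(SUP d\<in>D. Re (\<sigma> d)) = (SUP d\<in>D. Re (\<tau> d))"
   using D(1) eq by (intro SUP_cong) (auto simp: self_adjoints_def)
  moreover have "\<sigma> s = \<tau> s" using D(3) eq by (auto simp: lub_in_def self_adjoints_def)
  ultimately show ?thesis using nft_SUP[OF \<tau> D] by simp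
 qed
 thus ?thesis
  using nft_pos[OF \<tau>] nft_faithful[OF \<tau>] nft_comm[OF \<tau>]
  unfolding nf_tracial_state_def
  by (auto simp: eq vn_intros[OF M] nft_add[OF \<tau>] nft_cscale[OF \<tau>] nft_id[OF \<tau>])
qed

end

section \<open>Factors: connecting projections, comparison, and uniqueness of the trace\<close>

lemma
 assumes "factor N"
 shows factor_vn: "von_neumann_algebra N"
  and factor_center: "x : N ==> x : commutant N ==> EX c. x = cscale c Id"
 using assms unfolding factor_def by auto

lemma scalar_in_vn: "von_neumann_algebra N ==> cscale c Id : N"
 by (intro vn_intros)

lemma factorI:
 assumes N: "von_neumann_algebra N" and "!!x. x : N ==> x : commutant N ==> EX c. x = cscale c Id"
 shows "factor N"
proof -
 have "cscale c Id : commutant N" for c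
  using vn_inBH[OF N] by (intro commutantI) (auto simp: oL_cscale_left oL_cscale_right BH_intros)
 thus ?thesis unfolding factor_def using assms scalar_in_vn by blast
qed

lemma factor_commutant: "factor N ==> factor (commutant N)"
proof (rule factorI)
 assume N: "factor N"
 show "von_neumann_algebra (commutant N)" by (rule vn_commutant_vn[OF factor_vn[OF N]])
 fix x assume "x : commutant N" "x : commutant (commutant N)"
 thus "EX c. x = cscale c Id"
  using factor_center[OF N] vn_bicommutant[OF factor_vn[OF N]] by auto
qed

lemma factor_central_proj: "factor N ==> p : N ==> p : commutant N ==> is_proj p ==> p = 0 | p = Id"
proof -
 assume N: "factor N" and p: "p : N" "p : commutant N" "is_proj p"
 obtain c where c: "p = cscale c Id" using factor_center[OF N p(1,2)] by blast
 have "cscale (c * c - c) Id = (0 :: 'a op)"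
  using is_projD(2)[OF p(3)] by (simp add: c oL_cscale_left cscale_cscale cscale_diff_left)
 hence "c * c - c = 0 | (Id :: 'a op) = 0"
  by (metis norm_cscale norm_eq_zero mult_eq_0_iff)
 thus ?thesis
 proof
  assume "c * c - c = 0"
  hence "c = 0 | c = 1" by (simp add: right_diff_distrib[symmetric])
  thus ?thesis by (auto simp: c)
 qed (use c in auto)
qed

lemma csubspace_span:
 assumes "!!c x. x : S ==> c *C x : S" shows "csubspace (span S)"
proof (rule csubspaceI)
 show "c *C x : span S" if "x : span S" for c x
 proof -
  have "span S <= {x. c *C x : span S}"
  proof (rule span_minimal)
   show "S <= {x. c *C x : span S}" using assms by (auto intro: span_base)
   show "subspace {x. c *C x : span S}"
    by (auto simp: subspace_def scaleC_add_right scaleC_scaleR intro: span_add span_scale span_zero)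
  qed
  thus ?thesis using that by blast
 qed
qed (auto intro: span_add span_zero)

lemma subspace_closure:
 fixes V :: "'a :: real_normed_vector set"
 assumes V: "subspace V" shows "subspace (closure V)"
 unfolding subspace_def
proof (intro conjI ballI allI)
 show "0 : closure V" using V subspace_0 closure_subset by blast
 fix x assume "x : closure V"
 then obtain f where f: "ALL n. f n : V" "f \<longlonglongrightarrow> x" unfolding closure_sequential by blast
 show "c *R x : closure V" for c
  unfolding closure_sequential
  by (rule exI[of _ "%n. c *R f n"]) (use f V in "auto intro!: tendsto_intros subspace_scale")
 fix y assume "y : closure V"
 then obtain g where g: "ALL n. g n : V" "g \<longlonglongrightarrow> y" unfolding closure_sequential by blast
 show "x + y : closure V"
  unfolding closure_sequential
  by (rule exI[of _ "%n. f n + g n"]) (use f g V in "auto intro!: tendsto_intros subspace_add")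
qed

lemma blinfun_image_closure_span:
 assumes "!!x. x : S ==> blinfun_apply T x : closure (span S')" and "v : closure (span S)"
 shows "blinfun_apply T v : closure (span S')"
proof -
 have sub: "subspace (closure (span S'))" by (intro subspace_closure subspace_span)
 have "span S <= {v. T v : closure (span S')}"
 proof (rule span_minimal)
  show "subspace {v. T v : closure (span S')}"
   using sub by (auto simp: subspace_def blinfun.add_right blinfun.scaleR_right)
 qed (use assms in auto)
 hence "T ` closure (span S) <= closure (span S')"
  by (intro image_closure_subset cont_blinfun) auto
 thus ?thesis using assms(2) by blast
qed

text \<open>The closed span of the vectors \<open>x (q v)\<close> with \<open>x\<close> in
  \<open>N\<close> is invariant under \<open>N\<close> and its commutant, so its projection is
  central and equals \<open>Id\<close>. If \<open>p\<close> annihilated all these vectors, it would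
  vanish.\<close>

lemma factor_connects:
 assumes N: "factor N" and p: "p : N" "is_proj p" "p ~= 0" and q: "q : N" "is_proj q" "q ~= 0"
 shows "EX x:N. p ** (x ** q) ~= 0"
proof (rule ccontr)
 assume n: "~ (EX x:N. p ** (x ** q) ~= 0)"
 note vN = factor_vn[OF N]
 define S where "S = {blinfun_apply x (q v) | x v. x : N}"
 define V where "V = closure (span S)"
 have Ssc: "c *C w : S" if wS: "w : S" for c w
 proof -
  obtain x v where "w = blinfun_apply x (q v)" "x : N" using wS unfolding S_def by blast
  hence "c *C w = x (q (c *C v))" using vn_inBH[OF vN] q(1) by (simp add: BH_apply)
  thus ?thesis using \<open>x : N\<close> unfolding S_def by blast
 qed
 have V: "csubspace V" "closed V" unfolding V_def by (auto intro: csubspace_closure csubspace_span Ssc)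
 have inS: "w : V" if "w : S" for w unfolding V_def using that by (meson closure_subset span_base subsetD)
 have inv: "y v : V" if y: "y : N | y : commutant N" and v: "v : V" for y v
  unfolding V_def
 proof (rule blinfun_image_closure_span[OF _ v[unfolded V_def]])
  fix w assume "w : S"
  then obtain x u where w: "w = blinfun_apply x (q u)" "x : N" unfolding S_def by blast
  have "y w : S"
  proof (cases "y : N")
   case True
   hence "y w = (y ** x) (q u)" "y ** x : N" using w vn_compose[OF vN] by auto
   thus ?thesis unfolding S_def by blast
  next
   case False
   hence "y w = x (q (y u))" using y w commutant_apply[of y N] q(1) by simp
   thus ?thesis using w(2) unfolding S_def by blast
  qed
  thus "y w : closure (span S)" using inS V_def by blast
 qed
 have "prj V : commutant N"
  by (rule prj_in_commutant[OF V vn_BH[OF vN] vn_adj[OF vN]]) (use inv in auto)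
 moreover have "prj V : commutant (commutant N)"
  by (rule prj_in_commutant[OF V commutant_BH vn_adj[OF vn_commutant_vn[OF vN]]]) (use inv in auto)
 ultimately have "prj V = 0 | prj V = Id"
  using factor_central_proj[OF N _ _ is_proj_prj[OF V]] vn_bicommutant[OF vN] by blast
 moreover have "prj V ~= 0"
 proof
  assume z: "prj V = 0"
  have "q v = 0" for v
  proof -
   have "Id (q v) : S" using vn_id[OF vN] unfolding S_def by blast
   thus ?thesis using prj_fix[OF V inS] z by fastforce
  qed
  thus False using q(3) by (metis blinfun_eqI zero_blinfun.rep_eq)
 qed
 ultimately have V1: "prj V = Id" by blast
 have "p v = 0" for v
 proof -
  have "v : V" using prj_mem[OF V, of v] V1 by simp
  moreover have "p w : closure (span {0})" if "w : V" for w
  proof (rule blinfun_image_closure_span[OF _ that[unfolded V_def]])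
   fix w assume "w : S"
   then obtain x u where w: "w = blinfun_apply x (q u)" "x : N" unfolding S_def by blast
   have "p ** (x ** q) = 0" using n w(2) by blast
   hence "p w = 0" using w(1) by (metis oL_apply zero_blinfun.rep_eq)
   thus "p w : closure (span {0})" by simp
  qed
  ultimately show ?thesis by fastforce
 qed
 thus False using p(3) by (metis blinfun_eqI zero_blinfun.rep_eq)
qed

lemma ex_connecting_partial_isometry:
 fixes p :: "'a :: chilbert_space op"
 assumes N: "factor N" and p: "p : N" "is_proj p" "p ~= 0" and q: "q : N" "is_proj q" "q ~= 0"
 shows "EX v:N. v ~= 0 & is_proj (adj v ** v) & v ** q = v & p ** v = v"
proof -
 note vN = factor_vn[OF N]
 obtain x where x: "x : N" "p ** (x ** q) ~= 0" using factor_connects[OF assms] by blast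
 define y where "y = p ** (x ** q)"
 have yN: "y : N" unfolding y_def by (intro vn_compose[OF vN] p q x)
 obtain v h where v: "v : N" "v ** h = y" "is_proj (adj v ** v)"
  "!!R :: 'a op. y ** R = 0 ==> v ** R = 0" "!!R :: 'a op. R ** y = 0 ==> R ** v = 0"
  using polar_decomposition[OF vN yN] by blast
 have "y ** (Id - q) = 0"
  using is_projD(2)[OF q(2)] by (simp add: y_def oL_simps)
 hence "v ** (Id - q) = 0" by (rule v(4))
 moreover have "(Id - p) ** y = 0"
  using is_projD(2)[OF p(2)] by (simp add: y_def oL_simps) (metis oL_assoc)
 hence "(Id - p) ** v = 0" by (rule v(5))
 moreover have "v ~= 0" using v(2) x(2) by (auto simp: y_def)
 ultimately show ?thesis using v(1,3) by (intro bexI[of _ v]) (auto simp: oL_simps)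
qed

lemma partial_isometry_apply:
 assumes v: "v : BH" "is_proj (adj v ** v)"
 shows "(adj v ** v) ** s = adj v ** v ==> v ** s = v"
  and "(v ** adj v) ** s = v ** adj v ==> adj v ** s = adj v"
proof -
 show "v ** s = v" if "(adj v ** v) ** s = adj v ** v"
  using partial_isometry(1)[OF v] that by (metis oL_assoc)
 show "adj v ** s = adj v" if "(v ** adj v) ** s = v ** adj v"
  using partial_isometry(3)[OF v] that by (metis oL_assoc)
qed

text \<open>A maximal family of partial isometries from \<open>p\<close> to \<open>q\<close> with
  orthogonal domains and ranges exhausts one of the two projections, because a factor connects any
  two nonzero remainders. The faithful trace then shows that \<open>p\<close> is exhausted.\<close>

lemma comparison:
 fixes p :: "'a :: chilbert_space op"
 assumes N: "factor N" and \<tau>: "nf_tracial_state N \<tau>"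
  and p: "p : N" "is_proj p" and q: "q : N" "is_proj q" and le: "Re (\<tau> p) <= Re (\<tau> q)"
 shows "EX w:N. adj w ** w = p & q ** w = w & (Re (\<tau> p) = Re (\<tau> q) --> w ** adj w = q)"
proof -
 note vN = factor_vn[OF N]
 define P where "P v \<longleftrightarrow> v : N & is_proj (adj v ** v) & v ** p = v & q ** v = v" for v
 from ex_maximal_family[of P "%v u. v ** adj u = 0 & adj v ** u = 0"] obtain F where
  F0: "ALL v:F. P v" "ALL v:F. ALL u:F. v ~= u --> v ** adj u = 0 & adj v ** u = 0"
  "ALL z. P z --> (ALL x:F. x ~= z --> (x ** adj z = 0 & adj x ** z = 0) & (z ** adj x = 0 & adj z ** x = 0)) --> z : F"
  by (elim exE conjE)
 have vF: "v : N" "is_proj (adj v ** v)" "v ** p = v" "q ** v = v" "v : BH" if "v : F" for v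
  using F0(1) that vn_inBH[OF vN] by (auto simp: P_def)
 have oF: "v ** adj u = 0" "adj v ** u = 0" if "v : F" "u : F" "v ~= u" for v u
  using F0(2) that by auto
 obtain w where w: "w : N"
  "!!x. ((%v. blinfun_apply (adj v ** v) x) has_sum (adj w ** w) x) F"
  "!!x. ((%v. blinfun_apply (v ** adj v) x) has_sum (w ** adj w) x) F"
  using partial_isometry_sum[OF vN, of F "%v. v"] vF(1,2) oF by blast
 have wB: "w : BH" using w(1) vn_inBH[OF vN] by blast
 have fam1: "orth_family N F (%v. adj v ** v)"
  unfolding orth_family_def
 proof (intro conjI ballI impI)
  fix v u assume vu: "v : F" "u : F" "v ~= u"
  have "(adj v ** v) ** (adj u ** u) = adj v ** ((v ** adj u) ** u)" by (simp add: oL_assoc)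
  thus "(adj v ** v) ** (adj u ** u) = 0" using oF[OF vu] by simp
 qed (use vF in "auto intro!: vn_compose[OF vN] vn_adj[OF vN]")
 have fam2: "orth_family N F (%v. v ** adj v)"
  unfolding orth_family_def
 proof (intro conjI ballI impI)
  fix v u assume vu: "v : F" "u : F" "v ~= u"
  have "(v ** adj v) ** (u ** adj u) = v ** ((adj v ** u) ** adj u)" by (simp add: oL_assoc)
  thus "(v ** adj v) ** (u ** adj u) = 0" using oF[OF vu] by simp
 qed (use vF in "auto intro!: vn_compose[OF vN] vn_adj[OF vN] partial_isometry(2)")
 define s1 s2 where "s1 = adj w ** w" and "s2 = w ** adj w"
 obtain t1 where t1: "is_proj t1" "!!v. v : F ==> (adj v ** v) ** t1 = adj v ** v"
  "!!x. ((%v. blinfun_apply (adj v ** v) x) has_sum t1 x) F"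
  using orth_family_sup[OF vN fam1] by blast
 obtain t2 where t2: "!!v. v : F ==> (v ** adj v) ** t2 = v ** adj v"
  "!!x. ((%v. blinfun_apply (v ** adj v) x) has_sum t2 x) F"
  using orth_family_sup[OF vN fam2] by blast
 have "t1 = s1" "t2 = s2"
  unfolding s1_def s2_def using has_sum_unique[OF t1(3) w(2)] has_sum_unique[OF t2(2) w(3)]
  by (auto intro: blinfun_eqI)
 note t1 = t1[unfolded \<open>t1 = s1\<close>] and t2 = t2[unfolded \<open>t2 = s2\<close>]
 have s2P: "is_proj s2" unfolding s2_def by (rule partial_isometry(2)[OF wB]) (use t1(1) s1_def in simp)
 have sN: "s1 : N" "s2 : N" unfolding s1_def s2_def using w(1) by (auto intro: vn_compose[OF vN] vn_adj[OF vN])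
 have \<tau>12: "\<tau> s1 = \<tau> s2" unfolding s1_def s2_def by (rule nft_comm[OF \<tau>]) (use w(1) vn_adj[OF vN] in auto)
 have ps1: "p ** s1 = s1"
 proof (rule has_sum_fixI[OF t1(3)])
  fix v assume v: "v : F"
  have "p ** adj v = adj v"
   using arg_cong[OF vF(3)[OF v], of adj] vF(5)[OF v] is_projD[OF p(2)] by (simp add: adj_compose)
  thus "p ** (adj v ** v) = adj v ** v" by (metis oL_assoc)
 qed
 have qs2: "q ** s2 = s2"
  by (rule has_sum_fixI[OF t2(2)]) (metis oL_assoc vF(4))
 have d1: "is_proj (p - s1)" by (rule proj_le_diff[OF p(2) t1(1) ps1])
 have d2: "is_proj (q - s2)" by (rule proj_le_diff[OF q(2) s2P qs2])
 have dN: "p - s1 : N" "q - s2 : N" using p q sN by (auto intro: vn_diff[OF vN])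
 have max: "p - s1 = 0 | q - s2 = 0"
 proof (rule ccontr)
  assume "~ (p - s1 = 0 | q - s2 = 0)"
  then obtain v where v: "v : N" "v ~= 0" "is_proj (adj v ** v)" "v ** (p - s1) = v" "(q - s2) ** v = v"
   using ex_connecting_partial_isometry[OF N dN(2) d2 _ dN(1) d1] by blast
  have vB: "v : BH" using v(1) vn_inBH[OF vN] by blast
  have pp: "(p - s1) ** p = p - s1" "q ** (q - s2) = q - s2"
   using proj_le_diff(2)[OF p(2) t1(1) ps1] is_projD(2)[OF p(2)] is_projD(2)[OF q(2)] qs2
   by (simp_all add: oL_simps)
  have "P v" unfolding P_def using v pp by (metis oL_assoc)
  have us: "u ** s1 = u" "adj u ** s2 = adj u" if u: "u : F" for u
   using partial_isometry_apply(1)[OF vF(5)[OF u] vF(2)[OF u] t1(2)[OF u]]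
    partial_isometry_apply(2)[OF vF(5)[OF u] vF(2)[OF u] t2(1)[OF u]] by blast+
  have 1: "u ** adj v = 0 & adj u ** v = 0" if u: "u : F" for u
  proof
   have av: "adj v = (p - s1) ** adj v"
    using arg_cong[OF v(4), of adj] vB is_projD[OF d1] by (simp add: adj_compose)
   have "u ** (p - s1) = 0" using us[OF u] vF(3)[OF u] by (simp add: oL_simps)
   thus "u ** adj v = 0" by (subst av) (simp flip: oL_assoc)
   have "adj u ** q = adj u"
    using arg_cong[OF vF(4)[OF u], of adj] vF(5)[OF u] is_projD[OF q(2)] by (simp add: adj_compose)
   hence "adj u ** (q - s2) = 0" using us[OF u] by (simp add: oL_simps)
   thus "adj u ** v = 0" by (subst v(5)[symmetric]) (simp flip: oL_assoc)
  qed
  moreover have "v ** adj u = 0 & adj v ** u = 0" if u: "u : F" for u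
   using arg_cong[OF conjunct1[OF 1[OF u]], of adj] arg_cong[OF conjunct2[OF 1[OF u]], of adj]
    vB vF(5)[OF u] by (simp add: adj_compose)
  ultimately have "v : F" using F0(3) \<open>P v\<close> by blast
  hence "v ** (p - s1) = 0" using us(1) vF(3) by (simp add: oL_simps)
  thus False using v by simp
 qed
 have sum1: "Re (\<tau> (p - s1)) = Re (\<tau> p) - Re (\<tau> s1)" "Re (\<tau> (q - s2)) = Re (\<tau> q) - Re (\<tau> s2)"
  using nft_diff[OF vN \<tau>] p q sN by auto
 have s1p: "s1 = p"
 proof (cases "p - s1 = 0")
  case False
  hence "q = s2" using max by simp
  hence "Re (\<tau> (p - s1)) = 0"
   using sum1 le \<tau>12 nft_proj_nonneg[OF vN \<tau> dN(1) d1] by simp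
  thus ?thesis using nft_proj_zero[OF vN \<tau> dN(1) d1] by simp
 qed simp
 have sw: "s2 ** w = w"
  using partial_isometry(1)[OF wB] t1(1) unfolding s1_def s2_def by (simp add: oL_assoc)
 have "q ** w = (q ** s2) ** w" by (simp add: oL_assoc sw)
 hence "q ** w = w" by (simp only: qs2 sw)
 moreover have "s2 = q" if "Re (\<tau> p) = Re (\<tau> q)"
 proof -
  have "Re (\<tau> (q - s2)) = 0" using sum1(2) that \<tau>12 unfolding s1p by simp
  thus ?thesis using nft_proj_zero[OF vN \<tau> dN(2) d2] by simp
 qed
 ultimately show ?thesis using w(1) s1p unfolding s1_def s2_def by blast
qed

text \<open>Otherwise \<open>\<sigma>\<close> is at most \<open>c * \<tau>\<close> with
  \<open>c < 1\<close> below some nonzero projection \<open>e\<close>. Partial isometries carry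
  pieces of \<open>e\<close> to a family with sum \<open>Id\<close>, and traciality spreads the
  inequality to \<open>1 <= c\<close>.\<close>

lemma trace_projection_le:
 fixes p :: "'a :: chilbert_space op"
 assumes N: "factor N" and \<tau>: "nf_tracial_state N \<tau>" and \<sigma>: "nf_tracial_state N \<sigma>"
  and p: "p : N" "is_proj p"
 shows "Re (\<tau> p) <= Re (\<sigma> p)"
proof (rule ccontr)
 assume "~ Re (\<tau> p) <= Re (\<sigma> p)"
 hence lt: "Re (\<sigma> p) < Re (\<tau> p)" by simp
 note vN = factor_vn[OF N]
 have s0: "0 <= Re (\<sigma> p)" by (rule nft_proj_nonneg[OF vN \<sigma> p])
 hence tp: "0 < Re (\<tau> p)" using lt by simp
 obtain c where c: "Re (\<sigma> p) / Re (\<tau> p) < c" "c < 1"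
  using dense[of "Re (\<sigma> p) / Re (\<tau> p)" 1] lt tp by auto
 have c0: "0 <= c" using c(1) s0 tp by (meson divide_nonneg_pos less_eq_real_def order_trans)
 have cp: "Re (\<sigma> p) < c * Re (\<tau> p)" using c(1) tp by (simp add: field_simps)
 note ns = nft_normal_pos[OF vN \<sigma>] and nt = normal_pos_cmult[OF vN nft_normal_pos[OF vN \<tau>] c0]
 obtain e where e: "e : N" "is_proj e" "c * Re (\<tau> (p - e)) <= Re (\<sigma> (p - e))"
  "!!x. x : N ==> positive_op x ==> x ** e = x ==> Re (\<sigma> x) <= c * Re (\<tau> x)"
  using hahn_decomposition[OF vN ns nt p] by blast
 have e0: "e ~= 0" using e(3) cp by auto
 define P where "P v \<longleftrightarrow> v : N & is_proj (adj v ** v) & v ** e = v" for v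
 from ex_maximal_family[of P "%v u. adj v ** u = 0"] obtain F where
  F0: "ALL v:F. P v" "ALL v:F. ALL u:F. v ~= u --> adj v ** u = 0"
  "ALL z. P z --> (ALL x:F. x ~= z --> adj x ** z = 0 & adj z ** x = 0) --> z : F"
  by (elim exE conjE)
 have vF: "v : N" "is_proj (adj v ** v)" "v ** e = v" "v : BH" if "v : F" for v
  using F0(1) that vn_inBH[OF vN] by (auto simp: P_def)
 have fam: "orth_family N F (%v. v ** adj v)"
  unfolding orth_family_def
 proof (intro conjI ballI impI)
  fix v u assume vu: "v : F" "u : F" "v ~= u"
  have "(v ** adj v) ** (u ** adj u) = v ** ((adj v ** u) ** adj u)" by (simp_all add: oL_assoc)
  thus "(v ** adj v) ** (u ** adj u) = 0" using F0(2) vu by auto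
 qed (use vF in "auto intro!: vn_compose[OF vN] vn_adj[OF vN] partial_isometry(2)")
 obtain s where s: "s : N" "is_proj s" "!!v. v : F ==> (v ** adj v) ** s = v ** adj v"
  "!!\<phi>. normal_pos N \<phi> ==> ((%v. \<phi> (v ** adj v)) has_sum \<phi> s) F"
  using orth_family_sup[OF vN fam] by blast
 have "Id - s = 0"
 proof (rule ccontr)
  assume ne: "Id - s ~= 0"
  obtain v where v: "v : N" "v ~= 0" "is_proj (adj v ** v)" "v ** e = v" "(Id - s) ** v = v"
   using ex_connecting_partial_isometry[OF N vn_diff[OF vN vn_id[OF vN] s(1)]
     is_proj_complement[OF s(2)] ne e(1,2) e0] by blast
  have vB: "v : BH" using v(1) vn_inBH[OF vN] by blast
  have us: "adj u ** s = adj u" if u: "u : F" for u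
   by (rule partial_isometry_apply(2)[OF vF(4)[OF u] vF(2)[OF u] s(3)[OF u]])
  have 1: "adj u ** v = 0" if u: "u : F" for u
  proof -
   have "adj u ** (Id - s) = 0" using us[OF u] by (simp add: oL_simps)
   thus "adj u ** v = 0" by (subst v(5)[symmetric]) (simp flip: oL_assoc)
  qed
  moreover have "adj v ** u = 0" if u: "u : F" for u
   using arg_cong[OF 1[OF u], of adj] vB vF(4)[OF u] by (simp add: adj_compose)
  ultimately have "v : F" using F0(3) v unfolding P_def by blast
  hence "adj v ** v = 0" by (rule 1)
  thus False using adj_compose_self_eq_0 vB v(2) by blast
 qed
 hence s1: "s = Id" by simp
 have "Re (\<sigma> Id) <= c * Re (\<tau> Id)"
 proof (rule has_sum_mono[OF s(4)[OF ns, unfolded s1] s(4)[OF nt, unfolded s1]])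
  fix v assume v: "v : F"
  have vv: "adj v ** v : N" using vF[OF v] by (intro vn_compose[OF vN] vn_adj[OF vN])
  have "Re (\<sigma> (adj v ** v)) <= c * Re (\<tau> (adj v ** v))"
   by (rule e(4)[OF vv positive_proj[OF vF(2)[OF v]]]) (simp add: oL_assoc vF(3)[OF v])
  thus "Re (\<sigma> (v ** adj v)) <= c * Re (\<tau> (v ** adj v))"
   using nft_comm[OF \<sigma>] nft_comm[OF \<tau>] vF(1)[OF v] vn_adj[OF vN] by metis
 qed
 thus False using c(2) nft_id[OF \<tau>] nft_id[OF \<sigma>] by simp
qed

text \<open>Projections determine a normal trace on positive elements through the dyadic expansion,
  and positive elements span. This gives the definite description in \<open>vn_trace\<close> its
  meaning.\<close>

theorem trace_unique:
 assumes N: "factor N" and \<tau>: "nf_tracial_state N \<tau>" and \<sigma>: "nf_tracial_state N \<sigma>" and x: "x : N"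
 shows "\<tau> x = \<sigma> x"
proof -
 note vN = factor_vn[OF N]
 have le: "Re (\<tau> x) <= Re (\<sigma> x)"
  if "nf_tracial_state N \<tau>" "nf_tracial_state N \<sigma>" "x : N" "positive_op x" for x \<tau> \<sigma>
  by (rule normal_pos_le_projections[OF vN nft_normal_pos[OF vN that(1)] nft_normal_pos[OF vN that(2)],
    of Id]) (use trace_projection_le[OF N that(1,2)] that in auto)
 have pos: "\<tau> x = \<sigma> x" if "x : N" "positive_op x" for x
  using le[OF \<tau> \<sigma> that] le[OF \<sigma> \<tau> that] nft_positive[OF vN \<tau> that] nft_positive[OF vN \<sigma> that]
  by (simp add: complex_eq_iff)
 have sa: "\<tau> x = \<sigma> x" if x: "x : N" "adj x = x" for x
 proof -
  define n where "n = norm x *R (Id :: 'a op)"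
  have nN: "n : N" unfolding n_def by (intro vn_intros vN)
  have P: "positive_op (n - x)" using op_le_norm[OF vn_inBH[OF vN x(1)] x(2)] by (simp add: op_le_def n_def)
  have "\<tau> (n - x) = \<sigma> (n - x)" by (rule pos[OF vn_diff[OF vN nN x(1)] P])
  moreover have "\<tau> n = \<sigma> n" using nft_scaleR[OF vN] vn_id[OF vN] \<tau> \<sigma> nft_id by (metis n_def)
  ultimately show ?thesis using nft_diff[OF vN \<tau> nN x(1)] nft_diff[OF vN \<sigma> nN x(1)] by simp
 qed
 have xB: "x : BH" using x vn_inBH[OF vN] by blast
 note aN = vn_adj[OF vN x]
 define a b where "a = x + adj x" and "b = cscale \<i> (x - adj x)"
 have abN: "a : N" "b : N" unfolding a_def b_def using x aN by (auto intro: vn_intros[OF vN])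
 have "\<tau> a = \<sigma> a" by (rule sa[OF abN(1)]) (simp add: a_def adj_add xB add.commute)
 moreover have "\<tau> b = \<sigma> b"
  by (rule sa[OF abN(2)]) (simp add: b_def imaginary_part_self_adjoint xB)
 moreover have "\<rho> a = \<rho> x + \<rho> (adj x)" "\<rho> b = \<i> * (\<rho> x - \<rho> (adj x))" if "nf_tracial_state N \<rho>" for \<rho>
  unfolding a_def b_def using that x aN vn_diff[OF vN x aN]
  by (simp_all add: nft_add nft_cscale nft_diff[OF vN])
 ultimately have "\<tau> x + \<tau> (adj x) = \<sigma> x + \<sigma> (adj x)" "\<i> * (\<tau> x - \<tau> (adj x)) = \<i> * (\<sigma> x - \<sigma> (adj x))"
  using \<tau> \<sigma> by metis+
 thus ?thesis by (simp add: complex_eq_iff)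
qed

lemma vn_trace_nft:
 assumes N: "factor N" and \<tau>: "nf_tracial_state N \<tau>"
 shows "nf_tracial_state N (vn_trace N)" and "x : N ==> vn_trace N x = \<tau> x"
proof -
 note vN = factor_vn[OF N]
 have "vn_trace N = restrict \<tau> N"
  unfolding vn_trace_def
 proof (rule the_equality)
  show "restrict \<tau> N : extensional N & nf_tracial_state N (restrict \<tau> N)"
   using nft_cong[OF vN \<tau>] by simp
  fix \<sigma> assume "\<sigma> : extensional N & nf_tracial_state N \<sigma>"
  thus "\<sigma> = restrict \<tau> N"
   using trace_unique[OF N _ \<tau>] by (intro extensionalityI[of _ N]) auto
 qed
 thus "x : N ==> vn_trace N x = \<tau> x" "nf_tracial_state N (vn_trace N)" for x
  using nft_cong[OF vN \<tau>] by auto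
qed

section \<open>The GNS representation on \<open>\<ell>^2\<close>\<close>

lemma closure_eq_UNIV_if_orthogonal:
 assumes V: "csubspace V" and o: "!!z. (!!v. v : V ==> cinner z v = 0) ==> z = 0"
 shows "closure V = UNIV"
proof -
 note cV = csubspace_closure[OF V] closed_closure[of V]
 have "z : closure V" for z
 proof -
  have "z - prj (closure V) z = 0"
   by (rule o) (rule prj_orth[OF cV closure_subset[THEN subsetD]])
  thus ?thesis using prj_mem[OF cV, of z] by simp
 qed
 thus ?thesis by blast
qed

lemma coord_scaleC [simp]: "coord (c *C x) n = c * coord x n"
 by transfer simp

definition tnorm :: "('a :: chilbert_space op => complex) => 'a op => real" where
 "tnorm \<tau> x = sqrt (Re (\<tau> (adj x ** x)))"

locale tracial =
 fixes M :: "'h :: chilbert_space op set" and \<tau> :: "'h op => complex"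
 assumes M: "von_neumann_algebra M" and \<tau>: "nf_tracial_state M \<tau>"
begin

abbreviation tin :: "'h op => 'h op => complex" where "tin x y \<equiv> \<tau> (adj y ** x)"

lemmas MBH = vn_inBH[OF M]

lemma tin_M: "x : M ==> y : M ==> adj y ** x : M"
 by (intro vn_compose[OF M] vn_adj[OF M])

lemma tin_add_left: "x : M ==> x' : M ==> y : M ==> tin (x + x') y = tin x y + tin x' y"
 by (simp add: oL_add_right nft_add[OF \<tau>] tin_M)

lemma tin_diff_left: "x : M ==> x' : M ==> y : M ==> tin (x - x') y = tin x y - tin x' y"
 by (simp add: oL_diff_right nft_diff[OF M \<tau>] tin_M)

lemma tin_cscale_left: "x : M ==> y : M ==> tin (cscale c x) y = c * tin x y"
 by (simp add: oL_cscale_right MBH nft_cscale[OF \<tau>] tin_M)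

lemma tin_diff_right: "x : M ==> y : M ==> y' : M ==> tin x (y - y') = tin x y - tin x y'"
 by (simp add: adj_diff MBH oL_diff_left nft_diff[OF M \<tau>] tin_M)

lemma tin_cscale_right: "x : M ==> y : M ==> tin x (cscale c y) = cnj c * tin x y"
 by (simp add: adj_cscale MBH oL_cscale_left nft_cscale[OF \<tau>] tin_M)

lemma tin_sum_left: "y : M ==> (!!i. i : I ==> f i : M) ==> tin (sum f I) y = (\<Sum>i\<in>I. tin (f i) y)"
 by (induction I rule: infinite_finite_induct)
  (auto simp: nft_zero[OF M \<tau>] oL_add_right nft_add[OF \<tau>] tin_M vn_sum[OF M])

lemma tin_commute: "x : M ==> y : M ==> tin x y = cnj (tin y x)"
 using nft_adj[OF M \<tau> tin_M[of y x]] by (simp add: adj_compose MBH)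

lemma tin_self: "x : M ==> tin x x = of_real ((tnorm \<tau> x)^2)"
 using nft_pos[OF \<tau>, of x] by (simp add: complex_eq_iff tnorm_def)

lemma tnorm_nonneg [simp]: "x : M ==> 0 <= tnorm \<tau> x"
 using nft_pos[OF \<tau>, of x] by (simp add: tnorm_def)

lemma tnorm_sq: "x : M ==> (tnorm \<tau> x)^2 = Re (tin x x)"
 using nft_pos[OF \<tau>, of x] by (simp add: tnorm_def)

lemma tnorm_eq_0: "x : M ==> tnorm \<tau> x = 0 ==> x = 0"
 using nft_faithful[OF \<tau>, of x] tin_self[of x] by simp

definition orthonormal :: "'h op set => bool" where
 "orthonormal S \<longleftrightarrow> S <= M & (ALL a:S. ALL b:S. tin a b = (if a = b then 1 else 0))"

text \<open>For an orthonormal set, the orthogonal projection onto its complex span with respect to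
  the trace inner product.\<close>

definition expand :: "'h op set => 'h op => 'h op" where
 "expand S x = (\<Sum>c\<in>S. cscale (tin x c) c)"

lemma expand_in_M: "orthonormal S ==> expand S x : M"
 unfolding expand_def orthonormal_def by (intro vn_sum[OF M] vn_cscale[OF M]) auto

lemma tin_expand:
 assumes S: "orthonormal S" "finite S" and c: "c : S" and x: "x : M"
 shows "tin (expand S x) c = tin x c"
proof -
 have SM: "b : M" if "b : S" for b using S that by (auto simp: orthonormal_def)
 have "tin (expand S x) c = (\<Sum>b\<in>S. tin x b * tin b c)"
  unfolding expand_def using SM c
  by (subst tin_sum_left) (auto simp: tin_cscale_left vn_cscale[OF M])
 also have "... = (\<Sum>b\<in>S. if b = c then tin x c else 0)"
  using S(1) c by (intro sum.cong) (auto simp: orthonormal_def)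
 finally show ?thesis using S(2) c by simp
qed

lemma tin_expand_left:
 assumes S: "orthonormal S" and x: "x : M" and y: "y : M"
 shows "tin (expand S x) y = (\<Sum>c\<in>S. tin x c * cnj (tin y c))"
proof -
 have SM: "b : M" if "b : S" for b using S that by (auto simp: orthonormal_def)
 have "tin (expand S x) y = (\<Sum>b\<in>S. tin x b * tin b y)"
  unfolding expand_def using SM y
  by (subst tin_sum_left) (auto simp: tin_cscale_left vn_cscale[OF M])
 also have "... = (\<Sum>c\<in>S. tin x c * cnj (tin y c))"
  by (rule sum.cong) (simp_all flip: tin_commute[OF SM y])
 finally show ?thesis .
qed

lemma tin_residual:
 assumes S: "orthonormal S" "finite S" and x: "x : M"
 shows "tin (x - expand S x) (x - expand S x) = tin x x - (\<Sum>c\<in>S. tin x c * cnj (tin x c))"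
proof -
 note eM = expand_in_M[OF S(1), of x]
 have o: "tin (x - expand S x) (expand S x) = 0"
 proof -
  have "tin (expand S x) (x - expand S x) = (\<Sum>c\<in>S. tin x c * cnj (tin (x - expand S x) c))"
   by (rule tin_expand_left[OF S(1) x vn_diff[OF M x eM]])
  also have "... = 0"
  proof (rule sum.neutral, rule ballI)
   fix c assume c: "c : S"
   hence "c : M" using S(1) by (auto simp: orthonormal_def)
   thus "tin x c * cnj (tin (x - expand S x) c) = 0"
    using tin_expand[OF S c x] by (simp add: tin_diff_left x eM)
  qed
  finally have "tin (expand S x) (x - expand S x) = 0" .
  thus ?thesis by (subst tin_commute[OF vn_diff[OF M x eM] eM]) simp
 qed
 have dM: "x - expand S x : M" by (rule vn_diff[OF M x eM])
 have "tin (x - expand S x) (x - expand S x) = tin (x - expand S x) x - tin (x - expand S x) (expand S x)"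
  by (rule tin_diff_right[OF dM x eM])
 thus ?thesis using o tin_expand_left[OF S(1) x x] tin_diff_left[OF x eM x] by simp
qed

lemma bessel:
 assumes S: "orthonormal S" "finite S" and x: "x : M"
 shows "(\<Sum>c\<in>S. (cmod (tin x c))^2) <= (tnorm \<tau> x)^2"
proof -
 have "0 <= Re (tin (x - expand S x) (x - expand S x))"
  using nft_pos(2)[OF \<tau> vn_diff[OF M x expand_in_M[OF S(1)]]] .
 also have "... = (tnorm \<tau> x)^2 - (\<Sum>c\<in>S. (cmod (tin x c))^2)"
  unfolding tin_residual[OF S x] by (simp add: tnorm_sq x complex_mult_cnj cmod_power2)
 finally show ?thesis by simp
qed

lemma tin_cauchy_schwarz:
 assumes x: "x : M" and y: "y : M"
 shows "cmod (tin x y) <= tnorm \<tau> x * tnorm \<tau> y"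
proof (cases "tnorm \<tau> y = 0")
 case True
 hence "y = 0" by (rule tnorm_eq_0[OF y])
 thus ?thesis using True by (simp add: nft_zero[OF M \<tau>])
next
 case False
 define c where "c = inverse (tnorm \<tau> y) *R y"
 have cM: "c : M" unfolding c_def by (rule vn_scaleR[OF M y])
 have tc: "tin z c = of_real (inverse (tnorm \<tau> y)) * tin z y" if "z : M" for z
  using that y by (simp add: c_def adj_scaleR MBH oL_scaleR_left nft_scaleR[OF M \<tau>] tin_M)
 have "tin c c = 1"
 proof -
  have "tin c y = inverse (of_real (tnorm \<tau> y)) * tin y y"
   using y by (simp add: c_def oL_scaleR_right nft_scaleR[OF M \<tau>] tin_M)
  thus ?thesis using False tin_self[OF y] tc[OF cM] by (simp add: power2_eq_square field_simps)
 qed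
 hence S: "orthonormal {c}" using cM by (simp add: orthonormal_def)
 have "(cmod (tin x c))^2 <= (tnorm \<tau> x)^2" using bessel[OF S _ x] by simp
 hence "cmod (tin x c) <= tnorm \<tau> x" by (rule power2_le_imp_le) (simp add: x)
 thus ?thesis using False tnorm_nonneg[OF y] by (simp add: tc[OF x] norm_divide field_simps)
qed

lemma expand_insert_fix:
 assumes S: "orthonormal S" "finite S" and x: "x : M" "expand S x = x"
  and S': "orthonormal (insert c S)" "c ~: S"
 shows "expand (insert c S) x = x"
proof -
 have cM: "c : M" using S' by (simp add: orthonormal_def)
 have "tin x c = (\<Sum>b\<in>S. tin x b * cnj (tin c b))"
  using tin_expand_left[OF S(1) x(1) cM] x(2) by simp
 also have "... = 0" using S' by (intro sum.neutral) (auto simp: orthonormal_def)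
 finally have "tin x c = 0" .
 thus ?thesis using S(2) S'(2) x(2) by (simp add: expand_def)
qed

text \<open>Infinite dimension provides a further orthonormal vector at every stage: the normalised
  residual of \<open>v\<close>, or that of another element of \<open>X\<close> when \<open>v\<close>
  lies in the span already.\<close>

lemma gram_schmidt_step:
 assumes X: "subspace X" "!!c x. x : X ==> cscale c x : X" "X <= M" "~ fin_dim X" and v: "v : X"
  and S: "orthonormal S" "finite S" "S <= X"
 shows "EX c:X. c ~: S & orthonormal (insert c S) & expand (insert c S) v = v"
proof -
 have SM: "b : M" if "b : S" for b using S that by (auto simp: orthonormal_def)
 have eX: "expand S x : X" for x unfolding expand_def using X S by (intro subspace_sum) auto
 have "EX z:X. z - expand S z ~= 0"
 proof (rule ccontr)
  assume "~ ?thesis"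
  hence ex: "z = expand S z" if "z : X" for z using that by auto
  have "z : span (S Un cscale \<i> ` S)" if "z : X" for z
  proof -
   have "cscale d c : span (S Un cscale \<i> ` S)" if "c : S" for d c
   proof -
    have "cscale d c = Re d *R c + Im d *R cscale \<i> c"
     by (rule blinfun_eqI) (simp add: cscale_apply blinfun.add_left blinfun.scaleR_left scaleC_Complex[of d])
    moreover have "c : span (S Un cscale \<i> ` S)" "cscale \<i> c : span (S Un cscale \<i> ` S)"
     using that by (auto intro: span_base)
    ultimately show ?thesis by (auto intro: span_add span_scale)
   qed
   hence "expand S z : span (S Un cscale \<i> ` S)" unfolding expand_def by (intro span_sum) auto
   thus ?thesis using ex[OF that] by simp
  qed
  hence "fin_dim X" unfolding fin_dim_def using S(2) by (intro exI[of _ "S Un cscale \<i> ` S"]) auto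
  thus False using X by blast
 qed
 then obtain z where z: "z : X" "z - expand S z ~= 0" "v - expand S v = 0 | z = v"
  using v by (cases "v - expand S v = 0") auto
 define r where "r = z - expand S z"
 have zM: "z : M" and eM: "expand S z : M" using z(1) X(3) expand_in_M[OF S(1)] by auto
 have rM: "r : M" and rX: "r : X" unfolding r_def using zM eM X(1) z(1) eX
  by (auto intro: vn_diff[OF M] subspace_diff)
 have n: "tnorm \<tau> r > 0" using tnorm_nonneg[OF rM] tnorm_eq_0[OF rM] z(2) by (fastforce simp: r_def)
 define c where "c = cscale (of_real (inverse (tnorm \<tau> r))) r"
 have cM: "c : M" unfolding c_def by (rule vn_cscale[OF M rM])
 have tr: "tin r b = 0" if "b : S" for b
  unfolding r_def using tin_expand[OF S(1,2) that zM] SM[OF that] by (simp add: tin_diff_left zM eM)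
 have cb: "tin c b = 0" "tin b c = 0" if "b : S" for b
 proof -
  show 1: "tin c b = 0" using tr[OF that] SM[OF that] by (simp add: c_def tin_cscale_left rM)
  show "tin b c = 0" using tin_commute[OF SM[OF that] cM] 1 by simp
 qed
 have rc: "tin r c = of_real (tnorm \<tau> r)"
  using tin_self[OF rM] n by (simp add: c_def tin_cscale_right rM power2_eq_square)
 have cc: "tin c c = 1" using rc n tin_cscale_left[OF rM cM, of "of_real (inverse (tnorm \<tau> r))", folded c_def]
  by simp
 have cS: "c ~: S" using cb cc by auto
 have on: "orthonormal (insert c S)"
  using S(1) cM cb cc unfolding orthonormal_def by auto
 have "expand (insert c S) v = v"
 proof (cases "v - expand S v = 0")
  case True
  thus ?thesis using v X(3) by (intro expand_insert_fix[OF S(1,2) _ _ on cS]) auto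
 next
  case False
  hence "z = v" using z(3) by simp
  have "tin v c = tin r c"
  proof -
   have "tin (expand S v) c = (\<Sum>b\<in>S. tin v b * cnj (tin c b))"
    by (rule tin_expand_left[OF S(1) _ cM]) (use v X in auto)
   also have "... = 0" by (rule sum.neutral) (simp add: cb)
   finally show ?thesis
    using \<open>z = v\<close> zM eM cM by (simp add: r_def tin_diff_left)
  qed
  hence "cscale (tin v c) c = r" using rc n by (simp add: c_def cscale_cscale)
  thus ?thesis using cS S(2) \<open>z = v\<close> by (simp add: expand_def r_def)
 qed
 thus ?thesis using cS on rX X(2) unfolding c_def by blast
qed

text \<open>The GNS space is realised on \<open>\<ell>^2\<close>: \<open>\<iota> x\<close> is the sequence of coordinates
 of \<open>x\<close> with respect to an orthonormal sequence.\<close>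

lemma ex_gns_embedding:
 assumes G: "countable G" "G <= M" "!!c x. x : span G ==> cscale c x : span G" "~ fin_dim (span G)"
 shows "EX \<iota> :: 'h op => ell2.
  (ALL x:M. ALL y:M. \<iota> (x + y) = \<iota> x + \<iota> y) & (ALL c. ALL x:M. \<iota> (cscale c x) = c *C \<iota> x) &
  (ALL x:M. ALL y:M. (ALL \<epsilon>>0. EX z:span G. tnorm \<tau> (x - z) < \<epsilon>) --> cinner (\<iota> x) (\<iota> y) = tin x y) &
  closure (\<iota> ` span G) = UNIV"
proof -
 define X where "X = span G"
 have XM: "X <= M"
  unfolding X_def by (rule span_minimal[OF G(2)]) (auto simp: subspace_def intro: vn_intros[OF M])
 have X: "subspace X" "!!c x. x : X ==> cscale c x : X" "X <= M" "~ fin_dim X"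
  using XM G unfolding X_def by auto
 have "G ~= {}" using G(4) by (auto simp: fin_dim_def)
 then obtain v :: "nat => 'h op" where v: "range v = G" using G(1) by (metis range_from_nat_into)
 have vX: "v n : X" for n using v unfolding X_def by (auto intro: span_base)
 define P where "P S \<longleftrightarrow> orthonormal S & finite S & S <= X" for S
 define Q where "Q n S S' \<longleftrightarrow> (EX c. c ~: S & S' = insert c S & expand S' (v n) = v n)" for n S S'
 \<comment> \<open>Every stage adds exactly one vector, even when \<open>v n\<close> is in the span
   already. The orthonormal sequence \<open>c\<close> is therefore infinite, and its coordinates
   fill \<open>ell2\<close>.\<close>
 have "EX S. S 0 = {} & (ALL n. P (S n) & Q n (S n) (S (Suc n)))"
 proof -
  have 1: "EX S. (S = {} | (0::nat) ~= 0) & P S" by (auto simp: P_def orthonormal_def)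
  have 2: "EX S'. ((S' = {} | Suc n ~= 0) & P S') & Q n S S'" if "(S = {} | n ~= 0) & P S" for S n
  proof -
   have P: "orthonormal S" "finite S" "S <= X" using that by (auto simp: P_def)
   thus ?thesis using gram_schmidt_step[OF X vX[of n] P] by (auto simp: P_def Q_def)
  qed
  from dependent_nat_choice[of "%n S. (S = {} | n ~= 0) & P S" Q, OF 1 2, simplified]
  obtain f where "ALL n. ((f n = {} | n ~= 0) & P (f n)) & Q n (f n) (f (Suc n))" by auto
  thus ?thesis by (intro exI[of _ f]) (metis less_irrefl)
 qed
 then obtain S where S: "S 0 = {}" "!!n. P (S n)" "!!n. Q n (S n) (S (Suc n))" by blast
 then obtain c where c: "!!n. c n ~: S n" "!!n. S (Suc n) = insert (c n) (S n)"
  "!!n. expand (S (Suc n)) (v n) = v n" unfolding Q_def by metis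
 have SP: "orthonormal (S n)" "finite (S n)" "S n <= X" for n using S(2) by (auto simp: P_def)
 have Sc: "S n = c ` {..<n}" for n by (induction n) (auto simp: S(1) c(2) lessThan_Suc)
 have cS: "c m : S n" if "m < n" for m n using that by (simp add: Sc)
 have inj: "inj c"
 proof (rule injI)
  fix m n assume e: "c m = c n"
  show "m = n"
  proof (rule ccontr)
   assume "m ~= n"
   hence "m < n | n < m" by auto
   thus False using c(1)[of m] c(1)[of n] cS e by metis
  qed
 qed
 have cM: "c n : M" and cX: "c n : X" for n using SP(3)[of "Suc n"] XM cS[of n "Suc n"] by auto
 have cc: "tin (c m) (c n) = (if m = n then 1 else 0)" for m n
  using SP(1)[of "Suc (max m n)"] cS[of m "Suc (max m n)"] cS[of n "Suc (max m n)"] inj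
  unfolding orthonormal_def by (auto dest: injD)
 have sumS: "(\<Sum>b\<in>S n. f b) = (\<Sum>k<n. f (c k))" for f :: "'h op => 'z :: comm_monoid_add" and n
  unfolding Sc by (rule sum.reindex_cong[of c]) (use inj in "auto intro: inj_on_subset")
 have fixSuc: "expand (S (n + k)) x = x" if "x : M" "expand (S n) x = x" for n k x
 proof (induction k)
  case (Suc k)
  thus ?case
   using expand_insert_fix[OF SP(1,2) that(1) Suc, of "c (n + k)"] c(1,2) SP(1)[of "Suc (n + k)"] by simp
 qed (use that in simp)
 have fixX: "EX n. expand (S n) x = x" if "x : X" for x
 proof -
  have lin: "expand (S n) (x + y) = expand (S n) x + expand (S n) y"
   "expand (S n) (r *R x) = r *R expand (S n) x" if "x : M" "y : M" for n x y r
  proof -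
   have SM: "b : M" if "b : S n" for b using that SP(3) XM by blast
   show "expand (S n) (x + y) = expand (S n) x + expand (S n) y"
    using that SM by (simp add: expand_def tin_add_left cscale_add_left sum.distrib)
   show "expand (S n) (r *R x) = r *R expand (S n) x"
    unfolding expand_def scaleR_sum_right
   proof (rule sum.cong)
    fix b assume "b : S n"
    hence "tin (r *R x) b = of_real r * tin x b"
     using that SM by (simp add: oL_scaleR_right nft_scaleR[OF M \<tau>] tin_M)
    thus "cscale (tin (r *R x) b) b = r *R cscale (tin x b) b"
     by (metis cscale_cscale cscale_of_real)
   qed simp
  qed
  have "span G <= {x : M. EX n. expand (S n) x = x}"
  proof (rule span_minimal)
   show "G <= {x : M. EX n. expand (S n) x = x}" using c(3) v G(2) by blast
   show "subspace {x : M. EX n. expand (S n) x = x}"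
    unfolding subspace_def
   proof (intro conjI ballI allI)
    show "0 : {x : M. EX n. expand (S n) x = x}"
     by (auto simp: vn_zero[OF M] expand_def nft_zero[OF M \<tau>])
    fix x assume x: "x : {x : M. EX n. expand (S n) x = x}"
    thus "r *R x : {x : M. EX n. expand (S n) x = x}" for r
     using lin(2) vn_scaleR[OF M] by (smt (verit, best) mem_Collect_eq)
    fix y assume y: "y : {x : M. EX n. expand (S n) x = x}"
    obtain m n where mn: "expand (S m) x = x" "expand (S n) y = y" using x y by blast
    have "expand (S (m + n)) x = x" "expand (S (m + n)) y = y"
     using fixSuc[of x m n] fixSuc[of y n m] mn x y by (auto simp: add.commute)
    hence "expand (S (m + n)) (x + y) = x + y" using lin(1) x y by simp
    thus "x + y : {x : M. EX n. expand (S n) x = x}" using x y vn_add[OF M] by blast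
   qed
  qed
  thus ?thesis using that unfolding X_def by blast
 qed
 define \<iota> where "\<iota> x = Abs_ell2 (%n. tin x (c n))" for x
 have bess: "(\<Sum>k<n. (cmod (tin x (c k)))^2) <= (tnorm \<tau> x)^2" if "x : M" for x n
  using bessel[OF SP(1,2) that, of n] by (simp add: sumS)
 have summ: "summable (%n. (cmod (tin x (c n)))^2)" if "x : M" for x
  by (rule bounded_imp_summable[where B = "(tnorm \<tau> x)^2"])
   (use bess[OF that, of "Suc _"] in "simp_all only: lessThan_Suc_atMost zero_le_power2")
 have co: "coord (\<iota> x) n = tin x (c n)" if "x : M" for x n
  unfolding \<iota>_def using Abs_ell2_inverse[of "%n. tin x (c n)"] summ[OF that] by simp
 have add: "\<iota> (x + y) = \<iota> x + \<iota> y" if "x : M" "y : M" for x y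
  by (rule ell2_eqI) (simp add: co that vn_add[OF M] tin_add_left cM)
 have scal: "\<iota> (cscale a x) = a *C \<iota> x" if "x : M" for x a
  by (rule ell2_eqI) (simp add: co that vn_cscale[OF M] tin_cscale_left cM)
 have nrm: "norm (\<iota> x) <= tnorm \<tau> x" if "x : M" for x
 proof (rule power2_le_imp_le)
  show "(norm (\<iota> x))^2 <= (tnorm \<tau> x)^2"
   unfolding norm_ell2_sq co[OF that] by (rule suminf_le_const[OF summ[OF that] bess[OF that]])
 qed (use that in simp)
 \<comment> \<open>Elements of \<open>span G\<close> have only finitely many nonzero coordinates, so
   the inner product is a finite sum.\<close>
 have isoX: "cinner (\<iota> x) (\<iota> y) = tin x y" if x: "x : X" and y: "y : M" for x y
 proof -
  have xM: "x : M" using x XM by blast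
  obtain n where n: "expand (S n) x = x" using fixX[OF x] by blast
  have zero: "tin x (c k) = 0" if "k ~: {..<n}" for k
  proof -
   have "tin x (c k) = (\<Sum>b\<in>S n. tin x b * cnj (tin (c k) b))"
    using tin_expand_left[OF SP(1)[of n] xM cM[of k]] unfolding n by simp
   also have "... = (\<Sum>j<n. tin x (c j) * cnj (tin (c k) (c j)))" by (rule sumS)
   also have "... = 0" using that by (intro sum.neutral) (auto simp: cc)
   finally show ?thesis .
  qed
  have "cinner (\<iota> x) (\<iota> y) = (\<Sum>k. tin x (c k) * cnj (tin y (c k)))"
   by (simp add: cinner_ell2_def co xM y)
  also have "... = (\<Sum>k<n. tin x (c k) * cnj (tin y (c k)))"
   by (rule suminf_finite) (use zero in auto)
  also have "... = tin (expand (S n) x) y" using tin_expand_left[OF SP(1) xM y, of n] by (simp add: sumS)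
  finally show ?thesis using n by simp
 qed
 \<comment> \<open>Off \<open>span G\<close> the map \<open>\<iota>\<close> is at first only a
   contraction; elements approximated by \<open>span G\<close> in trace norm inherit the isometry by
   continuity.\<close>
 have iso: "cinner (\<iota> x) (\<iota> y) = tin x y"
  if x: "x : M" and y: "y : M" and ap: "ALL \<epsilon>>0. EX z:span G. tnorm \<tau> (x - z) < \<epsilon>" for x y
 proof -
  have "cmod (cinner (\<iota> x) (\<iota> y) - tin x y) <= \<epsilon>" if e: "\<epsilon> > 0" for \<epsilon>
  proof -
   define d where "d = \<epsilon> / (2 * tnorm \<tau> y + 1)"
   have ty: "0 <= tnorm \<tau> y" using y by simp
   have d: "d > 0" using e ty by (simp add: d_def)
   obtain z where z: "z : X" "tnorm \<tau> (x - z) < d" using ap d X_def by blast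
   have zM: "z : M" using z XM by blast
   have xz: "x - z : M" by (rule vn_diff[OF M x zM])
   have "\<iota> (x - z) + \<iota> z = \<iota> x" using add[OF xz zM] by simp
   hence "cinner (\<iota> x) (\<iota> y) - tin x y = cinner (\<iota> (x - z)) (\<iota> y) - tin (x - z) y"
    using isoX[OF z(1) y] tin_diff_left[OF x zM y] by (metis add_diff_cancel_right cinner_add_left diff_add_cancel add_diff_cancel_right')
   also have "cmod ... <= cmod (cinner (\<iota> (x - z)) (\<iota> y)) + cmod (tin (x - z) y)" by (rule norm_triangle_ineq4)
   also have "cmod (cinner (\<iota> (x - z)) (\<iota> y)) <= tnorm \<tau> (x - z) * tnorm \<tau> y"
    using cmod_cinner_le[of "\<iota> (x - z)" "\<iota> y"] mult_mono[OF nrm[OF xz] nrm[OF y]] xz by simp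
   also have "cmod (tin (x - z) y) <= tnorm \<tau> (x - z) * tnorm \<tau> y" by (rule tin_cauchy_schwarz[OF xz y])
   finally have "cmod (cinner (\<iota> x) (\<iota> y) - tin x y) <= tnorm \<tau> (x - z) * (2 * tnorm \<tau> y)"
    by (simp add: mult.commute mult.left_commute)
   also have "... <= d * (2 * tnorm \<tau> y)" using z(2) ty by (intro mult_right_mono) auto
   also have "... <= \<epsilon>" using e ty by (simp add: d_def field_simps)
   finally show ?thesis .
  qed
  hence "cmod (cinner (\<iota> x) (\<iota> y) - tin x y) <= 0" by (metis field_le_epsilon add_0)
  thus ?thesis by simp
 qed
 have "closure (\<iota> ` X) = UNIV"
 proof (rule closure_eq_UNIV_if_orthogonal)
  show "csubspace (\<iota> ` X)"
  proof (rule csubspaceI)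
   show "0 : \<iota> ` X"
    using scal[of 0 0] X(1) by (intro image_eqI[of _ _ 0]) (auto simp: vn_zero[OF M] subspace_0)
   show "a + b : \<iota> ` X" if ab: "a : \<iota> ` X" "b : \<iota> ` X" for a b
   proof -
    obtain x y where "a = \<iota> x" "b = \<iota> y" "x : X" "y : X" using ab by blast
    moreover from this have "\<iota> (x + y) = \<iota> x + \<iota> y" using XM by (intro add) auto
    ultimately show ?thesis using subspace_add[OF X(1)] by (intro image_eqI[of _ _ "x + y"]) simp_all
   qed
   show "d *C a : \<iota> ` X" if a: "a : \<iota> ` X" for d a
   proof -
    obtain x where "a = \<iota> x" "x : X" using a by blast
    moreover from this have "\<iota> (cscale d x) = d *C \<iota> x" using XM by (intro scal) auto
    ultimately show ?thesis using X(2) by (intro image_eqI[of _ _ "cscale d x"]) simp_all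
   qed
  qed
  fix z assume z: "!!v. v : \<iota> ` X ==> cinner z v = 0"
  show "z = 0"
  proof (rule ell2_eqI)
   fix n
   have "cinner z (\<iota> (c n)) = (\<Sum>k. coord z k * cnj (tin (c n) (c k)))"
    by (simp add: cinner_ell2_def co cM)
   also have "... = (\<Sum>k\<in>{n}. coord z k * cnj (tin (c n) (c k)))"
    by (rule suminf_finite) (auto simp: cc)
   finally show "coord z n = coord 0 n" using z cX by (simp add: cc)
  qed
 qed
 thus ?thesis using add scal iso unfolding X_def by (intro exI[of _ \<iota>]) blast
qed

end

section \<open>The GNS representation of a subalgebra, and maps from it to the given space\<close>

lemma scaleC_dense:
 fixes T :: "'a :: chilbert_space \<Rightarrow>\<^sub>L 'b :: chilbert_space"
 assumes "!!x. x : D ==> T (c *C x) = c *C T x" "closure D = UNIV"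
 shows "T (c *C x) = c *C T x"
 by (rule eq_on_dense[OF continuous_on_compose2[OF cont_blinfun cont_scaleC subset_UNIV]
    continuous_on_compose2[OF cont_scaleC cont_blinfun subset_UNIV] _ assms(2)]) (rule assms(1))

lemma BH_dense: "(!!c x. x : D ==> blinfun_apply T (c *C x) = c *C T x) ==> closure D = UNIV ==> T : BH"
 unfolding BH_def by (blast intro: scaleC_dense)

lemma cinner_eq_dense:
 fixes S T :: "'a :: chilbert_space op"
 assumes "!!x y. x : D ==> y : D ==> cinner (S x) y = cinner x (T y)" and D: "closure D = UNIV"
 shows "cinner (S x) y = cinner x (T y)"
proof -
 have 1: "cinner (S x) y = cinner x (T y)" if "x : D" for x y
  by (rule eq_on_dense[OF _ _ _ D, of _ "%y. cinner x (T y)"]) (use assms(1) that in "auto intro!: continuous_intros cont_blinfun")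
 show ?thesis
  by (rule eq_on_dense[OF _ _ _ D, of "%x. cinner (S x) y"]) (use 1 in "auto intro!: continuous_intros cont_blinfun")
qed

context tracial
begin

lemma tnorm_compose_left: "x : M ==> y : M ==> tnorm \<tau> (x ** y) <= norm x * tnorm \<tau> y"
proof (rule power2_le_imp_le)
 assume x: "x : M" and y: "y : M"
 have xB: "x : BH" and yB: "y : BH" using x y MBH by auto
 define k where "k = (norm x)^2 *R Id - (adj x ** x)"
 have kP: "positive_op k" unfolding k_def op_le_def[symmetric]
 proof (rule op_leI)
  fix v
  have "(norm (x v))^2 <= (norm x * norm v)^2" by (intro power_mono norm_blinfun) simp
  thus "Re (cinner ((adj x ** x) v) v) <= Re (cinner (((norm x)^2 *R Id) v) v)"
   by (simp add: cinner_adj_left xB blinfun.scaleR_left Re_cinner_self power_mult_distrib)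
 qed (use xB in "auto simp: adj_simps BH_intros")
 have kM: "k : M" unfolding k_def by (intro vn_intros M x)
 have "0 <= Re (\<tau> (adj y ** (k ** y)))"
  by (rule nft_positive(2)[OF M \<tau> _ positive_conj[OF kP yB]]) (intro vn_intros M y kM)
 also have "adj y ** (k ** y) = (norm x)^2 *R (adj y ** y) - (adj (x ** y) ** (x ** y))"
  by (simp add: k_def oL_simps adj_compose xB yB)
 finally show "(tnorm \<tau> (x ** y))^2 <= (norm x * tnorm \<tau> y)^2"
  using vn_compose[OF M x y] y
  by (simp add: tnorm_sq power_mult_distrib nft_diff[OF M \<tau>] nft_scaleR[OF M \<tau>] tin_M vn_scaleR[OF M])
qed simp

lemma tnorm_adj: "x : M ==> tnorm \<tau> (adj x) = tnorm \<tau> x"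
 unfolding tnorm_def using nft_comm[OF \<tau>, of x "adj x"] vn_adj[OF M] by (simp add: MBH)

lemma tnorm_compose_right: "x : M ==> y : M ==> tnorm \<tau> (y ** x) <= norm x * tnorm \<tau> y"
 using tnorm_compose_left[of "adj x" "adj y"] tnorm_adj[of "y ** x"] tnorm_adj[of y]
  vn_adj[OF M] vn_compose[OF M] by (simp add: adj_compose MBH norm_adj)

end

text \<open>\<open>C\<close> is a subalgebra and not yet \<open>M\<close>: isometry of
  \<open>\<iota>\<close> is known at first only on countably generated algebras, and the density
  that extends it to \<open>M\<close> is proved with these.\<close>

locale gns = tracial M \<tau> for M :: "'h :: chilbert_space op set" and \<tau> +
 fixes C :: "'h op set" and \<iota> :: "'h op => 'k :: chilbert_space"
 assumes C: "star_subalgebra C" and CM: "C <= M"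
  and iota_add: "x : C ==> y : C ==> \<iota> (x + y) = \<iota> x + \<iota> y"
  and iota_cscale: "x : C ==> \<iota> (cscale c x) = c *C \<iota> x"
  and iota_cinner: "x : C ==> y : C ==> cinner (\<iota> x) (\<iota> y) = \<tau> (adj y ** x)"
  and dense: "closure (\<iota> ` C) = UNIV"
begin

lemma C_id: "Id : C" and C_adj: "x : C ==> adj x : C" and C_add: "x : C ==> y : C ==> x + y : C"
 and C_compose: "x : C ==> y : C ==> x ** y : C" and C_cscale: "x : C ==> cscale c x : C"
 using C unfolding star_subalgebra_def by blast+

lemma C_scaleR: "x : C ==> r *R x : C"
 using C_cscale[of x "of_real r"] by (simp add: cscale_of_real)

lemma C_zero: "0 : C" using C_scaleR[OF C_id, of 0] by simp

lemma C_sum: "(!!i. i : I ==> f i : C) ==> sum f I : C"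
 by (induction I rule: infinite_finite_induct) (auto intro: C_zero C_add)

lemma CBH: "x : C ==> x : BH" using C unfolding star_subalgebra_def by blast

lemma C_inM: "x : C ==> x : M" using CM by blast

lemma iota_scaleR: "x : C ==> \<iota> (r *R x) = r *R \<iota> x"
 using iota_cscale[of x "of_real r"] by (simp add: cscale_of_real scaleC_of_real)

lemma iota_zero: "\<iota> 0 = 0" using iota_scaleR[OF C_zero, of 0] by simp

lemma iota_diff: "x : C ==> y : C ==> \<iota> (x - y) = \<iota> x - \<iota> y"
 using iota_add[of x "(-1) *R y"] iota_scaleR[of y "-1"] C_scaleR[of y "-1"] by simp

lemma iota_sum: "(!!i. i : I ==> f i : C) ==> \<iota> (sum f I) = (\<Sum>i\<in>I. \<iota> (f i))"
 by (induction I rule: infinite_finite_induct) (auto simp: iota_zero iota_add C_sum)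

lemma norm_iota: "x : C ==> norm (\<iota> x) = tnorm \<tau> x"
 using iota_cinner[of x x] tnorm_nonneg[OF C_inM]
 by (metis C_inM norm_ge_zero cinner_self of_real_eq_iff power2_eq_imp_eq tin_self)

lemma ex_ext:
 fixes \<kappa> :: "'h op => 'b :: banach"
 assumes add: "!!x y. x : C ==> y : C ==> \<kappa> (x + y) = \<kappa> x + \<kappa> y"
  and sc: "!!x r. x : C ==> \<kappa> (r *R x) = r *R \<kappa> x"
  and K: "0 <= K" and bd: "!!x. x : C ==> norm (\<kappa> x) <= K * tnorm \<tau> x"
 shows "EX T. ALL y:C. blinfun_apply T (\<iota> y) = \<kappa> y"
proof (rule ex_blinfun_on_image[OF _ iota_add iota_scaleR add sc K _ dense])
 show "subspace C" by (auto simp: subspace_def intro: C_zero C_add C_scaleR)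
 show "norm (\<kappa> x) <= K * norm (\<iota> x)" if "x : C" for x using bd[OF that] norm_iota[OF that] by simp
qed

definition \<pi> :: "'h op => 'k op" where
 "\<pi> x = (SOME T. ALL y:C. blinfun_apply T (\<iota> y) = \<iota> (x ** y))"

text \<open>Right multiplication, bounded because the trace gives \<open>x\<close> and
  \<open>adj x\<close> the same norm.\<close>

definition \<rho> :: "'h op => 'k op" where
 "\<rho> x = (SOME T. ALL y:C. blinfun_apply T (\<iota> y) = \<iota> (y ** x))"

lemma pi_iota: assumes x: "x : C" and y: "y : C" shows "\<pi> x (\<iota> y) = \<iota> (x ** y)"
proof -
 have "EX T. ALL y:C. blinfun_apply T (\<iota> y) = \<iota> (x ** y)"
  by (rule ex_ext[where K = "norm x"])
   (auto simp: oL_simps iota_add iota_scaleR C_compose x norm_iota tnorm_compose_left C_inM)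
 from someI_ex[OF this] show ?thesis using y unfolding \<pi>_def by blast
qed

lemma rho_iota: assumes x: "x : C" and y: "y : C" shows "\<rho> x (\<iota> y) = \<iota> (y ** x)"
proof -
 have "EX T. ALL y:C. blinfun_apply T (\<iota> y) = \<iota> (y ** x)"
  by (rule ex_ext[where K = "norm x"])
   (auto simp: oL_simps iota_add iota_scaleR C_compose x norm_iota tnorm_compose_right C_inM)
 from someI_ex[OF this] show ?thesis using y unfolding \<rho>_def by blast
qed

lemma eq_on_iota: "(!!y. y : C ==> blinfun_apply S (\<iota> y) = blinfun_apply T (\<iota> y)) ==> S = T"
 by (rule blinfun_eq_on_dense[OF _ dense]) auto

lemma pi_BH: "x : C ==> \<pi> x : BH"
 by (rule BH_dense[OF _ dense])
  (auto simp: pi_iota iota_cscale[symmetric] C_cscale C_compose oL_cscale_right CBH)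

lemma rho_BH: "x : C ==> \<rho> x : BH"
 by (rule BH_dense[OF _ dense])
  (auto simp: rho_iota iota_cscale[symmetric] C_cscale C_compose oL_cscale_left CBH)

lemma pi_compose: "x : C ==> y : C ==> \<pi> (x ** y) = \<pi> x ** \<pi> y"
 by (rule eq_on_iota) (simp add: pi_iota C_compose oL_assoc)

lemma pi_add: "x : C ==> y : C ==> \<pi> (x + y) = \<pi> x + \<pi> y"
 by (rule eq_on_iota) (simp add: pi_iota C_compose C_add oL_add_left blinfun.add_left iota_add)

lemma pi_diff: "x : C ==> y : C ==> \<pi> (x - y) = \<pi> x - \<pi> y"
 using pi_add[of "x + (-1) *R y" y] C_add[OF _ C_scaleR[of y "-1"], of x] by simp

lemma pi_cscale: "x : C ==> \<pi> (cscale c x) = cscale c (\<pi> x)"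
 by (rule eq_on_iota) (simp add: pi_iota C_compose C_cscale oL_cscale_left cscale_apply iota_cscale)

lemma pi_id: "\<pi> Id = Id"
 by (rule eq_on_iota) (simp add: pi_iota C_id)

lemma pi_adj: "x : C ==> \<pi> (adj x) = adj (\<pi> x)"
proof (rule sym, rule adj_eqI)
 fix u v assume x: "x : C"
 show "cinner (\<pi> x u) v = cinner u (\<pi> (adj x) v)"
  by (rule cinner_eq_dense[OF _ dense])
   (auto simp: pi_iota x C_adj iota_cinner C_compose adj_compose CBH oL_assoc)
qed

lemma rho_adj: "x : C ==> \<rho> (adj x) = adj (\<rho> x)"
proof (rule sym, rule adj_eqI)
 fix u v assume x: "x : C"
 show "cinner (\<rho> x u) v = cinner u (\<rho> (adj x) v)"
 proof (rule cinner_eq_dense[OF _ dense])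
  fix a b assume "a : \<iota> ` C" "b : \<iota> ` C"
  then obtain y z where yz: "a = \<iota> y" "b = \<iota> z" "y : C" "z : C" by blast
  have "\<tau> ((adj z ** y) ** x) = \<tau> (x ** (adj z ** y))"
   by (rule nft_comm[OF \<tau>]) (use yz x in "auto intro!: C_inM C_compose C_adj")
  thus "cinner (\<rho> x a) b = cinner a (\<rho> (adj x) b)"
   using yz x by (simp add: rho_iota C_adj iota_cinner C_compose adj_compose CBH oL_assoc)
 qed
qed

lemma pi_eq_0: "x : C ==> \<pi> x = 0 ==> x = 0"
 using pi_iota[OF _ C_id, of x] norm_iota[of x] tnorm_eq_0[OF C_inM] by simp

lemma pi_inject: "x : C ==> y : C ==> \<pi> x = \<pi> y ==> x = y"
 using pi_eq_0[of "x - y"] pi_diff[of x y] C_add[OF _ C_scaleR[of y "-1"], of x] by simp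

lemma pi_vector_state: "x : C ==> cinner (\<pi> x (\<iota> Id)) (\<iota> Id) = \<tau> x"
 by (simp add: pi_iota C_id iota_cinner)

end

text \<open>Projections \<open>q\<close> for which the trace and the state of some vector bound each
  other on the elements \<open>y ** q\<close>. Such a vector gives a bounded map from the GNS space
  to the given space.\<close>

definition bounded_corners :: "'h :: chilbert_space op set => ('h op => complex) => 'h op set" where
 "bounded_corners M \<tau> = {q : M. is_proj q & (EX \<xi> K. ALL y:M.
  (tnorm \<tau> (y ** q))^2 <= (norm (y (q \<xi>)))^2 & (norm (y (q \<xi>)))^2 <= K * (tnorm \<tau> (y ** q))^2)}"

context tracial
begin

text \<open>Two Hahn decompositions: the first produces \<open>e\<close> below \<open>p\<close>
  where the trace is at most the vector state, the second \<open>f\<close> below \<open>e\<close>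
  where the vector state is at most \<open>K\<close> times the trace.\<close>

lemma ex_bounded_corner:
 assumes p: "p : M" "is_proj p" "p ~= 0"
 shows "EX q:bounded_corners M \<tau>. q ~= 0 & p ** q = q"
proof -
 note nt = nft_normal_pos[OF M \<tau>]
 obtain \<eta>0 where e0: "p \<eta>0 ~= 0" using p(3) by (metis blinfun_eqI zero_blinfun.rep_eq)
 \<comment> \<open>Scaled so that the vector state exceeds the trace by 1 at \<open>p\<close>; this
   makes \<open>e\<close> nonzero.\<close>
 define r where "r = sqrt (Re (\<tau> p) + 1) / norm (p \<eta>0)"
 define \<eta> where "\<eta> = r *R \<eta>0"
 define \<omega> where "\<omega> x = Re (cinner (blinfun_apply x \<eta>) \<eta>)" for x
 have n\<omega>: "normal_pos M \<omega>" unfolding \<omega>_def by (rule normal_pos_vector_state[OF M])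
 have tp0: "0 <= Re (\<tau> p)" by (rule nft_proj_nonneg[OF M \<tau> p(1,2)])
 have \<omega>q: "\<omega> (adj (y ** q) ** (y ** q)) = (norm (y (q \<eta>)))^2" if "y : M" "q : M" for y q
  using that by (simp add: \<omega>_def cinner_adj_left[OF BH_compose[OF MBH MBH]] MBH Re_cinner_self)
 have "\<omega> p = (norm (p \<eta>))^2" unfolding \<omega>_def by (rule is_proj_norm_sq[OF p(2), symmetric])
 also have "... = Re (\<tau> p) + 1"
  using e0 tp0 by (simp add: \<eta>_def r_def blinfun.scaleR_right power_mult_distrib power_divide)
 finally have \<omega>p: "\<omega> p = Re (\<tau> p) + 1" .
 obtain e where e: "e : M" "is_proj e" "e ** p = e" "\<omega> (p - e) <= Re (\<tau> (p - e))"
  "!!x. x : M ==> positive_op x ==> x ** e = x ==> Re (\<tau> x) <= \<omega> x"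
  using hahn_decomposition[OF M nt n\<omega> p(1,2)] by blast
 have e0: "e ~= 0" using e(4) \<omega>p by auto
 have te: "Re (\<tau> e) > 0"
  using nft_proj_nonneg[OF M \<tau> e(1,2)] nft_proj_zero[OF M \<tau> e(1,2)] e0 by fastforce
 \<comment> \<open>The summand 1 makes \<open>K\<close> times the trace exceed the vector state at
   \<open>e\<close>, so that \<open>f\<close> is nonzero.\<close>
 define K where "K = \<omega> e / Re (\<tau> e) + 1"
 have \<omega>e: "0 <= \<omega> e" by (rule normal_pos_nonneg[OF n\<omega> e(1) positive_proj[OF e(2)]])
 have K0: "0 <= K" using \<omega>e te by (simp add: K_def)
 obtain f where f: "f : M" "is_proj f" "f ** e = f" "K * Re (\<tau> (e - f)) <= \<omega> (e - f)"
  "!!x. x : M ==> positive_op x ==> x ** f = x ==> \<omega> x <= K * Re (\<tau> x)"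
  using hahn_decomposition[OF M n\<omega> normal_pos_cmult[OF M nt K0] e(1,2)] by blast
 have f0: "f ~= 0"
 proof
  assume "f = 0"
  hence "K * Re (\<tau> e) <= \<omega> e" using f(4) by simp
  thus False using te by (simp add: K_def distrib_right)
 qed
 have "(tnorm \<tau> (y ** f))^2 <= (norm (y (f \<eta>)))^2 & (norm (y (f \<eta>)))^2 <= K * (tnorm \<tau> (y ** f))^2" if y: "y : M" for y
 proof -
  have yf: "y ** f : M" by (rule vn_compose[OF M y f(1)])
  define x where "x = adj (y ** f) ** (y ** f)"
  have xM: "x : M" unfolding x_def by (rule tin_M[OF yf yf])
  have xP: "positive_op x" unfolding x_def by (rule positive_adj_self[OF MBH[OF yf]])
  have xf: "x ** f = x" unfolding x_def by (simp add: oL_assoc is_projD(2)[OF f(2)])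
  have xe: "x ** e = x" unfolding x_def by (simp add: oL_assoc f(3))
  show ?thesis
   using e(5)[OF xM xP xe] f(5)[OF xM xP xf] \<omega>q[OF y f(1)] by (simp add: x_def tnorm_sq[OF yf])
 qed
 hence "f : bounded_corners M \<tau>" unfolding bounded_corners_def using f by blast
 moreover have "p ** f = f"
 proof -
  have "f ** p = f" using f(3) e(3) by (metis oL_assoc)
  from arg_cong[OF this, of adj] show ?thesis using is_projD[OF f(2)] is_projD[OF p(2)] by (simp add: adj_compose)
 qed
 ultimately show ?thesis using f0 by blast
qed

text \<open>By maximality the corners sum to \<open>Id\<close>. Their traces are positive with sum
  1, so the family is countable and fits into a countable set of generators.\<close>

lemma ex_bounded_corner_family:
 "EX F. countable F & F <= bounded_corners M \<tau> & orth_family M F (%q. q) & ((%q. Re (\<tau> q)) has_sum 1) F"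
proof -
 define P where "P q \<longleftrightarrow> q : bounded_corners M \<tau> & q ~= 0" for q
 from ex_maximal_family[of P "%q r. q ** r = 0"] obtain F where
  F: "ALL q:F. P q" "ALL q:F. ALL r:F. q ~= r --> q ** r = 0"
  "ALL z. P z --> (ALL x:F. x ~= z --> x ** z = 0 & z ** x = 0) --> z : F"
  by (elim exE conjE)
 have q: "q : M" "is_proj q" "q ~= 0" if "q : F" for q
  using F(1) that by (auto simp: P_def bounded_corners_def)
 have fam: "orth_family M F (%q. q)" using q F(2) by (simp add: orth_family_def)
 obtain s where s: "s : M" "is_proj s" "!!r. r : F ==> r ** s = r" "!!\<phi>. normal_pos M \<phi> ==> (\<phi> has_sum \<phi> s) F"
  using orth_family_sup[OF M fam] by blast
 have "Id - s = 0"
 proof (rule ccontr)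
  assume ne: "Id - s ~= 0"
  have dM: "Id - s : M" by (intro vn_diff[OF M] vn_id[OF M] s)
  obtain z where z: "z : bounded_corners M \<tau>" "z ~= 0" "(Id - s) ** z = z"
   using ex_bounded_corner[OF dM is_proj_complement[OF s(2)] ne] by blast
  have zP: "is_proj z" using z(1) by (simp add: bounded_corners_def)
  have xz: "x ** z = 0" if "x : F" for x
  proof -
   have "x ** (Id - s) = 0" using s(3)[OF that] by (simp add: oL_simps)
   thus ?thesis by (subst z(3)[symmetric]) (simp flip: oL_assoc)
  qed
  moreover have "z ** x = 0" if "x : F" for x
   using arg_cong[OF xz[OF that], of adj] is_projD[OF zP] is_projD[OF q(2)[OF that]] by (simp add: adj_compose)
  ultimately have "z : F" using F(3) z(1,2) unfolding P_def by blast
  thus False using xz[of z] is_projD(2)[OF zP] z(2) by simp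
 qed
 hence hs: "((%q. Re (\<tau> q)) has_sum 1) F"
  using s(4)[OF nft_normal_pos[OF M \<tau>]] nft_id[OF \<tau>] by simp
 have "countable {q : F. Re (\<tau> q) ~= 0}"
  by (rule summable_countable_real) (use hs in "auto simp: summable_on_def")
 moreover have "{q : F. Re (\<tau> q) ~= 0} = F" using nft_proj_zero[OF M \<tau>] q by blast
 ultimately show ?thesis using F(1) fam hs unfolding P_def by (intro exI[of _ F]) auto
qed

end

locale gns_family = gns M \<tau> C \<iota> for M :: "'h :: chilbert_space op set" and \<tau> and C
  and \<iota> :: "'h op => 'k :: chilbert_space" +
 fixes F :: "'h op set"
 assumes FC: "F <= C" and Fb: "F <= bounded_corners M \<tau>" and Forth: "orth_family M F (%q. q)"
  and Fsum: "((%q. Re (\<tau> q)) has_sum 1) F"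
begin

text \<open>Finite sums of members of \<open>F\<close> approximate \<open>Id\<close> in trace norm,
  so \<open>\<iota> y\<close> is a limit of sums of vectors \<open>\<rho> q (\<iota> y)\<close>, and
  these are orthogonal to \<open>\<zeta>\<close> because \<open>\<rho> q\<close> is
  self-adjoint.\<close>

lemma rho_separating:
 assumes z: "!!q. q : F ==> \<rho> q \<zeta> = 0"
 shows "\<zeta> = 0"
proof (rule cinner_zeroI_dense[OF _ dense])
 fix a assume "a : \<iota> ` C"
 then obtain y where y: "a = \<iota> y" "y : C" by blast
 have bound: "cmod (cinner \<zeta> a) <= norm \<zeta> * (norm y * sqrt (1 - (\<Sum>q\<in>S. Re (\<tau> q))))"
  if S: "finite S" "S <= F" for S
 proof -
  define e where "e = sum (%q. q) S"
  have eP: "is_proj e" unfolding e_def by (rule is_proj_sum[OF Forth S])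
  have eC: "e : C" unfolding e_def using S FC by (intro C_sum) auto
  have fP: "is_proj (Id - e)" by (rule is_proj_complement[OF eP])
  have fC: "Id - e : C" using C_add[OF C_id C_scaleR[OF eC, of "-1"]] by simp
  have "\<iota> (y ** e) = (\<Sum>q\<in>S. \<rho> q (\<iota> y))"
   unfolding e_def oL_sum_right using S FC y by (subst iota_sum) (auto intro!: C_compose sum.cong simp: rho_iota)
  moreover have "cinner \<zeta> (\<rho> q (\<iota> y)) = 0" if "q : S" for q
  proof -
   have qC: "q : C" and qF: "q : F" using that S FC by auto
   have "adj (\<rho> q) = \<rho> q"
    using rho_adj[OF qC] Forth qF is_projD(3)[of q] by (simp add: orth_family_def)
   thus ?thesis using z[OF qF] by (metis cinner_adj_right cinner_zero_left qC rho_BH)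
  qed
  moreover have "cinner \<zeta> (\<Sum>q\<in>S. f q) = (\<Sum>q\<in>S. cinner \<zeta> (f q))" for f :: "'h op => 'k"
   by (induction S rule: infinite_finite_induct) (auto simp: cinner_linear)
  ultimately have "cinner \<zeta> (\<iota> (y ** e)) = 0" by simp
  moreover have "\<iota> y = \<iota> (y ** e) + \<iota> (y ** (Id - e))"
   using iota_add[OF C_compose[OF y(2) eC] C_compose[OF y(2) fC]] by (simp add: oL_simps)
  ultimately have "cinner \<zeta> a = cinner \<zeta> (\<iota> (y ** (Id - e)))" by (simp add: y(1) cinner_add_right)
  hence "cmod (cinner \<zeta> a) <= norm \<zeta> * tnorm \<tau> (y ** (Id - e))"
   using cmod_cinner_le norm_iota[OF C_compose[OF y(2) fC]] by metis
  also have "... <= norm \<zeta> * (norm y * tnorm \<tau> (Id - e))"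
   by (intro mult_left_mono tnorm_compose_left C_inM y fC) simp
  also have "tnorm \<tau> (Id - e) = sqrt (1 - (\<Sum>q\<in>S. Re (\<tau> q)))"
  proof -
   have "\<tau> e = (\<Sum>q\<in>S. \<tau> q)"
    unfolding e_def using S FC C_inM
    by (induction S rule: infinite_finite_induct) (auto simp: nft_zero[OF M \<tau>] intro!: nft_add[OF \<tau>, THEN trans] vn_sum[OF M])
   thus ?thesis
    unfolding tnorm_def using is_projD[OF fP] C_inM[OF C_id] C_inM[OF eC] nft_id[OF \<tau>]
    by (simp add: nft_diff[OF M \<tau>])
  qed
  finally show ?thesis .
 qed
 have "cmod (cinner \<zeta> a) <= norm \<zeta> * (norm y * sqrt (1 - 1))"
 proof (rule tendsto_lowerbound)
  show "((%S. norm \<zeta> * (norm y * sqrt (1 - (\<Sum>q\<in>S. Re (\<tau> q))))) \<longlongrightarrow> norm \<zeta> * (norm y * sqrt (1 - 1)))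
    (finite_subsets_at_top F)"
   using Fsum unfolding has_sum_def by (intro tendsto_intros)
  show "\<forall>\<^sub>F S in finite_subsets_at_top F.
    cmod (cinner \<zeta> a) <= norm \<zeta> * (norm y * sqrt (1 - (\<Sum>q\<in>S. Re (\<tau> q))))"
   by (intro eventually_finite_subsets_at_top_weakI bound)
 qed simp
 thus "cinner \<zeta> a = 0" by simp
qed

text \<open>Module maps from the GNS space to the space on which \<open>M\<close> is given. The two
  spaces need not be isomorphic; these maps transport commutation relations between them.\<close>

definition intertwiners :: "('k \<Rightarrow>\<^sub>L 'h) set" where
 "intertwiners = {S. (ALL c v. blinfun_apply S (c *C v) = c *C S v) & (ALL x:C. ALL v. S (\<pi> x v) = blinfun_apply x (S v))}"

text \<open>For \<open>q\<close> in \<open>F\<close> with its vector \<open>\<xi>\<close>, sending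
  \<open>\<iota> y\<close> to \<open>y (q \<xi>)\<close> is bounded and defines an intertwiner. By
  the lower estimate it dominates \<open>\<rho> q\<close> in norm, and the \<open>\<rho> q\<close>
  separate vectors.\<close>

lemma intertwiners_separating:
 assumes z: "!!S. S : intertwiners ==> blinfun_apply S \<zeta> = 0"
 shows "\<zeta> = 0"
proof (rule rho_separating)
 fix q assume qF: "q : F"
 hence qC: "q : C" using FC by blast
 obtain \<xi> K where K: "!!y. y : M ==> (tnorm \<tau> (y ** q))^2 <= (norm (y (q \<xi>)))^2"
  "!!y. y : M ==> (norm (y (q \<xi>)))^2 <= K * (tnorm \<tau> (y ** q))^2"
  using Fb qF unfolding bounded_corners_def by blast
 define L where "L = sqrt \<bar>K\<bar> * norm q"
 have "EX S. ALL y:C. blinfun_apply S (\<iota> y) = y (q \<xi>)"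
 proof (rule ex_ext[where K = L])
  fix y assume y: "y : C"
  have "(norm (y (q \<xi>)))^2 <= \<bar>K\<bar> * (tnorm \<tau> (y ** q))^2"
   using K(2)[OF C_inM[OF y]] by (meson abs_ge_self mult_right_mono order_trans zero_le_power2)
  also have "... <= \<bar>K\<bar> * (norm q * tnorm \<tau> y)^2"
   by (intro mult_left_mono power_mono tnorm_compose_right C_inM y qC tnorm_nonneg C_compose) auto
  also have "... = (L * tnorm \<tau> y)^2" by (simp add: L_def power_mult_distrib)
  finally show "norm (y (q \<xi>)) <= L * tnorm \<tau> y"
   by (rule power2_le_imp_le) (use C_inM[OF y] in "auto simp: L_def")
 qed (auto simp: blinfun.add_left blinfun.scaleR_left L_def)
 then obtain S where S: "!!y. y : C ==> blinfun_apply S (\<iota> y) = y (q \<xi>)" by blast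
 have "S : intertwiners"
 proof -
  have "S (c *C v) = c *C S v" for c v
   by (rule scaleC_dense[OF _ dense]) (auto simp: iota_cscale[symmetric] S C_cscale cscale_apply)
  moreover have "S (\<pi> x v) = x (S v)" if x: "x : C" for x v
  proof -
   have "S ** \<pi> x = x ** S" by (rule eq_on_iota) (simp add: pi_iota x S C_compose)
   thus ?thesis by (metis oL_apply)
  qed
  ultimately show ?thesis by (simp add: intertwiners_def)
 qed
 hence "S \<zeta> = 0" by (rule z)
 moreover have "norm (\<rho> q v) <= norm (S v)" for v
 proof -
  have "closed {v. norm (\<rho> q v) <= norm (S v)}"
   by (intro closed_Collect_le continuous_intros cont_blinfun)
  moreover have "\<iota> ` C <= {v. norm (\<rho> q v) <= norm (S v)}"
   proof
   fix v assume "v : \<iota> ` C"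
   then obtain y where y: "v = \<iota> y" "y : C" by blast
   have "tnorm \<tau> (y ** q) <= norm (y (q \<xi>))" by (rule power2_le_imp_le[OF K(1)[OF C_inM[OF y(2)]]]) simp
   thus "v : {v. norm (\<rho> q v) <= norm (S v)}" using y by (simp add: rho_iota qC S norm_iota C_compose)
  qed
  ultimately have "closure (\<iota> ` C) <= {v. norm (\<rho> q v) <= norm (S v)}" by (rule closure_minimal[rotated])
  thus ?thesis using dense by auto
 qed
 ultimately show "\<rho> q \<zeta> = 0" by (metis norm_le_zero_iff norm_zero)
qed

text \<open>Sandwiched between an intertwiner and the adjoint of another, \<open>T\<close> becomes
  an operator on the given space that commutes with \<open>Q\<close>, hence with \<open>C\<close>.
  As intertwiners separate vectors, the commutator of \<open>T\<close> and \<open>\<pi> x\<close>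
  vanishes.\<close>

lemma commute_extends:
 assumes Q: "Q <= C" "!!x. x : Q ==> adj x : Q" "commutant Q <= commutant C"
  and T: "T : commutant (\<pi> ` Q)" and x: "x : C"
 shows "T ** \<pi> x = \<pi> x ** T"
proof -
 have TB: "T : BH" using T commutant_BH by blast
 define D where "D = (T ** \<pi> x) - (\<pi> x ** T)"
 have DB: "D : BH" unfolding D_def using TB pi_BH[OF x] by (intro BH_intros)
 have D0: "S' (D (S2 v)) = 0"
  if S': "S' : intertwiners" and S: "S : intertwiners" and S2: "!!c w. S2 (c *C w) = c *C S2 w"
   "!!a b. cinner (S a) b = cinner a (S2 b)" for S S' :: "'k \<Rightarrow>\<^sub>L 'h" and S2 :: "'h \<Rightarrow>\<^sub>L 'k" and v
 proof -
  have i: "S2 (y b) = \<pi> y (S2 b)" if "y : C" for y b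
  proof (rule cinner_ext_left)
   fix a
   have "cinner a (S2 (y b)) = cinner (adj y (S a)) b"
    by (simp add: S2(2)[symmetric] cinner_adj_left CBH that)
   also have "adj y (S a) = S (\<pi> (adj y) a)" using S C_adj[OF that] by (simp add: intertwiners_def)
   also have "cinner (S (\<pi> (adj y) a)) b = cinner a (\<pi> y (S2 b))"
    by (simp add: S2(2) pi_adj that cinner_adj_left pi_BH)
   finally show "cinner a (S2 (y b)) = cinner a (\<pi> y (S2 b))" .
  qed
  have S'i: "S' (\<pi> y w) = y (S' w)" if "y : C" for y w using S' that by (simp add: intertwiners_def)
  define W where "W = S' ** (T ** S2)"
  have "W : commutant Q"
  proof (rule commutantI)
   show "W : BH" using S' S2(1) TB by (simp add: BH_def W_def intertwiners_def)
   fix y assume y: "y : Q"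
   hence yC: "y : C" using Q by blast
   show "W ** y = y ** W"
    using commutant_apply[OF T imageI[OF y]] by (intro blinfun_eqI) (simp add: W_def i[OF yC] S'i[OF yC])
  qed
  hence "W (x v) = x (W v)" using Q(3) x commutant_apply by blast
  thus ?thesis by (simp add: W_def D_def i[OF x] S'i[OF x, symmetric] blinfun.diff_left blinfun.diff_right)
 qed
 have "D = 0"
 proof -
  have "adj D = 0"
  proof (rule blinfun_eqI)
   fix \<zeta>
   have "adj D \<zeta> = 0"
   proof (rule intertwiners_separating)
    fix S assume S: "S : intertwiners"
    then obtain S2 where S2: "ALL c w. blinfun_apply S2 (c *C w) = c *C S2 w"
     "ALL a b. cinner (S a) b = cinner a (S2 b)"
     using ex_adjoint[of S] by (auto simp: intertwiners_def)
    have DS2: "D (S2 v) = 0" for v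
     by (rule intertwiners_separating) (use D0[OF _ S] S2 in blast)
    show "S (adj D \<zeta>) = 0"
    proof (rule cinner_ext)
     fix v show "cinner (S (adj D \<zeta>)) v = cinner 0 v"
      using S2(2) DS2[of v] by (simp add: cinner_adj_left DB)
    qed
   qed
   thus "adj D \<zeta> = (0 :: 'k op) \<zeta>" by simp
  qed
  thus ?thesis using adj_adj[OF DB] by simp
 qed
 thus ?thesis by (simp add: D_def)
qed

text \<open>The projection onto the closure of the image of \<open>Q\<close> commutes with
  \<open>\<pi> y\<close> for \<open>y\<close> in \<open>Q\<close>, hence with
  \<open>\<pi> x\<close>. Since it fixes \<open>\<iota> Id\<close>, it fixes
  \<open>\<iota> x\<close>.\<close>

lemma iota_dense_subalgebra:
 assumes Q: "star_subalgebra Q" "Q <= C" "commutant Q <= commutant C" and x: "x : C" and e: "0 < \<epsilon>"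
 shows "EX y:Q. tnorm \<tau> (x - y) < \<epsilon>"
proof -
 have Qa: "Id : Q" "!!x. x : Q ==> adj x : Q" "!!x y. x : Q ==> y : Q ==> x + y : Q"
  "!!x y. x : Q ==> y : Q ==> x ** y : Q" "!!c x. x : Q ==> cscale c x : Q"
  using Q(1) unfolding star_subalgebra_def by auto
 have QC: "y : C" if "y : Q" for y using that Q(2) by blast
 have cs: "csubspace (\<iota> ` Q)"
 proof (rule csubspaceI)
  show "0 : \<iota> ` Q" using Qa(5)[OF Qa(1), of 0] iota_zero by (intro image_eqI[of _ _ 0]) auto
  show "a + b : \<iota> ` Q" if "a : \<iota> ` Q" "b : \<iota> ` Q" for a b
   using that Qa(3) by (auto simp: iota_add[symmetric] QC)
  show "c *C a : \<iota> ` Q" if "a : \<iota> ` Q" for c a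
   using that Qa(5) by (auto simp: iota_cscale[symmetric] QC)
 qed
 define V where "V = closure (\<iota> ` Q)"
 have V: "csubspace V" "closed V" unfolding V_def using csubspace_closure[OF cs] by auto
 have "prj V : commutant (\<pi> ` Q)"
 proof (rule prj_in_commutant[OF V])
  show "\<pi> ` Q <= BH" using pi_BH QC by auto
  show "adj a : \<pi> ` Q" if "a : \<pi> ` Q" for a using that Qa(2) by (auto simp: pi_adj[symmetric] QC)
  fix a v assume a: "a : \<pi> ` Q" and v: "v : V"
  obtain y where y: "a = \<pi> y" "y : Q" using a by blast
  have "a ` closure (\<iota> ` Q) <= closure (\<iota> ` Q)"
  proof (rule image_closure_subset)
   show "a ` (\<iota> ` Q) <= closure (\<iota> ` Q)"
    using y Qa(4) by (auto simp: pi_iota QC intro!: closure_subset[THEN subsetD])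
  qed (auto intro!: cont_blinfun)
  thus "a v : V" using v unfolding V_def by blast
 qed
 hence c: "prj V ** \<pi> x = \<pi> x ** prj V" using commute_extends[OF Q(2) Qa(2) Q(3) _ x] by blast
 have "\<iota> Id : V" unfolding V_def using Qa(1) by (intro closure_subset[THEN subsetD]) auto
 hence "prj V (\<iota> Id) = \<iota> Id" by (rule prj_fix[OF V])
 hence "prj V (\<iota> x) = \<iota> x"
  using c pi_iota[OF x C_id] by (metis oL_apply oL_id(2))
 hence "\<iota> x : closure (\<iota> ` Q)" using prj_mem[OF V, of "\<iota> x"] by (simp add: V_def)
 then obtain y where y: "y : Q" "dist (\<iota> y) (\<iota> x) < \<epsilon>" using e by (auto simp: closure_approachable)
 have "dist (\<iota> y) (\<iota> x) = tnorm \<tau> (x - y)"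
  using norm_iota[of "x - y"] iota_diff[OF x QC[OF y(1)]] C_add[OF x C_scaleR[OF QC[OF y(1)], of "-1"]]
  by (simp add: dist_norm norm_minus_commute)
 thus ?thesis using y by auto
qed

end

section \<open>Countably generated algebras and separability of the GNS space\<close>

definition words :: "'a :: chilbert_space op set => 'a op set" where
 "words S = (%l. foldr blinfun_compose l Id) ` lists S"

lemma countable_words: "countable S ==> countable (words S)"
 unfolding words_def by (intro countable_image countable_lists)

lemma words_base: "x : S ==> x : words S"
 unfolding words_def by (rule image_eqI[of _ _ "[x]"]) auto

lemma words_compose: "x : words S ==> y : words S ==> x ** y : words S"
proof -
 have "foldr blinfun_compose l Id ** foldr blinfun_compose l' Id = foldr blinfun_compose (l @ l') (Id :: 'a op)" for l l'
  by (induction l) (auto simp: oL_assoc)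
 moreover assume "x : words S" "y : words S"
 then obtain l l' where "x = foldr blinfun_compose l Id" "y = foldr blinfun_compose l' Id" "l : lists S" "l' : lists S"
  by (auto simp: words_def)
 ultimately show "x ** y : words S"
  unfolding words_def by (intro image_eqI[of _ _ "l @ l'"]) auto
qed

lemma words_subset_vn: "von_neumann_algebra M ==> S <= M ==> span (words S) <= M"
proof (rule span_minimal)
 assume M: "von_neumann_algebra M" and S: "S <= M"
 have "l : lists S ==> foldr blinfun_compose l Id : M" for l
  using S by (induction l) (auto intro!: vn_intros[OF M])
 thus "words S <= M" unfolding words_def by blast
 show "subspace M" by (auto simp: subspace_def intro: vn_intros[OF M])
qed

text \<open>Spans are real; the generator \<open>cscale \<i> Id\<close> makes them closed under
  complex scalars.\<close>

lemma star_subalgebra_span_words: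
 fixes S :: "'a :: chilbert_space op set"
 assumes S: "S <= BH" "!!x. x : S ==> adj x : S" "cscale \<i> Id : S"
 shows "star_subalgebra (span (words S))"
proof -
 have wB: "words S <= BH"
 proof -
  have "l : lists S ==> foldr blinfun_compose l Id : BH" for l
   using S by (induction l) (auto intro!: BH_intros)
  thus ?thesis unfolding words_def by blast
 qed
 hence sB: "span (words S) <= BH" by (rule span_minimal[OF _ BH_subspace])
 have w1: "Id : words S" unfolding words_def by (rule image_eqI[of _ _ "[]"]) auto
 have wa: "adj x : words S" if "x : words S" for x
 proof -
  have "l : lists S ==> adj (foldr blinfun_compose l Id) : words S" for l
  proof (induction l)
   case (Cons a l)
   hence a: "a : S" and l: "l : lists S" by auto
   have "foldr blinfun_compose l Id : BH" using wB l unfolding words_def by blast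
   thus ?case
    using words_compose[OF Cons.IH[OF l] words_base[OF S(2)[OF a]]] a S(1) by (auto simp: adj_compose)
  qed (simp add: w1)
  thus ?thesis using that unfolding words_def by blast
 qed
 have c1: "x ** y : span (words S)" if "x : words S" "y : span (words S)" for x y
  using that(2)
 proof (induction rule: span_induct)
  case base
  thus ?case by (auto simp: subspace_def oL_simps intro: span_zero span_add span_scale)
 qed (use that(1) in "blast intro: span_base words_compose")
 have c2: "x ** y : span (words S)" if y: "y : span (words S)" and x: "x : span (words S)" for x y
  using x
 proof (induction rule: span_induct)
  case base
  thus ?case by (auto simp: subspace_def oL_simps intro: span_zero span_add span_scale)
 qed (use y c1 in blast)
 have a2: "adj x : span (words S)" if x: "x : span (words S)" for x
 proof -
  have "x : BH & adj x : span (words S)" using x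
  proof (induction rule: span_induct)
   case base
   thus ?case by (auto simp: subspace_def adj_simps intro: span_zero span_add span_scale BH_intros)
  qed (use wB in "auto intro: span_base wa")
  thus ?thesis by simp
 qed
 have "cscale c x : span (words S)" if x: "x : span (words S)" for c x
 proof -
  have "cscale c x = Re c *R x + Im c *R (cscale \<i> Id ** x)"
   by (rule blinfun_eqI) (simp add: cscale_apply blinfun.add_left blinfun.scaleR_left scaleC_Complex[of c])
  thus ?thesis using x c2[OF x span_base[OF words_base[OF S(3)]]] by (auto intro: span_add span_scale)
 qed
 thus ?thesis
  unfolding star_subalgebra_def using sB a2 c2 span_base[OF w1] by (auto intro: span_add)
qed

lemma not_fin_dim_ex_independent:
 assumes "~ fin_dim M"
 shows "EX B. B <= M & independent B & countable B & infinite B"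
proof -
 obtain B where B: "B <= M" "independent B" "M <= span B" by (rule maximal_independent_subset)
 hence "infinite B" using assms by (auto simp: fin_dim_def)
 then obtain f :: "nat => _" where f: "inj f" "range f <= B" using infinite_countable_subset by blast
 thus ?thesis
  using B independent_mono[OF B(2) f(2)] range_inj_infinite[OF f(1)]
  by (intro exI[of _ "range f"]) auto
qed

lemma fin_dim_independent_finite: "fin_dim X ==> independent B ==> B <= X ==> finite B"
 unfolding fin_dim_def by (meson independent_span_bound order_trans)

text \<open>An increasing union of finite-dimensional algebras is spanned by countably many
  elements. This is the form in which hyperfiniteness enters.\<close>

lemma hyperfinite_generators:
 assumes M: "von_neumann_algebra M" and h: "hyperfinite M"
 shows "EX Q B. star_subalgebra Q & Q <= M & commutant Q = commutant M & countable B & B <= Q & Q <= span B"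
proof -
 obtain Q :: "nat => 'a op set" where Q: "!!n. star_subalgebra (Q n)" "!!n. fin_dim (Q n)" "!!n. Q n <= Q (Suc n)"
  and MQ: "M = commutant (commutant (\<Union>n. Q n))"
  using h unfolding hyperfinite_def by blast
 define R where "R = (\<Union>n. Q n)"
 have mono: "m <= n ==> Q m <= Q n" for m n by (rule lift_Suc_mono_le[of Q, OF Q(3)])
 have Qc: "x : Q n ==> adj x : Q n & cscale c x : Q n" for x n c
  using Q(1)[of n] by (simp add: star_subalgebra_def)
 have RB: "R <= BH" unfolding R_def using Q(1) by (intro UN_least) (simp add: star_subalgebra_def)
 have com: "x + y : R & x ** y : R" if xy: "x : R" "y : R" for x y
 proof -
  obtain m n where mn: "x : Q m" "y : Q n" using xy by (auto simp: R_def)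
  hence "x : Q (max m n)" "y : Q (max m n)" using mono[of m "max m n"] mono[of n "max m n"] by auto
  hence "x + y : Q (max m n) & x ** y : Q (max m n)" using Q(1)[of "max m n"] by (auto simp: star_subalgebra_def)
  thus ?thesis by (auto simp: R_def)
 qed
 have sR: "star_subalgebra R"
  unfolding star_subalgebra_def
 proof (intro conjI ballI allI)
  show "Id : R" using Q(1)[of 0] by (auto simp: R_def star_subalgebra_def)
  show "adj x : R" if "x : R" for x using that Qc unfolding R_def by blast
  show "cscale c x : R" if "x : R" for c x using that Qc unfolding R_def by blast
 qed (use com RB in auto)
 have "EX B. finite B & B <= Q n & Q n <= span B" for n
 proof -
  obtain B where "B <= Q n" "independent B" "Q n <= span B" by (rule maximal_independent_subset)
  thus ?thesis using fin_dim_independent_finite[OF Q(2)[of n]] by blast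
 qed
 then obtain B where B: "!!n. finite (B n)" "!!n. B n <= Q n" "!!n. Q n <= span (B n)" by metis
 have "R <= span (\<Union>n. B n)"
  unfolding R_def using B(3) span_mono[of "B _" "\<Union>n. B n"] by blast
 moreover have "commutant R = commutant M" unfolding MQ R_def[symmetric] by (rule triple_commutant[OF RB, symmetric])
 moreover have "R <= M" unfolding MQ R_def[symmetric] by (rule subset_bicommutant[OF RB])
 moreover have "(\<Union>n. B n) <= R" unfolding R_def using B(2) by blast
 moreover have "countable (\<Union>n. B n)" using B(1) by (auto simp: countable_finite)
 ultimately show ?thesis using sR by blast
qed

text \<open>The construction is run twice. With \<open>x\<close> among the generators it shows that
  \<open>Q\<close> approximates \<open>x\<close> in trace norm. As \<open>x\<close> is arbitrary,
  the embedding built from the generators with \<open>Id\<close> in place of \<open>x\<close> is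
  isometric on all of \<open>M\<close>.\<close>

lemma ex_gns_family:
 assumes M: "von_neumann_algebra M" and \<tau>: "nf_tracial_state M \<tau>" and h: "hyperfinite M" and inf: "~ fin_dim M"
 shows "EX (\<iota> :: 'h :: chilbert_space op => ell2) F. gns_family M \<tau> M \<iota> F"
proof -
 interpret tracial M \<tau> by standard (fact M \<tau>)+
 obtain Q B where Q: "star_subalgebra Q" "Q <= M" "commutant Q = commutant M" and B: "countable B" "B <= Q" "Q <= span B"
  using hyperfinite_generators[OF M h] by blast
 obtain I where I: "I <= M" "independent I" "countable I" "infinite I"
  using not_fin_dim_ex_independent[OF inf] by blast
 obtain F where F: "countable F" "F <= bounded_corners M \<tau>" "orth_family M F (%q. q)" "((%q. Re (\<tau> q)) has_sum 1) F"
  using ex_bounded_corner_family by blast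
 have FM: "F <= M" using F(2) by (auto simp: bounded_corners_def)
 \<comment> \<open>The infinite independent set \<open>I\<close> keeps the generated algebra
   infinite-dimensional, \<open>F\<close> supplies the bounded corners, and \<open>B\<close> spans
   \<open>Q\<close>.\<close>
 define S0 where "S0 x = insert x (insert (cscale \<i> Id) (B Un I Un F))" for x
 define S where "S x = S0 x Un adj ` S0 x" for x
 define G where "G x = words (S x)" for x
 have S0M: "S0 x <= M" if "x : M" for x
  unfolding S0_def using that B Q I FM by (auto intro!: vn_intros[OF M])
 have SM: "S x <= M" if "x : M" for x
  unfolding S_def using S0M[OF that] by (auto intro!: vn_adj[OF M])
 have GM: "span (G x) <= M" if "x : M" for x
  unfolding G_def by (rule words_subset_vn[OF M SM[OF that]])
 have S0G: "S0 x <= span (G x)" for x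
  unfolding G_def S_def by (auto intro!: span_base words_base)
 have GC: "star_subalgebra (span (G x))" if "x : M" for x
  unfolding G_def
 proof (rule star_subalgebra_span_words)
  show "S x <= BH" using SM[OF that] vn_BH[OF M] by blast
  show "adj y : S x" if "y : S x" for y using that S0M[OF \<open>x : M\<close>] MBH by (auto simp: S_def)
 qed (simp add: S_def S0_def)
 have Gc: "countable (G x)" for x unfolding G_def S_def S0_def
  using B I F by (intro countable_words) auto
 have Gi: "~ fin_dim (span (G x))" for x
  using fin_dim_independent_finite[of "span (G x)" I] S0G[of x] I by (auto simp: S0_def)
 have Gs: "cscale c y : span (G x)" if "x : M" "y : span (G x)" for c x y
  using GC[OF that(1)] that(2) by (simp add: star_subalgebra_def)
 have QG: "Q <= span (G x)" for x
 proof -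
  have "span B <= span (G x)" by (rule span_minimal) (use S0G[of x] in "auto simp: S0_def")
  thus ?thesis using B(3) by blast
 qed
 have ex: "EX \<iota> :: 'h op => ell2.
  (ALL x:M. ALL y:M. \<iota> (x + y) = \<iota> x + \<iota> y) & (ALL c. ALL x:M. \<iota> (cscale c x) = c *C \<iota> x) &
  (ALL x:M. ALL y:M. (ALL \<epsilon>>0. EX z:span (G w). tnorm \<tau> (x - z) < \<epsilon>) --> cinner (\<iota> x) (\<iota> y) = tin x y) &
  closure (\<iota> ` span (G w)) = UNIV" if w: "w : M" for w
  by (rule ex_gns_embedding[OF Gc _ Gs[OF w] Gi]) (use GM[OF w] span_superset in blast)
 have z0: "tnorm \<tau> 0 = 0" unfolding tnorm_def by (simp add: nft_zero[OF M \<tau>])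
 have dense: "EX y:Q. tnorm \<tau> (x - y) < \<epsilon>" if x: "x : M" and e: "0 < \<epsilon>" for x \<epsilon>
 proof -
  obtain \<iota> :: "'h op => ell2" where
   i: "!!x y. x : M ==> y : M ==> \<iota> (x + y) = \<iota> x + \<iota> y" "!!c x. x : M ==> \<iota> (cscale c x) = c *C \<iota> x"
   "!!y z. y : M ==> z : M ==> (ALL \<epsilon>>0. EX z:span (G x). tnorm \<tau> (y - z) < \<epsilon>) ==> cinner (\<iota> y) (\<iota> z) = tin y z"
   "closure (\<iota> ` span (G x)) = UNIV"
   using ex[OF x] by blast
  interpret C: gns_family M \<tau> "span (G x)" \<iota> F
  proof (unfold_locales)
   show "cinner (\<iota> y) (\<iota> z) = tin y z" if "y : span (G x)" "z : span (G x)" for y z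
   proof (rule i(3))
    show "ALL \<epsilon>>0. EX z:span (G x). tnorm \<tau> (y - z) < \<epsilon>" using that(1) z0 by (intro allI impI bexI[of _ y]) auto
   qed (use that GM[OF x] in auto)
   show "F <= span (G x)" using S0G[of x] by (auto simp: S0_def)
  qed (use GC[OF x] subsetD[OF GM[OF x]] i F in auto)
  have "commutant Q <= commutant (span (G x))" unfolding Q(3) by (rule commutant_antimono[OF GM[OF x]])
  moreover have "x : span (G x)" using S0G[of x] by (auto simp: S0_def)
  ultimately show ?thesis using C.iota_dense_subalgebra[OF Q(1) QG] e by blast
 qed
 have id: "Id : M" by (rule vn_id[OF M])
 obtain \<iota> :: "'h op => ell2" where
  i: "!!x y. x : M ==> y : M ==> \<iota> (x + y) = \<iota> x + \<iota> y" "!!c x. x : M ==> \<iota> (cscale c x) = c *C \<iota> x"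
  "!!y z. y : M ==> z : M ==> (ALL \<epsilon>>0. EX z:span (G Id). tnorm \<tau> (y - z) < \<epsilon>) ==> cinner (\<iota> y) (\<iota> z) = tin y z"
  "closure (\<iota> ` span (G Id)) = UNIV"
  using ex[OF id] by blast
 have "gns_family M \<tau> M \<iota> F"
 proof (unfold_locales)
  show "star_subalgebra M" unfolding star_subalgebra_def using vn_BH[OF M] by (auto intro: vn_intros[OF M])
  show "cinner (\<iota> y) (\<iota> z) = tin y z" if "y : M" "z : M" for y z
   by (rule i(3)[OF that]) (use dense[OF that(1)] QG in blast)
  show "closure (\<iota> ` M) = UNIV" using i(4) closure_mono[OF image_mono[OF GM[OF id]], of \<iota>] by auto
 qed (use i F FM in auto)
 thus ?thesis by blast
qed

section \<open>Images of von Neumann algebras under the GNS representation\<close>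

lemma blinfun_eq_on_span_dense:
 fixes S T :: "'a :: real_normed_vector \<Rightarrow>\<^sub>L 'b :: real_normed_vector"
 assumes eq: "!!x. x : X ==> S x = T x" and D: "closure (span X) = UNIV"
 shows "S = T"
proof (rule blinfun_eq_on_dense[OF _ D])
 fix x assume "x : span X"
 thus "S x = T x"
  by (rule linear_eq_on_span[rotated 3]) (auto intro: eq bounded_linear.linear[OF lin_right])
qed

text \<open>A self-adjoint contraction \<open>x\<close> is half the sum of the unitary
  \<open>x + cscale \<i> s\<close> and its adjoint, where \<open>s\<close> is the square root of
  \<open>Id - (x ** x)\<close>.\<close>

lemma vn_unitary_induct:
 assumes R: "von_neumann_algebra R" and T: "T : R"
  and u: "!!u. u : R ==> adj u ** u = Id ==> u ** adj u = Id ==> P u"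
  and add: "!!x y. P x ==> P y ==> P (x + y)" and sc: "!!c x. P x ==> P (cscale c x)"
 shows "P T"
proof -
 note RB = vn_inBH[OF R]
 have scR: "P (r *R x)" if "P x" for r x using sc[OF that, of "of_real r"] by (simp add: cscale_of_real)
 have contr: "P x" if x: "x : R" "adj x = x" "norm x <= 1" for x
 proof -
  define k where "k = Id - (x ** x)"
  have kR: "k : R" unfolding k_def by (intro vn_intros[OF R] x)
  have kP: "positive_op k" unfolding k_def op_le_def[symmetric]
  proof (rule op_leI)
   fix v
   have "norm (x v) <= 1 * norm v" using norm_blinfun[of x v] x(3) by (meson mult_right_mono norm_ge_zero order_trans)
   hence "(norm (x v))^2 <= (norm v)^2" by (intro power_mono) auto
   thus "Re (cinner ((x ** x) v) v) <= Re (cinner (Id v) v)"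
    using x(2) norm_apply_sq[OF RB[OF x(1)], of v] by (simp add: Re_cinner_self)
  qed (use RB[OF x(1)] x(2) in "auto simp: adj_compose intro: BH_intros")
  define s where "s = op_sqrt k"
  have sR: "s : R" unfolding s_def by (rule op_sqrt_in_vn[OF R kP kR])
  have sB: "s : BH" "x : BH" using RB sR x by auto
  have sa: "adj s = s" unfolding s_def by (rule positive_op_adj[OF positive_op_sqrt[OF kP]])
  have s2: "s ** s = Id - (x ** x)" unfolding s_def using op_sqrt_square[OF kP] by (simp add: k_def)
  have sx: "x ** s = s ** x" unfolding s_def
   by (rule op_sqrt_commute[OF kP]) (simp add: k_def oL_simps)
  define w where "w = x + cscale \<i> s"
  have wa: "adj w = x - cscale \<i> s"
   using sB by (simp add: w_def adj_simps BH_intros x(2) sa cscale_minus_left)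
  have "adj w ** w = Id" "w ** adj w = Id"
   unfolding wa unfolding w_def using sB by (simp_all add: oL_simps oL_cscale_left oL_cscale_right BH_intros cscale_cscale s2 sx cscale_minus_left)
  moreover have "w : R" "adj w : R" unfolding wa unfolding w_def by (intro vn_intros[OF R] x sR)+
  ultimately have "P w" "P (adj w)" using u[of w] u[of "adj w"] adj_adj[OF RB[of w]] by auto
  hence "P ((1/2) *R (w + adj w))" by (intro scR add)
  moreover have "(1/2) *R (w + adj w) = x" unfolding wa unfolding w_def by (simp flip: scaleR_2)
  ultimately show ?thesis by simp
 qed
 have sa: "P x" if x: "x : R" "adj x = x" for x
 proof (cases "x = 0")
  case True
  thus ?thesis using contr[of 0] vn_zero[OF R] by simp
 next
  case False
  have "P (norm x *R ((1 / norm x) *R x))"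
   by (intro scR contr vn_intros[OF R] x) (use x RB[OF x(1)] False in "auto simp: adj_scaleR")
  thus ?thesis using False by simp
 qed
 define a where "a = T + adj T"
 define b where "b = cscale \<i> (T - adj T)"
 have "P a" by (rule sa) (use T RB[OF T] in "auto simp: a_def adj_add add.commute intro: vn_intros[OF R]")
 moreover have "P b" by (rule sa) (use T RB[OF T] in "auto simp: b_def imaginary_part_self_adjoint intro: vn_intros[OF R]")
 ultimately have "P ((1/2) *R (a + cscale (- \<i>) b))" by (intro scR add sc)
 moreover have "(1/2) *R (a + cscale (- \<i>) b) = T"
  unfolding a_def b_def by (simp add: cscale_cscale flip: scaleR_2)
 ultimately show ?thesis by simp
qed

locale factor_gns = gns_family M \<tau> M \<iota> F for M :: "'h :: chilbert_space op set" and \<tau>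
  and \<iota> :: "'h op => 'k :: chilbert_space" and F +
 assumes factor_M: "factor M"
begin

text \<open>The closed span of all ranges is invariant under \<open>M\<close> and under its
  commutant, so its projection is central in a factor; it is not 0 because intertwiners separate
  vectors.\<close>

lemma intertwiners_dense: "closure (span {blinfun_apply S \<zeta> | S \<zeta>. S : intertwiners}) = UNIV"
proof -
 define X where "X = {blinfun_apply S \<zeta> | S \<zeta>. S : intertwiners}"
 define V where "V = closure (span X)"
 have cs: "csubspace (span X)"
 proof (rule csubspace_span)
  fix c x assume "x : X"
  then obtain S \<zeta> where "x = blinfun_apply S \<zeta>" and S: "S : intertwiners" by (auto simp: X_def)
  hence "c *C x = S (c *C \<zeta>)" by (simp add: intertwiners_def)
  thus "c *C x : X" using S by (auto simp: X_def)
 qed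
 have V: "csubspace V" "closed V" unfolding V_def using csubspace_closure[OF cs] by auto
 have p: "is_proj (prj V)" by (rule is_proj_prj[OF V])
 have inv: "r v : V" if v: "v : V" and r: "!!x. x : X ==> blinfun_apply r x : X" for r v
  unfolding V_def
 proof (rule blinfun_image_closure_span)
  show "v : closure (span X)" using v by (simp add: V_def)
  show "blinfun_apply r x : closure (span X)" if "x : X" for x
   by (intro closure_subset[THEN subsetD] span_base r that)
 qed
 have p1: "prj V : commutant M"
 proof (rule prj_in_commutant[OF V vn_BH[OF M] vn_adj[OF M]])
  fix x v assume x: "x : M" and v: "v : V"
  show "x v : V"
  proof (rule inv[OF v])
   fix y assume "y : X"
   then obtain S \<zeta> where "y = blinfun_apply S \<zeta>" and S: "S : intertwiners" by (auto simp: X_def)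
   hence "x y = S (\<pi> x \<zeta>)" using x by (simp add: intertwiners_def)
   thus "x y : X" using S by (auto simp: X_def)
  qed
 qed
 have "prj V : commutant (commutant M)"
 proof (rule prj_in_commutant[OF V commutant_BH vn_adj[OF vn_commutant_vn[OF M]]])
  fix r v assume r: "r : commutant M" and v: "v : V"
  show "r v : V"
  proof (rule inv[OF v])
   fix y assume "y : X"
   then obtain S \<zeta> where y: "y = blinfun_apply S \<zeta>" and S: "S : intertwiners" by (auto simp: X_def)
   have "r ** S : intertwiners"
    using S commutant_apply[OF r] BH_apply[OF subsetD[OF commutant_BH r]] by (auto simp: intertwiners_def)
   thus "r y : X" using y unfolding X_def by (intro CollectI exI[of _ "r ** S"] exI[of _ \<zeta>]) auto
  qed
 qed
 hence "prj V : M" by (simp add: vn_bicommutant[OF M])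
 then consider "prj V = 0" | "prj V = Id" using factor_central_proj[OF factor_M _ p1 p] by blast
 hence "V = UNIV"
 proof cases
  case 1
  have "\<iota> Id = 0"
  proof (rule intertwiners_separating)
   fix S assume S: "S : intertwiners"
   have "S (\<iota> Id) : V" unfolding V_def
    by (intro closure_subset[THEN subsetD] span_base) (use S in "auto simp: X_def")
   thus "S (\<iota> Id) = 0" using prj_fix[OF V] 1 by (metis zero_blinfun.rep_eq)
  qed
  hence "tnorm \<tau> Id = 0" using norm_iota[OF C_id] by simp
  thus ?thesis unfolding tnorm_def using nft_id[OF \<tau>] by simp
 next
  case 2
  thus ?thesis using range_prj[OF V] by simp
 qed
 thus ?thesis by (simp add: V_def X_def)
qed

text \<open>Operators that intertwine the two actions of \<open>A\<close> transfer a unitary of the bicommutant of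
 \<open>\<pi> ` A\<close> to the original space, where the bicommutant of \<open>A\<close> is known.\<close>

lemma pi_vn:
 assumes A: "von_neumann_algebra A" "A <= M"
 shows "von_neumann_algebra (\<pi> ` A)"
proof -
 have AM: "a : M" if "a : A" for a using that A(2) by blast
 have pB: "\<pi> ` A <= BH" using pi_BH AM by blast
 have pa: "adj y : \<pi> ` A" if "y : \<pi> ` A" for y using that by (auto simp: pi_adj[symmetric] AM vn_adj[OF A(1)])
 define R where "R = commutant (commutant (\<pi> ` A))"
 have vR: "von_neumann_algebra R"
  unfolding R_def by (rule vn_commutant_vn[OF vn_commutant[OF pB pa]])
 have "EX x:A. \<pi> x = T" if T: "T : R" for T
 proof (rule vn_unitary_induct[OF vR T])
  fix u assume u: "u : R" "adj u ** u = Id"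
  have uB: "u : BH" by (rule vn_inBH[OF vR u(1)])
  \<comment> \<open>Here only the action of \<open>A\<close> is intertwined, so \<open>IA\<close> is
    stable under the commutant of \<open>A\<close> and contains the intertwiners of
    \<open>M\<close>.\<close>
  define IA :: "('k \<Rightarrow>\<^sub>L 'h) set" where
   "IA = {S. (ALL c v. blinfun_apply S (c *C v) = c *C S v) & (ALL x:A. ALL v. S (\<pi> x v) = blinfun_apply x (S v))}"
  have IA: "intertwiners <= IA" using AM by (auto simp: IA_def intertwiners_def)
  have cIA: "r ** S : IA" if r: "r : commutant A" and S: "S : IA" for r S
   using S commutant_apply[OF r] BH_apply[OF subsetD[OF commutant_BH r]] by (auto simp: IA_def)
  \<comment> \<open>The adjoint of \<open>S'\<close> composed with \<open>S\<close> commutes with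
    the image of \<open>A\<close>, hence with \<open>u\<close>; then \<open>u\<close> cancels
    against its adjoint.\<close>
  have iso: "cinner (S (u v)) (S' (u w)) = cinner (S v) (S' w)" if S: "S : IA" "S' : IA" for S S' v w
  proof -
   obtain S2 where S2: "!!c y. blinfun_apply S2 (c *C y) = c *C S2 y" "!!x y. cinner (S' x) y = cinner x (S2 y)"
    using ex_adjoint[of S'] S(2) unfolding IA_def by blast
   have S2': "cinner x (S' y) = cinner (S2 x) y" for x y using S2(2) by (metis cinner_commute)
   have i: "S2 (y b) = \<pi> y (S2 b)" if "y : A" for y b
   proof (rule cinner_ext_left)
    fix a
    have "cinner a (S2 (y b)) = cinner (adj y (S' a)) b"
     by (simp add: S2(2)[symmetric] cinner_adj_left CBH AM that)
    also have "adj y (S' a) = S' (\<pi> (adj y) a)" using S(2) vn_adj[OF A(1) that] by (simp add: IA_def)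
    also have "cinner (S' (\<pi> (adj y) a)) b = cinner a (\<pi> y (S2 b))"
     by (simp add: S2(2) pi_adj AM that cinner_adj_left pi_BH)
    finally show "cinner a (S2 (y b)) = cinner a (\<pi> y (S2 b))" .
   qed
   have "S2 ** S : commutant (\<pi> ` A)"
    using S(1) S2(1) i by (intro commutantI) (auto simp: BH_def IA_def intro!: blinfun_eqI)
   hence c: "u ((S2 ** S) v) = (S2 ** S) (u v)" using u(1) commutant_apply unfolding R_def by blast
   have "cinner (S (u v)) (S' (u w)) = cinner (u (S2 (S v))) (u w)" using c by (simp add: S2')
   also have "... = cinner ((adj u ** u) (S2 (S v))) w" by (simp add: cinner_adj_left uB)
   finally show ?thesis by (simp add: u(2) S2')
  qed
  \<comment> \<open>By \<open>iso\<close>, sending \<open>S v\<close> to \<open>S (u v)\<close>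
    preserves inner products. It extends to an operator \<open>x\<close> on the given space that
    commutes with the commutant of \<open>A\<close>.\<close>
  define G0 where "G0 = {(blinfun_apply S v, blinfun_apply S (u v)) | S v. S : IA}"
  have ip: "inner (snd g) (snd h) = inner (fst g) (fst h)" if "g : G0" "h : G0" for g h
   using that iso by (auto simp: G0_def inner_eq_Re_cinner)
  have ip1: "inner (snd g) (snd h) = inner (fst g) (fst h)" if h: "h : G0" and g: "g : span G0" for g h
   using g by (induction rule: span_induct) (auto simp: subspace_def inner_add_left ip h)
  have ip2: "inner (snd g) (snd h) = inner (fst g) (fst h)" if g: "g : span G0" and h: "h : span G0" for g h
   using h by (induction rule: span_induct) (auto simp: subspace_def inner_add_right ip1 g)
  have fst: "fst ` span G0 = span (fst ` G0)"
   by (rule linear_span_image[symmetric]) (auto intro: linearI)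
  define X where "X = {blinfun_apply S \<zeta> | S \<zeta>. S : IA}"
  have fX: "fst ` G0 = X" by (force simp: G0_def X_def)
  have Xd: "closure (span X) = UNIV"
  proof -
   have "{blinfun_apply S \<zeta> | S \<zeta>. S : intertwiners} <= X" using IA by (auto simp: X_def)
   from closure_mono[OF span_mono[OF this]] show ?thesis using intertwiners_dense by auto
  qed
  have nb: "norm b <= 1 * norm a" if "(a, b) : span G0" for a b
   using ip2[OF that that] by (simp add: norm_eq_sqrt_inner)
  obtain x where x: "ALL (a, b):span G0. blinfun_apply x a = b"
   using ex_bounded_extension[OF subspace_span[of G0] zero_le_one nb] Xd unfolding fst fX by blast
  have xS: "x (S v) = S (u v)" if "S : IA" for S v
  proof -
   have "(S v, S (u v)) : span G0" using that by (intro span_base) (auto simp: G0_def)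
   thus ?thesis using x by auto
  qed
  have xr: "x ** r = r ** x" if r: "r : commutant A" for r
  proof (rule blinfun_eq_on_span_dense[OF _ Xd])
   fix y assume "y : X"
   then obtain S \<zeta> where y: "y = blinfun_apply S \<zeta>" "S : IA" by (auto simp: X_def)
   show "(x ** r) y = (r ** x) y" using xS[OF cIA[OF r y(2)]] xS[OF y(2)] by (simp add: y(1))
  qed
  have "x : BH" unfolding BH_def
  proof (intro CollectI allI)
   fix c v
   have "cscale c Id : commutant A" by (intro commutant_cscale vn_BH[OF A(1)]) simp
   from arg_cong[OF xr[OF this], of "%f. blinfun_apply f v"] show "x (c *C v) = c *C x v" by (simp add: cscale_apply)
  qed
  hence "x : commutant (commutant A)" by (rule commutantI) (rule xr)
  hence xA: "x : A" by (simp add: vn_bicommutant[OF A(1)])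
  have "\<pi> x v = u v" for v
  proof -
   have "\<pi> x v - u v = 0"
   proof (rule intertwiners_separating)
    fix S assume S: "S : intertwiners"
    hence "S (\<pi> x v) = x (S v)" using AM[OF xA] by (simp add: intertwiners_def)
    thus "S (\<pi> x v - u v) = 0" using xS S IA by (auto simp: blinfun.diff_right)
   qed
   thus ?thesis by simp
  qed
  thus "EX x:A. \<pi> x = u" using xA by (intro bexI[of _ x] blinfun_eqI) auto
 next
  fix S T assume "EX x:A. \<pi> x = S" "EX x:A. \<pi> x = T"
  then obtain x y where xy: "x : A" "y : A" "S = \<pi> x" "T = \<pi> y" by blast
  thus "EX x:A. \<pi> x = S + T" by (intro bexI[of _ "x + y"]) (auto simp: pi_add AM vn_add[OF A(1)])
 next
  fix c S assume "EX x:A. \<pi> x = S"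
  then obtain x where xy: "x : A" "S = \<pi> x" by blast
  thus "EX x:A. \<pi> x = cscale c S" by (intro bexI[of _ "cscale c x"]) (auto simp: pi_cscale AM vn_cscale[OF A(1)])
 qed
 hence "R <= \<pi> ` A" by blast
 moreover have "\<pi> ` A <= R" unfolding R_def by (rule subset_bicommutant[OF pB])
 ultimately show ?thesis unfolding von_neumann_algebra_def R_def using pB pa by auto
qed

end

lemma star_subalgebra_vn: "von_neumann_algebra M ==> star_subalgebra M"
 unfolding star_subalgebra_def using vn_BH by (auto intro: vn_intros)

lemma
 assumes "star_subalgebra N"
 shows sub_BH: "x : N ==> x : BH" and sub_id: "Id : N" and sub_adj: "x : N ==> adj x : N"
  and sub_add: "x : N ==> y : N ==> x + y : N" and sub_compose: "x : N ==> y : N ==> x ** y : N"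
  and sub_cscale: "x : N ==> cscale c x : N"
 using assms unfolding star_subalgebra_def by blast+

context factor_gns
begin

lemma standard_rep_pi:
 assumes "!!x. x : M ==> vn_trace M x = \<tau> x"
 shows "standard_rep M \<pi> (\<iota> Id)"
proof -
 have "{blinfun_apply (\<pi> x) (\<iota> Id) | x. x : M} = \<iota> ` M"
  unfolding setcompr_eq_image by (auto simp: pi_iota C_id intro!: image_cong)
 thus ?thesis
  unfolding standard_rep_def
  using assms dense by (auto simp: pi_BH pi_add pi_compose pi_cscale pi_adj pi_id pi_vector_state)
qed

lemma pi_factor: assumes A: "factor A" "A <= M" shows "factor (\<pi> ` A)"
proof (rule factorI[OF pi_vn[OF factor_vn[OF A(1)] A(2)]])
 fix y assume y: "y : \<pi> ` A" "y : commutant (\<pi> ` A)"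
 then obtain x where x: "x : A" "y = \<pi> x" by blast
 have "x : commutant A"
 proof (rule commutantI)
  show "x : BH" using x A CBH by blast
  fix a assume a: "a : A"
  have "\<pi> (x ** a) = \<pi> (a ** x)" using commutantD[OF y(2), of "\<pi> a"] a x A by (simp add: pi_compose subsetD[OF A(2)])
  thus "x ** a = a ** x" by (rule pi_inject[rotated 2]) (use a x A in "auto intro!: C_compose")
 qed
 then obtain c where "x = cscale c Id" using factor_center[OF A(1) x(1)] by blast
 thus "EX c. y = cscale c Id" by (auto simp: x(2) pi_cscale C_id pi_id)
qed

end

section \<open>Transport along unitary and anti-unitary symmetries\<close>

definition cj :: "'a :: chilbert_space op => 'a op => 'a op" where
 "cj U x = U ** x ** adj U"

lemma unitary_adj: "U : unitaries BH ==> adj U : unitaries BH"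
 by (simp add: unitaries_def)

context
 fixes U :: "'a :: chilbert_space op"
 assumes U: "U : unitaries BH"
begin

lemma unitary_simps: "U : BH" "adj U ** U = Id" "U ** adj U = Id"
 "adj U ** (U ** x) = x" "U ** (adj U ** x) = x"
 using U by (simp_all add: unitaries_def flip: oL_assoc)

lemma cj_BH: "x : BH ==> cj U x : BH"
 and cj_add: "cj U (x + y) = cj U x + cj U y"
 and cj_diff: "cj U (x - y) = cj U x - cj U y"
 and cj_compose: "cj U (x ** y) = cj U x ** cj U y"
 and cj_cscale: "cj U (cscale c x) = cscale c (cj U x)"
 and cj_adj: "x : BH ==> cj U (adj x) = adj (cj U x)"
 and cj_id: "cj U Id = Id"
 and cj_zero: "cj U 0 = 0"
 by (simp_all add: cj_def oL_simps adj_compose BH_intros unitary_simps oL_cscale_left oL_cscale_right)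

lemma cj_inverse: "cj (adj U) (cj U x) = x" "cj U (cj (adj U) x) = x"
 by (simp_all add: cj_def oL_assoc unitary_simps)

lemma cj_inverse_image: "cj (adj U) ` cj U ` N = N" "cj U ` cj (adj U) ` N = N"
 by (simp_all add: image_image cj_inverse)

lemma cj_apply: "cj U x v = U (x (adj U v))"
 by (simp add: cj_def)

lemma cj_positive: "positive_op x ==> positive_op (cj U x)"
 using positive_conj[of x "adj U"] by (simp add: cj_def oL_assoc unitary_simps)

end

lemma cj_positive_iff: "U : unitaries BH ==> positive_op (cj U x) \<longleftrightarrow> positive_op x"
 by (metis cj_inverse(1) cj_positive unitary_adj)

lemma cj_le_iff: "U : unitaries BH ==> cj U x \<sqsubseteq> cj U y \<longleftrightarrow> x \<sqsubseteq> y"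
 by (simp add: op_le_def cj_diff[symmetric] cj_positive_iff)

text \<open>\<open>\<kappa>\<close> admits complex-linear and conjugate-linear symmetries, so that
  conjugation by a unitary and by the modular conjugation share the same transfer lemmas.\<close>

locale op_symmetry =
 fixes \<Phi> \<Psi> :: "'a :: chilbert_space op => 'a op" and \<kappa> :: "complex => complex"
 assumes inverse: "\<Psi> (\<Phi> x) = x" "\<Phi> (\<Psi> x) = x" and kappa: "\<kappa> = (%c. c) | \<kappa> = cnj"
  and BH: "x : BH ==> \<Phi> x : BH" "x : BH ==> \<Psi> x : BH" and id: "\<Phi> Id = Id"
  and add: "\<Phi> (x + y) = \<Phi> x + \<Phi> y" and compose: "\<Phi> (x ** y) = \<Phi> x ** \<Phi> y"
  and cscale: "\<Phi> (cscale c x) = cscale (\<kappa> c) (\<Phi> x)" and adj: "x : BH ==> \<Phi> (adj x) = adj (\<Phi> x)"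
  and le: "\<Phi> x \<sqsubseteq> \<Phi> y \<longleftrightarrow> x \<sqsubseteq> y"
begin

lemma symmetric: "op_symmetry \<Psi> \<Phi> \<kappa>"
proof -
 have c: "\<Psi> (cscale c x) = cscale (\<kappa> c) (\<Psi> x)" for c x
  using kappa inverse cscale[of "\<kappa> c" "\<Psi> x"] by (metis complex_cnj_cnj)
 have "\<Psi> Id = Id" "\<Psi> (x + y) = \<Psi> x + \<Psi> y" "\<Psi> (x ** y) = \<Psi> x ** \<Psi> y" "\<Psi> x \<sqsubseteq> \<Psi> y \<longleftrightarrow> x \<sqsubseteq> y" for x y
  by (metis inverse id add compose le)+
 moreover have "\<Psi> (adj x) = adj (\<Psi> x)" if "x : BH" for x using adj[OF BH(2)[OF that]] inverse by metis
 ultimately show ?thesis unfolding op_symmetry_def using inverse kappa BH c by blast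
qed

lemma eq_iff: "\<Phi> x = \<Phi> y \<longleftrightarrow> x = y"
 by (metis inverse(1))

lemma zero: "\<Phi> 0 = 0"
 using add[of 0 0] by simp

lemma commutant_image: "commutant (\<Phi> ` N) = \<Phi> ` commutant N"
proof -
 have 1: "\<Phi>' ` commutant N <= commutant (\<Phi>' ` N)" if "op_symmetry \<Phi>' \<Psi>' \<kappa>" for \<Phi>' \<Psi>' N
 proof -
  interpret s: op_symmetry \<Phi>' \<Psi>' \<kappa> by fact
  have "\<Phi>' S ** \<Phi>' y = \<Phi>' y ** \<Phi>' S" if "S : commutant N" "y : N" for S y
   using commutantD[OF that] by (metis s.compose)
  thus ?thesis using subsetD[OF commutant_BH, of _ N] s.BH by (auto intro!: commutantI)
 qed
 have "\<Psi> ` commutant (\<Phi> ` N) <= commutant N" using 1[OF symmetric, of "\<Phi> ` N"] by (simp add: image_image inverse)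
 from image_mono[OF this, of \<Phi>] show ?thesis using 1[OF op_symmetry_axioms, of N] by (simp add: image_image inverse)
qed

lemma vn_image: "von_neumann_algebra N ==> von_neumann_algebra (\<Phi> ` N)"
 unfolding von_neumann_algebra_def by (auto simp: commutant_image BH adj[symmetric] subset_iff)

lemma factor_image:
 assumes N: "factor N"
 shows "factor (\<Phi> ` N)"
proof (rule factorI[OF vn_image[OF factor_vn[OF N]]])
 fix x assume "x : \<Phi> ` N" "x : commutant (\<Phi> ` N)"
 then obtain a where a: "a : N" "a : commutant N" "x = \<Phi> a" unfolding commutant_image by (auto simp: eq_iff)
 thus "EX c. x = cscale c Id" using factor_center[OF N a(1,2)] by (auto simp: cscale id)
qed

lemma self_adjoints_image: "N <= BH ==> self_adjoints (\<Phi> ` N) = \<Phi> ` self_adjoints N"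
 by (force simp: self_adjoints_def adj[symmetric] eq_iff)

lemma up_directed_image: "up_directed D ==> up_directed (\<Phi> ` D)"
 unfolding up_directed_def by (simp add: le)

lemma lub_in_image: "N <= BH ==> lub_in N D s ==> lub_in (\<Phi> ` N) (\<Phi> ` D) (\<Phi> s)"
 unfolding lub_in_def by (simp add: self_adjoints_image le)

lemma nft_image:
 assumes N: "N <= BH" and \<tau>: "nf_tracial_state N \<tau>"
 shows "nf_tracial_state (\<Phi> ` N) (%x. \<kappa> (\<tau> (\<Psi> x)))"
proof -
 interpret s: op_symmetry \<Psi> \<Phi> \<kappa> by (rule symmetric)
 have k: "\<kappa> (a + b) = \<kappa> a + \<kappa> b" "\<kappa> (a * b) = \<kappa> a * \<kappa> b" "\<kappa> 1 = 1" "Re (\<kappa> a) = Re a" "Im (\<kappa> a) = 0 \<longleftrightarrow> Im a = 0"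
  "\<kappa> a = 0 \<longleftrightarrow> a = 0" "\<kappa> (\<kappa> a) = a" for a b
  using kappa by auto
 have sup: "Re (\<tau> (\<Psi> s)) = (SUP d\<in>D. Re (\<tau> (\<Psi> d)))"
  if D: "D <= self_adjoints (\<Phi> ` N)" "up_directed D" "lub_in (\<Phi> ` N) D s" for D s
 proof -
  have B: "\<Phi> ` N <= BH" using N BH by blast
  have 1: "\<Psi> ` D <= self_adjoints N" using D(1) unfolding self_adjoints_image[OF N] using inverse(1) by auto
  have "lub_in N (\<Psi> ` D) (\<Psi> s)" using s.lub_in_image[OF B D(3)] by (simp add: image_image inverse)
  from nft_SUP[OF \<tau> 1 s.up_directed_image[OF D(2)] this] show ?thesis by (simp add: image_image)
 qed
 have B: "x : N ==> x : BH" for x using N by blast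
 show ?thesis
  unfolding nf_tracial_state_def k
 proof (intro conjI)
  show "ALL x:\<Phi> ` N. \<tau> (\<Psi> (adj x ** x)) = 0 --> x = 0"
   using nft_faithful[OF \<tau>] by (auto simp: adj[symmetric] compose[symmetric] inverse B) (metis zero)
 qed (use sup nft_pos[OF \<tau>] in "auto simp: add[symmetric] compose[symmetric] cscale[symmetric] k s.cscale s.id s.compose
    adj[symmetric] inverse B nft_add[OF \<tau>] nft_cscale[OF \<tau>] nft_id[OF \<tau>] nft_comm[OF \<tau>]")
qed

end

lemma cj_symmetry: "U : unitaries BH ==> op_symmetry (cj U) (cj (adj U)) (%c. c)"
 by standard (auto simp: cj_inverse cj_BH cj_add cj_compose cj_cscale cj_adj cj_id cj_le_iff unitary_adj)

lemmas commutant_cj_image = op_symmetry.commutant_image[OF cj_symmetry]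
lemmas vn_cj_image = op_symmetry.vn_image[OF cj_symmetry]
lemmas factor_cj_image = op_symmetry.factor_image[OF cj_symmetry]
lemmas nft_cj_image = op_symmetry.nft_image[OF cj_symmetry]

lemma finite_factor_cj_image:
 assumes U: "U : unitaries BH" and N: "finite_factor N"
 shows "finite_factor (cj U ` N)"
 using N factor_cj_image[OF U] nft_cj_image[OF U vn_BH[OF factor_vn]] unfolding finite_factor_def by blast

lemma finite_factor_cj_image_iff:
 assumes U: "U : unitaries BH"
 shows "finite_factor (cj U ` N) \<longleftrightarrow> finite_factor N"
 using finite_factor_cj_image[OF U, of N] finite_factor_cj_image[OF unitary_adj[OF U], of "cj U ` N"]
 by (auto simp: cj_inverse_image[OF U])

lemma vn_trace_cj:
 assumes U: "U : unitaries BH" and N: "finite_factor N" and x: "x : N"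
 shows "vn_trace (cj U ` N) (cj U x) = vn_trace N x"
proof -
 obtain \<tau> where \<tau>: "nf_tracial_state N \<tau>" and F: "factor N" using N by (auto simp: finite_factor_def)
 show ?thesis
  using vn_trace_nft(2)[OF factor_cj_image[OF U F] nft_cj_image[OF U vn_BH[OF factor_vn[OF F]] \<tau>], of "cj U x"]
   vn_trace_nft(2)[OF F \<tau> x] x by (simp add: cj_inverse[OF U])
qed

section \<open>Cyclic projections, and independence of the index from the representation\<close>

abbreviation orbit :: "'a op set => 'a => 'a :: chilbert_space set" where
 "orbit N \<xi> \<equiv> {blinfun_apply x \<xi> | x. x : N}"

lemma cyclic_proj:
 assumes N: "star_subalgebra N"
 shows "is_proj (cyclic_proj N \<xi>)" "cyclic_proj N \<xi> : commutant N"
  "range (cyclic_proj N \<xi>) = closure (orbit N \<xi>)" "cyclic_proj N \<xi> \<xi> = \<xi>"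
proof -
 let ?V = "orbit N \<xi>"
 have cs: "csubspace ?V"
 proof (rule csubspaceI)
  show "0 : ?V" using sub_cscale[OF N sub_id[OF N], of 0] by force
  show "a + b : ?V" if "a : ?V" "b : ?V" for a b using that sub_add[OF N] by clarsimp (metis blinfun.add_left)
  show "c *C a : ?V" if "a : ?V" for c a using that sub_cscale[OF N] by clarsimp (metis cscale_apply)
 qed
 note V = csubspace_closure[OF cs] closed_closure[of ?V]
 show "is_proj (cyclic_proj N \<xi>)" unfolding cyclic_proj_def by (rule is_proj_prj[OF V])
 show "range (cyclic_proj N \<xi>) = closure ?V" unfolding cyclic_proj_def by (rule range_prj[OF V])
 have "\<xi> : ?V" using sub_id[OF N] by force
 thus "cyclic_proj N \<xi> \<xi> = \<xi>" unfolding cyclic_proj_def by (intro prj_fix[OF V] closure_subset[THEN subsetD])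
 show "cyclic_proj N \<xi> : commutant N"
  unfolding cyclic_proj_def
 proof (rule prj_in_commutant[OF V _ sub_adj[OF N]])
  show "N <= BH" using sub_BH[OF N] by blast
  fix a v assume a: "a : N" and v: "v : closure ?V"
  have "a ` closure ?V <= closure ?V"
  proof (rule image_closure_subset)
   have "a ` ?V <= ?V" using sub_compose[OF N a] by auto (metis oL_apply)
   thus "a ` ?V <= closure ?V" using closure_subset by blast
  qed (auto intro!: cont_blinfun)
  thus "a v : closure ?V" using v by blast
 qed
qed

lemma cyclic_proj_fixI: "star_subalgebra N ==> x : N ==> cyclic_proj N \<xi> (blinfun_apply x \<xi>) = blinfun_apply x \<xi>"
 using cyclic_proj(2,4)[of N \<xi>] commutant_apply[of "cyclic_proj N \<xi>" N x \<xi>] by simp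

lemma cyclic_proj_cj_image:
 assumes U: "U : unitaries BH" and N: "von_neumann_algebra N"
 shows "cyclic_proj (cj U ` N) \<xi> = cj U (cyclic_proj N (adj U \<xi>))"
proof -
 let ?P = "cyclic_proj N (adj U \<xi>)"
 note P = cyclic_proj[OF star_subalgebra_vn[OF N], of "adj U \<xi>"]
 note vn = star_subalgebra_vn[OF vn_cj_image[OF U N]]
 have UB: "U : BH" by (rule unitary_simps(1)[OF U])
 have inv: "adj U (U v) = v" "U (adj U v) = v" for v
  using unitary_simps(2,3)[OF U] by (metis oL_apply id_blinfun.rep_eq id_apply)+
 have img: "orbit (cj U ` N) \<xi> = U ` orbit N (adj U \<xi>)"
  by (simp add: cj_apply[OF U] setcompr_eq_image image_image)
 have iso: "norm (U v) = norm v" for v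
  using norm_apply_sq[OF UB, of v] unitary_simps(2)[OF U] by (simp add: Re_cinner_self)
 have "closure (U ` S) = U ` closure S" for S
 proof
  have c: "(f :: 'a op) ` closure S <= closure (f ` S)" for f S
   by (rule image_closure_subset) (auto intro!: cont_blinfun closure_subset)
  thus "U ` closure S <= closure (U ` S)" .
  have "adj U ` closure (U ` S) <= closure S" using c[of "adj U" "U ` S"] by (simp add: image_image inv)
  hence "U ` adj U ` closure (U ` S) <= U ` closure S" by (rule image_mono)
  thus "closure (U ` S) <= U ` closure S" by (simp add: image_image inv)
 qed
 hence r: "range (cyclic_proj (cj U ` N) \<xi>) = U ` range ?P"
  unfolding cyclic_proj(3)[OF vn] P(3) img by simp
 have "is_proj (cj U ?P)"
  using is_projD[OF P(1)] by (simp add: is_proj_def cj_BH[OF U] cj_compose[OF U, symmetric] cj_adj[OF U, symmetric])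
 moreover have "range (cj U ?P) = U ` range ?P"
 proof -
  have "range (adj U) = UNIV" using inv(1) by (metis surjI)
  hence "(%v. ?P (adj U v)) ` UNIV = range ?P" by (metis image_image)
  hence "U ` (%v. ?P (adj U v)) ` UNIV = U ` range ?P" by (rule arg_cong)
  moreover have "blinfun_apply (cj U ?P) = (%v. U (?P (adj U v)))" by (rule ext) (rule cj_apply[OF U])
  ultimately show ?thesis by (simp only: image_image)
 qed
 ultimately show ?thesis using is_proj_range_eq[OF cyclic_proj(1)[OF vn]] r by simp
qed

lemma vn_dim_cj_image:
 assumes U: "U : unitaries BH" and N: "finite_factor N"
 shows "vn_dim (cj U ` N) = vn_dim N"
proof (cases "finite_factor (commutant N)")
 case True
 have vN: "von_neumann_algebra N" using N factor_vn by (auto simp: finite_factor_def)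
 note vN' = vn_commutant_vn[OF vN]
 have e: "Re (vn_trace (cj U ` N) (cyclic_proj (cj U ` commutant N) \<xi>)) / Re (vn_trace (cj U ` commutant N) (cyclic_proj (cj U ` N) \<xi>))
  = Re (vn_trace N (cyclic_proj (commutant N) (adj U \<xi>))) / Re (vn_trace (commutant N) (cyclic_proj N (adj U \<xi>)))" for \<xi>
  using cyclic_proj(2)[OF star_subalgebra_vn[OF vN], of "adj U \<xi>"] cyclic_proj(2)[OF star_subalgebra_vn[OF vN'], of "adj U \<xi>"]
  by (simp add: cyclic_proj_cj_image[OF U] vN vN' vn_trace_cj[OF U N] vn_trace_cj[OF U True] vn_bicommutant[OF vN])
 have inv: "adj U (U v) = v" "U (adj U v) = v" for v
  using unitary_simps(2,3)[OF U] by (metis oL_apply id_blinfun.rep_eq id_apply)+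
 \<comment> \<open>The substitution of \<open>adj U \<xi>\<close> for \<open>\<xi>\<close> permutes
   the nonzero vectors over which the definite description quantifies.\<close>
 have r: "(ALL \<xi>. \<xi> ~= 0 --> P (adj U \<xi>)) \<longleftrightarrow> (ALL \<xi>. \<xi> ~= 0 --> P \<xi>)" for P
  by (metis inv blinfun.zero_right)
 show ?thesis
  unfolding vn_dim_def commutant_cj_image[OF U] finite_factor_cj_image_iff[OF U] e
  using r[of "%\<xi>. _ = Re (vn_trace N (cyclic_proj (commutant N) \<xi>)) / Re (vn_trace (commutant N) (cyclic_proj N \<xi>))"] by simp
qed (simp add: vn_dim_def commutant_cj_image[OF U] finite_factor_cj_image_iff[OF U])

text \<open>In both representations the inner product of the vectors of \<open>x\<close> and
  \<open>y\<close> is the trace of \<open>adj y ** x\<close>, so matching these vectors is isometric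
  between dense subspaces.\<close>

lemma standard_rep_unitary_equivalent:
 fixes \<pi> \<pi>' :: "'h :: chilbert_space op => 'k :: chilbert_space op"
 assumes M: "von_neumann_algebra M" and s: "standard_rep M \<pi> \<Omega>" and s': "standard_rep M \<pi>' \<Omega>'"
 shows "EX U:unitaries BH. ALL x:M. \<pi>' x = cj U (\<pi> x)"
proof -
 note MI = vn_intros[OF M]
 have ip: "cinner (\<pi> x \<Omega>) (\<pi> y \<Omega>) = vn_trace M (adj y ** x)" if "standard_rep M \<pi> \<Omega>" "x : M" "y : M"
  for \<pi> :: "'h op => 'k op" and \<Omega> x y
 proof -
  note S = that(1)[unfolded standard_rep_def]
  have "cinner (\<pi> x \<Omega>) (\<pi> y \<Omega>) = cinner ((adj (\<pi> y) ** \<pi> x) \<Omega>) \<Omega>" using S that by (simp add: cinner_adj_left)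
  also have "adj (\<pi> y) ** \<pi> x = \<pi> (adj y ** x)" using S that MI(9) by simp
  finally have "cinner (\<pi> x \<Omega>) (\<pi> y \<Omega>) = cinner (\<pi> (adj y ** x) \<Omega>) \<Omega>" .
  moreover have "adj y ** x : M" using that by (intro MI)
  ultimately show ?thesis using S by simp
 qed
 have ex: "EX W:BH. ALL x:M. blinfun_apply W (\<pi> x \<Omega>) = \<pi>' x \<Omega>'"
  if s: "standard_rep M \<pi> \<Omega>" and s': "standard_rep M \<pi>' \<Omega>'" for \<pi> \<pi>' :: "'h op => 'k op" and \<Omega> \<Omega>'
 proof -
  note S = s[unfolded standard_rep_def] and S' = s'[unfolded standard_rep_def]
  have sc: "\<pi> (r *R x) = r *R \<pi> x" "\<pi>' (r *R x) = r *R \<pi>' x" if "x : M" for r x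
   using S S' that cscale_of_real[of r] by metis+
  have n: "norm (\<pi>' x \<Omega>') = norm (\<pi> x \<Omega>)" if x: "x : M" for x
  proof -
   have "(norm (\<pi>' x \<Omega>'))^2 = (norm (\<pi> x \<Omega>))^2"
    using ip[OF s x x] ip[OF s' x x] by (simp flip: Re_cinner_self)
   thus ?thesis by (metis norm_ge_zero power2_eq_imp_eq)
  qed
  have "EX W. ALL x:M. blinfun_apply W (\<pi> x \<Omega>) = \<pi>' x \<Omega>'"
  proof (rule ex_blinfun_on_image[OF vn_subspace[OF M], where C = 1])
   show "closure ((%x. \<pi> x \<Omega>) ` M) = UNIV" using S by (simp add: setcompr_eq_image)
  qed (use S S' n in "auto simp: sc blinfun.add_left blinfun.scaleR_left")
  then obtain W where W': "!!x. x : M ==> blinfun_apply W (\<pi> x \<Omega>) = \<pi>' x \<Omega>'" by blast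
  have "W : BH"
  proof (rule BH_dense)
   show "closure {blinfun_apply (\<pi> x) \<Omega> | x. x : M} = UNIV" using S by blast
   fix c v assume "v : {blinfun_apply (\<pi> x) \<Omega> | x. x : M}"
   then obtain x where x: "v = \<pi> x \<Omega>" "x : M" by blast
   have "\<pi> (cscale c x) = cscale c (\<pi> x)" "\<pi>' (cscale c x) = cscale c (\<pi>' x)" using S S' x(2) by auto
   thus "W (c *C v) = c *C W v"
    using W'[OF vn_cscale[OF M x(2), of c]] W'[OF x(2)] by (simp add: x(1) cscale_apply)
  qed
  thus ?thesis using W' by blast
 qed
 note S = s[unfolded standard_rep_def] and S' = s'[unfolded standard_rep_def]
 obtain U where U: "U : BH" "!!x. x : M ==> U (\<pi> x \<Omega>) = \<pi>' x \<Omega>'" using ex[OF s s'] by blast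
 obtain V where V: "V : BH" "!!x. x : M ==> V (\<pi>' x \<Omega>') = \<pi> x \<Omega>" using ex[OF s' s] by blast
 have d: "closure {blinfun_apply (\<pi> x) \<Omega> | x. x : M} = UNIV" "closure {blinfun_apply (\<pi>' x) \<Omega>' | x. x : M} = UNIV"
  using S S' by blast+
 have VU: "V ** U = Id" by (rule blinfun_eq_on_dense[OF _ d(1)]) (auto simp: U V)
 have UV: "U ** V = Id" by (rule blinfun_eq_on_dense[OF _ d(2)]) (auto simp: U V)
 have aU: "adj U = V"
 proof (rule adj_eqI)
  have "cinner (U v) (U w) = cinner v w" for v w
  proof -
   have "cinner ((adj U ** U) v) w = cinner v (Id w)"
   proof (rule cinner_eq_dense[OF _ d(1)])
    fix a b assume "a : {blinfun_apply (\<pi> x) \<Omega> | x. x : M}" "b : {blinfun_apply (\<pi> x) \<Omega> | x. x : M}"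
    then obtain x y where "a = \<pi> x \<Omega>" "b = \<pi> y \<Omega>" "x : M" "y : M" by blast
    thus "cinner ((adj U ** U) a) b = cinner a (Id b)"
     using ip[OF s, of x y] ip[OF s', of x y] by (simp add: cinner_adj_left U)
   qed
   thus ?thesis by (simp add: cinner_adj_left U)
  qed
  moreover have "U (V y) = y" for y using UV by (metis oL_apply id_blinfun.rep_eq id_apply)
  ultimately show "cinner (U x) y = cinner x (V y)" for x y by metis
 qed
 have un: "U : unitaries BH" using U(1) VU UV by (simp add: unitaries_def aU)
 have "\<pi>' x = cj U (\<pi> x)" if x: "x : M" for x
 proof (rule blinfun_eq_on_dense[OF _ d(2)])
  fix v assume "v : {blinfun_apply (\<pi>' x) \<Omega>' | x. x : M}"
  then obtain y where y: "v = \<pi>' y \<Omega>'" "y : M" by blast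
  have "\<pi>' x v = \<pi>' (x ** y) \<Omega>'" using S' x y by simp
  also have "... = U (\<pi> (x ** y) \<Omega>)" using U(2) vn_compose[OF M x y(2)] by simp
  also have "... = cj U (\<pi> x) v" using S x y V(2) by (simp add: cj_apply[OF un] aU)
  finally show "\<pi>' x v = cj U (\<pi> x) v" .
 qed
 thus ?thesis using un by blast
qed

lemma jones_index_eq:
 fixes \<pi> :: "'h :: chilbert_space op => ell2 op"
 assumes M: "von_neumann_algebra M" and s: "standard_rep M \<pi> \<Omega>" and A: "A <= M" "finite_factor (\<pi> ` A)"
 shows "jones_index M A = vn_dim (\<pi> ` A)"
 unfolding jones_index_def
proof (rule the_equality)
 show "EX (\<pi>' :: 'h op => ell2 op) \<Omega>. standard_rep M \<pi>' \<Omega> & vn_dim (\<pi> ` A) = vn_dim (\<pi>' ` A)" using s by blast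
 fix d assume "EX (\<pi> :: 'h op => ell2 op) \<Omega>. standard_rep M \<pi> \<Omega> & d = vn_dim (\<pi> ` A)"
 then obtain \<pi>' :: "'h op => ell2 op" and \<Omega>' where s': "standard_rep M \<pi>' \<Omega>'" and d: "d = vn_dim (\<pi>' ` A)" by blast
 obtain U where U: "U : unitaries BH" "ALL x:M. \<pi>' x = cj U (\<pi> x)"
  using standard_rep_unitary_equivalent[OF M s s'] by blast
 have "\<pi>' ` A = cj U ` \<pi> ` A" using U(2) A(1) by (force simp: image_image)
 thus "d = vn_dim (\<pi> ` A)" using vn_dim_cj_image[OF U(1) A(2)] d by simp
qed

section \<open>The standard form\<close>

text \<open>A vector \<open>\<eta>\<close> that is bounded relative to \<open>\<zeta>\<close> is the image of \<open>\<zeta>\<close> under an operator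
 in the commutant.\<close>

lemma ex_commutant_of_bounded:
 fixes \<zeta> \<eta> :: "'a :: chilbert_space"
 assumes R: "von_neumann_algebra R" and C: "0 <= C" "!!x. x : R ==> norm (blinfun_apply x \<eta>) <= C * norm (x \<zeta>)"
 shows "EX y:commutant R. blinfun_apply y \<zeta> = \<eta> & y ** cyclic_proj R \<zeta> = y"
proof -
 define p where "p = cyclic_proj R \<zeta>"
 note P = cyclic_proj[OF star_subalgebra_vn[OF R], of \<zeta>, folded p_def]
 note pP = is_projD[OF P(1)]
 note RI = vn_intros[OF R]
 have px: "p (x \<zeta>) = x \<zeta>" if "x : R" for x using commutant_apply[OF P(2) that, of \<zeta>] P(4) by simp
 \<comment> \<open>Vectors \<open>x \<zeta>\<close> plus vectors of the orthogonal complement of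
   their closure; the operator is to send \<open>x \<zeta>\<close> to \<open>x \<eta>\<close> and to
   vanish on the complement.\<close>
 define f where "f z = blinfun_apply (fst z) \<zeta> + (snd z - p (snd z))" for z :: "'a op \<times> 'a"
 define g where "g z = blinfun_apply (fst z) \<eta>" for z :: "'a op \<times> 'a"
 have bd: "norm (g z) <= C * norm (f z)" if z: "z : R \<times> UNIV" for z
 proof -
  have "p (f z) = fst z \<zeta>" using z px by (auto simp: f_def blinfun.add_right blinfun.diff_right pP(4))
  hence "norm (fst z \<zeta>) <= norm (f z)" using is_proj_norm_le[OF P(1), of "f z"] by simp
  hence "C * norm (fst z \<zeta>) <= C * norm (f z)" using C(1) by (rule mult_left_mono)
  moreover have "norm (g z) <= C * norm (fst z \<zeta>)" using C(2)[of "fst z"] z by (auto simp: g_def)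
  ultimately show ?thesis by simp
 qed
 have d: "closure (f ` (R \<times> UNIV)) = UNIV"
 proof (rule closure_eq_UNIV_if_orthogonal)
  show "csubspace (f ` (R \<times> UNIV))"
  proof (rule csubspaceI)
   show "0 : f ` (R \<times> UNIV)" by (rule image_eqI[of _ _ "(0, 0)"]) (auto simp: f_def RI)
   show "a + b : f ` (R \<times> UNIV)" if ab: "a : f ` (R \<times> UNIV)" "b : f ` (R \<times> UNIV)" for a b
   proof -
    obtain x v y w where "a = f (x, v)" "b = f (y, w)" "x : R" "y : R" using ab by auto
    thus ?thesis
     by (intro image_eqI[of _ _ "(x + y, v + w)"]) (auto simp: f_def RI blinfun.add_left blinfun.add_right)
   qed
   show "c *C a : f ` (R \<times> UNIV)" if a: "a : f ` (R \<times> UNIV)" for c a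
   proof -
    obtain x v where "a = f (x, v)" "x : R" using a by auto
    thus ?thesis
     by (intro image_eqI[of _ _ "(cscale c x, c *C v)"])
      (auto simp: f_def RI cscale_apply scaleC_add_right scaleC_diff_right BH_apply[OF pP(1)])
   qed
  qed
  fix z assume z: "!!v. v : f ` (R \<times> UNIV) ==> cinner z v = 0"
  have z1: "cinner z (x \<zeta>) = 0" if "x : R" for x
   using z[OF imageI[of "(x, 0)"]] that by (simp add: f_def)
  have "p z : closure (orbit R \<zeta>)" using P(3) by blast
  moreover have "closure (orbit R \<zeta>) <= {v. cinner z v = 0}"
   by (rule closure_minimal) (use z1 in "auto intro!: closed_Collect_eq continuous_intros")
  ultimately have "cinner z (p z) = 0" by blast
  moreover have "cinner z (z - p z) = 0"
   using z[OF imageI[of "(0, z)"]] RI(2) by (simp add: f_def)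
  ultimately show "z = 0" by (simp add: cinner_diff_right)
 qed
 have X: "subspace (R \<times> (UNIV :: 'a set))" by (rule subspace_Times[OF vn_subspace[OF R] subspace_UNIV])
 have "EX T. ALL x:R \<times> UNIV. blinfun_apply T (f x) = g x"
  by (rule ex_blinfun_on_image[OF X _ _ _ _ C(1) bd d])
   (auto simp: f_def g_def blinfun.add_left blinfun.add_right blinfun.scaleR_left blinfun.scaleR_right scaleR_diff_right scaleR_add_right)
 then obtain y where y: "!!z. z : R \<times> UNIV ==> blinfun_apply y (f z) = g z" by blast
 have y1: "y (x \<zeta>) = x \<eta>" if "x : R" for x using y[of "(x, 0)"] that by (simp add: f_def g_def)
 have y2: "y v = y (p v)" for v using y[of "(0, v)"] RI(2) by (simp add: f_def g_def blinfun.diff_right)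
 have yr: "y ** r = r ** y" if r: "r : R" for r
 proof (rule blinfun_eq_on_dense[OF _ d])
  fix v assume "v : f ` (R \<times> UNIV)"
  then obtain x w where v: "v = f (x, w)" "x : R" by auto
  have "y (r (w - p w)) = 0" using y2[of "r (w - p w)"] commutant_apply[OF P(2) r] by (simp add: blinfun.diff_right pP(4))
  moreover have "y (w - p w) = 0" using y2[of w] by (simp add: blinfun.diff_right)
  ultimately show "(y ** r) v = (r ** y) v"
   using y1[OF v(2)] y1[OF vn_compose[OF R r v(2)]] by (simp add: v(1) f_def blinfun.add_right)
 qed
 have "y : BH" unfolding BH_def
 proof (intro CollectI allI)
  fix c v
  from arg_cong[OF yr[OF scalar_in_vn[OF R, of c]], of "%h. blinfun_apply h v"]
  show "y (c *C v) = c *C y v" by (simp add: cscale_apply)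
 qed
 hence "y : commutant R" using yr by (intro commutantI)
 moreover have "y \<zeta> = \<eta>" using y1[OF RI(1)] by simp
 moreover have "y ** p = y" using y2 by (intro blinfun_eqI) simp
 ultimately show ?thesis unfolding p_def by blast
qed

locale stdform =
 fixes M :: "'k :: chilbert_space op set" and \<Omega> :: 'k
 assumes factor_M: "factor M" and cyclic: "closure (orbit M \<Omega>) = UNIV" and norm_Om: "norm \<Omega> = 1"
  and separating: "x : M ==> x \<Omega> = 0 ==> x = 0"
  and trace_Om: "x : M ==> y : M ==> cinner (x (y \<Omega>)) \<Omega> = cinner (y (x \<Omega>)) \<Omega>"
begin

lemmas M = factor_vn[OF factor_M]
lemmas MI = vn_intros[OF M]
lemmas MBH = vn_inBH[OF M]

abbreviation \<tau> :: "'k op => complex" where "\<tau> x \<equiv> cinner (blinfun_apply x \<Omega>) \<Omega>"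

lemma nft: "nf_tracial_state M \<tau>"
 unfolding nf_tracial_state_def
 using normal_pos_SUP[OF normal_pos_vector_state[OF M]] separating norm_Om
 by (auto simp: blinfun.add_left cinner_linear cscale_apply cinner_self cinner_adj_left MBH trace_Om)

lemma norm_adj_Om: assumes x: "x : M" shows "norm (adj x \<Omega>) = norm (x \<Omega>)"
proof -
 have "(norm (adj x \<Omega>))^2 = (norm (x \<Omega>))^2"
  using trace_Om[OF x MI(9)[OF x]] by (simp add: Re_cinner_self[symmetric] cinner_adj_left cinner_adj_right MBH x)
 thus ?thesis by simp
qed

text \<open>The modular conjugation. It is conjugate-linear and still an element of the operator
  type, which consists of real-linear maps.\<close>

definition J :: "'k op" where "J = (SOME T. ALL x:M. blinfun_apply T (blinfun_apply x \<Omega>) = adj x \<Omega>)"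

lemma J_Om: "x : M ==> J (x \<Omega>) = adj x \<Omega>"
proof -
 have "EX T. ALL x:M. blinfun_apply T (blinfun_apply x \<Omega>) = adj x \<Omega>"
  by (rule ex_blinfun_on_image[OF vn_subspace[OF M], where C = 1])
   (use cyclic in "auto simp: blinfun.add_left blinfun.scaleR_left adj_simps MBH norm_adj_Om setcompr_eq_image")
 thus "x : M ==> J (x \<Omega>) = adj x \<Omega>" unfolding J_def by (rule someI2_ex) blast
qed

lemma J_Om_self [simp]: "J \<Omega> = \<Omega>"
 using J_Om[OF MI(1)] by simp

lemma J_J [simp]: "J (J v) = v"
proof -
 have "J ** J = Id" by (rule blinfun_eq_on_dense[OF _ cyclic]) (auto simp: J_Om MI MBH)
 thus ?thesis by (metis oL_apply id_blinfun.rep_eq id_apply)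
qed

lemma J_J_compose [simp]: "J ** J = Id" "J ** (J ** x) = x"
 by (rule blinfun_eqI, simp)+

lemma cont: "continuous_on UNIV (blinfun_apply T)"
 by (intro cont_blinfun)

lemma J_scaleC: "J (c *C v) = cnj c *C J v"
proof (rule eq_on_dense[OF _ _ _ cyclic, of "%v. J (c *C v)" "%v. cnj c *C J v"])
 fix w assume "w : orbit M \<Omega>"
 then obtain x where x: "w = blinfun_apply x \<Omega>" "x : M" by blast
 show "J (c *C w) = cnj c *C J w"
  using J_Om[OF vn_cscale[OF M x(2), of c]] by (simp add: cscale_apply x adj_cscale MBH J_Om)
qed (intro continuous_on_compose2[OF cont] continuous_on_compose2[OF cont_scaleC] cont_scaleC cont; simp)+

lemma J_cinner: "cinner (J v) w = cinner (J w) v"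
proof -
 have 1: "cinner (J (x \<Omega>)) w = cinner (J w) (x \<Omega>)" if x: "x : M" for x w
 proof (rule eq_on_dense[OF _ _ _ cyclic, of "%w. cinner (J (x \<Omega>)) w" "%w. cinner (J w) (x \<Omega>)"])
  fix w assume "w : orbit M \<Omega>"
  then obtain y where y: "w = blinfun_apply y \<Omega>" "y : M" by blast
  show "cinner (J (x \<Omega>)) w = cinner (J w) (x \<Omega>)"
   using trace_Om[OF MI(9)[OF y(2)] MI(9)[OF x]] by (simp add: y x J_Om cinner_adj_left cinner_adj_right MBH)
 qed (intro continuous_intros cont)+
 show ?thesis
 proof (rule eq_on_dense[OF _ _ _ cyclic, of "%v. cinner (J v) w" "%v. cinner (J w) v"])
  show "cinner (J v) w = cinner (J w) v" if "v : orbit M \<Omega>" for v using that 1 by blast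
 qed (intro continuous_intros cont)+
qed

lemma J_cinner_right: "cinner v (J w) = cinner w (J v)"
 by (metis J_cinner cinner_commute)

text \<open>A conjugate-linear multiplicative involution that exchanges \<open>M\<close> and its
  commutant.\<close>

definition jj :: "'k op => 'k op" where "jj x = J ** (x ** J)"

lemma jj_apply: "jj x v = J (x (J v))"
 by (simp add: jj_def)

lemma jj_jj [simp]: "jj (jj x) = x"
 by (rule blinfun_eqI) (simp add: jj_apply)

lemma jj_BH: "x : BH ==> jj x : BH"
 by (simp add: BH_def jj_apply J_scaleC)

lemma jj_compose: "jj (x ** y) = jj x ** jj y"
 and jj_add: "jj (x + y) = jj x + jj y" and jj_diff: "jj (x - y) = jj x - jj y"
 and jj_id [simp]: "jj Id = Id" and jj_zero [simp]: "jj 0 = 0"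
 by (rule blinfun_eqI, simp add: jj_apply blinfun.add_left blinfun.add_right blinfun.diff_left blinfun.diff_right)+

lemma jj_cscale: "jj (cscale c x) = cscale (cnj c) (jj x)"
 by (rule blinfun_eqI) (simp add: jj_apply cscale_apply J_scaleC)

lemma jj_adj: "x : BH ==> jj (adj x) = adj (jj x)"
 by (rule sym, rule adj_eqI)
  (simp add: jj_apply J_cinner[of "blinfun_apply x _"] J_cinner_right[of _ "blinfun_apply (adj x) _"] cinner_adj_left)

lemma jj_positive: "positive_op x ==> positive_op (jj x)"
proof -
 have "cinner (jj x v) v = cnj (cinner (x (J v)) (J v))" for v by (metis J_cinner cinner_commute jj_apply)
 thus "positive_op x ==> positive_op (jj x)" by (simp add: positive_op_def jj_BH)
qed

lemma jj_le: "x \<sqsubseteq> y ==> jj x \<sqsubseteq> jj y"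
 using jj_positive[of "y - x"] by (simp add: op_le_def jj_diff)

lemma jj_symmetry: "op_symmetry jj jj cnj"
proof
 show "jj x \<sqsubseteq> jj y \<longleftrightarrow> x \<sqsubseteq> y" for x y using jj_le[of x y] jj_le[of "jj x" "jj y"] by auto
qed (auto simp: jj_BH jj_add jj_compose jj_cscale jj_adj)

lemmas jj_commutant = op_symmetry.commutant_image[OF jj_symmetry]
lemmas nft_jj = op_symmetry.nft_image[OF jj_symmetry]
lemmas factor_jj = op_symmetry.factor_image[OF jj_symmetry]

lemma jj_Om: assumes x: "x : M" and y: "y : M" shows "jj x (y \<Omega>) = y (adj x \<Omega>)"
 using J_Om[OF vn_compose[OF M x MI(9)[OF y]]] by (simp add: jj_apply J_Om y x adj_compose MBH)

lemma jj_Om_self: "x : M ==> jj x \<Omega> = adj x \<Omega>"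
 using jj_Om[OF _ MI(1), of x] by simp

lemma jj_in_commutant: assumes x: "x : M" shows "jj x : commutant M"
proof (rule commutantI[OF jj_BH[OF MBH[OF x]]])
 fix a assume a: "a : M"
 show "jj x ** a = a ** jj x"
 proof (rule blinfun_eq_on_dense[OF _ cyclic])
  fix v assume "v : orbit M \<Omega>"
  then obtain b where b: "v = blinfun_apply b \<Omega>" "b : M" by blast
  show "(jj x ** a) v = (a ** jj x) v"
   using jj_Om[OF x vn_compose[OF M a b(2)]] jj_Om[OF x b(2)] by (simp add: b)
 qed
qed

lemma J_commutant_Om: assumes T: "T : commutant M" shows "J (T \<Omega>) = adj T \<Omega>"
proof -
 have TB: "T : BH" using T commutant_BH by blast
 have "J (T \<Omega>) - adj T \<Omega> = 0"
 proof (rule cinner_zeroI_dense[OF _ cyclic])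
  fix v assume "v : orbit M \<Omega>"
  then obtain x where x: "v = blinfun_apply x \<Omega>" "x : M" by blast
  have "cinner (J (T \<Omega>)) (x \<Omega>) = cinner (adj x \<Omega>) (T \<Omega>)" by (subst J_cinner) (simp add: J_Om x)
  also have "... = cinner (adj T \<Omega>) (x \<Omega>)"
   using commutant_apply[OF T x(2), of \<Omega>] by (simp add: cinner_adj_left TB MBH x)
  finally show "cinner (J (T \<Omega>) - adj T \<Omega>) v = 0" by (simp add: x cinner_diff_left)
 qed
 thus ?thesis by simp
qed

lemma commutant_cyclic: "M' \<supseteq> commutant M ==> closure (orbit M' \<Omega>) = UNIV"
proof -
 assume s: "M' \<supseteq> commutant M"
 have "orbit M \<Omega> <= orbit M' \<Omega>"
 proof clarify
  fix x assume x: "x : M"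
  thus "EX y. x \<Omega> = blinfun_apply y \<Omega> & y : M'"
   using jj_Om_self[OF MI(9)[OF x]] jj_in_commutant[OF MI(9)[OF x]] s by (intro exI[of _ "jj (adj x)"]) (auto simp: MBH)
 qed
 from closure_mono[OF this] show ?thesis using cyclic by auto
qed

text \<open>On vectors \<open>R \<Omega>\<close> with \<open>R\<close> in the commutant,
  \<open>J\<close> again acts as the adjoint. So the computation for \<open>M\<close> repeats with
  the algebras exchanged and ends in the bicommutant.\<close>

lemma jj_commutant_in: assumes T: "T : commutant M" shows "jj T : M"
proof -
 note vM' = vn_commutant_vn[OF M]
 have TB: "T : BH" using T commutant_BH by blast
 have jO: "jj T (R \<Omega>) = R (adj T \<Omega>)" if R: "R : commutant M" for R
  using J_commutant_Om[OF vn_compose[OF vM' T vn_adj[OF vM' R]]] vn_inBH[OF vM' R]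
  by (simp add: jj_apply J_commutant_Om[OF R] adj_compose TB)
 have "jj T : commutant (commutant M)"
 proof (rule commutantI[OF jj_BH[OF TB]])
  fix S assume S: "S : commutant M"
  show "jj T ** S = S ** jj T"
  proof (rule blinfun_eq_on_dense[OF _ commutant_cyclic[OF order_refl]])
   fix v assume "v : orbit (commutant M) \<Omega>"
   then obtain R where R: "v = blinfun_apply R \<Omega>" "R : commutant M" by blast
   show "(jj T ** S) v = (S ** jj T) v"
    using jO[OF vn_compose[OF vM' S R(2)]] jO[OF R(2)] by (simp add: R)
  qed
 qed
 thus ?thesis by (simp add: vn_bicommutant[OF M])
qed

end

section \<open>The Jones projection, the basic construction and compression by
  \<open>e\<close>\<close>

locale stdform_sub = stdform M \<Omega> for M :: "'k :: chilbert_space op set" and \<Omega> +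
 fixes N :: "'k op set"
 assumes N: "star_subalgebra N" and NM: "N <= M"
begin

definition e :: "'k op" where "e = cyclic_proj N \<Omega>"

text \<open>The basic construction \<open>M\<^sub>1\<close>, with \<open>e\<close> its Jones
  projection. \<open>N\<close> is only a star subalgebra, because besides \<open>A\<close> the
  algebra \<open>A + Au\<close> is put in its place.\<close>

definition P :: "'k op set" where "P = commutant (jj ` N)"

lemmas e_cyclic = cyclic_proj[OF N, of \<Omega>, folded e_def]
lemmas eP = e_cyclic(1) and e_commutant = e_cyclic(2) and e_Om = e_cyclic(4)
lemmas e_simps = is_projD[OF eP]

lemma N_inM: "a : N ==> a : M" using NM by blast

lemma e_N: "a : N ==> e (a v) = a (e v)" by (rule commutant_apply[OF e_commutant])

lemma e_cinner: "cinner (e x) y = cinner x (e y)"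
 using cinner_adj_left[OF e_simps(1), of x y] by (simp add: e_simps(3))

lemma vn_commutant_N: "von_neumann_algebra (commutant N)"
 using sub_BH[OF N] sub_adj[OF N] by (intro vn_commutant) auto

lemma e_N_Om: "a : N ==> e (a \<Omega>) = a \<Omega>" by (simp add: e_N e_Om)

lemma e_zeroI: assumes v: "e v = v" and z: "!!a. a : N ==> cinner v (a \<Omega>) = 0" shows "v = 0"
proof -
 have "closure (orbit N \<Omega>) <= {w. cinner v w = 0}"
  by (rule closure_minimal) (use z in "auto intro!: closed_Collect_eq continuous_intros")
 moreover have "v : closure (orbit N \<Omega>)" using e_cyclic(3) v by (metis rangeI)
 ultimately show ?thesis by auto
qed

lemma e_eqI: assumes z: "!!a. a : N ==> blinfun_apply X (a \<Omega>) = blinfun_apply Y (a \<Omega>)" shows "X ** e = Y ** e"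
proof (rule blinfun_eqI)
 fix v
 have "closure (orbit N \<Omega>) <= {w. X w = Y w}"
  by (rule closure_minimal) (use z in "auto intro!: closed_Collect_eq cont")
 moreover have "e v : closure (orbit N \<Omega>)" using e_cyclic(3) by blast
 ultimately show "(X ** e) v = (Y ** e) v" by auto
qed

lemma e_J: "e (J v) = J (e v)"
proof -
 have 1: "e (J (e v)) = J (e v)" for v
 proof -
  have "closure (orbit N \<Omega>) <= {w. e (J w) = J w}"
  proof (rule closure_minimal)
   show "closed {w. e (J w) = J w}" by (intro closed_Collect_eq continuous_on_compose2[OF cont cont] cont) simp
  qed (use e_N_Om[OF sub_adj[OF N]] in "auto simp: J_Om N_inM")
  moreover have "e v : closure (orbit N \<Omega>)" using e_cyclic(3) by blast
  ultimately show ?thesis by blast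
 qed
 show ?thesis
 proof (rule cinner_ext)
  fix w
  have "cinner (e (J v)) w = cinner (J (e w)) v" by (simp add: e_cinner J_cinner[of v])
  also have "... = cinner (J (e w)) (e v)" by (subst 1[symmetric]) (rule e_cinner)
  also have "... = cinner (e (J (e v))) w" by (subst J_cinner) (simp add: e_cinner)
  finally show "cinner (e (J v)) w = cinner (J (e v)) w" by (simp add: 1)
 qed
qed

lemma jj_e: "jj e = e"
 by (rule blinfun_eqI) (simp add: jj_apply e_J[symmetric])

lemma vnP: "von_neumann_algebra P"
 unfolding P_def using sub_BH[OF N] sub_adj[OF N] by (intro vn_commutant) (auto simp: jj_BH jj_adj[symmetric])

lemma P_eq: "P = jj ` commutant N" unfolding P_def by (rule jj_commutant)

lemma e_inP: "e : P"
 using e_commutant jj_e unfolding P_eq by (metis image_eqI)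

lemma M_subset_P: "M <= P"
proof -
 have "jj ` N <= commutant M" using jj_in_commutant N_inM by blast
 from commutant_antimono[OF this] show ?thesis by (simp add: P_def vn_bicommutant[OF M])
qed

text \<open>\<open>X\<close> commutes with \<open>jj (adj a)\<close>, which takes
  \<open>\<Omega>\<close> to \<open>a \<Omega>\<close>. On the range of \<open>e\<close> an element
  of \<open>P\<close> is thus determined by its value at \<open>\<Omega>\<close>.\<close>

lemma P_apply: "X : P ==> a : N ==> X (a \<Omega>) = jj (adj a) (X \<Omega>)"
 using commutant_apply[of X "jj ` N" "jj (adj a)" \<Omega>] sub_adj[OF N, of a] jj_Om_self[OF MI(9)[OF N_inM], of a]
 by (simp add: P_def MBH N_inM)

lemma P_eqI: "X : P ==> Y : P ==> X \<Omega> = Y \<Omega> ==> X ** e = Y ** e"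
 by (rule e_eqI) (simp add: P_apply)

lemma e_J_commutant: assumes S: "S : commutant N" shows "e (J (S \<Omega>)) = e (adj S \<Omega>)"
proof -
 have SB: "S : BH" using S commutant_BH by blast
 have "e (J (S \<Omega>)) - e (adj S \<Omega>) = 0"
 proof (rule e_zeroI)
  fix a assume a: "a : N"
  have "cinner (J (S \<Omega>)) (a \<Omega>) = cinner (adj a \<Omega>) (S \<Omega>)" by (subst J_cinner) (simp add: J_Om N_inM a)
  also have "... = cinner (adj S \<Omega>) (a \<Omega>)"
   using commutant_apply[OF S a, of \<Omega>] by (simp add: cinner_adj_left SB sub_BH[OF N a])
  finally show "cinner (e (J (S \<Omega>)) - e (adj S \<Omega>)) (a \<Omega>) = 0"
   by (simp add: cinner_diff_left e_cinner e_N_Om a)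
 qed (simp add: blinfun.diff_right e_simps)
 thus ?thesis by simp
qed

text \<open>On the closure of \<open>orbit N \<Omega>\<close> compressions of \<open>P\<close> act
  like left multiplications and compressions of the commutant of \<open>N\<close> like right ones.
  Matrix coefficients in vectors \<open>a \<Omega>\<close> confirm this, using only the two vectors
  \<open>t = T \<Omega>\<close> and \<open>q = e (S \<Omega>)\<close>.\<close>

lemma compression_commutes:
 assumes Y: "Y : P" and S: "S : commutant N"
 shows "(e ** (Y ** e)) ** (e ** (S ** e)) = (e ** (S ** e)) ** (e ** (Y ** e))"
proof -
 define T where "T = e ** (Y ** e)"
 define K where "K = e ** (S ** e)"
 have SB: "S : BH" using S commutant_BH by blast
 have TP: "T : P" unfolding T_def by (intro vn_compose[OF vnP] e_inP Y)
 have TB: "T : BH" by (rule vn_inBH[OF vnP TP])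
 have eT: "e (T v) = T v" "T (e v) = T v" for v by (simp_all add: T_def e_simps)
 have eTa: "e (adj T v) = adj T v" for v
  by (rule cinner_ext_left) (simp add: e_cinner[symmetric] cinner_adj_right TB eT)
 define t where "t = T \<Omega>"
 define q where "q = e (S \<Omega>)"
 have q': "e (adj S \<Omega>) = J q" using e_J_commutant[OF S] by (simp add: q_def e_J)
 have t': "adj T \<Omega> = J t"
 proof -
  have "J t - adj T \<Omega> = 0"
  proof (rule e_zeroI)
   fix a assume a: "a : N"
   have "cinner (J t) (a \<Omega>) = cinner (adj a \<Omega>) t" by (subst J_cinner) (simp add: J_Om N_inM a)
   also have "adj a \<Omega> = jj a \<Omega>" by (simp add: jj_Om_self N_inM a)
   also have "cinner (jj a \<Omega>) t = cinner (adj T (jj a \<Omega>)) \<Omega>" by (simp add: t_def cinner_adj_left TB)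
   also have "adj T (jj a \<Omega>) = jj a (adj T \<Omega>)"
    using commutant_apply[of "adj T" "jj ` N" "jj a"] vn_adj[OF vnP TP] a by (simp add: P_def)
   also have "cinner (jj a (adj T \<Omega>)) \<Omega> = cinner (adj T \<Omega>) (jj (adj a) \<Omega>)"
    by (simp add: jj_adj sub_BH[OF N a] cinner_adj_right jj_BH)
   also have "jj (adj a) \<Omega> = a \<Omega>" by (simp add: jj_Om_self N_inM sub_adj[OF N] a sub_BH[OF N a])
   finally show "cinner (J t - adj T \<Omega>) (a \<Omega>) = 0" by (simp add: cinner_diff_left)
  qed (simp add: blinfun.diff_right e_J eTa t_def eT)
  thus ?thesis by simp
 qed
 have TK: "T (K (a \<Omega>)) = K (T (a \<Omega>))" if a: "a : N" for a
 proof -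
  have "T (K (a \<Omega>)) - K (T (a \<Omega>)) = 0"
  proof (rule e_zeroI)
   fix b assume b: "b : N"
   note aB = sub_BH[OF N a] sub_BH[OF N b] sub_BH[OF N sub_adj[OF N a]] sub_BH[OF N sub_adj[OF N b]]
   have 1: "K (a \<Omega>) = a q"
    using commutant_apply[OF S a, of \<Omega>] by (simp add: K_def q_def e_N a e_Om)
   have 2: "adj T (b \<Omega>) = J (adj b t)"
    using P_apply[OF vn_adj[OF vnP TP] b] by (simp add: t' jj_apply)
   have L: "cinner (T (K (a \<Omega>))) (b \<Omega>) = cinner t (b (J (a q)))"
   proof -
    have "cinner (T (K (a \<Omega>))) (b \<Omega>) = cinner (a q) (adj T (b \<Omega>))" by (simp add: 1 cinner_adj_right TB)
    also have "... = cinner (adj b t) (J (a q))" unfolding 2 by (rule J_cinner_right)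
    finally show ?thesis by (simp add: cinner_adj_left aB)
   qed
   have 3: "T (a \<Omega>) = J (adj a (J t))" using P_apply[OF TP a] by (simp add: t_def jj_apply)
   have 4: "e (adj S (b \<Omega>)) = b (J q)"
    by (simp add: commutant_apply[OF vn_adj[OF vn_commutant_N S] b] e_N b q')
   have "cinner (K (T (a \<Omega>))) (b \<Omega>) = cinner (e (T (a \<Omega>))) (adj S (b \<Omega>))"
    by (simp add: K_def eT e_cinner[of "blinfun_apply S _"] cinner_adj_right SB e_N_Om b)
   also have "... = cinner (T (a \<Omega>)) (e (adj S (b \<Omega>)))" by (rule e_cinner)
   also have "... = cinner (J (b (J q))) (adj a (J t))" unfolding 3 4 by (rule J_cinner)
   also have "... = cinner (a (J (b (J q)))) (J t)" by (simp add: cinner_adj_right aB)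
   also have "... = cinner t (J (a (J (b (J q)))))" by (rule J_cinner_right)
   \<comment> \<open>\<open>jj a\<close> lies in the commutant of \<open>M\<close> and passes
     \<open>b\<close>.\<close>
   also have "J (a (J (b (J q)))) = b (J (a q))"
    using commutant_apply[OF jj_in_commutant[OF N_inM[OF a]] N_inM[OF b], of "J q"] by (simp add: jj_apply)
   finally show "cinner (T (K (a \<Omega>)) - K (T (a \<Omega>))) (b \<Omega>) = 0" using L by (simp add: cinner_diff_left)
  qed (simp add: blinfun.diff_right eT K_def e_simps)
  thus ?thesis by simp
 qed
 have "(T ** K) ** e = (K ** T) ** e" by (rule e_eqI) (simp add: TK)
 moreover have "K ** e = K" "T ** e = T" by (simp_all add: K_def T_def oL_assoc e_simps)
 ultimately show ?thesis unfolding T_def[symmetric] K_def[symmetric] by (simp add: oL_assoc)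
qed

text \<open>Because \<open>T\<close> commutes with the compressions of \<open>adj S ** S\<close>,
  the vector \<open>T \<Omega>\<close> is bounded relative to \<open>\<Omega>\<close> over the
  commutant of \<open>N\<close> and comes from an element \<open>y\<close> of the bicommutant. If
  \<open>N\<close> is a von Neumann algebra and \<open>Y\<close> is in \<open>M\<close>, this
  \<open>y\<close> is the conditional expectation of \<open>Y\<close>.\<close>

lemma ex_compression:
 assumes Y: "Y : P"
 shows "EX y:commutant (commutant N). e ** (Y ** e) = y ** e"
proof -
 define T where "T = e ** (Y ** e)"
 have TP: "T : P" unfolding T_def by (intro vn_compose[OF vnP] e_inP Y)
 have eT: "e (T v) = T v" for v by (simp add: T_def e_simps)
 note vN' = vn_commutant_N
 have bd: "norm (S (T \<Omega>)) <= norm T * norm (S \<Omega>)" if S: "S : commutant N" for S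
 proof -
  have SB: "S : BH" using S commutant_BH by blast
  define K where "K = adj (S ** e) ** (S ** e)"
  have K: "K = e ** ((adj S ** S) ** e)" by (simp add: K_def adj_compose SB e_simps oL_assoc)
  have KP: "positive_op K" unfolding K_def by (intro positive_adj_self BH_compose SB e_simps)
  \<comment> \<open>The absolute value of \<open>S ** e\<close>: it commutes with \<open>T\<close>
    and gives vectors in the range of \<open>e\<close> the same norm as \<open>S\<close>
    does.\<close>
  define k where "k = op_sqrt K"
  have TK: "T ** K = K ** T"
   unfolding K T_def by (rule compression_commutes[OF Y]) (intro vn_compose[OF vN'] vn_adj[OF vN'] S)
  have Tk: "T ** k = k ** T" unfolding k_def by (rule op_sqrt_commute[OF KP TK])
  have kB: "k : BH" and ka: "adj k = k" and kk: "k ** k = K"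
   unfolding k_def using positive_op_BH positive_op_adj positive_op_sqrt[OF KP] op_sqrt_square[OF KP] by auto
  have n: "(norm (k v))^2 = (norm (S (e v)))^2" for v
   using norm_apply_sq[OF kB, of v] norm_apply_sq[OF BH_compose[OF SB e_simps(1)], of v] ka kk by (simp add: K_def flip: oL_apply)
  have "norm (S (T \<Omega>)) = norm (k (T \<Omega>))" using n[of "T \<Omega>"] by (simp add: eT)
  also have "k (T \<Omega>) = T (k \<Omega>)" using Tk by (metis oL_apply)
  also have "norm (T (k \<Omega>)) <= norm T * norm (k \<Omega>)" by (rule norm_blinfun)
  also have "norm (k \<Omega>) = norm (S \<Omega>)" using n[of \<Omega>] by (simp add: e_Om)
  finally show ?thesis .
 qed
 obtain y where y: "y : commutant (commutant N)" "y \<Omega> = T \<Omega>"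
  using ex_commutant_of_bounded[OF vN' norm_ge_zero bd] by blast
 have "y ** e = T ** e"
 proof (rule e_eqI)
  fix a assume a: "a : N"
  have "jj (adj a) : commutant N"
   using jj_in_commutant[OF N_inM[OF sub_adj[OF N a]]] commutant_antimono[OF NM] by blast
  hence "y (jj (adj a) \<Omega>) = jj (adj a) (y \<Omega>)" by (rule commutant_apply[OF y(1)])
  thus "y (a \<Omega>) = T (a \<Omega>)"
   using P_apply[OF TP a] y(2) jj_Om_self[OF N_inM[OF sub_adj[OF N a]]] by (simp add: sub_BH[OF N a])
 qed
 moreover have "T ** e = T" by (simp add: T_def oL_assoc e_simps)
 ultimately show ?thesis using y(1) unfolding T_def by metis
qed

lemma bicommutant_subset: "commutant (commutant N) <= M"
 using commutant_antimono[OF commutant_antimono[OF NM]] by (simp add: vn_bicommutant[OF M])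

end

section \<open>The coupling constant\<close>

text \<open>Normality on \<open>A\<close> concerns least upper bounds formed in \<open>A\<close>;
  these are strong limits and so least upper bounds in \<open>M\<close> too.\<close>

lemma nft_restrict:
 assumes M: "von_neumann_algebra M" and \<tau>: "nf_tracial_state M \<tau>" and A: "von_neumann_algebra A" "A <= M"
 shows "nf_tracial_state A \<tau>"
proof -
 have AM: "x : A ==> x : M" for x using A(2) by blast
 have sup: "Re (\<tau> s) = (SUP d\<in>D. Re (\<tau> d))" if D: "D <= self_adjoints A" "up_directed D" "lub_in A D s" for D s
 proof -
  have D': "D <= self_adjoints M" using D(1) A(2) by (auto simp: self_adjoints_def)
  show ?thesis
   by (rule nft_SUP[OF \<tau> D' D(2) strong_limit_lub_in[OF M D' D(2) lub_in_strong_limit[OF A(1) D]]])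
 qed
 show ?thesis
  unfolding nf_tracial_state_def
  using sup nft_add[OF \<tau>] nft_cscale[OF \<tau>] nft_id[OF \<tau>] nft_pos[OF \<tau>] nft_faithful[OF \<tau>]
  by (auto simp: AM intro: nft_comm[OF \<tau> AM AM])
qed

lemma contraction_limit:
 fixes T :: "nat => 'a :: chilbert_space op"
 assumes c: "!!n v. norm (T n v) <= norm v" and D: "!!x. x : D ==> (%n. T n x) \<longlonglongrightarrow> 0" and v: "v : closure D"
 shows "(%n. T n v) \<longlonglongrightarrow> 0"
proof (rule LIMSEQ_I)
 fix r :: real assume r: "0 < r"
 obtain x where x: "x : D" "dist x v < r / 2" using v r by (metis closure_approachable half_gt_zero)
 obtain k where k: "!!n. n \<ge> k ==> norm (T n x) < r / 2" using LIMSEQ_D[OF D[OF x(1)], of "r / 2"] r by auto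
 have "norm (T n v - 0) < r" if n: "n \<ge> k" for n
 proof -
  have "norm (T n v) <= norm (T n x) + norm (T n (v - x))"
   using norm_triangle_ineq[of "T n x" "T n (v - x)"] by (simp add: blinfun.diff_right)
  thus ?thesis using k[OF n] c[of n "v - x"] x(2) by (simp add: dist_norm norm_minus_commute)
 qed
 thus "EX k. ALL n>=k. norm (T n v - 0) < r" by blast
qed

lemma range_subset_fix: "range (blinfun_apply q) <= closure D ==> (!!x. x : D ==> blinfun_apply p x = x) ==> p ** q = q"
proof (rule blinfun_eqI)
 fix v assume r: "range (blinfun_apply q) <= closure D" and f: "!!x. x : D ==> blinfun_apply p x = x"
 have "closure D <= {x. p x = x}"
  by (rule closure_minimal) (use f in "auto intro!: closed_Collect_eq cont_blinfun")
 thus "(p ** q) v = q v" using r by auto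
qed

lemma proj_eqI: "is_proj p ==> is_proj q ==> p ** q = q ==> q ** p = p ==> p = q"
 by (metis adj_compose is_projD(1,3))

lemma proj_le_iff_op_le: "is_proj p ==> is_proj q ==> p ** q = q ==> q \<sqsubseteq> p"
 unfolding op_le_def using positive_proj proj_le_diff(1) by blast

context stdform
begin

lemma jj_is_proj: "is_proj p ==> is_proj (jj p)"
 by (simp add: is_proj_def jj_BH jj_compose[symmetric] jj_adj[symmetric])

end

text \<open>Divided by \<open>tr g\<close>, the functional \<open>tr (a ** g)\<close> is a normal
  faithful trace on the factor \<open>A\<close>, where the trace is unique.\<close>

lemma trace_compression:
 fixes g :: "'a :: chilbert_space op"
 assumes vnP: "von_neumann_algebra P" and nft_tr: "nf_tracial_state P tr" and A: "factor A" "A <= P"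
  and \<tau>: "nf_tracial_state A \<tau>" and g: "g : P" "is_proj g" "g : commutant A"
  and inj: "!!a. a : A ==> a ** g = 0 ==> a = 0" and a: "a : A"
 shows "tr (a ** g) = tr g * \<tau> a"
proof -
 note PI = vn_intros[OF vnP]
 note vnA = factor_vn[OF A(1)]
 note AI = vn_intros[OF vnA]
 note A_BH = vn_inBH[OF vnA]
 note g_simps = is_projD[OF g(2)]
 define t where "t = Re (tr g)"
 have tg: "tr g = of_real t" unfolding t_def by (rule nft_proj[OF vnP nft_tr g(1,2)])
 have g0: "g ~= 0" using inj[OF AI(1)] nft_id[OF \<tau>] nft_zero[OF vnA \<tau>] by auto
 hence t0: "0 < t" unfolding t_def
  using nft_proj_nonneg[OF vnP nft_tr g(1,2)] nft_proj_zero[OF vnP nft_tr g(1,2)] by fastforce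
 have g_push: "g ** a = a ** g" "g ** (a ** z) = a ** (g ** z)" if "a : A" for a z
  using commutantD[OF g(3) that] by (simp_all flip: oL_assoc)
 have gg: "g ** (g ** z) = g ** z" for z by (simp add: g_simps flip: oL_assoc)
 have aeP: "a ** g : P" if "a : A" for a by (intro PI subsetD[OF A(2)] g that)
 have sq: "adj (a ** g) ** (a ** g) = (adj a ** a) ** g" if a: "a : A" for a
  by (simp add: adj_compose A_BH a g_simps oL_assoc g_push gg AI)
 define \<sigma> where "\<sigma> a = tr (a ** g) / t" for a
 have sup: "Re (\<sigma> s) = (SUP d\<in>D. Re (\<sigma> d))" if D: "D <= self_adjoints A" "up_directed D" "lub_in A D s" for D s
 proof -
  have sa: "d ** g : self_adjoints P" if "d : self_adjoints A" for d
   using that aeP by (auto simp: self_adjoints_def adj_compose A_BH g_simps g_push gg)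
  have le: "d ** g \<sqsubseteq> d' ** g" if d: "d : A" "d' : A" "d \<sqsubseteq> d'" for d d'
  proof -
   have "positive_op (adj g ** ((d' - d) ** g))" using d(3) by (intro positive_conj g_simps) (simp add: op_le_def)
   moreover have "adj g ** ((d' - d) ** g) = (d' ** g) - (d ** g)"
    using d by (simp add: g_simps oL_simps g_push gg)
   ultimately show ?thesis by (simp add: op_le_def)
  qed
  have DA: "d : A" if "d : D" for d using that D(1) by (auto simp: self_adjoints_def)
  have sA: "s : self_adjoints A" "s : A" using D(3) by (auto simp: lub_in_def self_adjoints_def)
  have 1: "(%d. d ** g) ` D <= self_adjoints P" using sa D(1) by blast
  have 2: "up_directed ((%d. d ** g) ` D)"
   using D(2) le DA unfolding up_directed_def by (auto) metis
  have 3: "lub_in P ((%d. d ** g) ` D) (s ** g)"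
   unfolding lub_in_def
  proof (intro conjI ballI impI)
   show "s ** g : self_adjoints P" by (rule sa[OF sA(1)])
   show "x \<sqsubseteq> s ** g" if "x : (%d. d ** g) ` D" for x
    using that le[OF DA sA(2)] D(3) by (auto simp: lub_in_def)
   fix t assume t: "t : self_adjoints P" "ALL d:(%d. d ** g) ` D. d \<sqsubseteq> t"
   show "s ** g \<sqsubseteq> t"
   proof (rule op_leI)
    fix v
    show "Re (cinner ((s ** g) v) v) <= Re (cinner (t v) v)"
    proof (rule tendsto_upperbound)
     show "((%d. Re (cinner (blinfun_apply d (g v)) v)) \<longlongrightarrow> Re (cinner ((s ** g) v) v)) (up_filter D)"
      using lub_in_strong_limit[OF vnA D, of "g v"] by (auto intro!: tendsto_intros)
     show "\<forall>\<^sub>F d in up_filter D. Re (cinner (blinfun_apply d (g v)) v) <= Re (cinner (t v) v)"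
      by (rule eventually_mono[OF up_filter_in[OF D(2)]]) (use t(2) op_le_Re[of "_ ** g" t v] in auto)
    qed (rule up_filter_nonbot[OF D(2)])
   qed (use sa[OF sA(1)] t(1) vn_inBH[OF vnP] in "auto simp: self_adjoints_def")
  qed
  have S: "Re (tr (s ** g)) = (SUP d\<in>D. Re (tr (d ** g)))"
   using nft_SUP[OF nft_tr 1 2 3] by (simp add: image_image)
  have "normal_pos P (%x. (1 / t) * Re (tr x))"
   by (rule normal_pos_cmult[OF vnP nft_normal_pos[OF vnP nft_tr]]) (use t0 in simp)
  from normal_pos_SUP[OF this 1 2 3] show ?thesis by (simp add: \<sigma>_def image_image Re_divide_of_real)
 qed
 have "nf_tracial_state A \<sigma>"
  unfolding nf_tracial_state_def
 proof (intro conjI ballI allI impI)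
  fix x y assume x: "x : A" and y: "y : A"
  show "\<sigma> (x + y) = \<sigma> x + \<sigma> y"
   by (simp add: \<sigma>_def oL_add_left nft_add[OF nft_tr aeP[OF x] aeP[OF y]] add_divide_distrib)
  have c: "tr ((x ** g) ** (y ** g)) = tr ((y ** g) ** (x ** g))" by (rule nft_comm[OF nft_tr aeP[OF x] aeP[OF y]])
  have m: "(x ** g) ** (y ** g) = (x ** y) ** g" if "y : A" for x y
   using that by (simp add: oL_assoc g_push gg g_simps)
  show "\<sigma> (x ** y) = \<sigma> (y ** x)" using c m[OF y, of x] m[OF x, of y] by (simp add: \<sigma>_def)
 next
  fix c x assume x: "x : A"
  show "\<sigma> (cscale c x) = c * \<sigma> x" by (simp add: \<sigma>_def oL_cscale_left nft_cscale[OF nft_tr aeP[OF x]])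
 next
  show "\<sigma> Id = 1" using t0 by (simp add: \<sigma>_def tg)
 next
  fix x assume x: "x : A"
  note p = nft_pos[OF nft_tr aeP[OF x], unfolded sq[OF x]]
  show "Im (\<sigma> (adj x ** x)) = 0" "0 <= Re (\<sigma> (adj x ** x))"
   using p t0 by (simp_all add: \<sigma>_def Re_divide_of_real Im_divide_of_real)
  assume "\<sigma> (adj x ** x) = 0"
  hence "tr (adj (x ** g) ** (x ** g)) = 0" using t0 by (simp add: \<sigma>_def sq[OF x])
  hence "x ** g = 0" by (rule nft_faithful[OF nft_tr aeP[OF x]])
  thus "x = 0" by (rule inj[OF x])
 qed (use sup in blast)
 hence "\<sigma> a = \<tau> a" by (rule trace_unique[OF A(1) _ \<tau> a])
 thus ?thesis using t0 by (simp add: \<sigma>_def tg field_simps)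
qed

section \<open>The coupling formula for bounded vectors\<close>

locale subfactor_trace = stdform_sub M \<Omega> A for M :: "'k :: chilbert_space op set" and \<Omega> and A +
 fixes tr' :: "'k op => complex"
 assumes factor_A: "factor A" and tr': "nf_tracial_state (commutant A) tr'"
begin

text \<open>The trace of the commutant of \<open>A\<close>, carried to \<open>P\<close> by
  \<open>J\<close>; complex conjugation compensates for the conjugate-linearity of
  \<open>jj\<close>.\<close>

definition tr :: "'k op => complex" where "tr x = cnj (tr' (jj x))"

text \<open>The trace of the Jones projection, which \<open>vn_dim_eq\<close> shows to be the
  reciprocal of the index.\<close>

definition \<mu> :: real where "\<mu> = Re (tr e)"

lemmas vnA = factor_vn[OF factor_A]
lemmas AI = vn_intros[OF vnA]
lemmas A_BH = vn_inBH[OF vnA]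

lemma nft_tr: "nf_tracial_state P tr"
 unfolding P_eq tr_def using nft_jj[OF commutant_BH tr'] .

lemma factor_P: "factor P"
 unfolding P_eq by (rule factor_jj[OF factor_commutant[OF factor_A]])

lemma A_P: "a : A ==> a : P" using NM M_subset_P by blast

lemma tr_e: "tr e = of_real \<mu>" and lambda_pos: "0 < \<mu>"
proof -
 show "tr e = of_real \<mu>" unfolding \<mu>_def by (rule nft_proj[OF vnP nft_tr e_inP eP])
 have "e ~= 0" using e_Om norm_Om by auto
 thus "0 < \<mu>" unfolding \<mu>_def
  using nft_proj_nonneg[OF vnP nft_tr e_inP eP] nft_proj_zero[OF vnP nft_tr e_inP eP] by fastforce
qed

lemma A_e: "a : A ==> a ** e = e ** a"
 using commutantD[OF e_commutant] by simp

lemma e_push: "a : A ==> e ** a = a ** e" "a : A ==> e ** (a ** z) = a ** (e ** z)" "e ** (e ** z) = e ** z"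
 using A_e[of a] by (simp_all add: e_simps flip: oL_assoc)

lemma A_e_eq_0: "a : A ==> a ** e = 0 ==> a = 0"
 by (metis N_inM oL_apply e_Om separating zero_blinfun.rep_eq)

lemma A_e_inject: "a : A ==> b : A ==> a ** e = b ** e ==> a = b"
 using A_e_eq_0[of "a - b"] AI(4)[of a b] by (simp add: oL_diff_left)

lemma tr_A_e: assumes a: "a : A" shows "tr (a ** e) = \<mu> * \<tau> a"
proof -
 have "A <= P" using A_P by blast
 from trace_compression[OF vnP nft_tr factor_A this nft_restrict[OF M nft vnA NM] e_inP eP e_commutant A_e_eq_0 a]
 show ?thesis by (simp add: tr_e)
qed

text \<open>A bounded vector is \<open>S \<Omega>\<close> with \<open>S\<close> in the commutant of
  \<open>A\<close>. The polar decomposition of \<open>S\<close> makes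
  \<open>cyclic_proj A \<xi>\<close> equivalent to some \<open>s\<close> below \<open>e\<close>, and
  \<open>jj s\<close> has the form \<open>p ** e\<close> with
  \<open>p = cyclic_proj (commutant A) \<xi>\<close>. The trace of \<open>p ** e\<close> is
  \<open>\<mu> * \<tau> p\<close>.\<close>

lemma coupling_bounded:
 assumes bd: "0 <= C" "!!a. a : A ==> norm (blinfun_apply a \<xi>) <= C * norm (a \<Omega>)"
 shows "tr' (cyclic_proj A \<xi>) = \<mu> * Re (\<tau> (cyclic_proj (commutant A) \<xi>))"
proof -
 define k where "k = cyclic_proj A \<xi>"
 define l where "l = cyclic_proj (commutant A) \<xi>"
 note vA' = vn_commutant_N
 note A'B = vn_inBH[OF vA']
 note k = cyclic_proj[OF star_subalgebra_vn[OF vnA], of \<xi>, folded k_def]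
 note l = cyclic_proj[OF star_subalgebra_vn[OF vA'], of \<xi>, folded l_def, unfolded vn_bicommutant[OF vnA]]
 obtain S where S: "S : commutant A" "S \<Omega> = \<xi>" "S ** e = S"
  using ex_commutant_of_bounded[OF vnA bd] unfolding e_def by blast
 obtain v h :: "'k op" where v: "v : commutant A" "h : commutant A" "positive_op h" "v ** h = S" "is_proj (adj v ** v)"
  "(adj v ** v) ** h = h" "(v ** adj v) ** S = S" "!!R :: 'k op. S ** R = 0 ==> v ** R = 0" "!!R :: 'k op. R ** S = 0 ==> R ** v = 0"
  using polar_decomposition[OF vA' S(1)] by blast
 define s where "s = adj v ** v"
 have sP: "is_proj s" and sA': "s : commutant A" unfolding s_def by (fact v) (intro vn_intros[OF vA'] v)
 note vv = partial_isometry[OF A'B[OF v(1)] v(5)]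
 have Sa: "S (a \<Omega>) = a \<xi>" if "a : A" for a using commutant_apply[OF S(1) that, of \<Omega>] S(2) by simp
 have "k = v ** adj v"
 proof (rule proj_eqI[OF k(1) vv(2)])
  have "(k ** S) ** e = S ** e"
   by (rule e_eqI) (use cyclic_proj_fixI[OF star_subalgebra_vn[OF vnA]] in "simp add: Sa k_def")
  hence "(Id - k) ** S = 0" using S(3) by (simp add: oL_simps)
  from v(9)[OF this] show "k ** (v ** adj v) = v ** adj v" by (simp add: oL_diff_left flip: oL_assoc)
  show "(v ** adj v) ** k = k"
  proof (rule range_subset_fix[OF eq_refl[OF k(3)]])
   fix x assume "x : {blinfun_apply a \<xi> | a. a : A}"
   then obtain a :: "'k op" where "x = S (a \<Omega>)" "a : A" using Sa by auto
   thus "(v ** adj v) x = x" using v(7) by (metis oL_apply)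
  qed
 qed
 hence tk: "tr' k = tr' s"
  unfolding s_def using nft_comm[OF tr' v(1) vn_adj[OF vA' v(1)]] by simp
 have Ss: "S ** s = S"
 proof -
  have "h ** s = h"
   using arg_cong[OF v(6), of adj] positive_op_adj[OF v(3)] A'B v(2) sA' is_projD(3)[OF sP] by (simp add: s_def[symmetric] adj_compose)
  thus ?thesis using v(4) by (metis oL_assoc)
 qed
 have sR: "s ** R = 0 \<longleftrightarrow> S ** R = 0" for R :: "'k op"
 proof
  show "S ** R = 0" if "s ** R = 0" using arg_cong[OF Ss, of "%z. z ** R"] that
   by (simp add: oL_assoc oL_zero_right)
  show "s ** R = 0" if "S ** R = 0" using v(8)[OF that] by (simp add: s_def oL_assoc)
 qed
 have "S ** (Id - e) = 0" using S(3) by (simp add: oL_diff_right)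
 hence se: "s ** e = s" using sR[of "Id - e"] by (simp add: oL_diff_right)
 have es: "e ** s = s" using arg_cong[OF se, of adj] is_projD[OF sP] e_simps by (simp add: adj_compose)
 have jsP: "jj s : P" unfolding P_eq using sA' by blast
 obtain p where p: "p : A" "e ** (jj s ** e) = p ** e" using ex_compression[OF jsP] vn_bicommutant[OF vnA] by blast
 have js: "jj s = p ** e"
  using p(2) arg_cong[OF se, of jj] arg_cong[OF es, of jj] by (simp add: jj_compose jj_e)
 note jsp = is_projD[OF jj_is_proj[OF sP], unfolded js]
 have pp: "p ** p = p"
 proof (rule A_e_inject)
  have "(p ** p) ** e = (p ** e) ** (p ** e)" by (simp add: oL_assoc e_push p e_simps)
  thus "(p ** p) ** e = p ** e" using jsp(2) by simp
 qed (use p AI in auto)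
 have "adj p = p"
 proof (rule A_e_inject)
  have "adj p ** e = adj (p ** e)" using A_e[OF AI(9)[OF p(1)]] by (simp add: adj_compose A_BH p e_simps)
  thus "adj p ** e = p ** e" using jsp(3) by simp
 qed (use p AI in auto)
 hence pP: "is_proj p" using pp A_BH[OF p(1)] by (simp add: is_proj_def)
 have s_eq: "s = jj p ** e" using arg_cong[OF js, of jj] by (simp add: jj_compose jj_e)
 \<comment> \<open>Together with the converse \<open>xq\<close> this identifies \<open>p\<close> as
   the support of \<open>\<xi>\<close> in \<open>A\<close>: an element of \<open>A\<close> kills
   \<open>\<xi>\<close> exactly if it kills \<open>p\<close>.\<close>
 have qx: "q ** p = 0" if q: "q : A" "q \<xi> = 0" for q
 proof -
  have "(S ** jj (adj q)) ** e = 0 ** e"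
  proof (rule e_eqI)
   fix a assume a: "a : A"
   show "(S ** jj (adj q)) (a \<Omega>) = (0 :: 'k op) (a \<Omega>)"
    using Sa[OF AI(6)[OF a q(1)]] q by (simp add: jj_Om N_inM AI a A_BH)
  qed
  hence "s ** (jj (adj q) ** e) = 0" unfolding sR by (simp add: oL_assoc)
  hence "jj s ** (adj q ** e) = 0" using jj_compose[of s "jj (adj q) ** e"] by (simp add: jj_compose[of "jj (adj q)"] jj_e)
  hence "(p ** adj q) ** e = 0"
   by (simp add: js oL_assoc e_push AI q e_simps)
  hence "p ** adj q = 0" by (rule A_e_eq_0[rotated]) (intro AI p q)
  from arg_cong[OF this, of adj] show ?thesis using is_projD(3)[OF pP] by (simp add: adj_compose A_BH p q AI)
 qed
 have xq: "q \<xi> = 0" if q: "q : A" "q ** p = 0" for q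
 proof -
  have "p ** adj q = 0" using arg_cong[OF q(2), of adj] is_projD(3)[OF pP] by (simp add: adj_compose A_BH p q(1))
  hence "s ** (jj (adj q) ** e) = 0"
  proof -
   have "s ** (jj (adj q) ** e) = jj ((p ** e) ** (adj q ** e))" by (simp add: s_eq jj_compose jj_e oL_assoc)
   also have "(p ** e) ** (adj q ** e) = (p ** adj q) ** e" by (simp add: oL_assoc e_push AI q e_simps)
   finally show ?thesis using \<open>p ** adj q = 0\<close> by simp
  qed
  hence "(S ** jj (adj q)) \<Omega> = 0" unfolding sR by (metis oL_apply e_Om zero_blinfun.rep_eq)
  thus ?thesis using jj_Om_self[OF N_inM[OF AI(9)[OF q(1)]]] Sa[OF q(1)] by (simp add: A_BH q)
 qed
 have "p = l"
 proof (rule proj_eqI[OF pP l(1)])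
  have "p \<xi> = \<xi>" using xq[of "Id - p"] pp AI p by (simp add: oL_diff_left blinfun.diff_left)
  hence "p (x \<xi>) = x \<xi>" if "x : commutant A" for x using commutant_apply[OF that p(1), of \<xi>] by simp
  thus "p ** l = l" by (intro range_subset_fix[OF eq_refl[OF l(3)]]) auto
  have "(Id - l) ** p = 0" by (rule qx) (use l AI in "auto simp: blinfun.diff_left")
  thus "l ** p = p" by (simp add: oL_diff_left)
 qed
 moreover have "tr' s = cnj (tr (jj s))" by (simp add: tr_def)
 moreover have "\<tau> p = of_real (Re (\<tau> p))" by (rule nft_proj[OF M nft N_inM[OF p(1)] pP])
 ultimately show ?thesis using tk tr_A_e[OF p(1)] by (simp add: k_def[symmetric] l_def[symmetric] js) (metis complex_cnj_complex_of_real)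
qed

end

section \<open>From bounded vectors to all vectors: the coupling constant\<close>

context subfactor_trace
begin

definition bounded_vec :: "'k => bool" where
 "bounded_vec \<xi> \<longleftrightarrow> (EX C>=0. ALL a:A. norm (blinfun_apply a \<xi>) <= C * norm (a \<Omega>))"

lemma bounded_vec_add: "bounded_vec \<xi> ==> bounded_vec \<eta> ==> bounded_vec (\<xi> + \<eta>)"
 unfolding bounded_vec_def
proof clarify
 fix C D :: real
 assume C: "0 <= C" "ALL a:A. norm (blinfun_apply a \<xi>) <= C * norm (a \<Omega>)"
  and D: "0 <= D" "ALL a:A. norm (blinfun_apply a \<eta>) <= D * norm (a \<Omega>)"
 have "norm (a (\<xi> + \<eta>)) <= (C + D) * norm (a \<Omega>)" if "a : A" for a
  using C(2) D(2) that norm_triangle_ineq[of "a \<xi>" "a \<eta>"] by (fastforce simp: blinfun.add_right distrib_right)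
 thus "EX C>=0. ALL a:A. norm (a (\<xi> + \<eta>)) <= C * norm (a \<Omega>)" using C(1) D(1) by (intro exI[of _ "C + D"]) auto
qed

text \<open>Hahn decomposition of the state of \<open>\<xi>\<close> against a multiple of the trace:
  below \<open>r\<close> the state is bounded by the trace, so \<open>r \<xi>\<close> is a bounded
  vector, and what remains has small trace. Decomposing only the complement of the previous
  projection makes the sequence increase.\<close>

lemma bounded_projections:
 "EX q. ALL n. q n : A & is_proj (q n) & bounded_vec (q n \<xi>) & q (Suc n) ** q n = q n &
  real (Suc n) * Re (\<tau> (Id - q (Suc n))) <= (norm \<xi>)^2"
proof -
 define \<phi> where "\<phi> x = Re (cinner (blinfun_apply x \<xi>) \<xi>)" for x
 have n\<phi>: "normal_pos A \<phi>" unfolding \<phi>_def by (rule normal_pos_vector_state[OF vnA])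
 note n\<tau> = nft_normal_pos[OF vnA nft_restrict[OF M nft vnA NM]]
 define Q where "Q q \<longleftrightarrow> q : A & is_proj q & bounded_vec (blinfun_apply q \<xi>)" for q
 have "EX q. ALL n. Q (q n) & (q (Suc n) ** q n = q n & real (Suc n) * Re (\<tau> (Id - q (Suc n))) <= (norm \<xi>)^2)"
 proof (rule dependent_nat_choice)
  show "EX q. Q q" by (rule exI[of _ 0]) (auto simp: Q_def bounded_vec_def AI)
  fix q n assume Qq: "Q q"
  hence q: "q : A" "is_proj q" "bounded_vec (q \<xi>)" by (auto simp: Q_def)
  have pA: "Id - q : A" by (intro AI q)
  obtain r where r: "r : A" "is_proj r" "r ** (Id - q) = r"
   "real (Suc n) * Re (\<tau> (Id - q - r)) <= \<phi> (Id - q - r)"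
   "!!x. x : A ==> positive_op x ==> x ** r = x ==> \<phi> x <= real (Suc n) * Re (\<tau> x)"
   using hahn_decomposition[OF vnA n\<phi> normal_pos_cmult[OF vnA n\<tau> of_nat_0_le_iff[of "Suc n"]] pA is_proj_complement[OF q(2)]] by blast
  have "norm (a (r \<xi>)) <= sqrt (Suc n) * norm (a \<Omega>)" if a: "a : A" for a
  proof (rule power2_le_imp_le)
   define x where "x = adj (a ** r) ** (a ** r)"
   have arB: "a ** r : BH" by (intro BH_compose A_BH a r)
   have "(norm (a (r \<xi>)))^2 = \<phi> x" by (simp add: \<phi>_def x_def cinner_adj_left arB Re_cinner_self)
   also have "... <= real (Suc n) * Re (\<tau> x)"
    by (rule r(5)) (use a r(1) in "auto simp: x_def oL_assoc is_projD(2)[OF r(2)] intro!: AI positive_adj_self arB")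
   also have "Re (\<tau> x) = (norm (a (r \<Omega>)))^2" by (simp add: x_def cinner_adj_left arB Re_cinner_self)
   also have "real (Suc n) * (norm (a (r \<Omega>)))^2 <= real (Suc n) * (norm (a \<Omega>))^2"
    using is_proj_norm_le[OF jj_is_proj[OF r(2)], of "a \<Omega>"]
    by (intro mult_left_mono power_mono) (auto simp: jj_Om N_inM a r is_projD(3)[OF r(2)])
   finally show "(norm (a (r \<xi>)))^2 <= (sqrt (Suc n) * norm (a \<Omega>))^2" by (simp add: power_mult_distrib)
  qed simp
  hence br: "bounded_vec (r \<xi>)" unfolding bounded_vec_def by (intro exI[of _ "sqrt (Suc n)"]) simp
  have rq: "r ** q = 0" using r(3) by (simp add: oL_diff_right)
  have qr: "q ** r = 0" using arg_cong[OF rq, of adj] is_projD[OF q(2)] is_projD[OF r(2)] by (simp add: adj_compose)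
  have P': "is_proj (q + r)"
   using is_projD[OF q(2)] is_projD[OF r(2)] by (simp add: is_proj_def BH_add adj_add oL_simps rq qr)
  have c: "is_proj (Id - (q + r))" by (rule is_proj_complement[OF P'])
  have "\<phi> (Id - (q + r)) <= (norm \<xi>)^2"
  proof -
   have "\<phi> (Id - (q + r)) = (norm ((Id - (q + r)) \<xi>))^2" unfolding \<phi>_def by (rule is_proj_norm_sq[OF c, symmetric])
   also have "... <= (norm \<xi>)^2" by (intro power_mono is_proj_norm_le[OF c]) simp
   finally show ?thesis .
  qed
  hence "real (Suc n) * Re (\<tau> (Id - (q + r))) <= (norm \<xi>)^2" using r(4) by (simp add: diff_diff_eq)
  moreover have "Q (q + r)" using q r(1) P' bounded_vec_add[OF q(3) br] by (auto simp: Q_def blinfun.add_left AI)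
  moreover have "(q + r) ** q = q" using is_projD(2)[OF q(2)] rq by (simp add: oL_add_left)
  ultimately show "EX q'. Q q' & (q' ** q = q & real (Suc n) * Re (\<tau> (Id - q')) <= (norm \<xi>)^2)" by blast
 qed
 thus ?thesis unfolding Q_def by blast
qed

text \<open>By the polar decomposition of \<open>q ** l\<close> the projection \<open>l'\<close> is
  equivalent to a subprojection of \<open>l\<close>. What is missing in \<open>l\<close> is
  annihilated by \<open>q\<close>, so it lies below \<open>Id - q\<close>.\<close>

lemma commutant_cyclic_cut:
 fixes \<xi> :: 'k
 assumes q: "q : A" "is_proj q"
 defines "l \<equiv> cyclic_proj (commutant A) \<xi>" and "l' \<equiv> cyclic_proj (commutant A) (q \<xi>)"
 shows "Re (\<tau> l') <= Re (\<tau> l)" and "Re (\<tau> l) <= Re (\<tau> l') + Re (\<tau> (Id - q))"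
proof -
 note nA = nft_restrict[OF M nft vnA NM]
 note sA' = star_subalgebra_vn[OF vn_commutant_N]
 note l = cyclic_proj[OF sA', of \<xi>, folded l_def, unfolded vn_bicommutant[OF vnA]]
 note l' = cyclic_proj[OF sA', of "q \<xi>", folded l'_def, unfolded vn_bicommutant[OF vnA]]
 define x where "x = q ** l"
 have xA: "x : A" unfolding x_def by (intro AI q l)
 obtain v h :: "'k op" where v: "v : A" "v ** h = x" "is_proj (adj v ** v)" "(adj v ** v) ** h = h" "positive_op h" "h : A"
  "(v ** adj v) ** x = x" "!!R :: 'k op. x ** R = 0 ==> v ** R = 0" "!!R :: 'k op. R ** x = 0 ==> R ** v = 0"
  using polar_decomposition[OF vnA xA] by blast
 note vv = partial_isometry[OF A_BH[OF v(1)] v(3)]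
 have sA: "adj v ** v : A" "v ** adj v : A" by (intro AI v)+
 have "x ** (Id - l) = 0" using is_projD(2)[OF l(1)] by (simp add: x_def oL_simps)
 hence vl: "v ** l = v" using v(8)[of "Id - l"] by (simp add: oL_diff_right)
 have l'x: "l' ** x = x"
 proof -
  have "(Id - l') ** q ** l = 0 ** l"
  proof (rule blinfun_eqI)
   fix w
   have "closure {blinfun_apply a \<xi> | a. a : commutant A} <= {w. ((Id - l') ** q) w = 0}"
   proof (rule closure_minimal)
    show "{blinfun_apply a \<xi> | a. a : commutant A} <= {w. ((Id - l') ** q) w = 0}"
     using commutant_apply[OF _ q(1), of _ \<xi>] cyclic_proj_fixI[OF sA', of _ "q \<xi>"]
     by (auto simp: blinfun.diff_left l'_def)
   qed (intro closed_Collect_eq cont continuous_intros)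
   thus "((Id - l') ** q ** l) w = (0 ** l) w" using l(3) by auto
  qed
  thus ?thesis by (simp add: x_def oL_simps)
 qed
 have "v ** adj v = l'"
 proof (rule proj_eqI[OF vv(2) l'(1)])
  have "(Id - l') ** x = 0" using l'x by (simp add: oL_diff_left)
  from v(9)[OF this] show "l' ** (v ** adj v) = v ** adj v" by (simp add: oL_diff_left flip: oL_assoc)
  have "x \<xi> = q \<xi>" by (simp add: x_def l(4))
  hence "(v ** adj v) (q \<xi>) = q \<xi>" using v(7) by (metis oL_apply)
  hence "(v ** adj v) (a (q \<xi>)) = a (q \<xi>)" if "a : commutant A" for a
   using commutant_apply[OF that sA(2), of "q \<xi>"] by simp
  thus "(v ** adj v) ** l' = l'" by (intro range_subset_fix[OF eq_refl[OF l'(3)]]) auto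
 qed
 hence tl': "\<tau> l' = \<tau> (adj v ** v)" using nft_comm[OF nA v(1) AI(9)[OF v(1)]] by simp
 define r where "r = l - (adj v ** v)"
 have sl: "(adj v ** v) ** l = adj v ** v" by (simp add: oL_assoc vl)
 have ls: "l ** (adj v ** v) = adj v ** v"
  using arg_cong[OF sl, of adj] is_projD(1,3)[OF l(1)] is_projD(1,3)[OF v(3)] by (simp add: adj_compose[of "adj v ** v" l])
 have rP: "is_proj r" unfolding r_def by (rule proj_le_diff(1)[OF l(1) v(3) ls])
 have rA: "r : A" unfolding r_def by (intro AI l sA)
 have tr: "Re (\<tau> r) = Re (\<tau> l) - Re (\<tau> l')" using tl' by (simp add: r_def blinfun.diff_left cinner_diff_left)
 show "Re (\<tau> l') <= Re (\<tau> l)" using nft_proj_nonneg[OF vnA nA rA rP] tr by simp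
 have "v ** r = 0" using vv(1) vl by (simp add: r_def oL_diff_right)
 moreover have "x ** (adj v ** v) = x"
 proof -
  have "h ** (adj v ** v) = h"
   using arg_cong[OF v(4), of adj] positive_op_adj[OF v(5)] is_projD[OF v(3)] A_BH[OF v(6)] by (simp add: adj_compose[of "adj v ** v" h])
  thus ?thesis using v(2) by (metis oL_assoc)
 qed
 ultimately have "x ** r = 0" by (metis oL_assoc oL_zero_right)
 moreover have "l ** r = r" using is_projD(2)[OF l(1)] ls by (simp add: r_def oL_diff_right)
 ultimately have "q ** r = 0" by (simp add: x_def oL_assoc)
 hence "(Id - q) ** r = r" by (simp add: oL_diff_left)
 hence "r \<sqsubseteq> Id - q" by (rule proj_le_iff_op_le[OF is_proj_complement[OF q(2)] rP])
 hence "Re (\<tau> r) <= Re (\<tau> (Id - q))" using op_le_Re by blast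
 thus "Re (\<tau> l) <= Re (\<tau> l') + Re (\<tau> (Id - q))" using tr by simp
qed

text \<open>The bounded vectors \<open>q n \<xi>\<close> exhaust \<open>\<xi>\<close>. The left side
  converges along them by normality of \<open>tr'\<close>, the right side because its defect is at
  most a multiple of \<open>\<tau> (Id - q n)\<close>.\<close>

theorem coupling: "tr' (cyclic_proj A \<xi>) = \<mu> * Re (\<tau> (cyclic_proj (commutant A) \<xi>))"
proof -
 define k where "k = cyclic_proj A \<xi>"
 define T where "T = Re (\<tau> (cyclic_proj (commutant A) \<xi>))"
 note vA' = vn_commutant_N
 note sA = star_subalgebra_vn[OF vnA]
 note k = cyclic_proj[OF sA, of \<xi>, folded k_def]
 obtain q where q: "!!n. q n : A" "!!n. is_proj (q n)" "!!n. bounded_vec (q n \<xi>)" "!!n. q (Suc n) ** q n = q n"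
  "!!n. real (Suc n) * Re (\<tau> (Id - q (Suc n))) <= (norm \<xi>)^2"
  using bounded_projections[of \<xi>] by blast
 define kn where "kn n = cyclic_proj A (q n \<xi>)" for n
 note kn = cyclic_proj[OF sA, of "q _ \<xi>", folded kn_def]
 have tn: "tr' (kn n) = \<mu> * Re (\<tau> (cyclic_proj (commutant A) (q n \<xi>)))" for n
  using q(3)[of n] coupling_bounded unfolding bounded_vec_def kn_def by blast
 have cn: "is_proj (Id - q n)" for n by (rule is_proj_complement[OF q(2)])
 have tq: "Re (\<tau> (Id - q n)) = (norm ((Id - q n) \<Omega>))^2" for n by (rule is_proj_norm_sq[OF cn, symmetric])
 have tlim: "(%n. Re (\<tau> (Id - q n))) \<longlonglongrightarrow> 0"
 proof (rule LIMSEQ_imp_Suc, rule tendsto_sandwich)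
  show "\<forall>\<^sub>F n in sequentially. 0 <= Re (\<tau> (Id - q (Suc n)))" by (simp add: tq)
  show "\<forall>\<^sub>F n in sequentially. Re (\<tau> (Id - q (Suc n))) <= (norm \<xi>)^2 / real (Suc n)"
  proof (rule always_eventually, rule allI)
   show "Re (\<tau> (Id - q (Suc n))) <= (norm \<xi>)^2 / real (Suc n)" for n using q(5)[of n] by (simp add: pos_le_divide_eq mult.commute)
  qed
  show "(%n. (norm \<xi>)^2 / real (Suc n)) \<longlonglongrightarrow> 0" by (rule LIMSEQ_Suc[OF lim_const_over_n])
 qed simp
 have "(%n. norm ((Id - q n) \<Omega>)) \<longlonglongrightarrow> 0"
  using tendsto_real_sqrt[OF tlim] unfolding tq by simp
 hence Om0: "(%n. (Id - q n) \<Omega>) \<longlonglongrightarrow> 0" by (rule tendsto_norm_zero_cancel)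
 \<comment> \<open>Convergence is known at \<open>\<Omega>\<close>; the \<open>q n\<close> commute
   with the commutant of \<open>A\<close>, whose orbit of \<open>\<Omega>\<close> is dense.\<close>
 have q0: "(%n. (Id - q n) \<xi>) \<longlonglongrightarrow> 0"
 proof (rule contraction_limit[where D = "orbit (commutant A) \<Omega>"])
  show "norm ((Id - q n) v) <= norm v" for n v by (rule is_proj_norm_le[OF cn])
  show "\<xi> : closure (orbit (commutant A) \<Omega>)" using commutant_cyclic[OF commutant_antimono[OF NM]] by simp
  fix v assume "v : orbit (commutant A) \<Omega>"
  then obtain S where S: "v = blinfun_apply S \<Omega>" "S : commutant A" by blast
  have "(%n. S ((Id - q n) \<Omega>)) \<longlonglongrightarrow> S 0" by (rule blinfun.tendsto[OF tendsto_const Om0])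
  moreover have "S ((Id - q n) \<Omega>) = (Id - q n) v" for n
   unfolding S(1) by (rule commutant_apply[OF S(2)]) (intro AI q)
  ultimately show "(%n. (Id - q n) v) \<longlonglongrightarrow> 0" by simp
 qed
 have le: "kn n ** kn m = kn m" if "m <= n" for m n
 proof (rule range_subset_fix[OF eq_refl[OF kn(3)]])
  fix x assume "x : {blinfun_apply a (q m \<xi>) | a. a : A}"
  then obtain a where a: "x = blinfun_apply a (q m \<xi>)" "a : A" by blast
  have "q n ** q m = q m" using that
  proof (induction n rule: dec_induct)
   case base
   thus ?case using is_projD(2)[OF q(2)] by simp
  next
   case (step n)
   thus ?case using q(4)[of n] by (metis oL_assoc)
  qed
  hence "q m ** q n = q m" by (rule proj_le_diff(2)[OF q(2) q(2)])
  hence "x = (a ** q m) (q n \<xi>)" using a(1) by (metis oL_apply)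
  thus "kn n x = x" using cyclic_proj_fixI[OF sA AI(6)[OF a(2) q(1)[of m]], of "q n \<xi>"] by (simp only: kn_def)
 qed
 have kk: "k ** kn n = kn n" for n
 proof (rule range_subset_fix[OF eq_refl[OF kn(3)]])
  fix x assume "x : {blinfun_apply a (q n \<xi>) | a. a : A}"
  then obtain a where a: "x = (a ** q n) \<xi>" "a : A" by auto
  thus "k x = x" using cyclic_proj_fixI[OF sA AI(6)[OF a(2) q(1)[of n]], of \<xi>] by (simp only: k_def)
 qed
 have kd: "is_proj (k - kn n)" "kn n ** k = kn n" for n using proj_le_diff[OF k(1) kn(1) kk] by auto
 have lim: "(%n. kn n v) \<longlonglongrightarrow> k v" for v
 proof -
  have "(%n. (k - kn n) (k v)) \<longlonglongrightarrow> 0"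
  proof (rule contraction_limit[where D = "{blinfun_apply a \<xi> | a. a : A}"])
   show "norm ((k - kn n) v) <= norm v" for n v by (rule is_proj_norm_le[OF kd(1)])
   show "k v : closure {blinfun_apply a \<xi> | a. a : A}" using k(3) by blast
   fix x assume "x : {blinfun_apply a \<xi> | a. a : A}"
   then obtain a where a: "x = blinfun_apply a \<xi>" "a : A" by blast
   have e: "(k - kn n) x = (k - kn n) (a ((Id - q n) \<xi>))" for n
    using cyclic_proj_fixI[OF sA a(2), of "q n \<xi>"] kk[of n] cyclic_proj_fixI[OF sA AI(6)[OF a(2) q(1)[of n]], of \<xi>]
    by (simp add: a(1) blinfun.diff_left blinfun.diff_right kn_def k_def)
   have "(%n. a ((Id - q n) \<xi>)) \<longlonglongrightarrow> a 0" by (rule blinfun.tendsto[OF tendsto_const q0])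
   hence "(%n. a ((Id - q n) \<xi>)) \<longlonglongrightarrow> 0" by simp
   thus "(%n. (k - kn n) x) \<longlonglongrightarrow> 0"
    unfolding e by (rule Lim_null_comparison[rotated, OF tendsto_norm_zero]) (simp add: is_proj_norm_le[OF kd(1)])
  qed
  moreover have "(k - kn n) (k v) = k v - kn n v" for n using kd(2)[of n] is_projD(4)[OF k(1)]
   by (simp add: blinfun.diff_left) (metis oL_apply)
  ultimately have "(%n. k v - (k v - kn n v)) \<longlonglongrightarrow> k v - 0" by (intro tendsto_intros) simp
  thus ?thesis by simp
 qed
 have D1: "range kn <= self_adjoints (commutant A)" using kn(2) is_projD(3)[OF kn(1)] by (auto simp: self_adjoints_def)
 have kle: "m <= n ==> kn m \<sqsubseteq> kn n" for m n by (rule proj_le_iff_op_le[OF kn(1) kn(1) le])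
 have D2: "up_directed (range kn)"
  unfolding up_directed_def using kle[OF max.cobounded1] kle[OF max.cobounded2] by blast
 have D3: "lub_in (commutant A) (range kn) k"
  unfolding lub_in_def
 proof (intro conjI ballI impI)
  show "k : self_adjoints (commutant A)" using k is_projD(3)[OF k(1)] by (simp add: self_adjoints_def)
  show "d \<sqsubseteq> k" if "d : range kn" for d using that proj_le_iff_op_le[OF k(1) kn(1) kk] by auto
  fix t assume t: "t : self_adjoints (commutant A)" "ALL d:range kn. d \<sqsubseteq> t"
  show "k \<sqsubseteq> t"
  proof (rule op_leI)
   fix v
   show "Re (cinner (k v) v) <= Re (cinner (t v) v)"
   proof (rule tendsto_upperbound)
    show "(%n. Re (cinner (kn n v) v)) \<longlonglongrightarrow> Re (cinner (k v) v)" by (rule tendsto_Re[OF tendsto_cinner[OF lim tendsto_const]])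
    show "\<forall>\<^sub>F n in sequentially. Re (cinner (kn n v) v) <= Re (cinner (t v) v)"
     using t(2) by (intro always_eventually allI op_le_Re) blast
   qed simp
  qed (use t(1) is_projD[OF k(1)] commutant_BH in "auto simp: self_adjoints_def")
 qed
 have S: "Re (tr' k) = (SUP n. Re (tr' (kn n)))" using nft_SUP[OF tr' D1 D2 D3] by (simp add: image_image)
 have "(SUP n. Re (tr' (kn n))) = \<mu> * T"
 proof (rule antisym)
  have ub: "Re (tr' (kn n)) <= \<mu> * T" for n
   using commutant_cyclic_cut(1)[OF q(1,2), of n \<xi>] lambda_pos by (simp add: tn T_def mult_left_mono)
  thus "(SUP n. Re (tr' (kn n))) <= \<mu> * T" by (intro cSUP_least) auto
  show "\<mu> * T <= (SUP n. Re (tr' (kn n)))"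
  proof (rule tendsto_upperbound)
   show "(%n. \<mu> * (T - Re (\<tau> (Id - q n)))) \<longlonglongrightarrow> \<mu> * T" using tendsto_mult_left[OF tendsto_diff[OF tendsto_const tlim], of \<mu> T] by simp
   show "\<forall>\<^sub>F n in sequentially. \<mu> * (T - Re (\<tau> (Id - q n))) <= (SUP n. Re (tr' (kn n)))"
   proof (rule always_eventually, rule allI)
    fix n
    have "\<mu> * (T - Re (\<tau> (Id - q n))) <= Re (tr' (kn n))"
     using commutant_cyclic_cut(2)[OF q(1,2), of \<xi> n] lambda_pos by (simp add: tn T_def mult_left_mono)
    also have "... <= (SUP n. Re (tr' (kn n)))" using ub by (intro cSUP_upper bdd_aboveI2) auto
    finally show "\<mu> * (T - Re (\<tau> (Id - q n))) <= (SUP n. Re (tr' (kn n)))" .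
   qed
  qed simp
 qed
 moreover have "tr' k = of_real (Re (tr' k))" by (rule nft_proj[OF vA' tr' k(2,1)])
 ultimately show ?thesis using S by (simp add: k_def T_def)
qed

text \<open>By \<open>coupling\<close> the quotient in the definition has the same value at every
  nonzero vector.\<close>

theorem vn_dim_eq: "vn_dim A = ereal (1 / \<mu>)"
proof -
 note nA = nft_restrict[OF M nft vnA NM]
 have fin: "finite_factor (commutant A)" using factor_commutant[OF factor_A] tr' by (auto simp: finite_factor_def)
 note sA' = star_subalgebra_vn[OF vn_commutant_N]
 have r: "Re (vn_trace A (cyclic_proj (commutant A) \<xi>)) / Re (vn_trace (commutant A) (cyclic_proj A \<xi>)) = 1 / \<mu>"
  if x: "\<xi> ~= 0" for \<xi>
 proof -
  note l = cyclic_proj[OF sA', of \<xi>, unfolded vn_bicommutant[OF vnA]]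
  have "cyclic_proj (commutant A) \<xi> ~= 0" using l(4) x by (metis zero_blinfun.rep_eq)
  hence "Re (\<tau> (cyclic_proj (commutant A) \<xi>)) ~= 0" using nft_proj_zero[OF vnA nA l(2,1)] by blast
  moreover have "vn_trace A (cyclic_proj (commutant A) \<xi>) = \<tau> (cyclic_proj (commutant A) \<xi>)"
   by (rule vn_trace_nft(2)[OF factor_A nA l(2)])
  moreover have "vn_trace (commutant A) (cyclic_proj A \<xi>) = tr' (cyclic_proj A \<xi>)"
   by (rule vn_trace_nft(2)[OF factor_commutant[OF factor_A] tr' cyclic_proj(2)[OF star_subalgebra_vn[OF vnA]]])
  ultimately show ?thesis using lambda_pos by (simp add: coupling)
 qed
 have "\<Omega> ~= 0" using norm_Om by auto
 hence "(THE d. ALL \<xi>. \<xi> ~= 0 --> d = Re (vn_trace A (cyclic_proj (commutant A) \<xi>)) / Re (vn_trace (commutant A) (cyclic_proj A \<xi>))) = 1 / \<mu>"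
  using r by (intro the_equality) auto
 thus ?thesis using fin by (simp add: vn_dim_def)
qed

end

section \<open>Pushing down, and bimodule projections\<close>

lemma nft_positive_zero:
 "von_neumann_algebra M ==> nf_tracial_state M \<tau> ==> x : M ==> positive_op x ==> \<tau> x = 0 ==> x = 0"
 using nft_faithful[OF _ op_sqrt_in_vn, of M \<tau> x] op_sqrt_square[of x] positive_op_adj[OF positive_op_sqrt, of x] by auto

lemma norm_le_dense:
 fixes v :: "'a :: chilbert_space"
 assumes "!!w. w : D ==> cmod (cinner v w) <= K * norm w" and D: "closure D = UNIV" and K: "0 <= K"
 shows "norm v <= K"
proof -
 have "closure D <= {w. cmod (cinner v w) <= K * norm w}"
  by (rule closure_minimal) (use assms in "auto intro!: closed_Collect_le continuous_intros")
 hence "cmod (cinner v v) <= K * norm v" using D by auto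
 hence "norm v * norm v <= K * norm v" by (simp add: cinner_self power2_eq_square norm_mult)
 thus ?thesis using K by (cases "v = 0") (auto dest: mult_right_le_imp_le)
qed

text \<open>The Markov property is what ties \<open>tr\<close> to \<open>e\<close> here. The same
  results can therefore be used for \<open>A\<close> with the number \<open>\<mu>\<close> and for
  \<open>A + Au\<close> with \<open>2 * \<mu>\<close>.\<close>

locale jones = stdform_sub M \<Omega> N for M :: "'k :: chilbert_space op set" and \<Omega> and N +
 fixes tr :: "'k op => complex" and \<mu> :: real
 assumes factor_P: "factor P" and nft_tr: "nf_tracial_state P tr" and mu_pos: "0 < \<mu>"
  and markov: "x : M ==> tr (x ** e) = \<mu> * \<tau> x"
begin

lemmas PI = vn_intros[OF vnP]
lemmas PBH = vn_inBH[OF vnP]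

lemma M_P: "x : M ==> x : P" using M_subset_P by blast

lemma tr_M: "x : M ==> tr x = \<tau> x"
 by (rule trace_unique[OF factor_M nft_restrict[OF vnP nft_tr M M_subset_P] nft])

lemma tr_e: "tr e = \<mu>" using markov[OF MI(1)] norm_Om by (simp add: cinner_self)

lemma tr_pushed: assumes "m : M" "x : M" shows "tr (x ** (m ** (e ** adj m))) = \<mu> * \<tau> (x ** (m ** adj m))"
proof -
 have "tr ((x ** m) ** (e ** adj m)) = tr ((e ** adj m) ** (x ** m))"
  by (rule nft_comm[OF nft_tr]) (intro PI M_P assms e_inP)+
 also have "... = tr (e ** (adj m ** (x ** m)))" by (simp add: oL_assoc)
 also have "... = tr ((adj m ** (x ** m)) ** e)" by (rule nft_comm[OF nft_tr]) (intro PI M_P assms e_inP)+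
 also have "... = \<mu> * \<tau> (adj m ** (x ** m))" by (intro markov MI assms)
 also have "\<tau> (adj m ** (x ** m)) = \<tau> ((x ** m) ** adj m)" by (rule nft_comm[OF nft]) (intro MI assms)+
 finally show ?thesis by (simp add: oL_assoc)
qed

text \<open>An \<open>m\<close> with \<open>m \<Omega> = W \<Omega>\<close> is wanted; it exists if
  this vector is bounded over the commutant of \<open>M\<close>. For \<open>S = jj c\<close>, the
  inner product of \<open>S (W \<Omega>)\<close> with \<open>b \<Omega>\<close> is the trace of
  \<open>adj b ** (W ** adj c)\<close> divided by \<open>\<mu>\<close>, and Cauchy-Schwarz for
  \<open>tr\<close> bounds it.\<close>

lemma pushdown:
 assumes W: "W : P" "W ** e = W"
 shows "EX m:M. W = m ** e"
proof -
 interpret T: tracial P tr by standard (fact vnP nft_tr)+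
 have WB: "W : BH" by (rule PBH[OF W(1)])
 \<comment> \<open>Compressed by \<open>e\<close>, the element \<open>adj b ** W\<close> becomes
   \<open>y ** e\<close> with \<open>y\<close> in \<open>M\<close>; the Markov property evaluates
   its trace as the vector state of \<open>y\<close>.\<close>
 have f: "tr (adj b ** W) = of_real \<mu> * cinner (W \<Omega>) (b \<Omega>)" if b: "b : M" for b :: "'k op"
 proof -
  define X where "X = adj b ** W"
  have XP: "X : P" unfolding X_def by (intro PI M_P b W)
  have Xe: "X ** e = X" by (simp add: X_def oL_assoc W)
  obtain y where y: "y : M" "e ** (X ** e) = y ** e" using ex_compression[OF XP] bicommutant_subset by blast
  have "tr X = tr (X ** e)" by (simp add: Xe)
  also have "... = tr (e ** X)" by (rule nft_comm[OF nft_tr XP e_inP])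
  also have "... = \<mu> * \<tau> y" using y markov Xe by metis
  also have "\<tau> y = \<tau> (e ** X)" using y(2) Xe by (metis oL_apply e_Om)
  also have "... = cinner (X \<Omega>) \<Omega>" by (simp add: e_cinner e_Om)
  also have "... = cinner (W \<Omega>) (b \<Omega>)" by (simp add: X_def cinner_adj_left MBH b)
  finally show ?thesis by (simp add: X_def)
 qed
 have bd: "norm (S (W \<Omega>)) <= (norm W / \<mu>) * norm (S \<Omega>)" if S: "S : commutant M" for S
 proof (rule norm_le_dense[OF _ cyclic])
  show "0 <= (norm W / \<mu>) * norm (S \<Omega>)" using mu_pos by simp
  define c where "c = jj S"
  have cM: "c : M" unfolding c_def by (rule jj_commutant_in[OF S])
  have Sc: "S = jj c" by (simp add: c_def)
  have tn: "tnorm tr x = norm (x \<Omega>)" if "x : M" for x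
   using that MI by (simp add: tnorm_def tr_M cinner_adj_left MBH Re_cinner_self)
  fix w assume "w : orbit M \<Omega>"
  then obtain b where b: "w = blinfun_apply b \<Omega>" "b : M" by blast
  have "cinner (S (W \<Omega>)) w = cinner (W \<Omega>) (jj (adj c) (b \<Omega>))"
   by (simp add: Sc b jj_adj MBH cM cinner_adj_right jj_BH)
  also have "... = cinner (W \<Omega>) ((b ** c) \<Omega>)" by (simp add: jj_Om MI cM b MBH)
  also have "... = tr (adj (b ** c) ** W) / \<mu>" using f[OF MI(6)[OF b(2) cM]] mu_pos by simp
  also have "tr (adj (b ** c) ** W) = tr (adj b ** (W ** adj c))"
   using nft_comm[OF nft_tr, of "adj c" "adj b ** W"] by (simp add: adj_compose MBH b cM oL_assoc PI M_P W)
  finally have "cmod (cinner (S (W \<Omega>)) w) = cmod (tr (adj b ** (W ** adj c))) / \<mu>" using mu_pos by (simp add: norm_divide)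
  also have "... <= (tnorm tr (W ** adj c) * tnorm tr b) / \<mu>"
   by (intro divide_right_mono T.tin_cauchy_schwarz PI M_P b cM W) (use mu_pos in simp)
  also have "... <= ((norm W * tnorm tr (adj c)) * tnorm tr b) / \<mu>"
   by (intro divide_right_mono mult_right_mono T.tnorm_compose_left T.tnorm_nonneg PI M_P b cM W) (use mu_pos in simp)
  also have "... = (norm W / \<mu>) * norm (S \<Omega>) * norm w" by (simp add: tn MI cM b Sc jj_Om_self)
  finally show "cmod (cinner (S (W \<Omega>)) w) <= (norm W / \<mu>) * norm (S \<Omega>) * norm w" .
 qed
 have "0 <= norm W / \<mu>" using mu_pos by simp
 from ex_commutant_of_bounded[OF vn_commutant_vn[OF M] this bd] obtain m where
  "m : M" "m \<Omega> = W \<Omega>" unfolding vn_bicommutant[OF M] by blast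
 hence "W ** e = m ** e" by (intro P_eqI W M_P) simp_all
 thus ?thesis using W(2) \<open>m : M\<close> by auto
qed

text \<open>A projection of trace below that of \<open>e\<close> is equivalent to part of
  \<open>e\<close>, and pushing down writes it as \<open>m ** (e ** adj m)\<close>. Commutation with
  \<open>N\<close> and irreducibility make \<open>m ** adj m\<close>, and then
  \<open>adj m ** m\<close>, the same scalar, so the part of \<open>e\<close> is 0 or
  \<open>e\<close> itself.\<close>

lemma bimodule_projection_trace:
 assumes irr: "!!x. x : M ==> x : commutant N ==> EX c. x = cscale c Id"
  and k: "k : P" "k : commutant N" "is_proj k" "k ~= 0"
 shows "\<mu> <= Re (tr k)"
proof (rule ccontr)
 assume lt: "~ \<mu> <= Re (tr k)"
 then obtain w where w: "w : P" "adj w ** w = k" "e ** w = w"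
  using comparison[OF factor_P nft_tr k(1,3) e_inP eP] tr_e by auto
 have We: "adj w ** e = adj w" using arg_cong[OF w(3), of adj] by (simp add: adj_compose PBH w(1) e_simps)
 obtain m where m: "m : M" "adj w = m ** e" using pushdown[OF PI(9)[OF w(1)] We] by blast
 have wm: "w = e ** adj m" using arg_cong[OF m(2), of adj] by (simp add: adj_compose PBH w(1) MBH m(1) e_simps)
 have k_eq: "k = m ** (e ** adj m)"
  unfolding w(2)[symmetric] m(2) using arg_cong[OF e_simps(2), of "%z. m ** (z ** adj m)"] by (simp add: wm oL_assoc)
 define z where "z = m ** adj m"
 have zM: "z : M" unfolding z_def by (intro MI m)
 have "z : commutant N"
 proof (rule commutantI[OF MBH[OF zM]])
  fix a assume a: "a : N"
  define d where "d = (z ** a) - (a ** z)"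
  have aM: "a : M" by (rule N_inM[OF a])
  have dM: "d : M" unfolding d_def by (intro MI zM aM)
  \<comment> \<open>Up to the factor \<open>\<mu>\<close> the trace of \<open>x ** z\<close> is
    \<open>tr (x ** k)\<close>, and \<open>k\<close> commutes with \<open>a\<close>.\<close>
  have "\<tau> (x ** d) = 0" if x: "x : M" for x
  proof -
   have "\<mu> * \<tau> ((a ** x) ** z) = tr (a ** (x ** k))"
    using tr_pushed[OF m(1) MI(6)[OF aM x]] by (simp add: z_def k_eq oL_assoc)
   also have "... = tr ((x ** k) ** a)" by (rule nft_comm[OF nft_tr]) (intro PI M_P aM x k)+
   also have "... = tr ((x ** a) ** k)" using commutantD[OF k(2) a] by (simp add: oL_assoc)
   also have "... = \<mu> * \<tau> ((x ** a) ** z)" using tr_pushed[OF m(1) MI(6)[OF x aM]] by (simp add: z_def k_eq oL_assoc)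
   finally have "\<tau> (a ** (x ** z)) = \<tau> (x ** (a ** z))" using mu_pos by simp
   moreover have "\<tau> (a ** (x ** z)) = \<tau> ((x ** z) ** a)" by (rule nft_comm[OF nft aM MI(6)[OF x zM]])
   ultimately show ?thesis by (simp add: d_def blinfun.diff_left blinfun.diff_right cinner_diff_left)
  qed
  from this[OF MI(9)[OF dM]] have "d = 0" by (rule nft_faithful[OF nft dM])
  thus "z ** a = a ** z" by (simp add: d_def)
 qed
 then obtain c0 where c0: "z = cscale c0 Id" using irr[OF zM] by blast
 define c where "c = Re c0"
 have tz: "\<tau> z = c0" using norm_Om by (simp add: c0 cscale_apply cinner_scaleC_left cinner_self)
 have "c0 = of_real c"
  using nft_self_adjoint[OF M nft zM] MBH[OF m(1)] tz by (simp add: c_def z_def adj_compose)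
 hence zc: "z = c *R Id" by (simp add: c0 cscale_of_real)
 \<comment> \<open>It is self-adjoint with square \<open>(- c) *R y\<close> and has trace 0, so
   faithfulness makes it vanish.\<close>
 define y where "y = (adj m ** m) - c *R Id"
 have yM: "y : M" unfolding y_def by (intro MI m)
 have ya: "adj y = y" by (simp add: y_def adj_simps MBH m(1) BH_intros)
 have mm: "(adj m ** m) ** (adj m ** m) = c *R (adj m ** m)"
 proof -
  have "(adj m ** m) ** (adj m ** m) = adj m ** (z ** m)" by (simp add: z_def oL_assoc)
  thus ?thesis by (simp add: zc oL_scaleR_left oL_scaleR_right)
 qed
 have "\<tau> (adj m ** m) = \<tau> z" unfolding z_def by (rule nft_comm[OF nft MI(9)[OF m(1)] m(1)])
 hence ty: "\<tau> y = 0" using norm_Om by (simp add: y_def zc blinfun.diff_left blinfun.scaleR_left cinner_diff_left)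
 have "adj y ** y = (- c) *R y" unfolding ya unfolding y_def using mm
  by (simp add: oL_diff_left oL_diff_right oL_scaleR_left oL_scaleR_right scaleR_diff_right)
 hence "\<tau> (adj y ** y) = 0" using ty by (simp add: blinfun.scaleR_left blinfun.minus_left)
 hence "y = 0" by (rule nft_faithful[OF nft yM])
 hence mc: "adj m ** m = c *R Id" by (simp add: y_def)
 have ww: "w ** adj w = c *R e"
 proof -
  have "w ** adj w = e ** ((adj m ** m) ** e)" unfolding m(2) unfolding wm by (simp add: oL_assoc)
  thus ?thesis by (simp add: mc oL_scaleR_left oL_scaleR_right e_simps)
 qed
 have "tr k = tr (w ** adj w)" unfolding w(2)[symmetric] by (rule nft_comm[OF nft_tr PI(9)[OF w(1)] w(1)])
 also have "... = c * \<mu>" by (simp add: ww nft_scaleR[OF vnP nft_tr e_inP] tr_e)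
 finally have tk: "Re (tr k) = c * \<mu>" by simp
 have "is_proj (c *R e)" using partial_isometry(2)[OF PBH[OF w(1)]] w(2) k(3) ww by simp
 hence "c *R (c *R e) = c *R e" using is_projD(2)[of "c *R e"] by (simp add: oL_scaleR_left oL_scaleR_right e_simps)
 hence "(c * c - c) *R e = 0" by (simp add: scaleR_diff_left)
 moreover have "e ~= 0" using e_Om norm_Om by auto
 ultimately have "c = 0 | c = 1" by auto
 moreover have "c ~= 0"
  using tk nft_proj_zero[OF vnP nft_tr k(1,3)] k(4) by auto
 ultimately show False using lt tk by simp
qed

end

text \<open>The compression of \<open>x\<close> by \<open>e\<close> is \<open>y ** e\<close> with
  \<open>y\<close> in \<open>A\<close> of the same trace, which reduces the Markov property to
  elements of \<open>A\<close>.\<close>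

sublocale subfactor_trace < jones M \<Omega> A tr \<mu>
proof
 show "factor P" "nf_tracial_state P tr" "0 < \<mu>" by (fact factor_P nft_tr lambda_pos)+
 note PI = vn_intros[OF vnP]
 fix x assume x: "x : M"
 have xP: "x : P" using x M_subset_P by blast
 obtain y where y: "y : A" "e ** (x ** e) = y ** e" using ex_compression[OF xP] vn_bicommutant[OF vnA] by blast
 have "tr (x ** e) = tr ((x ** e) ** e)" by (simp add: oL_assoc e_simps)
 also have "... = tr (e ** (x ** e))" by (rule nft_comm[OF nft_tr]) (intro PI xP e_inP)+
 also have "... = \<mu> * \<tau> y" by (simp add: y tr_A_e)
 also have "\<tau> y = \<tau> x"
  using arg_cong[OF y(2), of "%T. cinner (blinfun_apply T \<Omega>) \<Omega>"] by (simp add: e_Om e_cinner)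
 finally show "tr (x ** e) = \<mu> * \<tau> x" .
qed

section \<open>Irreducibility and singularity in the standard form\<close>

context subfactor_trace
begin

lemma ex_cond_exp: assumes x: "x : M" shows "EX y:A. e ** (x ** e) = y ** e"
 using ex_compression[OF M_P[OF x]] vn_bicommutant[OF vnA] by blast

text \<open>Evaluated at \<open>a \<Omega>\<close>, the hypothesis says that
  \<open>x ** (a ** p)\<close> kills \<open>\<Omega>\<close> for every \<open>a\<close> in
  \<open>M\<close>; in a factor this forces \<open>x = 0\<close>.\<close>

lemma M_jj_eq_0:
 assumes p: "p : M" "is_proj p" "p ~= 0" and x: "x : M" "x ** jj p = 0"
 shows "x = 0"
proof (rule ccontr)
 assume x0: "x ~= 0"
 have 0: "x ** (a ** p) = 0" if a: "a : M" for a
 proof (rule separating)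
  show "(x ** (a ** p)) \<Omega> = 0"
   using arg_cong[OF x(2), of "%T. blinfun_apply T (a \<Omega>)"] jj_Om[OF p(1) a] is_projD(3)[OF p(2)] by simp
 qed (intro MI x a p)
 obtain v h :: "'k op" where v: "v : M" "v ** h = x" "is_proj (adj v ** v)" "!!R :: 'k op. x ** R = 0 ==> v ** R = 0"
  using polar_decomposition[OF M x(1)] by blast
 have "v ~= 0" using v(2) x0 by auto
 hence "adj v ** v ~= 0" using adj_compose_self_eq_0[OF MBH[OF v(1)]] by blast
 then obtain a where a: "a : M" "(adj v ** v) ** (a ** p) ~= 0"
  using factor_connects[OF factor_M MI(6)[OF MI(9)[OF v(1)] v(1)] v(3) _ p] by blast
 thus False using v(4)[OF 0[OF a(1)]] by (simp add: oL_assoc oL_zero_right)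
qed

text \<open>As \<open>p\<close> commutes with \<open>A\<close>, its expectation is the scalar
  \<open>s\<close>, so \<open>p ** (e ** p)\<close> divided by \<open>s\<close> is a projection, of
  trace \<open>\<mu>\<close>. It lies below \<open>p ** jj p\<close>, whose trace is the product on
  the right.\<close>

lemma relative_commutant_projection:
 assumes p: "p : M" "p : commutant A" "is_proj p" "p ~= 0"
 shows "\<mu> <= Re (\<tau> p) * Re (tr (jj p))"
proof -
 note pp = is_projD[OF p(3)]
 define s where "s = Re (\<tau> p)"
 have ts: "\<tau> p = of_real s" unfolding s_def by (rule nft_proj[OF M nft p(1,3)])
 have s0: "0 < s" unfolding s_def using nft_proj_nonneg[OF M nft p(1,3)] nft_proj_zero[OF M nft p(1,3)] p(4) by fastforce
 have jP: "jj p : P" unfolding P_eq using p(2) by blast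
 have jp: "is_proj (jj p)" by (rule jj_is_proj[OF p(3)])
 have pj: "p ** jj p = jj p ** p" using commutantD[OF jj_in_commutant[OF p(1)] p(1)] by simp
 have ppz: "p ** (p ** z) = p ** z" and jpz: "jj p ** (p ** z) = p ** (jj p ** z)" for z :: "'k op"
  using pp(2) pj by (simp_all flip: oL_assoc)
 obtain y where y: "y : A" "e ** (p ** e) = y ** e" using ex_cond_exp[OF p(1)] by blast
 have "y : commutant A"
 proof (rule commutantI[OF A_BH[OF y(1)]])
  fix a assume a: "a : A"
  show "y ** a = a ** y"
  proof (rule A_e_inject)
   have "(y ** a) ** e = (y ** e) ** a" by (simp add: oL_assoc e_push a)
   also have "... = a ** (e ** (p ** e))"
    unfolding y(2)[symmetric] using commutantD[OF p(2) a] e_push(2)[OF a] e_push(1)[OF a] by (metis oL_assoc)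
   finally show "(y ** a) ** e = (a ** y) ** e" by (simp add: y(2) oL_assoc)
  qed (use a y AI in auto)
 qed
 then obtain c where c: "y = cscale c Id" using factor_center[OF factor_A y(1)] by blast
 have "c = s"
  using arg_cong[OF y(2), of "%T. cinner (blinfun_apply T \<Omega>) \<Omega>"] norm_Om ts
  by (simp add: e_Om e_cinner c cscale_apply cinner_scaleC_left cinner_self)
 hence epe: "e ** (p ** e) = s *R e" using y(2) by (simp add: c cscale_of_real oL_scaleR_left)
 define q where "q = (1 / s) *R (p ** (e ** p))"
 have qB: "q : BH" unfolding q_def by (intro BH_intros pp e_simps)
 have "q ** q = (1 / s) *R (1 / s) *R (p ** ((e ** (p ** e)) ** p))"
  unfolding q_def using pp(2) by (simp add: oL_scaleR_left oL_scaleR_right oL_assoc) (metis oL_assoc)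
 also have "... = q" unfolding epe q_def using s0 by (simp add: oL_scaleR_left oL_scaleR_right)
 finally have qP: "is_proj q" using qB pp e_simps by (simp add: is_proj_def q_def adj_scaleR adj_compose BH_compose oL_assoc)
 have "(jj p ** p) ** e = p ** e"
 proof (rule e_eqI)
  fix a assume a: "a : A"
  have "jj p ((p ** a) \<Omega>) = (p ** a) (p \<Omega>)" using jj_Om[OF p(1) MI(6)[OF p(1) N_inM[OF a]]] pp(3) by simp
  also have "... = p (a \<Omega>)" using commutant_apply[OF p(2) a] by (simp add: pp(4))
  finally show "(jj p ** p) (a \<Omega>) = p (a \<Omega>)" by simp
 qed
 hence "((jj p ** p) ** e) ** p = (p ** e) ** p" by (rule arg_cong)
 hence rq: "(p ** jj p) ** q = q" unfolding q_def pj by (simp add: oL_scaleR_right oL_assoc ppz)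
 have rP: "is_proj (p ** jj p)"
  unfolding is_proj_def using pp(1,3) is_projD(1-3)[OF jp]
  by (simp add: BH_compose adj_compose oL_assoc jpz ppz pj[symmetric])
 have "Re (tr q) <= Re (tr (p ** jj p))"
  by (rule normal_pos_mono[OF vnP nft_normal_pos[OF vnP nft_tr] _ _ proj_le_iff_op_le[OF rP qP rq]])
   (auto simp: q_def intro!: PI M_P[OF p(1)] e_inP jP)
 moreover have "tr q = \<mu>"
 proof -
  have "tr (p ** (p ** (e ** adj p))) = \<mu> * \<tau> (p ** (p ** adj p))" by (rule tr_pushed[OF p(1,1)])
  hence "tr (p ** (e ** p)) = \<mu> * s" by (simp add: pp(3,4) ts ppz)
  thus ?thesis using s0 by (simp add: q_def nft_scaleR[OF vnP nft_tr] PI M_P p e_inP)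
 qed
 moreover have "tr (p ** jj p) = tr (jj p) * \<tau> p"
  by (rule trace_compression[OF vnP nft_tr factor_M M_subset_P nft jP jp jj_in_commutant[OF p(1)] M_jj_eq_0[OF p(1,3,4)] p(1)])
 ultimately show ?thesis by (simp add: ts mult.commute)
qed

end

text \<open>The only choice for the scalar is the normalised trace, so each self-adjoint element is
 compared with that multiple of \<open>p\<close> by means of a single spectral projection.\<close>

lemma minimal_corner_scalar:
 assumes R: "von_neumann_algebra R" and \<tau>: "nf_tracial_state R \<tau>" and p: "p : R" "is_proj p" "p ~= 0"
  and min: "!!q. q : R ==> is_proj q ==> q ** p = q ==> q = 0 | q = p"
  and x: "x : R" "p ** x = x" "x ** p = x"
 shows "EX c. x = cscale c p"
proof -
 note RI = vn_intros[OF R]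
 note pp = is_projD[OF p(2)]
 define t where "t = Re (\<tau> p)"
 have tp: "\<tau> p = of_real t" unfolding t_def by (rule nft_proj[OF R \<tau> p(1,2)])
 have t0: "t ~= 0" unfolding t_def using nft_proj_zero[OF R \<tau> p(1,2)] p(3) by blast
 have sa: "EX c. y = c *R p" if y: "y : R" "adj y = y" "p ** y = y" "y ** p = y" for y
 proof -
  define c where "c = Re (\<tau> y) / t"
  have d: "y - c *R p : R" "\<tau> (y - c *R p) = 0"
   using y p t0 nft_self_adjoint[OF R \<tau> y(1,2)] by (auto simp: nft_diff[OF R \<tau>] nft_scaleR[OF R \<tau>] RI tp c_def)
  obtain r where r: "r : R" "is_proj r" "positive_op (r ** (y - c *R Id))"
   "positive_op ((Id - r) ** (c *R Id - y))" "p ** r = r ** p"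
   using ex_spectral_projection[OF R y(1,2), of c] p(2) y(3,4) by metis
  have pz: "p ** (p ** z) = p ** z" "r ** (p ** z) = p ** (r ** z)" "p ** (y ** z) = y ** z" for z :: "'a op"
   using pp(2) r(5) y(3) by (simp_all flip: oL_assoc)
  have "is_proj (r ** p)"
   using pp is_projD[OF r(2)] r(5) by (simp add: is_proj_def BH_compose adj_compose) (simp add: oL_assoc pz pp(2) flip: r(5))
  \<comment> \<open>Minimality leaves only these two values, so \<open>y - c *R p\<close> has a
    sign; being of trace 0, it vanishes.\<close>
  hence "r ** p = 0 | r ** p = p" by (intro min) (auto simp: oL_assoc pp intro: RI r p)
  hence "y - c *R p = 0"
  proof
   assume "r ** p = 0"
   hence ry: "r ** y = 0" using y(3) by (metis oL_assoc oL_zero_left)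
   have "positive_op (adj p ** (((Id - r) ** (c *R Id - y)) ** p))" by (rule positive_conj[OF r(4) pp(1)])
   also have "... = - (y - c *R p)"
    using \<open>r ** p = 0\<close> ry by (simp add: oL_simps pp y(3,4))
   finally have "- (y - c *R p) = 0"
    using nft_positive_zero[OF R \<tau> RI(5)[OF d(1)]] nft_minus[OF R \<tau> d(1)] d(2) by simp
   thus ?thesis by simp
  next
   assume rp: "r ** p = p"
   hence ry: "r ** y = y" using y(3) by (metis oL_assoc)
   have "positive_op (adj p ** ((r ** (y - c *R Id)) ** p))" by (rule positive_conj[OF r(3) pp(1)])
   also have "... = y - c *R p" using rp ry by (simp add: oL_simps pp y(3,4))
   finally show ?thesis using nft_positive_zero[OF R \<tau> d(1) _ d(2)] by simp
  qed
  thus ?thesis by auto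
 qed
 have xB: "x : BH" by (rule vn_inBH[OF R x(1)])
 have xa: "p ** adj x = adj x" "adj x ** p = adj x"
  using arg_cong[OF x(3), of adj] arg_cong[OF x(2), of adj] by (simp_all add: adj_compose xB pp)
 obtain a where a: "x + adj x = a *R p"
  using sa[of "x + adj x"] x xB xa by (auto simp: adj_add add.commute RI oL_add_left oL_add_right)
 obtain b where b: "cscale \<i> (x - adj x) = b *R p"
  using sa[of "cscale \<i> (x - adj x)"] x xB xa
  by (auto simp: imaginary_part_self_adjoint RI oL_cscale_left oL_cscale_right pp oL_diff_left oL_diff_right)
 have "x = (1/2) *R ((x + adj x) + cscale (- \<i>) (cscale \<i> (x - adj x)))" by (simp add: cscale_cscale flip: scaleR_2)
 also have "... = cscale ((1/2) * (of_real a - \<i> * of_real b)) p"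
  unfolding a b by (rule blinfun_eqI)
   (simp add: cscale_apply blinfun.add_left blinfun.scaleR_left scaleC_scaleC scaleC_diff_right scaleC_diff_left diff_divide_distrib flip: scaleC_of_real)
 finally show ?thesis by blast
qed

context subfactor_trace
begin

text \<open>A nontrivial projection of the relative commutant and its complement give
  \<open>\<mu> <= s * s'\<close> and \<open>\<mu> <= (1 - s) * (1 - s')\<close>. The product of the
  right sides is at most \<open>1/16\<close>, which excludes \<open>\<mu> > 1/4\<close>.\<close>

lemma irreducible:
 assumes mu: "1 / 4 < \<mu>" and x: "x : M" "x : commutant A"
 shows "EX c. x = cscale c Id"
proof -
 \<comment> \<open>The relative commutant, written as a single commutant so that it is visibly a von
   Neumann algebra.\<close>
 define R where "R = commutant (commutant M Un A)"
 have Req: "y : R \<longleftrightarrow> y : M & y : commutant A" for y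
 proof -
  have "R = commutant (commutant M) Int commutant A" unfolding R_def commutant_def by auto
  thus ?thesis by (simp add: vn_bicommutant[OF M])
 qed
 have vR: "von_neumann_algebra R" unfolding R_def
  by (rule vn_commutant) (use vn_BH[OF vnA] commutant_BH vn_adj[OF vnA] vn_adj[OF vn_commutant_vn[OF M]] in auto)
 have RM: "R <= M" using Req by blast
 show ?thesis
 proof (rule minimal_corner_scalar[OF vR nft_restrict[OF M nft vR RM] vn_id[OF vR]])
  show "x : R" using x Req by simp
  show "(Id :: 'k op) ~= 0" using norm_Om by (metis id_blinfun.rep_eq id_apply norm_zero zero_blinfun.rep_eq zero_neq_one)
  fix p assume p: "p : R" "is_proj p"
  show "p = 0 | p = Id"
  proof (rule ccontr)
   assume n: "~ (p = 0 | p = Id)"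
   define s s' where "s = Re (\<tau> p)" and "s' = Re (tr (jj p))"
   have pM: "p : M" and pA: "p : commutant A" using p Req by auto
   have jP: "jj p : P" unfolding P_eq using pA by blast
   have 1: "\<mu> <= s * s'" unfolding s_def s'_def by (rule relative_commutant_projection[OF pM pA p(2)]) (use n in simp)
   have "\<mu> <= Re (\<tau> (Id - p)) * Re (tr (jj (Id - p)))"
    by (rule relative_commutant_projection[OF MI(4)[OF MI(1) pM] _ is_proj_complement[OF p(2)]])
     (use n vn_diff[OF vn_commutant_N _ pA] in auto)
   hence 2: "\<mu> <= (1 - s) * (1 - s')"
    using norm_Om jP by (simp add: s_def s'_def blinfun.diff_left cinner_diff_left cinner_self jj_diff nft_diff[OF vnP nft_tr] PI nft_id[OF nft_tr])
   have s0: "0 <= s" "0 <= s'" unfolding s_def s'_def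
    by (rule nft_proj_nonneg[OF M nft pM p(2)], rule nft_proj_nonneg[OF vnP nft_tr jP jj_is_proj[OF p(2)]])
   have "\<mu> * \<mu> <= (s * s') * ((1 - s) * (1 - s'))" by (intro mult_mono 1 2) (use mu 1 in auto)
   also have "... = (s * (1 - s)) * (s' * (1 - s'))" by (simp add: algebra_simps)
   also have "... <= (1 / 4) * (1 / 4)"
   proof -
    have q: "y * (1 - y) <= 1 / 4" for y :: real
     using zero_le_power2[of "y - 1 / 2"] by (simp add: power2_eq_square algebra_simps)
    have "s <= 1" "s' <= 1" unfolding s_def s'_def
     using normal_pos_mono[OF M nft_normal_pos[OF M nft] pM MI(1) proj_le_id[OF p(2)]] norm_Om
      normal_pos_mono[OF vnP nft_normal_pos[OF vnP nft_tr] jP PI(1) proj_le_id[OF jj_is_proj[OF p(2)]]] nft_id[OF nft_tr]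
     by (simp_all add: cinner_self)
    thus ?thesis using q s0 by (intro mult_mono) auto
   qed
   finally have "\<mu> * \<mu> <= 1 / 16" by simp
   moreover have "1 / 4 * (1 / 4) < \<mu> * \<mu>" using mu by (intro mult_strict_mono) auto
   ultimately show False by simp
  qed
 qed simp_all
qed

text \<open>The expectation \<open>y\<close> of \<open>w\<close> satisfies
  \<open>y ** a = (w ** (a ** adj w)) ** y\<close>, so \<open>adj w ** y\<close> commutes with
  \<open>A\<close> and is a scalar. Thus \<open>y\<close> is a multiple of \<open>w\<close>, and the
  factor is 0 because \<open>w\<close> is not in \<open>A\<close>.\<close>

lemma normalizer_compression:
 assumes irr: "!!x. x : M ==> x : commutant A ==> EX c. x = cscale c Id"
  and w: "w : M" "adj w ** w = Id" "w ** adj w = Id" "!!a. a : A ==> w ** (a ** adj w) : A" "w ~: A"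
 shows "e ** (w ** e) = 0"
proof -
 obtain y where y: "y : A" "e ** (w ** e) = y ** e" using ex_cond_exp[OF w(1)] by blast
 have wB: "w : BH" by (rule MBH[OF w(1)])
 have ww: "adj w ** (w ** z) = z" "w ** (adj w ** z) = z" for z :: "'k op" using w(2,3) by (simp_all flip: oL_assoc)
 have ya: "y ** a = (w ** (a ** adj w)) ** y" if a: "a : A" for a
 proof (rule A_e_inject)
  have "(y ** a) ** e = (y ** e) ** a" by (simp add: oL_assoc e_push a)
  also have "... = e ** ((w ** (a ** adj w)) ** (w ** e))" unfolding y(2)[symmetric] by (simp add: oL_assoc e_push a ww)
  also have "... = (w ** (a ** adj w)) ** (e ** (w ** e))" by (rule e_push(2)[OF w(4)[OF a]])
  finally show "(y ** a) ** e = ((w ** (a ** adj w)) ** y) ** e" by (simp add: y(2) oL_assoc)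
 qed (use a y AI w(4) in auto)
 have "adj w ** y : commutant A"
 proof (rule commutantI)
  show "adj w ** y : BH" by (intro BH_compose adj_BH wB A_BH y)
  show "(adj w ** y) ** a = a ** (adj w ** y)" if "a : A" for a
   using ya[OF that] by (simp add: oL_assoc ww)
 qed
 moreover have "adj w ** y : M" by (intro MI w N_inM y)
 ultimately obtain c where "adj w ** y = cscale c Id" using irr by blast
 from arg_cong[OF this, of "%z. w ** z"] have yc: "y = cscale c w" by (simp add: ww oL_cscale_right wB)
 have "c = 0"
 proof (rule ccontr)
  assume c: "c ~= 0"
  have "cscale (1 / c) y : A" by (intro AI y)
  thus False using w(5) c by (simp add: yc cscale_cscale)
 qed
 thus ?thesis using y(2) yc by simp
qed

theorem singular_standard:
 assumes mu: "1 / 4 < \<mu>" "\<mu> < 1 / 3" and u: "u : unitaries M" "conj_by u A = A"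
 shows "u : A"
proof (rule ccontr)
 assume nA: "u ~: A"
 note irr = irreducible[OF mu(1)]
 have uM: "u : M" and uu: "adj u ** u = Id" "u ** adj u = Id" using u by (auto simp: unitaries_def)
 have uB: "u : BH" by (rule MBH[OF uM])
 have U: "u : unitaries BH" using uB uu by (simp add: unitaries_def)
 have uz: "adj u ** (u ** z) = z" "u ** (adj u ** z) = z" for z :: "'k op" using uu by (simp_all flip: oL_assoc)
 have cA: "cj u ` A = A" using u(2) by (simp add: conj_by_def cj_def)
 hence cA': "cj (adj u) ` A = A" using cj_inverse_image(1)[OF U, of A] by simp
 have ua: "u ** (a ** adj u) : A" "adj u ** (a ** u) : A" if "a : A" for a
  using that cA cA' uB by (auto simp: cj_def oL_assoc)
 note AP = subsetD[OF M_subset_P]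
 have uP: "u : P" by (rule M_P[OF uM])
 have cj_comm: "cj u g : commutant A" if "g : commutant A" for g
  using that commutant_cj_image[OF U, of A] cA by auto
 have cjP: "cj u g : P" if "g : P" for g unfolding cj_def by (intro PI uP that)
 have cj_tr: "tr (cj u g) = tr g" if "g : P" for g
  using nft_comm[OF nft_tr PI(6)[OF uP that] PI(9)[OF uP]] by (simp add: cj_def uz)
 have cj_proj: "is_proj (cj u g)" if "is_proj g" for g
  using is_projD[OF that] by (simp add: is_proj_def cj_BH[OF U] cj_compose[OF U, symmetric] cj_adj[OF U, symmetric])
 have eue: "e ** (u ** e) = 0" by (rule normalizer_compression[OF irr uM uu ua(1) nA])
 have eu'e: "e ** (adj u ** e) = 0" using arg_cong[OF eue, of adj] by (simp add: adj_compose uB e_simps BH_compose oL_assoc)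
 define g where "g = cj u e"
 have g: "g : P" "g : commutant A" "is_proj g" unfolding g_def by (intro cjP cj_comm cj_proj e_inP e_commutant eP)+
 have eg: "e ** g = 0" using arg_cong[OF eue, of "%z. z ** adj u"] by (simp add: g_def cj_def oL_assoc)
 have ge: "g ** e = 0" using arg_cong[OF eg, of adj] is_projD[OF g(3)] e_simps by (simp add: adj_compose)
 have sum: "is_proj (p + q)" if "is_proj p" "is_proj q" "p ** q = 0" "q ** p = 0" for p q :: "'k op"
  using is_projD[OF that(1)] is_projD[OF that(2)] that(3,4) by (simp add: is_proj_def BH_add adj_add oL_add_left oL_add_right)
 note trI = nft_id[OF nft_tr]
 show False
 proof (cases "u ** u : A")
  \<comment> \<open>Three orthogonal projections of trace \<open>\<mu>\<close> leave
    \<open>1 - 3 * \<mu>\<close>, positive since \<open>\<mu> < 1/3\<close> and below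
    \<open>\<mu>\<close> since \<open>\<mu> > 1/4\<close>.\<close>
  case False
  have "e ** ((u ** u) ** e) = 0"
  proof (rule normalizer_compression[OF irr])
   show "(u ** u) ** (a ** adj (u ** u)) : A" if "a : A" for a
    using ua(1)[OF ua(1)[OF that]] by (simp add: adj_compose uB oL_assoc)
  qed (use False in "simp_all add: MI uM adj_compose uB oL_assoc uz uu")
  from arg_cong[OF this, of "%z. z ** (adj u ** adj u)"]
  have eh: "e ** cj u g = 0" by (simp add: g_def cj_def oL_assoc)
  define h where "h = cj u g"
  have h: "h : P" "h : commutant A" "is_proj h" unfolding h_def by (intro cjP cj_comm cj_proj g)+
  have he: "h ** e = 0" using arg_cong[OF eh, of adj] is_projD[OF h(3)] e_simps by (simp add: adj_compose h_def)
  have gh: "g ** h = 0" "h ** g = 0"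
   using arg_cong[OF eg, of "cj u"] arg_cong[OF ge, of "cj u"] by (simp_all add: h_def cj_compose[OF U] cj_zero[OF U] flip: g_def)
  have s: "is_proj ((e + g) + h)"
   by (intro sum eP g h eg ge) (simp_all add: oL_add_left oL_add_right eh[folded h_def] he gh)
  define k where "k = Id - ((e + g) + h)"
  have kP: "k : P" unfolding k_def by (intro PI e_inP g h)
  have "tr k = 1 - 3 * \<mu>"
   by (simp add: k_def nft_diff[OF vnP nft_tr] nft_add[OF nft_tr] PI e_inP g h trI)
    (simp add: h_def g_def cj_tr cjP e_inP tr_e)
  moreover have "\<mu> <= Re (tr k)"
  proof (rule bimodule_projection_trace[OF irr kP])
   show "k : commutant A" unfolding k_def by (intro vn_intros[OF vn_commutant_N] e_commutant g h)
   show "is_proj k" unfolding k_def by (rule is_proj_complement[OF s])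
   show "k ~= 0" using \<open>tr k = 1 - 3 * \<mu>\<close> mu nft_zero[OF vnP nft_tr] by (auto simp: complex_eq_iff)
  qed
  ultimately show False using mu by simp
 next
  \<comment> \<open>Here \<open>e\<close> and \<open>g\<close> leave \<open>1 - 2 * \<mu>\<close>,
    too much for the bound over \<open>A\<close>. But \<open>A + Au\<close> is an algebra with Jones
    projection \<open>e + g\<close>; over it the least trace is \<open>2 * \<mu>\<close>, which
    exceeds \<open>1 - 2 * \<mu>\<close>.\<close>
  case True
  define N where "N = {a + (b ** u) | a b. a : A & b : A}"
  have NIn: "a + (b ** u) : N" if "a : A" "b : A" for a b using that by (auto simp: N_def)
  have AN: "a : N" if "a : A" for a using NIn[OF that AI(2)] by simp
  have sN: "star_subalgebra N"
   unfolding star_subalgebra_def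
  proof (intro conjI ballI allI)
   show "N <= BH" using A_BH uB by (auto simp: N_def intro!: BH_intros)
   show "Id : N" by (rule AN[OF AI(1)])
   fix x assume "x : N"
   then obtain a b where x: "x = a + (b ** u)" "a : A" "b : A" by (auto simp: N_def)
   have "adj x = adj a + (((adj u ** (adj b ** u)) ** adj (u ** u)) ** u)"
    by (simp add: x adj_add adj_compose A_BH uB BH_compose oL_assoc uz uu)
   thus "adj x : N" using x ua(2) True by (simp add: NIn AI)
   show "cscale c x : N" for c using x NIn[of "cscale c a" "cscale c b"] by (simp add: cscale_add_right oL_cscale_left AI)
   fix y assume "y : N"
   then obtain c d where y: "y = c + (d ** u)" "c : A" "d : A" by (auto simp: N_def)
   have s: "x + y = (a + c) + ((b + d) ** u)" by (simp add: x y oL_add_left)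
   show "x + y : N" unfolding s by (intro NIn AI x(2,3) y(2,3))
   have "x ** y = ((a ** c) + (b ** ((u ** (d ** adj u)) ** (u ** u))))
    + (((a ** d) + (b ** (u ** (c ** adj u)))) ** u)"
    by (simp add: x y oL_add_left oL_add_right oL_assoc uz uu)
   thus "x ** y : N" using x y ua(1) True by (simp add: NIn AI)
  qed
  have NM': "N <= M" using N_inM uM by (auto simp: N_def intro!: MI)
  interpret B: stdform_sub M \<Omega> N by unfold_locales (fact sN NM')+
  have cNA: "commutant N <= commutant A" by (rule commutant_antimono) (use AN in blast)
  \<comment> \<open>The centre lies in the relative commutant of \<open>A\<close> in
    \<open>M\<close>, which is trivial.\<close>
  have fcN: "factor (commutant N)"
  proof (rule factorI[OF B.vn_commutant_N])
   fix x assume "x : commutant N" "x : commutant (commutant N)"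
   thus "EX c. x = cscale c Id" using irr cNA B.bicommutant_subset by blast
  qed
  have PP: "B.P <= P" unfolding B.P_eq P_eq using cNA by blast
  define q where "q = e + g"
  have qP: "is_proj q" unfolding q_def by (intro sum eP g eg ge)
  have "B.e = q"
  proof (rule proj_eqI[OF B.eP qP])
   have ef: "(B.e ** e) = Id ** e"
    by (rule e_eqI) (simp add: B.e_N_Om AN)
   have "B.e ** u ** e = u ** e"
   proof (rule e_eqI)
    fix a assume a: "a : A"
    have "u ** a = 0 + ((u ** (a ** adj u)) ** u)" by (simp add: oL_assoc uu)
    hence "u ** a : N" using NIn[OF AI(2) ua(1)[OF a]] by simp
    from B.e_N_Om[OF this] show "(B.e ** u) (a \<Omega>) = u (a \<Omega>)" by simp
   qed
   from arg_cong[OF this, of "%z. z ** adj u"] have "B.e ** g = g" by (simp add: g_def cj_def oL_assoc)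
   thus "B.e ** q = q" using ef by (simp add: q_def oL_add_right)
   have "q ** B.e = Id ** B.e"
   proof (rule B.e_eqI)
    fix x assume "x : N"
    then obtain a b where x: "x = a + (b ** u)" "a : A" "b : A" by (auto simp: N_def)
    have 1: "(e ** (b ** u)) \<Omega> = 0"
     using arg_cong[OF eue, of "%z. (b ** z) \<Omega>"] by (simp add: e_push x e_Om oL_assoc)
    have 2: "(g ** a) \<Omega> = 0"
     using arg_cong[OF ge, of "%z. (a ** z) \<Omega>"] commutant_apply[OF g(2) x(2)] by (simp add: e_Om)
    have "(g ** u) ** e = u ** e" by (simp add: g_def cj_def oL_assoc uu e_simps)
    hence "g (u \<Omega>) = u \<Omega>" by (metis oL_apply e_Om)
    hence 3: "g (b (u \<Omega>)) = b (u \<Omega>)" using commutant_apply[OF g(2) x(3)] by simp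
    show "q (x \<Omega>) = Id (x \<Omega>)"
     using 1 2 3 e_N_Om[OF x(2)] by (simp add: x q_def blinfun.add_left blinfun.add_right)
   qed
   thus "q ** B.e = B.e" by simp
  qed
  interpret B: jones M \<Omega> N tr "2 * \<mu>"
  proof
   show "factor B.P" unfolding B.P_eq by (rule factor_jj[OF fcN])
   show "nf_tracial_state B.P tr" by (rule nft_restrict[OF vnP nft_tr B.vnP PP])
   show "0 < 2 * \<mu>" using lambda_pos by simp
   fix x assume x: "x : M"
   have "tr (x ** g) = \<mu> * \<tau> (x ** (u ** adj u))" using tr_pushed[OF uM x] by (simp add: g_def cj_def oL_assoc)
   thus "tr (x ** B.e) = complex_of_real (2 * \<mu>) * \<tau> x"
    using x by (simp add: \<open>B.e = q\<close> q_def oL_add_right nft_add[OF nft_tr] PI M_P e_inP g markov uu)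
  qed
  define k where "k = Id - B.e"
  have kP: "k : B.P" unfolding k_def by (intro B.PI B.e_inP)
  have tk: "tr k = 1 - 2 * \<mu>"
   by (simp add: k_def nft_diff[OF B.vnP B.nft_tr] B.PI B.e_inP trI B.tr_e)
  have "2 * \<mu> <= Re (tr k)"
  proof (rule B.bimodule_projection_trace[OF _ kP])
   show "EX c. x = cscale c Id" if "x : M" "x : commutant N" for x using irr that cNA by blast
   show "k : commutant N" unfolding k_def by (intro vn_intros[OF B.vn_commutant_N] B.e_commutant)
   show "is_proj k" unfolding k_def by (rule is_proj_complement[OF B.eP])
   show "k ~= 0" using tk mu nft_zero[OF vnP nft_tr] by (auto simp: complex_eq_iff)
  qed
  thus False using tk mu by simp
 qed
qed

end

section \<open>Projections of prescribed trace\<close>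

text \<open>Copies of \<open>r\<close> are split off \<open>q\<close> by comparison. A rest of
  smaller trace is equivalent to a proper subprojection of \<open>r\<close>, hence zero by
  minimality.\<close>

lemma trace_multiple_of_minimal:
 assumes N: "factor N" and \<tau>: "nf_tracial_state N \<tau>" and r: "r : N" "is_proj r" "r ~= 0"
  and min: "!!q. q : N ==> is_proj q ==> q ** r = q ==> q = 0 | q = r" and q: "q : N" "is_proj q"
 shows "EX n. Re (\<tau> q) = real n * Re (\<tau> r)"
proof -
 note vN = factor_vn[OF N]
 note NI = vn_intros[OF vN]
 have tr: "0 < Re (\<tau> r)"
  using nft_proj_nonneg[OF vN \<tau> r(1,2)] nft_proj_zero[OF vN \<tau> r(1,2)] r(3) by fastforce
 have "EX n. Re (\<tau> q) = real n * Re (\<tau> r)" if "q : N" "is_proj q" "Re (\<tau> q) <= real k * Re (\<tau> r)" for k q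
  using that
 proof (induction k arbitrary: q)
  case 0
  thus ?case using nft_proj_nonneg[OF vN \<tau> 0(1,2)] by (intro exI[of _ 0]) simp
 next
  case (Suc k)
  note q = Suc.prems
  have wr: "is_proj (w ** adj w)" "\<tau> (w ** adj w) = \<tau> (adj w ** w)" if "w : N" "is_proj (adj w ** w)" for w
   using partial_isometry(2)[OF vn_inBH[OF vN that(1)] that(2)] nft_comm[OF \<tau> that(1) NI(9)[OF that(1)]] by auto
  show ?case
  proof (cases "Re (\<tau> r) <= Re (\<tau> q)")
   case True
   then obtain w where w: "w : N" "adj w ** w = r" "q ** w = w" using comparison[OF N \<tau> r(1,2) q(1,2)] by blast
   have qw: "q ** (w ** adj w) = w ** adj w" using w(3) by (simp flip: oL_assoc)
   have wN: "w ** adj w : N" by (intro NI w)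
   have "Re (\<tau> (q - (w ** adj w))) = Re (\<tau> q) - Re (\<tau> r)"
    using wr[OF w(1)] w(2) r(2) by (simp add: nft_diff[OF vN \<tau> q(1) wN])
   moreover have "is_proj (q - (w ** adj w))" using proj_le_diff(1)[OF q(2) _ qw] wr[OF w(1)] w(2) r(2) by simp
   ultimately obtain n where "Re (\<tau> q) - Re (\<tau> r) = real n * Re (\<tau> r)"
    using Suc.IH[of "q - (w ** adj w)"] q(3) NI(4)[OF q(1) wN] by (auto simp: distrib_right)
   thus ?thesis by (intro exI[of _ "Suc n"]) (simp add: distrib_right)
  next
   case False
   then obtain w where w: "w : N" "adj w ** w = q" "r ** w = w" using comparison[OF N \<tau> q(1,2) r(1,2)] by auto
   have P: "is_proj (w ** adj w)" "\<tau> (w ** adj w) = \<tau> q" using wr[OF w(1)] w(2) q(2) by auto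
   have "r ** (w ** adj w) = w ** adj w" using w(3) by (simp flip: oL_assoc)
   hence "(w ** adj w) ** r = w ** adj w" by (rule proj_le_diff(2)[OF r(2) P(1)])
   hence "w ** adj w = 0 | w ** adj w = r" by (intro min NI w P)
   hence "Re (\<tau> q) = 0" using P(2) False nft_zero[OF vN \<tau>] by auto
   thus ?thesis by (intro exI[of _ 0]) simp
  qed
 qed
 moreover obtain k where "Re (\<tau> q) <= real k * Re (\<tau> r)" using reals_Archimedean3[OF tr] less_imp_le by blast
 ultimately show ?thesis using q by blast
qed

text \<open>Repeated halving yields nonzero projections of arbitrarily small trace below any given
  one. A maximal orthogonal family whose finite sums have trace at most \<open>t\<close> must then
  reach \<open>t\<close>, as otherwise a small projection would still fit.\<close>

lemma ex_projection_of_trace: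
 assumes N: "von_neumann_algebra N" and \<tau>: "nf_tracial_state N \<tau>" and t: "0 <= t" "t <= 1"
  and nomin: "!!p. p : N ==> is_proj p ==> p ~= 0 ==> EX q:N. is_proj q & q ** p = q & q ~= 0 & q ~= p"
 shows "EX h:N. is_proj h & Re (\<tau> h) = t"
proof -
 note NI = vn_intros[OF N]
 note nn = nft_proj_nonneg[OF N \<tau>]
 have half: "EX q:N. is_proj q & q ** p = q & q ~= 0 & Re (\<tau> q) <= Re (\<tau> p) / 2" if p: "p : N" "is_proj p" "p ~= 0" for p
 proof -
  obtain q where q: "q : N" "is_proj q" "q ** p = q" "q ~= 0" "q ~= p" using nomin[OF p] by blast
  have pq: "p ** q = q" using arg_cong[OF q(3), of adj] is_projD[OF q(2)] is_projD[OF p(2)] by (simp add: adj_compose)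
  note r = proj_le_diff(1)[OF p(2) q(2) pq]
  have "Re (\<tau> (p - q)) = Re (\<tau> p) - Re (\<tau> q)" by (simp add: nft_diff[OF N \<tau> p(1) q(1)])
  moreover have "(p - q) ** p = p - q" using q(3) is_projD(2)[OF p(2)] by (simp add: oL_diff_left)
  ultimately have "~ Re (\<tau> q) <= Re (\<tau> p) / 2 ==> ?thesis"
   using q r NI(4)[OF p(1) q(1)] by (intro bexI[of _ "p - q"]) auto
  thus ?thesis using q by blast
 qed
 have small: "EX q:N. is_proj q & q ** p = q & q ~= 0 & Re (\<tau> q) <= Re (\<tau> p) / 2 ^ n" if p: "p : N" "is_proj p" "p ~= 0" for p n
 proof (induction n)
  case 0
  thus ?case using p is_projD(2)[OF p(2)] by auto
 next
  case (Suc n)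
  then obtain q where q: "q : N" "is_proj q" "q ** p = q" "q ~= 0" "Re (\<tau> q) <= Re (\<tau> p) / 2 ^ n" by blast
  obtain r where r: "r : N" "is_proj r" "r ** q = r" "r ~= 0" "Re (\<tau> r) <= Re (\<tau> q) / 2" using half[OF q(1,2,4)] by blast
  have "r ** p = r" using q(3) r(3) by (metis oL_assoc)
  thus ?case using r q(5) by (intro bexI[of _ r]) auto
 qed
 define C where "C = {F. orth_family N F (%q. q) & 0 ~: F & (ALL S. finite S --> S <= F --> (\<Sum>q\<in>S. Re (\<tau> q)) <= t)}"
 have "EX F:C. ALL X:C. F <= X --> X = F"
 proof (rule subset_Zorn_nonempty)
  have "{} : C" using t by (auto simp: C_def orth_family_def)
  thus "C ~= {}" by blast
  fix K assume K: "K ~= {}" "subset.chain C K"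
  have KC: "F : C" if "F : K" for F using K(2) that by (auto simp: subset.chain_def)
  have fin: "EX F:K. S <= F" if "finite S" "S <= \<Union>K" for S
   using finite_subset_Union_chain[OF that K] by metis
  show "\<Union>K : C"
   unfolding C_def orth_family_def
  proof (intro CollectI conjI ballI impI allI)
   fix p q assume pq: "p : \<Union>K" "q : \<Union>K" "p ~= q"
   obtain F where "F : K" "{p, q} <= F" using fin[of "{p, q}"] pq by auto
   thus "p ** q = 0" using KC[of F] pq(3) by (auto simp: C_def orth_family_def)
  next
   fix S assume S: "finite S" "S <= \<Union>K"
   then obtain F where "F : K" "S <= F" using fin by blast
   thus "(\<Sum>q\<in>S. Re (\<tau> q)) <= t" using KC[of F] S(1) by (auto simp: C_def)
  qed (use KC in "auto simp: C_def orth_family_def")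
 qed
 then obtain F where F: "F : C" "!!X. X : C ==> F <= X ==> X = F" by blast
 have fam: "orth_family N F (%q. q)" and F0: "0 ~: F" and Ft: "!!S. finite S ==> S <= F ==> (\<Sum>q\<in>S. Re (\<tau> q)) <= t"
  using F(1) by (auto simp: C_def)
 obtain s where s: "s : N" "is_proj s" "!!q. q : F ==> q ** s = q" "((%q. Re (\<tau> q)) has_sum Re (\<tau> s)) F"
  using orth_family_sup[OF N fam] nft_normal_pos[OF N \<tau>] by blast
 have le: "Re (\<tau> s) <= t"
  using s(4) unfolding has_sum_def
  by (rule tendsto_upperbound) (auto intro!: eventually_finite_subsets_at_top_weakI Ft)
 have "Re (\<tau> s) = t"
 proof (rule ccontr)
  assume ne: "Re (\<tau> s) ~= t"
  have c: "Id - s : N" "is_proj (Id - s)" by (intro NI s, rule is_proj_complement[OF s(2)])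
  have "Id - s ~= 0" using ne le t nft_id[OF \<tau>] by auto
  moreover obtain n where n: "1 / 2 ^ n < t - Re (\<tau> s)" using real_arch_pow_inv[of "t - Re (\<tau> s)" "1/2"] ne le by (auto simp: power_one_over)
  ultimately obtain q where q: "q : N" "is_proj q" "q ** (Id - s) = q" "q ~= 0" "Re (\<tau> q) <= Re (\<tau> (Id - s)) / 2 ^ n"
   using small[OF c] by blast
  have "Re (\<tau> (Id - s)) <= 1" using nn[OF s(1,2)] s(1) nft_id[OF \<tau>] by (simp add: nft_diff[OF N \<tau>] NI)
  hence "Re (\<tau> (Id - s)) / 2 ^ n <= 1 / 2 ^ n" by (intro divide_right_mono) auto
  hence tq: "Re (\<tau> q) <= t - Re (\<tau> s)" using q(5) n by simp
  have qs: "q ** s = 0" using q(3) by (simp add: oL_diff_right)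
  have sq: "s ** q = 0" using arg_cong[OF qs, of adj] is_projD[OF q(2)] is_projD[OF s(2)] by (simp add: adj_compose)
  have rq: "r ** q = 0" if "r : F" for r
   using s(3)[OF that] sq by (metis oL_zero_right oL_assoc)
  have rP: "r : N" "is_proj r" if "r : F" for r using fam that by (auto simp: orth_family_def)
  have qr: "q ** r = 0" if "r : F" for r
   using arg_cong[OF rq[OF that], of adj] is_projD[OF q(2)] is_projD[OF rP(2)[OF that]] by (simp add: adj_compose)
  have qF: "q ~: F" using rq[of q] is_projD(2)[OF q(2)] q(4) by auto
  have fs: "(\<Sum>r\<in>S. Re (\<tau> r)) <= Re (\<tau> s)" if S: "finite S" "S <= F" for S
   by (rule has_sum_mono2[OF has_sum_finite[OF S(1)] s(4) S(2)]) (use nn rP in auto)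
  have "insert q F : C"
   unfolding C_def orth_family_def
  proof (intro CollectI conjI ballI impI allI)
   fix S assume S: "finite S" "S <= insert q F"
   have "(\<Sum>r\<in>S. Re (\<tau> r)) <= (\<Sum>r\<in>insert q (S - {q}). Re (\<tau> r))"
    using S nn q rP by (intro sum_mono2) auto
   also have "... <= t"
   proof -
    have "S - {q} <= F" using S by auto
    thus ?thesis using S fs[of "S - {q}"] tq by (subst sum.insert) auto
   qed
   finally show "(\<Sum>r\<in>S. Re (\<tau> r)) <= t" .
  qed (use q F0 fam qr rq in "auto simp: orth_family_def")
  thus False using F(2)[of "insert q F"] qF by auto
 qed
 thus ?thesis using s by blast
qed

context subfactor_trace
begin

text \<open>If \<open>p\<close> were minimal in \<open>A\<close>, then \<open>p ** e\<close> would
  be minimal in \<open>P\<close>, and the trace of \<open>p\<close> would be an integer multiple of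
  \<open>\<mu>\<close> times itself. But \<open>1 / \<mu> = 2 + sqrt 2\<close> is no
  integer.\<close>

lemma ex_projection_in_subfactor:
 assumes mu: "\<mu> = 1 / (2 + sqrt 2)" and t: "0 <= t" "t <= 1"
 shows "EX h:A. is_proj h & Re (\<tau> h) = t"
proof (rule ex_projection_of_trace[OF vnA nft_restrict[OF M nft vnA NM] t], rule ccontr)
 fix p assume p: "p : A" "is_proj p" "p ~= 0" and n: "~ (EX q:A. is_proj q & q ** p = q & q ~= 0 & q ~= p)"
 note pp = is_projD[OF p(2)]
 have corner: "EX c. x = cscale c p" if "x : A" "p ** x = x" "x ** p = x" for x
  by (rule minimal_corner_scalar[OF vnA nft_restrict[OF M nft vnA NM] p _ that]) (use n in blast)
 define r where "r = p ** e"
 have re: "r = e ** p" by (simp add: r_def e_push p)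
 have rP: "is_proj r" using pp e_simps re by (simp add: is_proj_def r_def BH_compose adj_compose oL_assoc e_push p) (metis oL_assoc)
 have r0: "r ~= 0" unfolding r_def using A_e_eq_0[OF p(1)] p(3) by blast
 have "EX n. Re (tr p) = real n * Re (tr r)"
 proof (rule trace_multiple_of_minimal[OF factor_P nft_tr _ rP r0 _ A_P[OF p(1)] p(2)])
  show "r : P" unfolding r_def by (intro PI A_P p e_inP)
  fix q assume q: "q : P" "is_proj q" "q ** r = q"
  have rq: "r ** q = q" using arg_cong[OF q(3), of adj] is_projD[OF q(2)] is_projD[OF rP] by (simp add: adj_compose)
  obtain y where y: "y : A" "e ** (q ** e) = y ** e" using ex_compression[OF q(1)] vn_bicommutant[OF vnA] by blast
  have "q = r ** (q ** r)" by (simp add: q(3) rq)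
  also have "... = p ** ((e ** (q ** e)) ** p)" by (simp add: oL_assoc re) (simp add: oL_assoc e_push p)
  also have "... = (p ** (y ** p)) ** e" by (simp add: y(2) oL_assoc e_push p)
  finally have qe: "q = (p ** (y ** p)) ** e" .
  have "EX c. p ** (y ** p) = cscale c p"
   by (rule corner) (auto simp: oL_assoc pp intro: AI p y, simp add: pp flip: oL_assoc)
  then obtain c where "p ** (y ** p) = cscale c p" by blast
  hence qc: "q = cscale c r" by (simp add: qe r_def oL_cscale_left)
  have "cscale (c * c) r = cscale c r"
   using is_projD(2)[OF q(2)] is_projD(1,2)[OF rP] by (simp add: qc oL_cscale_left oL_cscale_right cscale_cscale)
  hence "cscale (c * c - c) r = 0" by (simp add: cscale_diff_left)
  hence "c * c - c = 0" using r0 norm_cscale[of "c * c - c" r] by simp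
  hence "c = 0 | c = 1" by auto
  thus "q = 0 | q = r" using qc by auto
 qed
 then obtain n where "Re (\<tau> p) = real n * (\<mu> * Re (\<tau> p))"
  using p(1) by (auto simp: r_def tr_A_e tr_M N_inM)
 moreover have "Re (\<tau> p) ~= 0" using nft_proj_zero[OF M nft N_inM[OF p(1)] p(2)] p(3) by blast
 ultimately have "real n * \<mu> = 1" by (simp add: mult.assoc[symmetric])
 moreover have "0 < 2 + sqrt 2" by (rule add_pos_pos) simp_all
 ultimately have "sqrt 2 = real n - 2" unfolding mu by (simp add: field_simps)
 moreover have "1 < sqrt 2" "sqrt 2 < 2" by (simp_all add: real_less_lsqrt)
 ultimately have "real 3 < real n" "real n < real 4" by simp_all
 thus False unfolding of_nat_less_iff by simp
qed

end

section \<open>Distance of two projections, and failure of strong singularity in the standard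
  form\<close>

lemma two_projections:
 fixes p q :: "'a :: chilbert_space op"
 assumes p: "is_proj p" and q: "is_proj q" and k: "k <= 1"
  and 1: "!!v. p v = v ==> k * (norm v)^2 <= (norm (q v))^2" and 2: "!!v. q v = v ==> k * (norm v)^2 <= (norm (p v))^2"
 shows "(norm (p x - q x))^2 <= (1 - k) * (norm x)^2"
proof -
 have pyth: "(norm v)^2 = (norm (r v))^2 + (norm (v - r v))^2" if r: "is_proj r" for r v
  using norm_add_sq[of "r v" "v - r v"] is_proj_cinner[OF r, of v v] is_projD(4)[OF r, of v] is_proj_cinner[OF r, of "v - r v" v]
   is_projD(3)[OF r] cinner_adj_right[OF is_projD(1)[OF r], of "r v" v]
  by (simp add: cinner_diff_right)
 define z where "z = x - q x"
 define w where "w = q x"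
 have a: "(norm (w - p w))^2 <= (1 - k) * (norm w)^2"
  using 2[of w] pyth[OF p, of w] is_projD(4)[OF q] by (simp add: w_def left_diff_distrib)
 \<comment> \<open>By duality the size of \<open>p\<close> on the complement of \<open>q\<close> is
   that of \<open>Id - q\<close> on the range of \<open>p\<close>, which the first hypothesis
   controls.\<close>
 have b: "(norm (p z))^2 <= (1 - k) * (norm z)^2"
 proof -
  have "(norm (p z))^2 = Re (cinner z (p z))" using is_proj_norm_sq[OF p, of z] cinner_commute[of z "p z"] by simp
  also have "cinner z (p z) = cinner z (p z - q (p z))"
  proof -
   have "q z = 0" using is_projD(4)[OF q] by (simp add: z_def blinfun.diff_right)
   hence "cinner z (q (p z)) = 0"
    using cinner_adj_right[OF is_projD(1)[OF q], of z "p z"] is_projD(3)[OF q] by simp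
   thus ?thesis by (simp add: cinner_diff_right)
  qed
  also have "Re (cinner z (p z - q (p z))) <= norm z * norm (p z - q (p z))"
   using cmod_cinner_le complex_Re_le_cmod order_trans by blast
  finally have "((norm (p z))^2)^2 <= (norm z * norm (p z - q (p z)))^2" by (intro power_mono) auto
  also have "... <= (norm z)^2 * ((1 - k) * (norm (p z))^2)"
   using 1[of "p z"] pyth[OF q, of "p z"] is_projD(4)[OF p]
   by (auto simp: power_mult_distrib left_diff_distrib intro!: mult_left_mono)
  finally have le: "(norm (p z))^2 * (norm (p z))^2 <= ((1 - k) * (norm z)^2) * (norm (p z))^2" by (simp add: power2_eq_square mult_ac)
  show ?thesis by (cases "p z = 0") (use k in simp, use mult_right_le_imp_le[OF le] in simp)
 qed
 \<comment> \<open>\<open>p x - q x\<close> equals \<open>p z - (w - p w)\<close>. The two pieces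
   are orthogonal and come from the orthogonal vectors \<open>z\<close> and \<open>w\<close>, so the
   two estimates add up without loss.\<close>
 have "cinner (p z) (w - p w) = 0" by (simp add: cinner_diff_right is_proj_cinner[OF p])
 hence "(norm (p z - (w - p w)))^2 = (norm (p z))^2 + (norm (w - p w))^2"
  using norm_add_sq[of "p z" "- (w - p w)"]
  by (simp only: cinner_minus_right norm_minus_cancel add_uminus_conv_diff minus_zero zero_complex.sel mult_zero_right add_0_right)
 also have "... <= (1 - k) * ((norm w)^2 + (norm z)^2)" using a b by (simp add: distrib_left)
 also have "(norm w)^2 + (norm z)^2 = (norm x)^2" using pyth[OF q, of x] by (simp add: w_def z_def)
 also have "p z - (w - p w) = p x - q x" by (simp add: z_def w_def blinfun.diff_right)
 finally show ?thesis .
qed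

text \<open>\<open>n\<close>, \<open>g\<close> and \<open>R\<close> stand for \<open>|y|^2\<close>,
  the inner product of \<open>E(fyf)\<close> with \<open>y\<close>, and \<open>|E(fyf)|^2\<close>.
  Of \<open>16 * R\<close> one quarter completes a square by \<open>g^2 <= R * n\<close>; the rest
  is spent on the last hypothesis.\<close>

lemma quadratic_estimate:
 fixes n g R :: real
 assumes "0 <= n" "0 <= g" "0 <= R" "g^2 <= R * n" "(3 * sqrt 2 - 4) * g <= R"
 shows "n / 25 <= (57 - 40 * sqrt 2) * n + 8 * (5 - 4 * sqrt 2) * g + 16 * R"
proof -
 define s where "s = sqrt 2"
 have s: "1.41421 < s" "s < 1.41422" unfolding s_def
  by (rule real_less_rsqrt, simp add: power2_eq_square, rule real_less_lsqrt, simp_all add: power2_eq_square)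
 have "0 <= (57 - 40 * s - 1/25) * n - (8 - 4 * s) * g + 4 * R"
 proof (cases "n = 0")
  case True
  hence "g = 0" using assms(4) by simp
  thus ?thesis using True assms by simp
 next
  case False
  hence n: "0 < n" using assms by simp
  \<comment> \<open>The square reproduces the mixed term. The remaining coefficient
    \<open>51 - 36 * s - 1/25\<close> is about 0.048, the slack left by the choice of
    \<open>1/25\<close>.\<close>
  have "0 <= (2 * g - (2 - s) * n)^2 + (51 - 36 * s - 1/25) * n^2" using s by simp
  also have "... = n * ((57 - 40 * s - 1/25) * n - (8 - 4 * s) * g) + 4 * g^2 + n^2 * (s^2 - 2)"
   by (simp add: power2_eq_square algebra_simps)
  also have "s^2 = 2" by (simp add: s_def)
  finally have "0 <= n * ((57 - 40 * s - 1/25) * n - (8 - 4 * s) * g) + 4 * (R * n)" using assms(4) by simp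
  also have "... = n * ((57 - 40 * s - 1/25) * n - (8 - 4 * s) * g + 4 * R)" by (simp add: algebra_simps)
  finally show ?thesis using n by (simp add: zero_le_mult_iff)
 qed
 moreover have "12 * ((3 * s - 4) * g) <= 12 * R" using assms(5) by (simp add: s_def)
 ultimately show ?thesis unfolding s_def[symmetric] by (simp add: algebra_simps)
qed

context subfactor_trace
begin

lemma tau_eqI:
 assumes x: "x : M" "y : M" and eq: "!!z. z : M ==> \<tau> (z ** x) = \<tau> (z ** y)" shows "x = y"
proof -
 have d: "x - y : M" by (intro MI x)
 have "\<tau> (adj (x - y) ** (x - y)) = 0"
  using eq[OF MI(9)[OF d]] by (simp add: blinfun.diff_left[of x y] blinfun.diff_right cinner_diff_left)
 from nft_faithful[OF nft d this] show ?thesis by simp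
qed

text \<open>The two expectations appear as projections of the standard space and are compared on all
  vectors, which is stronger than a comparison on the unit ball of \<open>M\<close>.\<close>

theorem not_strongly_singular_standard:
 assumes mu: "\<mu> = 1 / (2 + sqrt 2)"
 shows "EX u:unitaries M. 24 / 25 < (norm (blinfun_apply u \<Omega> - e (u \<Omega>)))^2 &
  (ALL v. (norm (e v - cyclic_proj (conj_by u A) \<Omega> v))^2 <= 24 / 25 * (norm v)^2)"
proof -
 define t where "t = sqrt 2 - 1"
 have mt: "1 - \<mu> = \<mu> / t" "0 < t" "t <= 1" "\<mu> < 1" "(1 - 2 * \<mu>) = sqrt 2 * \<mu>" "t^2 = 3 - 2 * sqrt 2"
 proof -
  have s: "sqrt 2 * sqrt 2 = 2" "1 < sqrt 2" "sqrt 2 < 2" by (simp_all add: real_less_lsqrt)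
  have mu': "\<mu> = (2 - sqrt 2) / 2"
  proof -
   have "2 + sqrt 2 ~= 0" using s(2) by linarith
   thus ?thesis unfolding mu by (subst frac_eq_eq) (simp_all add: algebra_simps)
  qed
  show "1 - \<mu> = \<mu> / t" "0 < t" "t <= 1" "\<mu> < 1" "(1 - 2 * \<mu>) = sqrt 2 * \<mu>" "t^2 = 3 - 2 * sqrt 2"
   unfolding mu' t_def using s by (auto simp: field_simps power2_eq_square)
 qed
 obtain h where h: "h : A" "is_proj h" "Re (\<tau> h) = t" using ex_projection_in_subfactor[OF mu less_imp_le[OF mt(2)] mt(3)] by blast
 have hM: "h : M" by (rule N_inM[OF h(1)])
 note hh = is_projD[OF h(2)]
 define Q where "Q = h - (h ** e)"
 have QP: "Q : P" unfolding Q_def by (intro PI A_P h e_inP)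
 have Q_eq: "Q = h ** (Id - e)" by (simp add: Q_def oL_diff_right)
 have hhz: "h ** (h ** z) = h ** z" for z :: "'k op" using hh(2) by (simp flip: oL_assoc)
 have Qp: "is_proj Q"
  using hh e_simps by (simp add: is_proj_def Q_def BH_intros adj_diff adj_compose oL_diff_left oL_diff_right oL_assoc e_push h(1) hhz)
 have th: "\<tau> h = of_real t" using nft_proj[OF M nft hM h(2)] h(3) by simp
 have "tr Q = t - \<mu> * t" unfolding Q_def using h(1) by (simp add: nft_diff[OF vnP nft_tr] PI A_P e_inP tr_A_e tr_M hM th)
 hence "Re (tr Q) = (1 - \<mu>) * t" by (simp add: left_diff_distrib)
 hence trQ: "Re (tr Q) = \<mu>" using mt by simp
 obtain w where w: "w : P" "adj w ** w = e" "w ** adj w = Q"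
  using comparison[OF factor_P nft_tr e_inP eP QP Qp] trQ tr_e by auto
 have wB: "w : BH" by (rule PBH[OF w(1)])
 have "w ** (adj w ** w) = w" by (rule partial_isometry(1)[OF wB]) (simp add: w(2) eP)
 hence we: "w ** e = w" by (simp add: w(2))
 obtain m where m: "m : M" "w = m ** e" using pushdown[OF w(1) we] by blast
 have mB: "m : BH" by (rule MBH[OF m(1)])
 have aw: "adj w = e ** adj m" by (simp add: m(2) adj_compose mB e_simps)
 have emme: "e ** (adj m ** (m ** e)) = e" using w(2) unfolding aw unfolding m(2) by (simp add: oL_assoc)
 have mem: "m ** (e ** adj m) = Q" using w(3) unfolding aw unfolding m(2) by (simp add: oL_assoc e_push(3))
 \<comment> \<open>\<open>tr (z ** Q)\<close> is evaluated with \<open>Q = m ** (e ** adj m)\<close>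
   and with \<open>Q = h - (h ** e)\<close>; then \<open>1 - \<mu> = \<mu> / t\<close>.\<close>
 have mm: "m ** adj m = (1 / t) *R h"
 proof (rule tau_eqI)
  fix z assume z: "z : M"
  have zh: "z ** h : M" by (intro MI z hM)
  have "\<mu> * \<tau> (z ** (m ** adj m)) = tr (z ** Q)" using tr_pushed[OF m(1) z] by (simp add: mem)
  also have "... = tr (z ** h) - tr ((z ** h) ** e)"
   unfolding Q_def oL_diff_right using z hM by (simp add: nft_diff[OF vnP nft_tr] PI M_P e_inP oL_assoc)
  also have "... = complex_of_real (1 - \<mu>) * \<tau> (z ** h)" unfolding markov[OF zh] tr_M[OF zh] by (simp add: left_diff_distrib)
  finally show "\<tau> (z ** (m ** adj m)) = \<tau> (z ** (1 / t) *R h)"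
   using lambda_pos mt(2) unfolding mt(1) by (simp add: blinfun.scaleR_left blinfun.scaleR_right field_simps)
 qed (intro MI m hM)+
 have hm: "h ** m = m"
 proof -
  define d where "d = m - (h ** m)"
  have dB: "d : BH" unfolding d_def by (intro BH_intros mB hh)
  have "d ** adj d = (m ** adj m) - (h ** (m ** adj m)) - ((m ** adj m) ** h) + (h ** ((m ** adj m) ** h))"
   using hh by (simp add: d_def adj_diff adj_compose mB BH_compose oL_simps)
  hence "adj (adj d) ** adj d = 0" using dB by (simp add: mm oL_scaleR_left oL_scaleR_right hh)
  hence "adj d = 0" by (rule adj_compose_self_eq_0[OF adj_BH[OF dB]])
  hence "d = 0" using adj_adj[OF dB] by simp
  thus ?thesis by (simp add: d_def)
 qed
 have mh: "adj m ** h = adj m" using arg_cong[OF hm, of adj] by (simp add: adj_compose mB hh)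
 define f where "f = t *R (adj m ** m)"
 have fM: "f : M" unfolding f_def by (intro MI m)
 have fa: "adj f = f" by (simp add: f_def adj_scaleR adj_compose mB BH_compose)
 have ff: "f ** f = f"
 proof -
  have "f ** f = (t * t) *R (adj m ** ((m ** adj m) ** m))" by (simp add: f_def oL_scaleR_left oL_scaleR_right oL_assoc)
  thus ?thesis using mt(2) by (simp add: mm oL_scaleR_left oL_scaleR_right hm f_def)
 qed
 \<comment> \<open>The expectation of \<open>f\<close> is the scalar \<open>t\<close>, because
   \<open>adj w ** w = e\<close> says that the expectation of \<open>adj m ** m\<close> is
   1.\<close>
 have efe: "e ** (f ** e) = t *R e" by (simp add: f_def oL_scaleR_left oL_scaleR_right oL_assoc emme)
 \<comment> \<open>\<open>f ** (y ** f)\<close> is \<open>t^2\<close> times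
   \<open>adj m ** (\<beta> y ** m)\<close>, and \<open>\<beta>\<close> is the adjoint, for the
   trace inner product, of the map taking \<open>x\<close> to the expectation of
   \<open>adj m ** (x ** m)\<close>.\<close>
 define \<beta> where "\<beta> y = m ** (y ** adj m)" for y
 have \<beta>M: "\<beta> y : M" if "y : M" for y unfolding \<beta>_def by (intro MI m that)
 \<comment> \<open>The expectation of \<open>uyu\<close> is
   \<open>(1 - 4 * t) *R y + 4 *R \<theta>\<close> with \<open>\<theta>\<close> that of
   \<open>fyf\<close>. Its squared norm is a quadratic expression in \<open>y\<close> and
   \<open>\<theta>\<close>, which the relations \<open>gR\<close> and \<open>Rg\<close> keep away
   from 0.\<close>
 have key: "(norm (y \<Omega>))^2 / 25 <= (norm (e (((Id - 2 *R f) ** (y ** (Id - 2 *R f))) \<Omega>)))^2"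
  if y: "y : A" for y
 proof -
  have yM: "y : M" by (rule N_inM[OF y])
  define x where "x = \<beta> y"
  have xM: "x : M" unfolding x_def by (rule \<beta>M[OF yM])
  have hx: "h ** x = x" "x ** h = x" unfolding x_def \<beta>_def by (simp_all add: oL_assoc mh) (simp add: hm flip: oL_assoc)
  obtain \<theta>' where \<theta>': "\<theta>' : A" "e ** ((adj m ** (x ** m)) ** e) = \<theta>' ** e"
   using ex_cond_exp[OF MI(6)[OF MI(9)[OF m(1)] MI(6)[OF xM m(1)]]] by blast
  obtain \<kappa> where \<kappa>: "\<kappa> : A" "e ** (x ** e) = \<kappa> ** e" using ex_cond_exp[OF xM] by blast
  note \<theta>M = N_inM[OF \<theta>'(1)] and \<kappa>M = N_inM[OF \<kappa>(1)]
  \<comment> \<open>\<open>Q ** (x ** Q)\<close> is expanded with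
    \<open>Q = m ** (e ** adj m)\<close> and with \<open>Q = h ** (Id - e)\<close>, and both forms
    are traced against \<open>z\<close>. The terms \<open>e ** x\<close> and \<open>x ** e\<close>
    each take off \<open>\<mu>\<close>; \<open>e ** (x ** e)\<close> contributes
    \<open>\<kappa>\<close>.\<close>
  have b\<theta>: "\<mu> *R \<beta> \<theta>' = (1 - 2 * \<mu>) *R x + \<mu> *R \<kappa>"
  proof (rule tau_eqI)
   fix z assume z: "z : M"
   have QxQ: "m ** (\<theta>' ** (e ** adj m)) = x - (e ** x) - (x ** e) + (\<kappa> ** e)"
   proof -
    have "m ** (\<theta>' ** (e ** adj m)) = m ** ((e ** ((adj m ** (x ** m)) ** e)) ** adj m)"
     unfolding \<theta>'(2) by (simp add: oL_assoc)
    also have "... = Q ** (x ** Q)" by (simp add: oL_assoc flip: mem)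
    also have "... = (h ** x ** h) - (e ** ((h ** x) ** h)) - (h ** (x ** h) ** e) + (e ** ((h ** x ** h) ** e))"
     by (simp add: Q_def oL_simps e_push h(1))
    finally show ?thesis by (simp add: hx \<kappa>(2))
   qed
   have 1: "tr (z ** (m ** (\<theta>' ** (e ** adj m)))) = \<mu> * \<tau> (z ** \<beta> \<theta>')"
   proof -
    have "tr ((z ** (m ** (\<theta>' ** e))) ** adj m) = tr (adj m ** (z ** (m ** (\<theta>' ** e))))"
     by (rule nft_comm[OF nft_tr]) (intro PI e_inP M_P[OF z] M_P[OF m(1)] M_P[OF \<theta>M])+
    also have "... = tr ((adj m ** (z ** (m ** \<theta>'))) ** e)" by (simp add: oL_assoc)
    also have "... = \<mu> * \<tau> (adj m ** (z ** (m ** \<theta>')))" by (intro markov MI m z \<theta>M)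
    also have "\<tau> (adj m ** (z ** (m ** \<theta>'))) = \<tau> ((z ** (m ** \<theta>')) ** adj m)" by (rule nft_comm[OF nft]) (intro MI m z \<theta>M)+
    finally show ?thesis by (simp add: \<beta>_def oL_assoc)
   qed
   have zP: "z : P" "x : P" "\<kappa> : P" by (intro M_P z xM \<kappa>M)+
   have zx: "z ** x : M" "x ** z : M" "z ** \<kappa> : M" by (intro MI z xM \<kappa>M)+
   have "tr (z ** (e ** x)) = tr ((x ** z) ** e)"
    using nft_comm[OF nft_tr, of "z ** e" x] by (simp add: PI zP e_inP oL_assoc)
   also have "... = \<mu> * \<tau> (z ** x)" unfolding markov[OF zx(2)] by (simp only: nft_comm[OF nft z xM])
   finally have 2: "tr (z ** (e ** x)) = \<mu> * \<tau> (z ** x)" .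
   have "tr (z ** (x - (e ** x) - (x ** e) + (\<kappa> ** e)))
    = tr (z ** x) - tr (z ** (e ** x)) - tr ((z ** x) ** e) + tr ((z ** \<kappa>) ** e)"
    by (simp add: oL_simps nft_diff[OF vnP nft_tr] nft_add[OF nft_tr] PI zP e_inP)
   also have "... = \<tau> (z ** x) - \<mu> * \<tau> (z ** x) - \<mu> * \<tau> (z ** x) + \<mu> * \<tau> (z ** \<kappa>)"
    unfolding 2 markov[OF zx(1)] markov[OF zx(3)] tr_M[OF zx(1)] ..
   finally have "\<mu> * \<tau> (z ** \<beta> \<theta>') = complex_of_real (1 - 2 * \<mu>) * \<tau> (z ** x) + \<mu> * \<tau> (z ** \<kappa>)"
    using 1 unfolding QxQ by (simp add: left_diff_distrib)
   thus "\<tau> (z ** \<mu> *R \<beta> \<theta>') = \<tau> (z ** ((1 - 2 * \<mu>) *R x + \<mu> *R \<kappa>))"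
    by (simp add: blinfun.scaleR_left blinfun.scaleR_right blinfun.add_left blinfun.add_right cinner_add_left)
  qed (intro MI \<beta>M \<theta>M xM \<kappa>M)+
  define \<theta> where "\<theta> = t^2 *R \<theta>'"
  have fyf: "f ** (y ** f) = t^2 *R (adj m ** (x ** m))"
   by (simp add: f_def x_def \<beta>_def oL_scaleR_left oL_scaleR_right oL_assoc power2_eq_square)
  have \<theta>e: "e ** ((f ** (y ** f)) ** e) = \<theta> ** e"
   unfolding fyf \<theta>_def by (simp add: oL_scaleR_left oL_scaleR_right \<theta>'(2))
  have \<theta>\<Omega>: "\<theta> \<Omega> = e ((f ** (y ** f)) \<Omega>)" using arg_cong[OF \<theta>e, of "%T. blinfun_apply T \<Omega>"] by (simp add: e_Om)
  have \<theta>A: "\<theta> : A" unfolding \<theta>_def by (intro AI \<theta>')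
  have ip: "cinner (\<theta> \<Omega>) (b \<Omega>) = of_real (t^2) * cinner (x \<Omega>) (\<beta> b \<Omega>)" if b: "b : A" for b :: "'k op"
  proof -
   have bM: "b : M" by (rule N_inM[OF b])
   have "cinner (\<theta> \<Omega>) (b \<Omega>) = cinner ((f ** (y ** f)) \<Omega>) (b \<Omega>)" by (simp only: \<theta>\<Omega> e_cinner e_N_Om[OF b])
   also have "... = of_real (t^2) * \<tau> ((adj b ** (adj m ** x)) ** m)"
    unfolding fyf by (simp add: blinfun.scaleR_left cinner_adj_left MBH bM)
   also have "\<tau> ((adj b ** (adj m ** x)) ** m) = \<tau> (m ** (adj b ** (adj m ** x)))"
    by (rule nft_comm[OF nft]) (intro MI m bM xM)+
   also have "... = \<tau> (adj (\<beta> b) ** x)" by (simp add: \<beta>_def adj_compose mB MBH bM BH_compose oL_assoc)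
   also have "... = cinner (x \<Omega>) (\<beta> b \<Omega>)" by (simp add: cinner_adj_left MBH[OF \<beta>M[OF bM]])
   finally show ?thesis .
  qed
  define g where "g = t^2 * (norm (x \<Omega>))^2"
  have ipy: "cinner (\<theta> \<Omega>) (y \<Omega>) = of_real g" unfolding ip[OF y] g_def by (simp add: cinner_self flip: x_def)
  define R where "R = (norm (\<theta> \<Omega>))^2"
  \<comment> \<open>Putting \<open>\<theta>\<close> for \<open>b\<close> in \<open>ip\<close> and
    then using \<open>b\<theta>\<close> expresses \<open>R\<close> by \<open>x\<close> and its
    expectation. Dropping the nonnegative expectation term leaves
    \<open>sqrt 2 * t^2 * g <= R\<close>, since
    \<open>1 - 2 * \<mu> = sqrt 2 * \<mu>\<close>.\<close>
  have "\<mu> * R = t^2 * Re (cinner (x \<Omega>) ((\<mu> *R \<beta> \<theta>) \<Omega>))"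
   unfolding R_def using ip[OF \<theta>A] by (simp add: Re_cinner_self[symmetric] blinfun.scaleR_left)
  also have "\<mu> *R \<beta> \<theta> = t^2 *R ((1 - 2 * \<mu>) *R x + \<mu> *R \<kappa>)"
   unfolding b\<theta>[symmetric] by (simp add: \<theta>_def \<beta>_def oL_scaleR_left oL_scaleR_right)
  also have "Re (cinner (x \<Omega>) ((t^2 *R ((1 - 2 * \<mu>) *R x + \<mu> *R \<kappa>)) \<Omega>))
   = t^2 * ((1 - 2 * \<mu>) * (norm (x \<Omega>))^2 + \<mu> * Re (cinner (x \<Omega>) (\<kappa> \<Omega>)))"
   by (simp add: blinfun.scaleR_left blinfun.add_left cinner_add_right Re_cinner_self distrib_left)
  also have "\<kappa> \<Omega> = e (x \<Omega>)" using arg_cong[OF \<kappa>(2), of "%T. blinfun_apply T \<Omega>"] by (simp add: e_Om)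
  also have "Re (cinner (x \<Omega>) (e (x \<Omega>))) = (norm (e (x \<Omega>)))^2"
   using is_proj_norm_sq[OF eP, of "x \<Omega>"] by (simp add: e_cinner)
  finally have mR: "\<mu> * R = t^2 * (t^2 * ((1 - 2 * \<mu>) * (norm (x \<Omega>))^2 + \<mu> * (norm (e (x \<Omega>)))^2))" .
  have "\<mu> * (sqrt 2 * t^2 * g) = t^2 * (t^2 * ((1 - 2 * \<mu>) * (norm (x \<Omega>))^2))"
   unfolding mt(5) g_def by (simp add: algebra_simps)
  also have "... <= \<mu> * R" unfolding mR using lambda_pos by (intro mult_left_mono) auto
  finally have "sqrt 2 * t^2 * g <= R" by (rule mult_left_le_imp_le[OF _ lambda_pos])
  moreover have "sqrt 2 * t^2 = 3 * sqrt 2 - 4" unfolding mt(6) by (simp add: algebra_simps)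
  ultimately have Rg: "(3 * sqrt 2 - 4) * g <= R" by simp
  have "(cmod (cinner (\<theta> \<Omega>) (y \<Omega>)))^2 <= (norm (\<theta> \<Omega>) * norm (y \<Omega>))^2" by (intro power_mono cmod_cinner_le) simp
  hence gR: "g^2 <= R * (norm (y \<Omega>))^2" unfolding ipy R_def by (simp add: power_mult_distrib)
  have ef: "e (f \<Omega>) = t *R \<Omega>" using arg_cong[OF efe, of "%T. blinfun_apply T \<Omega>"] by (simp add: e_Om blinfun.scaleR_left)
  have efy: "e (f (y \<Omega>)) = t *R y \<Omega>"
   using arg_cong[OF efe, of "%T. blinfun_apply T (y \<Omega>)"] by (simp add: e_N_Om y blinfun.scaleR_left)
  have "e (((Id - 2 *R f) ** (y ** (Id - 2 *R f))) \<Omega>) = (1 - 4 * t) *R y \<Omega> + 4 *R \<theta> \<Omega>"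
   unfolding \<theta>\<Omega> using efy ef
   by (simp add: blinfun.diff_left blinfun.diff_right blinfun.scaleR_left blinfun.scaleR_right e_N y e_Om scaleR_diff_right scaleR_diff_left)
    (simp flip: scaleR_minus_left scaleR_diff_left)
  hence "(norm (e (((Id - 2 *R f) ** (y ** (Id - 2 *R f))) \<Omega>)))^2
   = (1 - 4 * t)^2 * (norm (y \<Omega>))^2 + 2 * ((1 - 4 * t) * (4 * g)) + 16 * R"
   using norm_add_sq[of "(1 - 4 * t) *R y \<Omega>" "4 *R \<theta> \<Omega>"] ipy cinner_commute[of "y \<Omega>" "\<theta> \<Omega>"]
   by (simp add: power_mult_distrib R_def)
  also have "(1 - 4 * t)^2 = 57 - 40 * sqrt 2" by (simp add: t_def power2_eq_square algebra_simps)
  also have "2 * ((1 - 4 * t) * (4 * g)) = 8 * (5 - 4 * sqrt 2) * g" by (simp add: t_def)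
  finally show ?thesis using quadratic_estimate[OF _ _ _ gR Rg] by (simp add: g_def R_def)
 qed
 define u where "u = Id - 2 *R f"
 have uM: "u : M" unfolding u_def by (intro MI fM)
 have uB: "u : BH" by (rule MBH[OF uM])
 have ua: "adj u = u" using fa by (simp add: u_def adj_diff adj_scaleR MBH[OF fM] BH_scaleR)
 have uu: "u ** u = Id" using ff by (simp add: u_def oL_simps scaleR_2 algebra_simps)
 have uv: "u (u v) = v" for v using uu by (metis oL_apply id_blinfun.rep_eq id_apply)
 have U: "u : unitaries BH" "u : unitaries M" using uB uM uu ua by (auto simp: unitaries_def)
 have V: "jj u : unitaries BH" using uB uu ua by (simp add: unitaries_def jj_BH jj_adj[symmetric] jj_compose[symmetric])
 have ja: "adj (jj u) = jj u" by (simp add: jj_adj[symmetric] uB ua)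
 have jv: "jj u (jj u v) = v" "u (jj u v) = jj u (u v)" for v
  using uv commutant_apply[OF jj_in_commutant[OF uM] uM, of v] by (simp_all add: jj_apply)
 define q where "q = cyclic_proj (conj_by u A) \<Omega>"
 \<comment> \<open>\<open>jj u\<close> commutes with \<open>A\<close> and exchanges
   \<open>\<Omega>\<close> and \<open>u \<Omega>\<close>, so it carries the orbit of
   \<open>\<Omega>\<close> under \<open>A\<close> to that of \<open>u \<Omega>\<close>;
   \<open>u\<close> carries the latter to the orbit of \<open>\<Omega>\<close> under
   \<open>conj_by u A\<close>.\<close>
 have q_eq: "q = cj u (cj (jj u) e)"
 proof -
  have "cj (jj u) ` A = A"
  proof -
   have "cj (jj u) a = a" if "a : A" for a
    using commutantD[OF jj_in_commutant[OF uM] N_inM[OF that]] unitary_simps(3)[OF V] by (simp add: cj_def oL_assoc)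
   thus ?thesis by simp
  qed
  hence "cyclic_proj A (u \<Omega>) = cj (jj u) (cyclic_proj A (adj (jj u) (u \<Omega>)))"
   using cyclic_proj_cj_image[OF V vnA, of "u \<Omega>"] by simp
  also have "adj (jj u) (u \<Omega>) = \<Omega>" using jj_Om[OF uM uM] by (simp add: ja ua uv)
  finally show ?thesis using cyclic_proj_cj_image[OF U(1) vnA, of \<Omega>] by (simp add: q_def conj_by_def cj_def[abs_def] ua e_def)
 qed
 have qv: "q v = u (jj u (e (jj u (u v))))" for v unfolding q_eq by (simp add: cj_apply[OF U(1)] cj_apply[OF V] ua ja)
 have qP: "is_proj q" unfolding q_def
  by (rule cyclic_proj(1)[OF star_subalgebra_vn]) (use vn_cj_image[OF U(1) vnA] in "simp add: conj_by_def cj_def[abs_def]")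
 have iso: "norm (u v) = norm v" "norm (jj u v) = norm v" for v
 proof -
  have "norm (x v) = norm v" if "x : unitaries BH" for x :: "'k op"
   using norm_apply_sq[OF unitary_simps(1)[OF that], of v]
    arg_cong[OF unitary_simps(2)[OF that], of "%T. blinfun_apply T v"] by (simp add: Re_cinner_self)
  thus "norm (u v) = norm v" "norm (jj u v) = norm v" using U V by blast+
 qed
 \<comment> \<open>\<open>jj u (u (y \<Omega>))\<close> is the vector of
   \<open>u ** (y ** u)\<close>, so this is \<open>key\<close> extended by continuity from
   \<open>orbit A \<Omega>\<close>.\<close>
 have key': "1 / 25 * (norm v)^2 <= (norm (e (jj u (u v))))^2" if v: "e v = v" for v
 proof -
  have "closure (orbit A \<Omega>) <= {v. 1 / 25 * (norm v)^2 <= (norm (e (jj u (u v))))^2}"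
  proof (rule closure_minimal)
   show "closed {v. 1 / 25 * (norm v)^2 <= (norm (e (jj u (u v))))^2}"
    using cont[of "e ** (jj u ** u)"] by (intro closed_Collect_le continuous_intros) simp
   show "orbit A \<Omega> <= {v. 1 / 25 * (norm v)^2 <= (norm (e (jj u (u v))))^2}"
   proof clarify
    fix y assume y: "y : A"
    have "jj u (u (y \<Omega>)) = (u ** (y ** u)) \<Omega>"
     using jj_Om[OF uM MI(6)[OF uM N_inM[OF y]]] by (simp add: ua)
    thus "1 / 25 * (norm (y \<Omega>))^2 <= (norm (e (jj u (u (y \<Omega>)))))^2" using key[OF y] unfolding u_def by simp
   qed
  qed
  moreover have "v : closure (orbit A \<Omega>)" using e_cyclic(3) v by (metis rangeI)
  ultimately show ?thesis by blast
 qed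
 \<comment> \<open>The self-inverse unitary \<open>jj u ** u\<close> exchanges \<open>e\<close> and
   \<open>q\<close>, so the one estimate \<open>key'\<close> serves both hypotheses of
   \<open>two_projections\<close>.\<close>
 have two: "(norm (e v - q v))^2 <= (1 - 1 / 25) * (norm v)^2" for v
 proof (rule two_projections[OF eP qP])
  show "1 / 25 * (norm v)^2 <= (norm (q v))^2" if "e v = v" for v using key'[OF that] by (simp add: qv iso)
  fix v assume v: "q v = v"
  define w where "w = jj u (u v)"
  have "e w = w" using arg_cong[OF v, of "%v. jj u (u v)"] unfolding qv by (simp add: w_def uv jv)
  from key'[OF this] show "1 / 25 * (norm v)^2 <= (norm (e v))^2" by (simp add: w_def jv uv iso)
 qed simp
 have eu: "e (u \<Omega>) = (1 - 2 * t) *R \<Omega>"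
  using arg_cong[OF efe, of "%T. blinfun_apply T \<Omega>"]
  by (simp add: u_def blinfun.diff_left blinfun.diff_right blinfun.scaleR_left blinfun.scaleR_right e_Om scaleR_diff_left)
 have "(norm (u \<Omega> - e (u \<Omega>)))^2 = (norm (u \<Omega>))^2 - (norm (e (u \<Omega>)))^2"
  using norm_add_sq[of "e (u \<Omega>)" "u \<Omega> - e (u \<Omega>)"] by (simp add: cinner_diff_right is_proj_cinner[OF eP])
 also have "... = 1 - (1 - 2 * t)^2" by (simp add: iso norm_Om eu)
 also have "(1 - 2 * t)^2 = 17 - 12 * sqrt 2" by (simp add: t_def power2_eq_square algebra_simps)
 finally have n: "(norm (u \<Omega> - e (u \<Omega>)))^2 = 12 * sqrt 2 - 16" by simp
 have "1.414 < sqrt 2" by (rule real_less_rsqrt) (simp add: power2_eq_square)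
 thus ?thesis using U(2) two n unfolding q_def by (intro bexI[of _ u]) auto
qed

end

section \<open>Conditional expectations\<close>

lemma conj_by_cj: "conj_by u B = cj u ` B"
 by (simp add: conj_by_def cj_def)

context tracial
begin

text \<open>The test element is the negative part \<open>b\<close> of \<open>y\<close>, which lies
  in \<open>B\<close>: the trace of \<open>b ** (y ** b)\<close> is minus that of the cube of
  \<open>b\<close>, so the cube and then \<open>b\<close> vanish.\<close>

lemma positive_opI_trace:
 assumes B: "von_neumann_algebra B" "B <= M" and y: "y : B" "adj y = y"
  and p: "!!b. b : B ==> 0 <= Re (\<tau> (adj b ** (y ** b)))"
 shows "positive_op y"
proof -
 note BI = vn_intros[OF B(1)]
 have yB: "y : BH" by (rule vn_inBH[OF B(1) y(1)])
 obtain a b where ab: "positive_op a" "positive_op b" "y = a - b" "a ** b = 0"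
  "!!R. R ** y = y ** R ==> R ** a = a ** R"
  using ex_positive_part[OF yB y(2)] by blast
 have "a : commutant (commutant B)"
  by (rule commutantI[OF positive_op_BH[OF ab(1)]]) (metis ab(5) commutantD y(1))
 hence aB: "a : B" by (simp add: vn_bicommutant[OF B(1)])
 hence bB: "b : B" using BI(4)[OF aB y(1)] ab(3) by simp
 have bM: "b : M" and ba: "adj b = b" and bBH: "b : BH" using bB B(2) positive_op_adj[OF ab(2)] positive_op_BH[OF ab(2)] by auto
 define c where "c = adj b ** (b ** b)"
 have cM: "c : M" and cP: "positive_op c" unfolding c_def by (intro vn_intros[OF M] bM, rule positive_conj[OF ab(2) bBH])
 have "adj b ** (y ** b) = - c" using ab(4) by (simp add: c_def ab(3) oL_diff_left oL_diff_right oL_minus_right)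
 hence "Re (\<tau> c) = 0" using p[OF bB] nft_positive(2)[OF M \<tau> cM cP] by (simp add: nft_minus[OF M \<tau> cM])
 hence "c = 0" using nft_positive_zero[OF M \<tau> cM cP] nft_positive(1)[OF M \<tau> cM cP] by (simp add: complex_eq_iff)
 hence "adj (b ** b) ** (b ** b) = 0"
  using oL_zero_left[of b] by (simp add: c_def adj_compose bBH ba oL_assoc)
 hence "b ** b = 0" by (rule adj_compose_self_eq_0[OF BH_compose[OF bBH bBH]])
 hence "b = 0" using adj_compose_self_eq_0[OF bBH] by (simp add: ba)
 thus ?thesis using ab by simp
qed

text \<open>\<open>cond_exp\<close> is a definite description with a long list of properties. All of
  them follow from the trace identity by testing against elements of \<open>B\<close>, and range,
  bimodule property and trace preservation already determine the map.\<close>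

lemma cond_exp_eqI:
 assumes tr: "vn_trace M = \<tau>" and B: "von_neumann_algebra B" "B <= M"
  and ex: "!!x. x : M ==> EX y:B. ALL b:B. \<tau> (b ** y) = \<tau> (b ** x)"
  and x: "x : M" and y: "y : B" "!!b. b : B ==> \<tau> (b ** y) = \<tau> (b ** x)"
 shows "cond_exp M B x = y"
proof -
 note BI = vn_intros[OF B(1)]
 note MI = vn_intros[OF M]
 have BM: "b : M" if "b : B" for b using that B(2) by blast
 have BBH: "b : BH" if "b : B" for b using vn_inBH[OF B(1) that] .
 have uniq: "y = y'" if y: "y : B" "y' : B" "!!b. b : B ==> \<tau> (b ** y) = \<tau> (b ** y')" for y y'
 proof -
  have d: "y - y' : B" by (intro BI y)
  have "\<tau> (adj (y - y') ** (y - y')) = 0"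
   using y(3)[OF BI(9)[OF d]] by (simp add: oL_diff_right nft_diff[OF M \<tau>] MI BM[OF y(1)] BM[OF y(2)])
  hence "y - y' = 0" by (rule nft_faithful[OF \<tau> BM[OF d]])
  thus ?thesis by simp
 qed
 define E where "E = (\<lambda>x\<in>M. SOME y. y : B & (ALL b:B. \<tau> (b ** y) = \<tau> (b ** x)))"
 have S: "E x : B & (ALL b:B. \<tau> (b ** E x) = \<tau> (b ** x))" if x: "x : M" for x
 proof -
  have "EX y. y : B & (ALL b:B. \<tau> (b ** y) = \<tau> (b ** x))" using ex[OF x] by blast
  from someI_ex[OF this] show ?thesis using x by (simp add: E_def)
 qed
 hence EB: "x : M ==> E x : B" and Et: "x : M ==> b : B ==> \<tau> (b ** E x) = \<tau> (b ** x)" for x b by auto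
 have EM: "x : M ==> E x : M" for x using EB BM by blast
 have EI: "E x = y" if "x : M" "y : B" "!!b. b : B ==> \<tau> (b ** y) = \<tau> (b ** x)" for x y
  by (rule uniq[OF EB[OF that(1)] that(2)]) (simp add: Et that)
 have Eadd: "E (x + y) = E x + E y" if "x : M" "y : M" for x y
  using that by (intro EI MI BI EB) (auto simp: oL_add_right nft_add[OF \<tau>] MI BM EM Et)
 have Ediff: "E x - E y = E (x - y)" if "x : M" "y : M" for x y
  using Eadd[OF MI(4)[OF that] that(2)] by simp
 have Eadj: "E (adj x) = adj (E x)" if x: "x : M" for x
 proof (rule EI[OF MI(9)[OF x] BI(9)[OF EB[OF x]]])
  fix b assume b: "b : B"
  have "\<tau> (b ** adj z) = cnj (\<tau> (adj b ** z))" if z: "z : M" for z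
   using nft_adj[OF M \<tau>, of "z ** adj b"] nft_comm[OF \<tau>, of z "adj b"]
   by (simp add: adj_compose MBH z BBH b MI BM)
  thus "\<tau> (b ** adj (E x)) = \<tau> (b ** adj x)" using Et[OF x BI(9)[OF b]] x EM by simp
 qed
 have conj: "\<tau> (adj b ** (E x ** b)) = \<tau> (adj b ** (x ** b))" if x: "x : M" and b: "b : B" for x b
 proof -
  have "\<tau> (adj b ** (z ** b)) = \<tau> ((b ** adj b) ** z)" if z: "z : M" for z
   using nft_comm[OF \<tau>, of "adj b ** z" b] by (simp add: oL_assoc MI z BM b)
  thus ?thesis using Et[OF x, of "b ** adj b"] x EM BI(6)[OF b BI(9)[OF b]] by simp
 qed
 have Epos: "positive_op (E x)" if x: "x : M" "positive_op x" for x
 proof (rule positive_opI_trace[OF B EB[OF x(1)]])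
  show "adj (E x) = E x" using Eadj[OF x(1)] positive_op_adj[OF x(2)] by simp
  fix b assume b: "b : B"
  show "0 <= Re (\<tau> (adj b ** (E x ** b)))"
   unfolding conj[OF x(1) b] by (rule nft_positive(2)[OF M \<tau> _ positive_conj[OF x(2) BBH[OF b]]]) (intro MI BM b x)
 qed
 have Elub: "lub_in B (E ` D) (E s)" if D: "D <= self_adjoints M" "up_directed D" "lub_in M D s" for D s
  unfolding lub_in_def
 proof (intro conjI ballI impI)
  have sM: "s : M" "adj s = s" and DM: "!!d. d : D ==> d : M" using D by (auto simp: lub_in_def self_adjoints_def)
  show Es: "E s : self_adjoints B" using EB sM Eadj[OF sM(1)] by (simp add: self_adjoints_def)
  have ds: "positive_op (s - d)" if "d : D" for d using D(3) that by (simp add: lub_in_def op_le_def)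
  show "x \<sqsubseteq> E s" if "x : E ` D" for x
   using that ds Epos[OF MI(4)[OF sM(1) DM]] by (auto simp: op_le_def Ediff sM DM)
  fix t assume t: "t : self_adjoints B" "ALL d:E ` D. d \<sqsubseteq> t"
  have tB: "t : B" "adj t = t" using t by (auto simp: self_adjoints_def)
  show "E s \<sqsubseteq> t" unfolding op_le_def
  proof (rule positive_opI_trace[OF B])
   show "t - E s : B" "adj (t - E s) = t - E s" using tB Es by (auto simp: self_adjoints_def adj_diff BBH intro: BI)
   fix b assume b: "b : B"
   define \<psi> where "\<psi> x = Re (\<tau> (adj b ** (x ** b)))" for x
   have \<psi>d: "\<psi> (x - y) = \<psi> x - \<psi> y" if "x : M" "y : M" for x y
    using that by (simp add: \<psi>_def oL_diff_left oL_diff_right nft_diff[OF M \<tau>] MI BM b)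
   have \<psi>E: "\<psi> (E x) = \<psi> x" if "x : M" for x by (simp add: \<psi>_def conj[OF that b])
   have \<psi>p: "0 <= \<psi> x" if "x : M" "positive_op x" for x
    unfolding \<psi>_def by (rule nft_positive(2)[OF M \<tau> _ positive_conj[OF that(2) BBH[OF b]]]) (intro MI BM b that)
   \<comment> \<open>The trace controls \<open>\<psi>\<close> up to the factor
     \<open>(norm b)^2\<close>, so some \<open>d\<close> with trace close to that of
     \<open>s\<close> refutes \<open>\<psi> s > \<psi> t\<close>. Normality of \<open>E\<close> is
     thus reduced to that of \<open>\<tau>\<close>.\<close>
   have le: "\<psi> s - \<psi> t <= (norm b)^2 * (Re (\<tau> s) - Re (\<tau> d))" if d: "d : D" for d
   proof -
    define h where "h = op_sqrt (s - d)"
    have hM: "h : M" unfolding h_def by (intro op_sqrt_in_vn[OF M] ds d MI sM DM)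
    have hh: "adj h ** h = s - d" unfolding h_def using op_sqrt_square[OF ds[OF d]] positive_op_adj[OF positive_op_sqrt[OF ds[OF d]]] by simp
    have "(tnorm \<tau> (h ** b))^2 <= (norm b * tnorm \<tau> h)^2"
     by (intro power_mono tnorm_compose_right tnorm_nonneg MI hM BM b)
    moreover have "(tnorm \<tau> (h ** b))^2 = \<psi> (s - d)"
     using arg_cong[OF hh, of "%z. adj b ** (z ** b)"] by (simp add: tnorm_sq MI hM BM b \<psi>_def adj_compose MBH oL_assoc)
    moreover have "(tnorm \<tau> h)^2 = Re (\<tau> s) - Re (\<tau> d)" by (simp add: tnorm_sq hM hh nft_diff[OF M \<tau> sM(1) DM[OF d]])
    moreover have "\<psi> (s - d) = \<psi> s - \<psi> d" by (rule \<psi>d[OF sM(1) DM[OF d]])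
    moreover have "0 <= \<psi> (t - E d)" using t(2) d by (intro \<psi>p MI BM tB EM DM) (auto simp: op_le_def)
    hence "\<psi> d <= \<psi> t" using \<psi>d[OF BM[OF tB(1)] EM[OF DM[OF d]]] \<psi>E[OF DM[OF d]] by simp
    ultimately show ?thesis by (simp add: power_mult_distrib)
   qed
   have "\<psi> s <= \<psi> t"
   proof (rule ccontr)
    assume "~ \<psi> s <= \<psi> t"
    hence "Re (\<tau> s) - (\<psi> s - \<psi> t) / ((norm b)^2 + 1) < Re (\<tau> s)" by (simp add: add_nonneg_pos)
    then obtain d where d: "d : D" "Re (\<tau> s) - (\<psi> s - \<psi> t) / ((norm b)^2 + 1) < Re (\<tau> d)"
    proof -
     have "bdd_above ((%d. Re (\<tau> d)) ` D)"
      using nft_positive(2)[OF M \<tau> MI(4)[OF sM(1) DM] ds] by (intro bdd_aboveI2[of _ _ "Re (\<tau> s)"]) (simp add: nft_diff[OF M \<tau> sM(1) DM])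
     thus ?thesis
      using that less_cSUP_iff[of D "%d. Re (\<tau> d)"] nft_SUP[OF \<tau> D] D(2) \<open>_ < Re (\<tau> s)\<close> by (auto simp: up_directed_def)
    qed
    have n: "0 < (norm b)^2 + 1" by (simp add: add_nonneg_pos)
    have "Re (\<tau> s) - Re (\<tau> d) < (\<psi> s - \<psi> t) / ((norm b)^2 + 1)" using d(2) by simp
    hence "((norm b)^2 + 1) * (Re (\<tau> s) - Re (\<tau> d)) < \<psi> s - \<psi> t" using n by (simp add: pos_less_divide_eq mult.commute)
    moreover have "0 <= Re (\<tau> s) - Re (\<tau> d)"
     using nft_positive(2)[OF M \<tau> MI(4)[OF sM(1) DM[OF d(1)]] ds[OF d(1)]] by (simp add: nft_diff[OF M \<tau> sM(1) DM[OF d(1)]])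
    ultimately show False using le[OF d(1)] by (simp add: distrib_right)
   qed
   thus "0 <= Re (\<tau> (adj b ** ((t - E s) ** b)))"
    using \<psi>d[OF BM[OF tB(1)] EM[OF sM(1)]] \<psi>E[OF sM(1)] unfolding \<psi>_def[symmetric] by simp
  qed
 qed
 have E: "trace_cond_exp M B E"
  unfolding trace_cond_exp_def tr
 proof (intro conjI ballI allI impI)
  fix x a b assume x: "x : M" and ab: "a : B" "b : B"
  show "E (a ** x ** b) = a ** E x ** b"
  proof (rule EI)
   fix c assume c: "c : B"
   have "\<tau> (c ** (a ** z ** b)) = \<tau> ((b ** (c ** a)) ** z)" if z: "z : M" for z
    using nft_comm[OF \<tau>, of "c ** (a ** z)" b] by (simp add: oL_assoc MI BM ab c z)
   thus "\<tau> (c ** (a ** E x ** b)) = \<tau> (c ** (a ** x ** b))"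
    using Et[OF x, of "b ** (c ** a)"] x EM ab c by (simp add: BI)
  qed (intro MI BI BM EB x ab)+
 next
  fix c x assume x: "x : M"
  show "E (cscale c x) = cscale c (E x)"
  proof (rule EI)
   show "\<tau> (b ** cscale c (E x)) = \<tau> (b ** cscale c x)" if b: "b : B" for b
    using Et[OF x b] x b by (simp add: oL_cscale_right BBH nft_cscale[OF \<tau>] MI BM EM)
  qed (intro MI BI EB x)+
 next
  show "x = 0" if "x : M" "E (adj x ** x) = 0" for x
   using Et[OF tin_M[OF that(1,1)] BI(1)] that nft_faithful[OF \<tau> that(1)] nft_zero[OF M \<tau>] by simp
 qed (use EB Eadd Epos Elub Et[OF _ BI(1)] EI[OF BM] in auto)
 have ext: "E : extensional M" by (simp add: E_def)
 have "cond_exp M B = E"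
  unfolding cond_exp_def
 proof (rule the_equality)
  show "E : extensional M & trace_cond_exp M B E" using E ext by blast
  fix E' assume E': "E' : extensional M & trace_cond_exp M B E'"
  note Q = E'[THEN conjunct2, unfolded trace_cond_exp_def tr]
  \<comment> \<open>The first, sixth and last conjuncts: range, bimodule property and trace.\<close>
  note tc = Q[THEN conjunct1] Q[THEN conjunct2, THEN conjunct2, THEN conjunct2, THEN conjunct2, THEN conjunct2, THEN conjunct1] Q[THEN conjunct2, THEN conjunct2, THEN conjunct2, THEN conjunct2, THEN conjunct2, THEN conjunct2, THEN conjunct2, THEN conjunct2]
  show "E' = E"
  proof (rule extensionalityI)
   fix x assume x: "x : M"
   show "E' x = E x"
   proof (rule EI[OF x, symmetric])
    show "E' x : B" using tc x by blast
    fix b assume b: "b : B"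
    have "E' (b ** x) = b ** E' x" using tc(2) x b BI(1) by (metis oL_id(2))
    thus "\<tau> (b ** E' x) = \<tau> (b ** x)" using tc(3) MI(6)[OF BM[OF b] x] by metis
   qed
  qed (use E' ext in auto)
 qed
 thus ?thesis using EI[OF x y] by simp
qed

end

section \<open>Expectations as orthogonal projections of the GNS space\<close>

context factor_gns
begin

lemma stdform_pi: "stdform (\<pi> ` M) (\<iota> Id)"
proof
 show "factor (\<pi> ` M)" by (rule pi_factor[OF factor_M order_refl])
 have "{blinfun_apply x (\<iota> Id) | x. x : \<pi> ` M} = \<iota> ` M"
  unfolding setcompr_eq_image by (simp add: image_image pi_iota C_id)
 thus "closure {blinfun_apply x (\<iota> Id) | x. x : \<pi> ` M} = UNIV" using dense by simp
 show "norm (\<iota> Id) = 1" using norm_iota[OF C_id] nft_id[OF \<tau>] by (simp add: tnorm_def)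
 show "x = 0" if "x : \<pi> ` M" "x (\<iota> Id) = 0" for x
  using that pi_iota[OF _ C_id] norm_iota tnorm_eq_0 iota_zero eq_on_iota[of "\<pi> 0" 0]
  by (auto simp: pi_iota C_zero) (metis norm_zero)
 show "cinner (x (y (\<iota> Id))) (\<iota> Id) = cinner (y (x (\<iota> Id))) (\<iota> Id)"
  if "x : \<pi> ` M" "y : \<pi> ` M" for x y
  using that nft_comm[OF \<tau>] C_compose by (auto simp: pi_iota C_id iota_cinner)
qed

text \<open>\<open>ex_compression\<close> supplies an element of \<open>B\<close> whose vector is
  the projection of that of \<open>x\<close>; pairing with vectors of \<open>B\<close> gives the
  trace identity that characterises the expectation.\<close>

lemma cond_exp_vector:
 assumes tr: "vn_trace M = \<tau>" and B: "von_neumann_algebra B" "B <= M" and x: "x : M"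
 shows "cond_exp M B x : B"
  and "\<pi> (cond_exp M B x) (\<iota> Id) = cyclic_proj (\<pi> ` B) (\<iota> Id) (\<pi> x (\<iota> Id))"
proof -
 interpret S: stdform "\<pi> ` M" "\<iota> Id" by (rule stdform_pi)
 note vB = pi_vn[OF B]
 interpret S: stdform_sub "\<pi> ` M" "\<iota> Id" "\<pi> ` B"
  by unfold_locales (rule star_subalgebra_vn[OF vB], use B in blast)
 have BM: "b : M" if "b : B" for b using that B by blast
 have ex: "EX y:B. \<pi> y (\<iota> Id) = S.e (\<pi> x (\<iota> Id))" if x: "x : M" for x
 proof -
  have "\<pi> x : S.P" using x S.M_subset_P by blast
  from S.ex_compression[OF this] obtain y where "y : B" "S.e ** (\<pi> x ** S.e) = \<pi> y ** S.e"
   unfolding vn_bicommutant[OF vB] by blast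
  thus ?thesis using S.e_Om by (intro bexI[of _ y]) (metis oL_apply)
 qed
 have eq: "\<tau> (b ** y) = \<tau> (b ** x)" if y: "y : B" "\<pi> y (\<iota> Id) = S.e (\<pi> x (\<iota> Id))" and x: "x : M" and b: "b : B" for x y b
 proof -
  have t: "\<tau> (b ** z) = cinner (\<pi> b (\<pi> z (\<iota> Id))) (\<iota> Id)" if "z : M" for z
   using pi_vector_state[OF C_compose[OF BM[OF b] that]] by (simp add: pi_compose BM b that)
  have "\<tau> (b ** y) = cinner (S.e (\<pi> b (\<pi> x (\<iota> Id)))) (\<iota> Id)"
   using b by (simp add: t BM y S.e_N)
  thus ?thesis by (simp add: S.e_cinner S.e_Om t x)
 qed
 obtain y where y: "y : B" "\<pi> y (\<iota> Id) = S.e (\<pi> x (\<iota> Id))" using ex[OF x] by blast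
 have "cond_exp M B x = y"
  by (rule cond_exp_eqI[OF tr B _ x y(1) eq[OF y x]]) (use ex eq in blast)
 thus "cond_exp M B x : B"
  "\<pi> (cond_exp M B x) (\<iota> Id) = cyclic_proj (\<pi> ` B) (\<iota> Id) (\<pi> x (\<iota> Id))"
  using y by (simp_all add: S.e_def)
qed

end

theorem theorem4p6:
  fixes M A :: "('h::chilbert_space) op set"
  assumes "II1_factor M" and "hyperfinite M"
    and "subfactor A M"
    and "jones_index M A = ereal (2 + sqrt 2)"
  shows "singular M A \<and> \<not> strongly_singular M A"
proof -
 have F: "factor M" and inf: "~ fin_dim M" and fA: "factor A" and AM: "A <= M"
  using assms by (auto simp: II1_factor_def finite_factor_def subfactor_def)
 obtain \<tau>0 where "nf_tracial_state M \<tau>0" using assms(1) by (auto simp: II1_factor_def finite_factor_def)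
 hence nft: "nf_tracial_state M (vn_trace M)" by (rule vn_trace_nft(1)[OF F])
 note vM = factor_vn[OF F] and vA = factor_vn[OF fA]
 obtain \<iota> :: "'h op => ell2" and Fam where "gns_family M (vn_trace M) M \<iota> Fam"
  using ex_gns_family[OF vM nft assms(2) inf] by blast
 then interpret gns_family M "vn_trace M" M \<iota> Fam .
 interpret factor_gns M "vn_trace M" \<iota> Fam by unfold_locales (rule F)
 define \<Omega> where "\<Omega> = \<iota> Id"
 have std: "stdform (\<pi> ` M) \<Omega>" unfolding \<Omega>_def by (rule stdform_pi)
 then interpret S: stdform "\<pi> ` M" \<Omega> .
 have vA': "von_neumann_algebra (\<pi> ` A)" by (rule pi_vn[OF vA AM])
 have AM': "\<pi> ` A <= \<pi> ` M" using AM by blast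
 have fA': "factor (\<pi> ` A)" by (rule pi_factor[OF fA AM])
 have "finite_factor (\<pi> ` A)"
  using fA' nft_restrict[OF S.M S.nft vA' AM'] unfolding finite_factor_def by blast
 from jones_index_eq[OF vM standard_rep_pi[OF refl] AM this]
 have dim: "vn_dim (\<pi> ` A) = ereal (2 + sqrt 2)" using assms(4) by simp
 \<comment> \<open>A finite value excludes the branch of \<open>vn_dim\<close> with value
   \<open>\<infinity>\<close>; this is how the commutant obtains a trace.\<close>
 hence "finite_factor (commutant (\<pi> ` A))" unfolding vn_dim_def by (auto split: if_splits)
 then obtain tr' where tr': "nf_tracial_state (commutant (\<pi> ` A)) tr'" by (auto simp: finite_factor_def)
 interpret S: subfactor_trace "\<pi> ` M" \<Omega> "\<pi> ` A" tr'
  by unfold_locales (rule star_subalgebra_vn[OF vA'], fact AM', fact fA', fact tr')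
 have mu: "S.\<mu> = 1 / (2 + sqrt 2)"
 proof -
  have "1 / S.\<mu> = 2 + sqrt 2" using dim S.vn_dim_eq by simp
  thus ?thesis by (metis divide_divide_eq_right div_by_1 mult_1)
 qed
 have s2: "1 < sqrt 2" "sqrt 2 < 2" by (simp_all add: real_less_lsqrt)
 have mu': "1 / 4 < S.\<mu>" "S.\<mu> < 1 / 3" unfolding mu
  by (intro divide_strict_left_mono mult_pos_pos add_pos_pos; use s2 in simp)+
 have un: "\<pi> u : unitaries (\<pi> ` M) \<longleftrightarrow> u : unitaries M" if u: "u : M" for u
 proof -
  have "\<pi> (adj u ** u) = adj (\<pi> u) ** \<pi> u" "\<pi> (u ** adj u) = \<pi> u ** adj (\<pi> u)" by (simp_all add: pi_compose pi_adj C_adj u)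
  moreover have "\<pi> x = Id \<longleftrightarrow> x = Id" if "x : M" for x using pi_inject[OF that C_id] pi_id by auto
  ultimately show ?thesis using u C_compose C_adj by (auto simp: unitaries_def) metis+
 qed
 have pconj: "conj_by (\<pi> u) (\<pi> ` A) = \<pi> ` conj_by u A" if "u : M" for u
  unfolding conj_by_def image_image
  by (rule image_cong[OF refl]) (use that AM in "auto simp: pi_compose pi_adj C_adj C_compose subset_iff")
 have "singular M A"
  unfolding singular_def
 proof (intro ballI impI)
  fix u assume u: "u : unitaries M" "conj_by u A = A"
  hence uM: "u : M" by (simp add: unitaries_def)
  have "\<pi> u : \<pi> ` A" by (rule S.singular_standard[OF mu']) (use un[OF uM] pconj[OF uM] u in auto)
  thus "u : A" using pi_inject[OF uM] AM by blast
 qed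
 moreover have "~ strongly_singular M A"
 proof
  assume ss: "strongly_singular M A"
  obtain u1 where u1: "u1 : unitaries (\<pi> ` M)" "24 / 25 < (norm (u1 \<Omega> - S.e (u1 \<Omega>)))^2"
   "!!v. (norm (S.e v - cyclic_proj (conj_by u1 (\<pi> ` A)) \<Omega> v))^2 <= 24 / 25 * (norm v)^2"
   using S.not_strongly_singular_standard[OF mu] by blast
  then obtain u where u: "u : M" "u1 = \<pi> u" by (auto simp: unitaries_def)
  have uu: "u : unitaries M" using un u u1(1) by blast
  define B where "B = conj_by u A"
  have ub: "u : unitaries BH" using uu MBH by (auto simp: unitaries_def)
  have vB: "von_neumann_algebra B" unfolding B_def conj_by_cj by (rule vn_cj_image[OF ub vA])
  have BM: "B <= M" unfolding B_def conj_by_def using u AM by (auto intro!: C_compose C_adj)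
  note EA = cond_exp_vector[OF refl vA AM, folded \<Omega>_def] and EB = cond_exp_vector[OF refl vB BM, folded \<Omega>_def]
  have n2: "norm2 M x = norm (\<pi> x \<Omega>)" if "x : M" for x
   using norm_iota[OF that] by (simp add: norm2_def tnorm_def \<Omega>_def pi_iota that C_id)
  \<comment> \<open>An element of the unit ball has a vector of norm at most 1, so the bound on
    projections applies to the expectations.\<close>
  have "norm_inf_2 M (%x. cond_exp M A x - cond_exp M B x) <= ereal (sqrt (24 / 25))"
   unfolding norm_inf_2_def
  proof (rule SUP_least)
   fix x assume "x : {x : M. norm x <= 1}"
   hence x: "x : M" "norm x <= 1" by auto
   have M: "cond_exp M A x : M" "cond_exp M B x : M" using EA(1) EB(1) x AM BM by blast+
   have "norm2 M (cond_exp M A x - cond_exp M B x) = norm (S.e (\<pi> x \<Omega>) - cyclic_proj (conj_by u1 (\<pi> ` A)) \<Omega> (\<pi> x \<Omega>))"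
    using vn_diff[OF vM M] by (simp add: n2 pi_diff M blinfun.diff_left EA(2) EB(2) x S.e_def u(2) pconj[OF u(1), folded B_def])
   also have "... <= sqrt (24 / 25)"
   proof (rule real_le_rsqrt)
    have "norm (\<pi> x \<Omega>) <= 1"
     using tnorm_compose_left[OF x(1) C_id] norm_iota[OF C_id] S.norm_Om x norm_iota[OF x(1)] by (simp add: \<Omega>_def pi_iota C_id)
    hence "(norm (\<pi> x \<Omega>))^2 <= 1" by (simp add: power_le_one)
    thus "(norm (S.e (\<pi> x \<Omega>) - cyclic_proj (conj_by u1 (\<pi> ` A)) \<Omega> (\<pi> x \<Omega>)))^2 <= 24 / 25"
     using u1(3)[of "\<pi> x \<Omega>"] by simp
   qed
   finally show "ereal (norm2 M (cond_exp M A x - cond_exp M B x)) <= ereal (sqrt (24 / 25))" by simp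
  qed
  moreover have "ereal (norm2 M (u - cond_exp M A u)) <= norm_inf_2 M (%x. cond_exp M A x - cond_exp M B x)"
   using ss uu unfolding strongly_singular_def B_def by blast
  ultimately have "ereal (norm2 M (u - cond_exp M A u)) <= ereal (sqrt (24 / 25))" by (rule order_trans[rotated])
  moreover have EuM: "cond_exp M A u : M" using EA(1)[OF u(1)] AM by blast
  hence "norm2 M (u - cond_exp M A u) = norm (u1 \<Omega> - S.e (u1 \<Omega>))"
   using vn_diff[OF vM u(1) EuM] by (simp add: n2 pi_diff u blinfun.diff_left EA(2) S.e_def)
  moreover have "sqrt (24 / 25) < norm (u1 \<Omega> - S.e (u1 \<Omega>))"
   using u1(2) by (intro real_less_lsqrt) auto
  ultimately show False by simp
 qed
 ultimately show ?thesis ..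
qed

end
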